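(* Let $\{\hat V,\check V\}$ be a Darboux pair on a manifold $M$. Then about each point of $M$ there exists a 0-adapted coframe $\{\boldsymbol\theta,\boldsymbol{\hat\sigma},\boldsymbol{\hat\eta},\boldsymbol{\check\sigma},\boldsymbol{\check\eta}\}$ with structure equations $$d\boldsymbol{\hat\sigma}=0,\qquad d\boldsymbol{\hat\eta}=\boldsymbol{\hat E}\,\boldsymbol{\hat\eta}\wedge\boldsymbol{\hat\sigma}+\boldsymbol{\hat F}\,\boldsymbol{\hat\sigma}\wedge\boldsymbol{\hat\sigma},$$ $$d\boldsymbol{\check\sigma}=0,\qquad d\boldsymbol{\check\eta}=\boldsymbol{\check E}\,\boldsymbol{\check\eta}\wedge\boldsymbol{\check\sigma}+\boldsymbol{\check F}\,\boldsymbol{\check\sigma}\wedge\boldsymbol{\check\sigma},$$ $$d\boldsymbol\theta\equiv\boldsymbol A\,\boldsymbol{\hat\sigma}\wedge\boldsymbol{\hat\sigma}+\boldsymbol B\,\boldsymbol{\check\sigma}\wedge\boldsymbol{\check\sigma}\mod\{\boldsymbol\theta,\boldsymbol{\hat\eta},\boldsymbol{\check\eta}\},$$ for some coefficient functions $\boldsymbol{\hat E},\boldsymbol{\hat F},\boldsymbol{\check E},\boldsymbol{\check F},\boldsymbol A,\boldsymbol B$.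
   Context: Everything is smooth. A Pfaffian system is a constant rank subbundle $V\subset T^*M$. $V^{(\infty)}$ is the largest integrable subbundle of $V$ (the last derived system of $V$; the derived systems are assumed to have constant rank). $\Omega^k(V)$ denotes the sections of $\Lambda^kV$. Darboux pair: $\hat V,\check V$ form a Darboux pair if (i) $\hat V+\check V^{(\infty)}=T^*M$ and $\check V+\hat V^{(\infty)}=T^*M$; (ii) $\hat V^{(\infty)}\cap\check V^{(\infty)}=\{0\}$; (iii) $d\omega\in\Omega^2(\hat V)+\Omega^2(\check V)$ for all $\omega\in\Omega^1(\hat V\cap\check V)$. Standing assumption: $\hat V^{(\infty)},\check V^{(\infty)},\hat V^{(\infty)}\cap\check V,\hat V\cap\check V^{(\infty)},\hat V\cap\check V$ are constant rank subbundles. Boldface letters denote tuples of forms, and an expression such as $\boldsymbol A\,\boldsymbol{\hat\sigma}\wedge\boldsymbol{\hat\sigma}$ denotes a tuple of linear combinations, with function coefficients, of the products $\hat\sigma^a\wedge\hat\sigma^b$. "mod $\{\dots\}$" means modulo the algebraic ideal generated by the listed 1-forms. 0-adapted coframe: tuples of 1-forms such that $\boldsymbol{\hat\eta}$ is a basis of $\hat V^{(\infty)}\cap\check V$, $\boldsymbol{\check\eta}$ a basis of $\hat V\cap\check V^{(\infty)}$, $\{\boldsymbol{\hat\sigma},\boldsymbol{\hat\eta}\}$ a basis of $\hat V^{(\infty)}$, $\{\boldsymbol{\check\sigma},\boldsymbol{\check\eta}\}$ a basis of $\check V^{(\infty)}$, and $\{\boldsymbol\theta,\boldsymbol{\hat\eta},\boldsymbol{\check\eta}\}$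 a basis of $\hat V\cap\check V$. (All these forms together are a local coframe of $M$, and $\hat V=\mathrm{span}\{\boldsymbol\theta,\boldsymbol{\hat\sigma},\boldsymbol{\hat\eta},\boldsymbol{\check\eta}\}$, $\check V=\mathrm{span}\{\boldsymbol\theta,\boldsymbol{\hat\eta},\boldsymbol{\check\sigma},\boldsymbol{\check\eta}\}$.) *)

theory Defs
  imports "HOL-Analysis.Analysis" "HOL-Library.Function_Algebras"
begin

text \<open>
  Pointwise real vector space structure on function spaces, so that \<^const>\<open>span\<close> and
  \<^term>\<open>independent\<close> apply to covectors, which are represented below by functions.
\<close>

instantiation "fun" :: (type, real_vector) real_vector
begin

definition scaleR_fun :: "real \<Rightarrow> ('a \<Rightarrow> 'b) \<Rightarrow> 'a \<Rightarrow> 'b"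
  where "scaleR_fun r f = (\<lambda>x. r *\<^sub>R f x)"

instance
  by standard (simp_all add: scaleR_fun_def fun_eq_iff scaleR_add_right scaleR_add_left)

end


subsection \<open>Smooth manifolds\<close>

text \<open>\<open>Ck_on k S f\<close>: \<open>f\<close> is of class $C^k$ on the open set \<open>S\<close> of a Euclidean space.\<close>

primrec Ck_on :: "nat \<Rightarrow> 'e::euclidean_space set \<Rightarrow> ('e \<Rightarrow> 'b::real_normed_vector) \<Rightarrow> bool" where
  "Ck_on 0 S f \<longleftrightarrow> continuous_on S f"
| "Ck_on (Suc k) S f \<longleftrightarrow>
     (\<forall>x\<in>S. f differentiable (at x)) \<and>
     (\<forall>v. Ck_on k S (\<lambda>x. frechet_derivative f (at x) v))"

definition smooth_on :: "'e::euclidean_space set \<Rightarrow> ('e \<Rightarrow> 'b::real_normed_vector) \<Rightarrow> bool"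
  where "smooth_on S f \<longleftrightarrow> (\<forall>k. Ck_on k S f)"

text \<open>
  A chart is a pair of its domain and its coordinate map; values of the coordinate map outside
  of the domain are irrelevant.
\<close>

type_synonym ('m, 'e) chart = "'m set \<times> ('m \<Rightarrow> 'e)"

abbreviation dom_of :: "('m, 'e) chart \<Rightarrow> 'm set" where "dom_of \<equiv> fst"
abbreviation map_of_chart :: "('m, 'e) chart \<Rightarrow> 'm \<Rightarrow> 'e" where "map_of_chart \<equiv> snd"

definition chart_inv :: "('m, 'e) chart \<Rightarrow> 'e \<Rightarrow> 'm"
  where "chart_inv \<kappa> = inv_into (dom_of \<kappa>) (map_of_chart \<kappa>)"

record ('m, 'e) manifold =
  mtop :: "'m topology"
  atlas :: "('m, 'e) chart set"

abbreviation points :: "('m, 'e) manifold \<Rightarrow> 'm set"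
  where "points M \<equiv> topspace (mtop M)"

text \<open>The change of coordinates from the chart \<open>\<kappa>\<close> to the chart \<open>\<kappa>'\<close>.\<close>

definition transition :: "('m, 'e) chart \<Rightarrow> ('m, 'e) chart \<Rightarrow> 'e \<Rightarrow> 'e"
  where "transition \<kappa> \<kappa>' = (\<lambda>x. map_of_chart \<kappa>' (chart_inv \<kappa> x))"

definition smooth_manifold :: "('m, 'e::euclidean_space) manifold \<Rightarrow> bool" where
  "smooth_manifold M \<longleftrightarrow>
     Hausdorff_space (mtop M) \<and> second_countable (mtop M) \<and>
     (\<forall>\<kappa>\<in>atlas M. openin (mtop M) (dom_of \<kappa>) \<and>
        open (map_of_chart \<kappa> ` dom_of \<kappa>) \<and>
        homeomorphic_map (subtopology (mtop M) (dom_of \<kappa>))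
          (top_of_set (map_of_chart \<kappa> ` dom_of \<kappa>)) (map_of_chart \<kappa>)) \<and>
     (\<Union>\<kappa>\<in>atlas M. dom_of \<kappa>) = points M \<and>
     (\<forall>\<kappa>\<in>atlas M. \<forall>\<kappa>'\<in>atlas M.
        smooth_on (map_of_chart \<kappa> ` (dom_of \<kappa> \<inter> dom_of \<kappa>')) (transition \<kappa> \<kappa>'))"

definition smooth_fun :: "('m, 'e::euclidean_space) manifold \<Rightarrow> 'm set \<Rightarrow> ('m \<Rightarrow> real) \<Rightarrow> bool" where
  "smooth_fun M W f \<longleftrightarrow>
     (\<forall>\<kappa>\<in>atlas M. smooth_on (map_of_chart \<kappa> ` (dom_of \<kappa> \<inter> W)) (\<lambda>x. f (chart_inv \<kappa> x)))"


subsection \<open>Covectors and differential forms\<close>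

text \<open>
  A covector at \<open>p\<close> is the family of its coordinate representations: to each chart around \<open>p\<close> it
  assigns a linear functional on the model space, and these functionals are related by the
  derivatives of the coordinate changes. Charts not around \<open>p\<close> get the value 0, so that the
  covectors at \<open>p\<close> form a vector space of the dimension of \<open>M\<close>. Likewise for 2-covectors, which
  are bilinear in each chart.
\<close>

type_synonym ('m, 'e) covector = "('m, 'e) chart \<Rightarrow> 'e \<Rightarrow> real"
type_synonym ('m, 'e) covector2 = "('m, 'e) chart \<Rightarrow> 'e \<Rightarrow> 'e \<Rightarrow> real"
type_synonym ('m, 'e) form1 = "'m \<Rightarrow> ('m, 'e) covector"
type_synonym ('m, 'e) form2 = "'m \<Rightarrow> ('m, 'e) covector2"

definition charts_at :: "('m, 'e) manifold \<Rightarrow> 'm \<Rightarrow> ('m, 'e) chart set"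
  where "charts_at M p = {\<kappa>\<in>atlas M. p \<in> dom_of \<kappa>}"

definition cotangent_space ::
  "('m, 'e::euclidean_space) manifold \<Rightarrow> 'm \<Rightarrow> ('m, 'e) covector set" where
  "cotangent_space M p = {\<xi>.
     (\<forall>\<kappa>\<in>charts_at M p. linear (\<xi> \<kappa>)) \<and>
     (\<forall>\<kappa>\<in>charts_at M p. \<forall>\<kappa>'\<in>charts_at M p. \<forall>v.
        \<xi> \<kappa> v = \<xi> \<kappa>' (frechet_derivative (transition \<kappa> \<kappa>') (at (map_of_chart \<kappa> p)) v)) \<and>
     (\<forall>\<kappa>. \<kappa> \<notin> charts_at M p \<longrightarrow> \<xi> \<kappa> = 0)}"

definition wedge :: "('m, 'e) covector \<Rightarrow> ('m, 'e) covector \<Rightarrow> ('m, 'e) covector2"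
    (infixl "\<and>\<^sub>w" 75)
  where "\<alpha> \<and>\<^sub>w \<beta> = (\<lambda>\<kappa> u v. \<alpha> \<kappa> u * \<beta> \<kappa> v - \<alpha> \<kappa> v * \<beta> \<kappa> u)"

text \<open>The subspace $\Lambda^2 S$ of the 2-covectors, for a space \<open>S\<close> of covectors.\<close>

definition Lambda2 :: "('m, 'e) covector set \<Rightarrow> ('m, 'e) covector2 set"
  where "Lambda2 S = span {\<alpha> \<and>\<^sub>w \<beta> | \<alpha> \<beta>. \<alpha> \<in> S \<and> \<beta> \<in> S}"

text \<open>
  In the following \<open>W\<close> is an open set of points, and \<open>V\<close> is a family of subspaces \<open>V p\<close> of the
  cotangent spaces. \<open>Omega1 M W V\<close> and \<open>Omega2 M W V\<close> are the smooth sections over \<open>W\<close> of \<open>V\<close>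
  and of $\Lambda^2V$. Values of forms outside of \<open>W\<close> are irrelevant.
\<close>

definition Omega1 :: "('m, 'e::euclidean_space) manifold \<Rightarrow> 'm set \<Rightarrow>
    ('m \<Rightarrow> ('m, 'e) covector set) \<Rightarrow> ('m, 'e) form1 set" where
  "Omega1 M W V = {\<omega>.
     (\<forall>p\<in>W. \<omega> p \<in> cotangent_space M p \<and> \<omega> p \<in> V p) \<and>
     (\<forall>\<kappa>\<in>atlas M. \<forall>u. smooth_fun M (W \<inter> dom_of \<kappa>) (\<lambda>p. \<omega> p \<kappa> u))}"

definition Omega2 :: "('m, 'e::euclidean_space) manifold \<Rightarrow> 'm set \<Rightarrow>
    ('m \<Rightarrow> ('m, 'e) covector set) \<Rightarrow> ('m, 'e) form2 set" where
  "Omega2 M W V = {\<xi>.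
     (\<forall>p\<in>W. \<xi> p \<in> Lambda2 (cotangent_space M p) \<and> \<xi> p \<in> Lambda2 (V p)) \<and>
     (\<forall>\<kappa>\<in>atlas M. \<forall>u v. smooth_fun M (W \<inter> dom_of \<kappa>) (\<lambda>p. \<xi> p \<kappa> u v))}"

text \<open>
  The exterior derivative, computed in each chart: for constant vectors \<open>u\<close>, \<open>v\<close> of the model space,
  $d\omega(u,v) = u(\omega(v)) - v(\omega(u))$.
\<close>

definition ext_d :: "('m, 'e::euclidean_space) manifold \<Rightarrow> ('m, 'e) form1 \<Rightarrow> ('m, 'e) form2" where
  "ext_d M \<omega> p = (\<lambda>\<kappa> u v. if \<kappa> \<in> charts_at M p then
       frechet_derivative (\<lambda>x. \<omega> (chart_inv \<kappa> x) \<kappa> v) (at (map_of_chart \<kappa> p)) u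
     - frechet_derivative (\<lambda>x. \<omega> (chart_inv \<kappa> x) \<kappa> u) (at (map_of_chart \<kappa> p)) v
     else 0)"

text \<open>
  Degree 2 part of the algebraic ideal of the forms on \<open>W\<close> generated by the set \<open>G\<close> of 1-forms.
  For \<open>\<xi>\<close> in it, \<open>\<xi> \<equiv> 0 mod G\<close>.
\<close>

definition ideal2 :: "('m, 'e::euclidean_space) manifold \<Rightarrow> 'm set \<Rightarrow>
    ('m, 'e) form1 set \<Rightarrow> ('m, 'e) form2 set" where
  "ideal2 M W G = {\<xi>. \<exists>(n::nat) \<omega> \<beta>.
     (\<forall>i<n. \<omega> i \<in> G \<and> \<beta> i \<in> Omega1 M W (cotangent_space M)) \<and>
     (\<forall>p\<in>W. \<xi> p = (\<Sum>i<n. \<omega> i p \<and>\<^sub>w \<beta> i p))}"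


subsection \<open>Pfaffian systems\<close>

text \<open>Tuples of forms are lists.\<close>

definition local_frame :: "('m, 'e::euclidean_space) manifold \<Rightarrow> 'm set \<Rightarrow>
    ('m, 'e) form1 list \<Rightarrow> ('m \<Rightarrow> ('m, 'e) covector set) \<Rightarrow> bool" where
  "local_frame M W \<omega>s V \<longleftrightarrow>
     set \<omega>s \<subseteq> Omega1 M W V \<and>
     (\<forall>p\<in>W. distinct (map (\<lambda>\<omega>. \<omega> p) \<omega>s) \<and> independent (set (map (\<lambda>\<omega>. \<omega> p) \<omega>s)) \<and>
        span (set (map (\<lambda>\<omega>. \<omega> p) \<omega>s)) = V p)"

text \<open>Constant rank subbundles of the cotangent bundle.\<close>

definition pfaffian_system :: "('m, 'e::euclidean_space) manifold \<Rightarrow>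
    ('m \<Rightarrow> ('m, 'e) covector set) \<Rightarrow> bool" where
  "pfaffian_system M V \<longleftrightarrow> (\<exists>r. \<forall>p\<in>points M. \<exists>W \<omega>s.
     openin (mtop M) W \<and> p \<in> W \<and> length \<omega>s = r \<and> local_frame M W \<omega>s V)"

definition derived :: "('m, 'e::euclidean_space) manifold \<Rightarrow>
    ('m \<Rightarrow> ('m, 'e) covector set) \<Rightarrow> ('m \<Rightarrow> ('m, 'e) covector set)" where
  "derived M V p = span {\<omega> p | \<omega>. \<omega> \<in> Omega1 M (points M) V \<and>
     ext_d M \<omega> \<in> ideal2 M (points M) (Omega1 M (points M) V)}"

text \<open>
  The last derived system $V^{(\infty)}$: the term of the derived flag of \<open>V\<close> at which the flag
  becomes stationary. It exists if all derived systems have constant rank.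
\<close>

definition last_derived :: "('m, 'e::euclidean_space) manifold \<Rightarrow>
    ('m \<Rightarrow> ('m, 'e) covector set) \<Rightarrow> ('m \<Rightarrow> ('m, 'e) covector set)" where
  "last_derived M V = (derived M ^^
     (LEAST N. \<forall>p\<in>points M. (derived M ^^ Suc N) V p = (derived M ^^ N) V p)) V"


subsection \<open>Darboux pairs\<close>

definition darboux_pair :: "('m, 'e::euclidean_space) manifold \<Rightarrow>
    ('m \<Rightarrow> ('m, 'e) covector set) \<Rightarrow> ('m \<Rightarrow> ('m, 'e) covector set) \<Rightarrow> bool" where
  "darboux_pair M Vh Vc \<longleftrightarrow>
     (let Ih = last_derived M Vh; Ic = last_derived M Vc in
     \<comment> \<open>constant rank of the systems, of their derived systems, and of the intersections\<close>
     (\<forall>k. pfaffian_system M ((derived M ^^ k) Vh)) \<and>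
     (\<forall>k. pfaffian_system M ((derived M ^^ k) Vc)) \<and>
     pfaffian_system M (\<lambda>p. Ih p \<inter> Vc p) \<and>
     pfaffian_system M (\<lambda>p. Vh p \<inter> Ic p) \<and>
     pfaffian_system M (\<lambda>p. Vh p \<inter> Vc p) \<and>
     \<comment> \<open>(i), (ii), (iii)\<close>
     (\<forall>p\<in>points M. {\<alpha> + \<beta> | \<alpha> \<beta>. \<alpha> \<in> Vh p \<and> \<beta> \<in> Ic p} = cotangent_space M p) \<and>
     (\<forall>p\<in>points M. {\<alpha> + \<beta> | \<alpha> \<beta>. \<alpha> \<in> Vc p \<and> \<beta> \<in> Ih p} = cotangent_space M p) \<and>
     (\<forall>p\<in>points M. Ih p \<inter> Ic p = {0}) \<and>
     (\<forall>\<omega>\<in>Omega1 M (points M) (\<lambda>p. Vh p \<inter> Vc p).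
        \<exists>\<xi>\<in>Omega2 M (points M) Vh. \<exists>\<zeta>\<in>Omega2 M (points M) Vc.
          \<forall>p\<in>points M. ext_d M \<omega> p = \<xi> p + \<zeta> p))"

text \<open>
  0-adapted coframes on an open set \<open>W\<close>. The suffixes h and c stand for the hat and the check
  accents.
\<close>

definition zero_adapted_coframe :: "('m, 'e::euclidean_space) manifold \<Rightarrow>
    ('m \<Rightarrow> ('m, 'e) covector set) \<Rightarrow> ('m \<Rightarrow> ('m, 'e) covector set) \<Rightarrow> 'm set \<Rightarrow>
    ('m, 'e) form1 list \<Rightarrow> ('m, 'e) form1 list \<Rightarrow> ('m, 'e) form1 list \<Rightarrow>
    ('m, 'e) form1 list \<Rightarrow> ('m, 'e) form1 list \<Rightarrow> bool" where
  "zero_adapted_coframe M Vh Vc W \<theta> \<sigma>h \<eta>h \<sigma>c \<eta>c \<longleftrightarrow>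
     (let Ih = last_derived M Vh; Ic = last_derived M Vc in
     local_frame M W \<eta>h (\<lambda>p. Ih p \<inter> Vc p) \<and>
     local_frame M W \<eta>c (\<lambda>p. Vh p \<inter> Ic p) \<and>
     local_frame M W (\<sigma>h @ \<eta>h) Ih \<and>
     local_frame M W (\<sigma>c @ \<eta>c) Ic \<and>
     local_frame M W (\<theta> @ \<eta>h @ \<eta>c) (\<lambda>p. Vh p \<inter> Vc p) \<and>
     local_frame M W (\<theta> @ \<sigma>h @ \<eta>h @ \<sigma>c @ \<eta>c) (cotangent_space M))"

text \<open>
  One component of a boldface expression such as
  $\boldsymbol C\,\boldsymbol\alpha\wedge\boldsymbol\beta$, where \<open>C i j\<close> is the coefficient of
  $\alpha^i\wedge\beta^j$.
\<close>

definition wedge_comb :: "(nat \<Rightarrow> nat \<Rightarrow> 'm \<Rightarrow> real) \<Rightarrow>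
    ('m, 'e) form1 list \<Rightarrow> ('m, 'e) form1 list \<Rightarrow> ('m, 'e) form2" where
  "wedge_comb C \<alpha> \<beta> p =
     (\<Sum>i<length \<alpha>. \<Sum>j<length \<beta>. C i j p *\<^sub>R ((\<alpha> ! i) p \<and>\<^sub>w (\<beta> ! j) p))"

text \<open>\<open>C a i j\<close> is the coefficient of $\alpha^i\wedge\beta^j$ in the component \<open>a\<close> of the tuple.\<close>

definition smooth_coeffs :: "('m, 'e::euclidean_space) manifold \<Rightarrow> 'm set \<Rightarrow>
    (nat \<Rightarrow> nat \<Rightarrow> nat \<Rightarrow> 'm \<Rightarrow> real) \<Rightarrow> bool"
  where "smooth_coeffs M W C \<longleftrightarrow> (\<forall>a i j. smooth_fun M W (C a i j))"

end

theory Submission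
  imports Defs
begin

text \<open>
  By the Frobenius theorem the last derived systems are spanned by exact forms. Completing a frame
  of $\hat V^{(\infty)}\cap\check V$ by some of these gives the closed forms $\hat\sigma$, and
  correcting the other exact forms by combinations of $\hat\sigma$ gives
  $\hat\eta = dI - P\hat\sigma$ in $\hat V^{(\infty)}\cap\check V$, so that
  $d\hat\eta = -dP\wedge\hat\sigma$. Condition (iii) forces $dP\in\hat V$. A closed form in a Pfaffian
  system lies in all of its derived systems, hence $dP\in\hat V^{(\infty)}$, which is the structure
  equation of $\hat\eta$. The equation for $\theta$ is a direct consequence of (iii).

  The first integrals of the Frobenius theorem near $x_0$ are found without straightening: if
  $A(x)$ is the projection onto the annihilator of the system along a fixed complement, the value at
  time 1 of the solution of $z' = -A(z)(c - x_0)$, $z(0) = c$, is a first integral as a function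
  of $c$, because by integrability its derivative along $A(c)v$ is $(1 - t)A(z(t))v$ at time $t$.
\<close>


section \<open>Calculus of smooth maps\<close>

text \<open>Two obstacles lie behind the overview. Derived systems and condition (iii) are
  formulated with sections over all of M, while frames and exact forms are available only near a
  point; bump functions bridge the gap, and closedness of a form has to survive this in a weakened,
  ideal-theoretic sense. Smoothness of the first integrals is smooth dependence of an integral
  equation on its initial value. Derivatives of solutions satisfy linear equations of the same kind,
  so the regularity classes treat time as a parameter in which only continuity is asked. The time
  interval is always [0,1], and shrinking the domain makes Lipschitz constants at most 1/2; one
  contraction and one crude bound then serve throughout. All coefficients in the structure equations
  are contractions with vector fields dual to the coframe, read in one fixed chart. This makes them
  smooth and turns membership in a subspace into vanishing on certain dual vectors, so that
  condition (iii) acts through the values of a 2-form on pairs of such vectors.\<close>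

primrec Ck_param :: "nat \<Rightarrow> 't::topological_space set \<Rightarrow> 'e::euclidean_space set \<Rightarrow>
    ('t \<Rightarrow> 'e \<Rightarrow> 'b::real_normed_vector) \<Rightarrow> bool" where
  "Ck_param 0 T S F \<longleftrightarrow> continuous_on (T \<times> S) (\<lambda>(t, x). F t x)"
| "Ck_param (Suc k) T S F \<longleftrightarrow> continuous_on (T \<times> S) (\<lambda>(t, x). F t x) \<and>
     (\<forall>t\<in>T. \<forall>x\<in>S. F t differentiable (at x)) \<and>
     (\<forall>v. Ck_param k T S (\<lambda>t x. frechet_derivative (F t) (at x) v))"

lemma Ck_param_continuous_on:
  "Ck_param k T S F \<Longrightarrow> continuous_on (T \<times> S) (\<lambda>(t, x). F t x)"
  by (cases k) auto

lemma Ck_param_SucD: "Ck_param (Suc k) T S F \<Longrightarrow> Ck_param k T S F"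
proof (induction k arbitrary: F)
  case (Suc k)
  then have "Ck_param k T S (\<lambda>t x. frechet_derivative (F t) (at x) v)" for v by auto
  with Suc show ?case by simp
qed simp

lemma Ck_param_cong:
  assumes "open S" "\<And>t x. t \<in> T \<Longrightarrow> x \<in> S \<Longrightarrow> F t x = G t x" "Ck_param k T S F"
  shows "Ck_param k T S G"
  using assms(2,3)
proof (induction k arbitrary: F G)
  case 0
  have "continuous_on (T \<times> S) (\<lambda>(t, x). F t x) = continuous_on (T \<times> S) (\<lambda>(t, x). G t x)"
    by (rule continuous_on_cong) (auto simp: 0)
  then show ?case using 0 by simp
next
  case (Suc k)
  have c: "continuous_on (T \<times> S) (\<lambda>(t, x). F t x) = continuous_on (T \<times> S) (\<lambda>(t, x). G t x)"
    by (rule continuous_on_cong) (auto simp: Suc)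
  have d: "(G t has_derivative frechet_derivative (F t) (at x)) (at x)" if "t \<in> T" "x \<in> S" for t x
  proof -
    have "(F t has_derivative frechet_derivative (F t) (at x)) (at x)"
      using Suc.prems(2) that by (simp add: frechet_derivative_works)
    then show ?thesis
      by (rule has_derivative_transform_within_open[OF _ \<open>open S\<close>]) (use that Suc.prems in auto)
  qed
  have e: "frechet_derivative (F t) (at x) v = frechet_derivative (G t) (at x) v"
    if "t \<in> T" "x \<in> S" for t x v
    using frechet_derivative_at[OF d[OF that]] by simp
  have "Ck_param k T S (\<lambda>t x. frechet_derivative (G t) (at x) v)" for v
    by (rule Suc.IH[where F="\<lambda>t x. frechet_derivative (F t) (at x) v"])
      (use e Suc.prems in auto)
  moreover have "G t differentiable (at x)" if "t \<in> T" "x \<in> S" for t x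
    using d[OF that] by (auto simp: differentiable_def)
  ultimately show ?case using c Suc.prems by simp
qed

text \<open>Any explicit derivative \<open>D\<close> may be used in an induction on the order. Joint
  continuity is a separate premise because differentiability in \<open>x\<close> for each
  \<open>t\<close> says nothing about the dependence on \<open>t\<close>.\<close>

lemma Ck_param_SucI:
  assumes "open S" "continuous_on (T \<times> S) (\<lambda>(t, x). F t x)"
    and D: "\<And>t x. t \<in> T \<Longrightarrow> x \<in> S \<Longrightarrow> (F t has_derivative D t x) (at x)"
    and k: "\<And>v. Ck_param k T S (\<lambda>t x. D t x v)"
  shows "Ck_param (Suc k) T S F"
proof -
  have "frechet_derivative (F t) (at x) = D t x" if "t \<in> T" "x \<in> S" for t x
    using frechet_derivative_at[OF D[OF that]] by simp
  then have "Ck_param k T S (\<lambda>t x. frechet_derivative (F t) (at x) v)" for v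
    by (intro Ck_param_cong[OF \<open>open S\<close> _ k[of v]]) auto
  then show ?thesis
    using assms(2) D unfolding Ck_param.simps differentiable_def by blast
qed

lemma Ck_param_has_derivative:
  assumes "Ck_param (Suc k) T S F" "t \<in> T" "x \<in> S"
  shows "(F t has_derivative frechet_derivative (F t) (at x)) (at x)"
  using assms by (simp add: frechet_derivative_works)

lemma Ck_param_derivative:
  "Ck_param (Suc k) T S F \<Longrightarrow> Ck_param k T S (\<lambda>t x. frechet_derivative (F t) (at x) v)"
  by simp

lemma Ck_param_subset:
  "Ck_param k T S F \<Longrightarrow> S' \<subseteq> S \<Longrightarrow> Ck_param k T S' F"
proof (induction k arbitrary: F)
  case 0
  have "T \<times> S' \<subseteq> T \<times> S" using 0 by auto
  with 0 show ?case by (auto intro: continuous_on_subset)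
next
  case (Suc k)
  have "T \<times> S' \<subseteq> T \<times> S" using Suc by auto
  with Suc show ?case by (auto intro: continuous_on_subset)
qed

lemma Ck_param_const:
  fixes g :: "'t::topological_space \<Rightarrow> 'b::real_normed_vector" and S :: "'e::euclidean_space set"
  assumes "open S" "continuous_on T g" shows "Ck_param k T S (\<lambda>t x. g t)"
proof -
  have c: "continuous_on (T \<times> S) (\<lambda>(t, x). g t)"
    unfolding split_beta using assms(2)
    by (rule continuous_on_compose2) (auto intro!: continuous_intros)
  \<comment> \<open>All derivatives of a map that is constant in \<open>x\<close> vanish, so the
    induction on the order concerns only the zero map.\<close>
  have z: "Ck_param k T S (\<lambda>t x. 0::'b)" for k
  proof (induction k)
    case (Suc k)
    then show ?case
      by (intro Ck_param_SucI[where D="\<lambda>_ _ _. 0"] assms) (auto simp: split_beta)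
  qed (simp add: split_beta)
  show ?thesis
  proof (cases k)
    case (Suc m)
    then show ?thesis using z c
      by (simp only:) (intro Ck_param_SucI[where D="\<lambda>_ _ _. 0"] assms, auto)
  qed (use c in simp)
qed

lemma Ck_param_add:
  assumes "open S" "Ck_param k T S F" "Ck_param k T S G"
  shows "Ck_param k T S (\<lambda>t x. F t x + G t x)"
  using assms(2,3)
proof (induction k arbitrary: F G)
  case 0 then show ?case by (auto simp: split_beta intro: continuous_on_add)
next
  case (Suc k)
  show ?case
  proof (rule Ck_param_SucI[OF \<open>open S\<close>])
    show "continuous_on (T \<times> S) (\<lambda>(t, x). F t x + G t x)"
      using Suc.prems by (auto simp: split_beta intro: continuous_on_add)
    show "((\<lambda>x. F t x + G t x) has_derivative
        (\<lambda>v. frechet_derivative (F t) (at x) v + frechet_derivative (G t) (at x) v)) (at x)"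
      if "t \<in> T" "x \<in> S" for t x
      using Ck_param_has_derivative[OF Suc.prems(1) that] Ck_param_has_derivative[OF Suc.prems(2) that]
      by (rule has_derivative_add)
  qed (use Suc in auto)
qed

lemma Ck_param_bilinear:
  assumes "bounded_bilinear prd" "open S" "Ck_param k T S F" "Ck_param k T S G"
  shows "Ck_param k T S (\<lambda>t x. prd (F t x) (G t x))"
  using assms(3,4)
proof (induction k arbitrary: F G)
  case 0 then show ?case
    by (auto simp: split_beta intro: bounded_bilinear.continuous_on[OF assms(1)])
next
  case (Suc k)
  show ?case
  proof (rule Ck_param_SucI[OF \<open>open S\<close>])
    show "continuous_on (T \<times> S) (\<lambda>(t, x). prd (F t x) (G t x))"
      using Suc.prems by (auto simp: split_beta intro: bounded_bilinear.continuous_on[OF assms(1)])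
    show "((\<lambda>x. prd (F t x) (G t x)) has_derivative
        (\<lambda>v. prd (F t x) (frechet_derivative (G t) (at x) v)
           + prd (frechet_derivative (F t) (at x) v) (G t x))) (at x)"
      if "t \<in> T" "x \<in> S" for t x
      using Ck_param_has_derivative[OF Suc.prems(1) that] Ck_param_has_derivative[OF Suc.prems(2) that]
      by (rule bounded_bilinear.FDERIV[OF assms(1)])
    show "Ck_param k T S (\<lambda>t x. prd (F t x) (frechet_derivative (G t) (at x) v)
           + prd (frechet_derivative (F t) (at x) v) (G t x))" for v
      using Ck_param_derivative Suc.prems
      by (intro Ck_param_add[OF assms(2)] Suc.IH Ck_param_SucD[OF Suc.prems(1)] Ck_param_SucD[OF Suc.prems(2)])
        auto
  qed
qed

lemma Ck_param_linear:
  assumes "bounded_linear L" "open S" shows "Ck_param k T S (\<lambda>t x. L x)"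
proof -
  have c: "continuous_on (T \<times> S) (\<lambda>(t, x). L x)"
    unfolding split_beta by (intro bounded_linear.continuous_on[OF assms(1)] continuous_intros)
  show ?thesis
  proof (cases k)
    case (Suc m)
    show ?thesis unfolding Suc
      by (intro Ck_param_SucI[where D="\<lambda>_ _. L"] bounded_linear_imp_has_derivative assms c
          Ck_param_const continuous_on_const)
  qed (use c in simp)
qed

lemma Ck_param_sum:
  assumes "open S" "\<And>i. i \<in> I \<Longrightarrow> Ck_param k T S (F i)"
  shows "Ck_param k T S (\<lambda>t x. \<Sum>i\<in>I. F i t x)"
proof (cases "finite I")
  case True
  then show ?thesis using assms(2)
    by (induction I) (auto intro!: Ck_param_add Ck_param_const assms(1) continuous_intros)
qed (auto intro!: Ck_param_const assms(1) continuous_intros)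

lemmas Ck_param_scaleR = Ck_param_bilinear[OF bounded_bilinear_scaleR]
lemmas Ck_param_inner = Ck_param_bilinear[OF bounded_bilinear_inner]
lemmas Ck_param_mult = Ck_param_bilinear[OF bounded_bilinear_mult]

lemma Ck_param_bounded_linear:
  assumes "bounded_linear L" "open S" "Ck_param k T S F"
  shows "Ck_param k T S (\<lambda>t x. L (F t x))"
proof -
  interpret L: bounded_linear L by fact
  \<comment> \<open>Composition with \<open>L\<close> becomes a case of the product rule, for the
    bilinear map \<open>\<lambda>r y. r *\<^sub>R L y\<close> with the constant first factor
    1.\<close>
  have bb: "bounded_bilinear (\<lambda>(r::real) y. r *\<^sub>R L y)"
    using bounded_bilinear.comp[OF bounded_bilinear_scaleR bounded_linear_ident assms(1)] .
  have "Ck_param k T S (\<lambda>t x. 1 *\<^sub>R L (F t x))"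
    by (rule Ck_param_bilinear[OF bb assms(2) _ assms(3)])
      (intro Ck_param_const assms continuous_intros)
  then show ?thesis by simp
qed

text \<open>A one-point parameter space turns \<open>Ck_param\<close> into \<open>Ck_on\<close>, so
  closure rules proved with parameters also serve for plain smooth maps. Continuity, which
  \<open>Ck_on\<close> does not list at positive orders, follows from differentiability.\<close>

lemma Ck_param_iff_Ck_on:
  assumes "open S"
  shows "Ck_param k {0::real} S (\<lambda>_. f) \<longleftrightarrow> Ck_on k S f"
proof -
  have c: "continuous_on ({0::real} \<times> S) (\<lambda>(t, x). f x) \<longleftrightarrow> continuous_on S f" for f :: "'a \<Rightarrow> 'c::real_normed_vector"
  proof
    assume "continuous_on ({0::real} \<times> S) (\<lambda>(t, x). f x)"
    then have "continuous_on S (\<lambda>x. (\<lambda>(t, x). f x) (0::real, x))"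
      by (rule continuous_on_compose2) (auto intro!: continuous_intros)
    then show "continuous_on S f" by simp
  next
    assume "continuous_on S f"
    then show "continuous_on ({0::real} \<times> S) (\<lambda>(t, x). f x)"
      unfolding split_beta by (rule continuous_on_compose2) (auto intro!: continuous_intros)
  qed
  show ?thesis
  proof (induction k arbitrary: f)
    case 0 show ?case by (simp add: c)
  next
    case (Suc k)
    have "continuous_on S f" if "\<forall>x\<in>S. f differentiable (at x)"
      using that by (meson continuous_at_imp_continuous_on differentiable_imp_continuous_within)
    then show ?case using Suc by (auto simp: c)
  qed
qed

lemma Ck_param_compose:
  fixes F :: "'t::topological_space \<Rightarrow> 'e::euclidean_space \<Rightarrow> 'f::euclidean_space"
    and g :: "'f \<Rightarrow> 'b::real_normed_vector"
  assumes "open S" "open U" "\<And>t x. t \<in> T \<Longrightarrow> x \<in> S \<Longrightarrow> F t x \<in> U" "Ck_param k T S F" "Ck_on k U g"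
  shows "Ck_param k T S (\<lambda>t x. g (F t x))"
  using assms(4,5)
proof (induction k arbitrary: g)
  case 0
  then show ?case
    unfolding split_beta Ck_param.simps Ck_on.simps
    by (auto intro: continuous_on_compose2 simp: assms(3))
next
  case (Suc k)
  have dg: "(g has_derivative frechet_derivative g (at y)) (at y)" if "y \<in> U" for y
    using Suc.prems(2) that by (simp add: frechet_derivative_works)
  have lg: "linear (frechet_derivative g (at y))" if "y \<in> U" for y
    using dg[OF that] by (rule has_derivative_linear)
  have cg: "continuous_on U g"
    using dg by (meson continuous_at_imp_continuous_on has_derivative_continuous)
  show ?case
  proof (rule Ck_param_SucI[OF \<open>open S\<close>])
    show "continuous_on (T \<times> S) (\<lambda>(t, x). g (F t x))"
      using Ck_param_continuous_on[OF Suc.prems(1)] unfolding split_beta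
      by (rule continuous_on_compose2[OF cg]) (auto simp: assms(3))
    fix t x assume tx: "t \<in> T" "x \<in> S"
    have "((\<lambda>x. g (F t x)) has_derivative
        (\<lambda>v. frechet_derivative g (at (F t x)) (frechet_derivative (F t) (at x) v))) (at x)"
      using diff_chain_at[OF Ck_param_has_derivative[OF Suc.prems(1) tx] dg[OF assms(3)[OF tx]]]
      by (simp add: o_def)
    \<comment> \<open>The induction hypothesis concerns derivatives of \<open>g\<close> in a fixed
      direction, whereas the chain rule produces a direction that varies with the point. Expanding
      it over \<open>Basis\<close> leaves fixed directions with varying scalar factors.\<close>
    moreover have eq: "frechet_derivative g (at (F t x)) w =
        (\<Sum>b\<in>Basis. (w \<bullet> b) *\<^sub>R frechet_derivative g (at (F t x)) b)" for w
    proof -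
      have "frechet_derivative g (at (F t x)) (\<Sum>b\<in>Basis. (w \<bullet> b) *\<^sub>R b) =
        (\<Sum>b\<in>Basis. (w \<bullet> b) *\<^sub>R frechet_derivative g (at (F t x)) b)"
        by (simp only: linear_sum[OF lg[OF assms(3)[OF tx]]] linear_scale[OF lg[OF assms(3)[OF tx]]])
      then show ?thesis by (simp add: euclidean_representation)
    qed
    ultimately show "((\<lambda>x. g (F t x)) has_derivative
        (\<lambda>v. (\<Sum>b\<in>Basis. (frechet_derivative (F t) (at x) v \<bullet> b) *\<^sub>R frechet_derivative g (at (F t x)) b))) (at x)"
      by (subst (asm) eq)
  next
    fix v
    have "Ck_param k T S (\<lambda>t x. frechet_derivative g (at (F t x)) b)" for b
      by (rule Suc.IH[OF Ck_param_SucD[OF Suc.prems(1)]]) (use Suc.prems in auto)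
    then show "Ck_param k T S (\<lambda>t x. (\<Sum>b\<in>Basis. (frechet_derivative (F t) (at x) v \<bullet> b) *\<^sub>R
        frechet_derivative g (at (F t x)) b))"
      using Suc.prems
      by (intro Ck_param_sum Ck_param_scaleR Ck_param_inner Ck_param_const Ck_param_derivative assms(1)
          continuous_intros) auto
  qed
qed

lemma Ck_on_local:
  assumes "\<And>x. x \<in> S \<Longrightarrow> \<exists>N. open N \<and> x \<in> N \<and> Ck_on k N f"
  shows "Ck_on k S f"
  using assms
proof (induction k arbitrary: f)
  case 0
  have "continuous (at x) f" if "x \<in> S" for x
    using 0[OF that] by (auto simp: continuous_on_eq_continuous_at)
  then show ?case by (simp add: continuous_at_imp_continuous_on)
next
  case (Suc k)
  have "Ck_on k S (\<lambda>x. frechet_derivative f (at x) v)" for v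
    by (rule Suc.IH) (use Suc.prems in fastforce)
  moreover have "\<forall>x\<in>S. f differentiable (at x)"
    using Suc.prems by fastforce
  ultimately show ?case by simp
qed

section \<open>Closure properties of smooth maps\<close>

lemma smooth_on_param: "open S \<Longrightarrow> smooth_on S f \<longleftrightarrow> (\<forall>k. Ck_param k {0::real} S (\<lambda>_. f))"
  by (simp add: smooth_on_def Ck_param_iff_Ck_on)

lemma smooth_on_const: "open S \<Longrightarrow> smooth_on S (\<lambda>x. c)"
  unfolding smooth_on_param by (intro allI Ck_param_const continuous_on_const)

lemma smooth_on_linear: "bounded_linear L \<Longrightarrow> open S \<Longrightarrow> smooth_on S L"
  unfolding smooth_on_param by (intro allI, rule Ck_param_linear) auto

lemma smooth_on_bounded_linear:
  "bounded_linear L \<Longrightarrow> open S \<Longrightarrow> smooth_on S f \<Longrightarrow> smooth_on S (\<lambda>x. L (f x))"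
  unfolding smooth_on_param by (intro allI, rule Ck_param_bounded_linear) auto

lemma smooth_on_bilinear:
  "bounded_bilinear prd \<Longrightarrow> open S \<Longrightarrow> smooth_on S f \<Longrightarrow> smooth_on S g \<Longrightarrow> smooth_on S (\<lambda>x. prd (f x) (g x))"
  unfolding smooth_on_param by (intro allI, rule Ck_param_bilinear) auto

lemmas smooth_on_scaleR = smooth_on_bilinear[OF bounded_bilinear_scaleR]
lemmas smooth_on_inner = smooth_on_bilinear[OF bounded_bilinear_inner]
lemmas smooth_on_mult = smooth_on_bilinear[OF bounded_bilinear_mult]

lemma smooth_on_add:
  "open S \<Longrightarrow> smooth_on S f \<Longrightarrow> smooth_on S g \<Longrightarrow> smooth_on S (\<lambda>x. f x + g x)"
  unfolding smooth_on_param by (intro allI, rule Ck_param_add) auto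

lemma smooth_on_sum:
  "open S \<Longrightarrow> (\<And>i. i \<in> I \<Longrightarrow> smooth_on S (f i)) \<Longrightarrow> smooth_on S (\<lambda>x. \<Sum>i\<in>I. f i x)"
  unfolding smooth_on_param by (intro allI Ck_param_sum) auto

lemma smooth_on_minus:
  "open S \<Longrightarrow> smooth_on S f \<Longrightarrow> smooth_on S (\<lambda>x. - f x)"
  by (rule smooth_on_bounded_linear) (auto intro: bounded_linear_minus bounded_linear_ident)

lemma smooth_on_diff:
  "open S \<Longrightarrow> smooth_on S f \<Longrightarrow> smooth_on S g \<Longrightarrow> smooth_on S (\<lambda>x. f x - g x)"
  using smooth_on_add[of S f "\<lambda>x. - g x"] by (simp add: smooth_on_minus)

lemma smooth_on_compose:
  fixes f :: "'e::euclidean_space \<Rightarrow> 'f::euclidean_space"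
  assumes "open S" "open U" "f ` S \<subseteq> U" "smooth_on S f" "smooth_on U g"
  shows "smooth_on S (\<lambda>x. g (f x))"
proof -
  have "Ck_param k {0::real} S (\<lambda>_ x. g (f x))" for k
  proof (rule Ck_param_compose[OF assms(1,2)])
    show "Ck_param k {0::real} S (\<lambda>_. f)" using assms by (simp add: smooth_on_param)
    show "Ck_on k U g" using assms by (simp add: smooth_on_def)
  qed (use assms in auto)
  then show ?thesis unfolding smooth_on_param[OF assms(1)] by blast
qed

lemma smooth_on_cong:
  "open S \<Longrightarrow> (\<And>x. x \<in> S \<Longrightarrow> f x = g x) \<Longrightarrow> smooth_on S f \<Longrightarrow> smooth_on S g"
  unfolding smooth_on_param by (intro allI, rule Ck_param_cong[where F="\<lambda>_. f"]) auto

lemma smooth_on_subset: "open S' \<Longrightarrow> S' \<subseteq> S \<Longrightarrow> open S \<Longrightarrow> smooth_on S f \<Longrightarrow> smooth_on S' f"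
  unfolding smooth_on_param by (intro allI, rule Ck_param_subset) auto

lemma smooth_on_local:
  assumes "\<And>x. x \<in> S \<Longrightarrow> \<exists>N. open N \<and> x \<in> N \<and> smooth_on N f"
  shows "smooth_on S f"
  unfolding smooth_on_def
proof
  fix k
  show "Ck_on k S f"
    by (rule Ck_on_local) (use assms in \<open>auto simp: smooth_on_def\<close>)
qed

lemma smooth_on_differentiable: "smooth_on S f \<Longrightarrow> x \<in> S \<Longrightarrow> f differentiable (at x)"
  using Ck_on.simps(2)[of 0 S f] by (auto simp: smooth_on_def)

lemma smooth_on_has_derivative:
  "smooth_on S f \<Longrightarrow> x \<in> S \<Longrightarrow> (f has_derivative frechet_derivative f (at x)) (at x)"
  using smooth_on_differentiable frechet_derivative_works by blast

lemma smooth_on_linear_derivative: "smooth_on S f \<Longrightarrow> x \<in> S \<Longrightarrow> linear (frechet_derivative f (at x))"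
  using smooth_on_has_derivative has_derivative_linear by blast

lemma smooth_on_derivative: "smooth_on S f \<Longrightarrow> smooth_on S (\<lambda>x. frechet_derivative f (at x) v)"
  unfolding smooth_on_def using Ck_on.simps(2) by blast

lemma smooth_on_continuous: "smooth_on S f \<Longrightarrow> continuous_on S f"
  using Ck_on.simps(1)[of S f] by (simp only: smooth_on_def)

text \<open>The derivative of \<open>inverse\<close> is a polynomial in \<open>inverse\<close>
  itself, which lets the induction on the order close.\<close>

lemma smooth_on_inverse: "smooth_on (- {0::real}) inverse"
proof -
  have "Ck_param k {0::real} (- {0::real}) (\<lambda>_. inverse)" for k
  proof (induction k)
    case 0
    show ?case by (auto simp: split_beta intro!: continuous_intros)
  next
    case (Suc k)
    show ?case
    proof (rule Ck_param_SucI[where D="\<lambda>_ x v. (- 1 * v) * (inverse x * inverse x)"])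
      show "Ck_param k {0::real} (- {0::real}) (\<lambda>_ x. (- 1 * v) * (inverse x * inverse x))" for v
        using Suc by (intro Ck_param_mult Ck_param_const continuous_intros) auto
      show "continuous_on ({0} \<times> - {0}) (\<lambda>(t::real, x::real). inverse x)"
        by (auto simp: split_beta intro!: continuous_intros)
      show "(inverse has_derivative (\<lambda>v. (- 1 * v) * (inverse x * inverse x))) (at x)"
        if "x \<in> - {0::real}" for x
        using has_derivative_inverse'[of x UNIV] that
        by (simp add: algebra_simps)
    qed auto
  qed
  then show ?thesis unfolding smooth_on_param[OF open_Compl[OF closed_singleton]] by blast
qed

lemma smooth_on_divide:
  fixes f g :: "'e::euclidean_space \<Rightarrow> real"
  assumes "open S" "smooth_on S f" "smooth_on S g" "\<And>x. x \<in> S \<Longrightarrow> g x \<noteq> 0"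
  shows "smooth_on S (\<lambda>x. f x / g x)"
proof -
  have "smooth_on S (\<lambda>x. inverse (g x))"
    using assms by (intro smooth_on_compose[OF _ _ _ _ smooth_on_inverse]) auto
  then have "smooth_on S (\<lambda>x. f x * inverse (g x))"
    using assms by (intro smooth_on_mult)
  then show ?thesis by (simp add: divide_inverse)
qed


section \<open>Mixed partial derivatives, bump functions, integral equations\<close>

lemma mixed_difference:
  fixes f :: "'e::euclidean_space \<Rightarrow> real"
  assumes "open S" "smooth_on S f" "x \<in> S" "e > 0"
  shows "\<exists>h0>0. \<forall>h. 0 < h \<and> h < h0 \<longrightarrow>
    \<bar>f (x + h *\<^sub>R u + h *\<^sub>R v) - f (x + h *\<^sub>R u) - f (x + h *\<^sub>R v) + f x
      - h\<^sup>2 * frechet_derivative (\<lambda>y. frechet_derivative f (at y) u) (at x) v\<bar> \<le> e * h\<^sup>2"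
proof -
  define g where "g y = frechet_derivative f (at y) u" for y
  define k where "k y = frechet_derivative g (at y) v" for y
  have sg: "smooth_on S g" unfolding g_def[abs_def] by (rule smooth_on_derivative[OF assms(2)])
  have "smooth_on S k" unfolding k_def[abs_def] by (rule smooth_on_derivative[OF sg])
  then have "continuous (at x) k"
    using smooth_on_continuous continuous_on_eq_continuous_at assms by blast
  then obtain d where d: "d > 0" "\<And>y. dist y x < d \<Longrightarrow> \<bar>k y - k x\<bar> < e"
    using \<open>e > 0\<close> unfolding continuous_at_eps_delta dist_real_def by metis
  obtain r where r: "r > 0" "ball x r \<subseteq> S" using assms openE by blast
  \<comment> \<open>The summand 1 keeps the constant positive for \<open>u = v = 0\<close>. With
    steps below \<open>h0\<close> the whole parallelogram lies in \<open>S\<close> and within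
    distance \<open>d\<close> of \<open>x\<close>.\<close>
  define C where "C = norm u + norm v + 1"
  have C: "C > 0" by (simp add: C_def add_nonneg_pos)
  define h0 where "h0 = min d r / C"
  have near: "x + s *\<^sub>R u + t *\<^sub>R v \<in> S \<and> dist (x + s *\<^sub>R u + t *\<^sub>R v) x < d"
    if "0 \<le> s" "s \<le> h" "0 \<le> t" "t \<le> h" "0 < h" "h < h0" for s t h
  proof -
    have "norm (s *\<^sub>R u + t *\<^sub>R v) \<le> s * norm u + t * norm v"
      using norm_triangle_ineq[of "s *\<^sub>R u" "t *\<^sub>R v"] that by simp
    also have "\<dots> \<le> h * norm u + h * norm v"
      using that by (intro add_mono mult_right_mono) auto
    also have "\<dots> \<le> h * C" using that by (simp add: C_def algebra_simps)
    also have "\<dots> < min d r" using that C by (simp add: h0_def field_simps)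
    finally have "dist (x + s *\<^sub>R u + t *\<^sub>R v) x < min d r"
      by (simp add: dist_norm add.assoc)
    then show ?thesis using r by (auto simp: dist_commute)
  qed
  show ?thesis
  proof (intro exI[of _ h0] conjI allI impI)
    show "h0 > 0" using C d r by (simp add: h0_def)
    fix h assume h: "0 < h \<and> h < h0"
    \<comment> \<open>The mean value theorem is applied twice: to \<open>\<phi>\<close> in the
      direction \<open>u\<close>, then to \<open>g\<close> in the direction \<open>v\<close>. The
      second difference becomes h squared times a value of \<open>k\<close> near
      \<open>x\<close>.\<close>
    define \<phi> where "\<phi> s = f (x + s *\<^sub>R u + h *\<^sub>R v) - f (x + s *\<^sub>R u)" for s
    have lf: "linear (frechet_derivative f (at y))" if "y \<in> S" for y
      using smooth_on_linear_derivative[OF assms(2) that] .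
    have df: "((\<lambda>s. f (a + s *\<^sub>R u)) has_real_derivative g (a + s *\<^sub>R u)) (at s)" if "a + s *\<^sub>R u \<in> S" for a s
    proof -
      have "((\<lambda>s. a + s *\<^sub>R u) has_derivative (\<lambda>t. t *\<^sub>R u)) (at s)"
        by (auto intro!: derivative_eq_intros)
      from diff_chain_at[OF this smooth_on_has_derivative[OF assms(2) that]]
      show ?thesis
        by (simp add: o_def has_field_derivative_def g_def linear_scale[OF lf[OF that]] mult_commute_abs)
    qed
    have dg: "((\<lambda>s. g (a + s *\<^sub>R v)) has_real_derivative k (a + s *\<^sub>R v)) (at s)" if "a + s *\<^sub>R v \<in> S" for a s
    proof -
      have "((\<lambda>s. a + s *\<^sub>R v) has_derivative (\<lambda>t. t *\<^sub>R v)) (at s)"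
        by (auto intro!: derivative_eq_intros)
      from diff_chain_at[OF this smooth_on_has_derivative[OF sg that]]
      show ?thesis
        using linear_scale[OF smooth_on_linear_derivative[OF sg that]]
        by (simp add: o_def has_field_derivative_def k_def mult_commute_abs)
    qed
    have "(\<phi> has_real_derivative g (x + s *\<^sub>R u + h *\<^sub>R v) - g (x + s *\<^sub>R u)) (at s)"
      if "0 \<le> s" "s \<le> h" for s
    proof -
      have "((\<lambda>s. f (x + h *\<^sub>R v + s *\<^sub>R u)) has_real_derivative g (x + h *\<^sub>R v + s *\<^sub>R u)) (at s)"
        by (rule df) (use near[of s h h] that h in \<open>simp add: algebra_simps\<close>)
      moreover have "((\<lambda>s. f (x + s *\<^sub>R u)) has_real_derivative g (x + s *\<^sub>R u)) (at s)"
        by (rule df) (use near[of s h 0] that h in \<open>simp add: algebra_simps\<close>)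
      ultimately show ?thesis
        unfolding \<phi>_def[abs_def] by (intro DERIV_diff) (simp_all add: algebra_simps)
    qed
    then obtain s where s: "0 < s" "s < h" "\<phi> h - \<phi> 0 = (h - 0) * (g (x + s *\<^sub>R u + h *\<^sub>R v) - g (x + s *\<^sub>R u))"
      using MVT2[of 0 h \<phi> "\<lambda>s. g (x + s *\<^sub>R u + h *\<^sub>R v) - g (x + s *\<^sub>R u)"] h by auto
    have "((\<lambda>t. g (x + s *\<^sub>R u + t *\<^sub>R v)) has_real_derivative k (x + s *\<^sub>R u + t *\<^sub>R v)) (at t)"
      if "0 \<le> t" "t \<le> h" for t
      by (rule dg) (use near[of s h t] that h s in simp)
    then obtain t where t: "0 < t" "t < h" "g (x + s *\<^sub>R u + h *\<^sub>R v) - g (x + s *\<^sub>R u + 0 *\<^sub>R v) = (h - 0) * k (x + s *\<^sub>R u + t *\<^sub>R v)"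
      using MVT2[of 0 h "\<lambda>t. g (x + s *\<^sub>R u + t *\<^sub>R v)" "\<lambda>t. k (x + s *\<^sub>R u + t *\<^sub>R v)"] h by auto
    have "\<bar>k (x + s *\<^sub>R u + t *\<^sub>R v) - k x\<bar> < e"
      using near[of s h t] s t h by (intro d) auto
    moreover have "f (x + h *\<^sub>R u + h *\<^sub>R v) - f (x + h *\<^sub>R u) - f (x + h *\<^sub>R v) + f x
      - h\<^sup>2 * k x = (k (x + s *\<^sub>R u + t *\<^sub>R v) - k x) * h\<^sup>2"
    proof -
      have "f (x + h *\<^sub>R u + h *\<^sub>R v) - f (x + h *\<^sub>R u) - f (x + h *\<^sub>R v) + f x = \<phi> h - \<phi> 0"
        by (simp add: \<phi>_def)
      also have "\<dots> = h * (h * k (x + s *\<^sub>R u + t *\<^sub>R v))" using s(3) t(3) by simp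
      finally show ?thesis by (simp add: algebra_simps power2_eq_square)
    qed
    ultimately show "\<bar>f (x + h *\<^sub>R u + h *\<^sub>R v) - f (x + h *\<^sub>R u) - f (x + h *\<^sub>R v) + f x
      - h\<^sup>2 * frechet_derivative (\<lambda>y. frechet_derivative f (at y) u) (at x) v\<bar> \<le> e * h\<^sup>2"
      by (simp add: k_def g_def[symmetric] abs_mult mult_right_mono flip: g_def[abs_def])
  qed
qed

text \<open>The second difference does not change when \<open>u\<close> and \<open>v\<close> are
  swapped, so after division by h squared both iterated derivatives are limits of the same
  quotient.\<close>

lemma mixed_partials_commute:
  fixes f :: "'e::euclidean_space \<Rightarrow> real"
  assumes "open S" "smooth_on S f" "x \<in> S"
  shows "frechet_derivative (\<lambda>y. frechet_derivative f (at y) u) (at x) v =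
    frechet_derivative (\<lambda>y. frechet_derivative f (at y) v) (at x) u" (is "?a = ?b")
proof -
  have "\<bar>?a - ?b\<bar> \<le> 0 + e" if "e > 0" for e
  proof -
    from that have e2: "e / 2 > 0" by simp
    obtain h1 where h1: "h1 > 0" "\<And>h. 0 < h \<and> h < h1 \<Longrightarrow>
      \<bar>f (x + h *\<^sub>R u + h *\<^sub>R v) - f (x + h *\<^sub>R u) - f (x + h *\<^sub>R v) + f x - h\<^sup>2 * ?a\<bar> \<le> e / 2 * h\<^sup>2"
      using mixed_difference[OF assms e2] by blast
    obtain h2 where h2: "h2 > 0" "\<And>h. 0 < h \<and> h < h2 \<Longrightarrow>
      \<bar>f (x + h *\<^sub>R v + h *\<^sub>R u) - f (x + h *\<^sub>R v) - f (x + h *\<^sub>R u) + f x - h\<^sup>2 * ?b\<bar> \<le> e / 2 * h\<^sup>2"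
      using mixed_difference[OF assms e2] by blast
    define h where "h = min h1 h2 / 2"
    have h: "0 < h" "h < h1" "h < h2" using h1 h2 by (auto simp: h_def min_def)
    have "x + h *\<^sub>R v + h *\<^sub>R u = x + h *\<^sub>R u + h *\<^sub>R v" by simp
    then have "\<bar>h\<^sup>2 * ?a - h\<^sup>2 * ?b\<bar> \<le> e * h\<^sup>2"
      using h1(2)[OF conjI[OF h(1,2)]] h2(2)[OF conjI[OF h(1,3)]] by (simp only:)
    then have "h\<^sup>2 * \<bar>?a - ?b\<bar> \<le> h\<^sup>2 * e"
      by (simp add: right_diff_distrib[symmetric] abs_mult mult.commute)
    then show ?thesis using h by (simp add: mult_le_cancel_left_pos)
  qed
  then have "\<bar>?a - ?b\<bar> \<le> 0" by (rule field_le_epsilon)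
  then show ?thesis by simp
qed

section \<open>Flat functions and smooth bumps\<close>

definition flat :: "nat \<Rightarrow> real \<Rightarrow> real" where
  "flat n t = (if t > 0 then exp (- (1 / t)) / t ^ n else 0)"

text \<open>One term of the exponential series, of order \<open>n + 2\<close> at
  \<open>1 / t\<close>, gives the estimate. A quadratic bound forces the difference quotient at 0 to
  vanish in the limit.\<close>

lemma flat_bound: "\<exists>C. \<forall>t. \<bar>flat n t\<bar> \<le> C * t\<^sup>2"
proof -
  have "flat n t \<le> fact (n + 2) * t\<^sup>2" if "t > 0" for t
  proof -
    have "(1 / t) ^ (n + 2) / fact (n + 2) \<le> exp (1 / t)"
    proof -
      have "(\<Sum>k\<in>{n + 2}. (1 / t) ^ k /\<^sub>R fact k) \<le> (\<Sum>k. (1 / t) ^ k /\<^sub>R fact k)"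
        by (rule sum_le_suminf) (use that summable_exp[of "1 / t"] in \<open>auto simp: mult.commute\<close>)
      then show ?thesis by (simp add: exp_def divide_inverse mult.commute)
    qed
    moreover define a :: real where "a = fact (n + 2)"
    moreover have "a > 0" by (simp add: a_def)
    ultimately have "exp (- (1 / t)) \<le> a * t ^ (n + 2)"
      using that by (simp add: exp_minus power_divide divide_simps mult.commute)
    then show ?thesis using that unfolding a_def[symmetric]
      by (simp add: flat_def divide_simps power_add power2_eq_square algebra_simps)
  qed
  moreover have "0 \<le> flat n t" for t by (simp add: flat_def)
  ultimately have "\<bar>flat n t\<bar> \<le> fact (n + 2) * t\<^sup>2" for t
    by (cases "t > 0") (auto simp: flat_def)
  then show ?thesis by blast
qed

text \<open>The powers of \<open>t\<close> in the denominators of \<open>flat\<close> are there for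
  this closure: differentiation stays within linear combinations of the family, so smoothness
  follows by induction on the order for all \<open>n\<close> at once.\<close>

lemma flat_has_derivative:
  "(flat n has_real_derivative (flat (n + 2) t - real n * flat (n + 1) t)) (at t)"
proof -
  consider "t > 0" | "t < 0" | "t = 0" by linarith
  then show ?thesis
  proof cases
    case 1
    have "((\<lambda>t. exp (- (1 / t)) / t ^ n) has_real_derivative (flat (n + 2) t - real n * flat (n + 1) t)) (at t)"
    proof (cases n)
      case 0
      show ?thesis unfolding 0 using 1
        by (auto intro!: derivative_eq_intros simp: flat_def field_simps power2_eq_square)
    next
      case (Suc m)
      have "t ^ m = t * t ^ (m - Suc 0) \<or> m = 0" by (cases m) auto
      then show ?thesis unfolding Suc using 1
        by (elim disjE) (auto intro!: derivative_eq_intros simp: flat_def field_simps power2_eq_square power_add)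
    qed
    then show ?thesis
      by (rule has_field_derivative_transform_within_open[of _ _ _ "{0<..}"]) (use 1 in \<open>auto simp: flat_def\<close>)
  next
    case 2
    have "((\<lambda>t. 0) has_real_derivative (flat (n + 2) t - real n * flat (n + 1) t)) (at t)"
      using 2 by (simp add: flat_def)
    then show ?thesis
      by (rule has_field_derivative_transform_within_open[of _ _ _ "{..<0}"]) (use 2 in \<open>auto simp: flat_def\<close>)
  next
    case 3
    obtain C where C: "\<And>t. \<bar>flat n t\<bar> \<le> C * t\<^sup>2" using flat_bound by blast
    have "((\<lambda>t. flat n t / t) \<longlongrightarrow> 0) (at 0)"
    proof (rule Lim_null_comparison)
      show "\<forall>\<^sub>F t in at 0. norm (flat n t / t) \<le> C * \<bar>t\<bar>"
      proof (rule always_eventually, rule allI)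
        fix t
        have "C * t\<^sup>2 = C * \<bar>t\<bar> * \<bar>t\<bar>" by (simp add: power2_eq_square mult.assoc)
        then show "norm (flat n t / t) \<le> C * \<bar>t\<bar>"
          using C[of t] C[of 1] by (cases "t = 0") (auto simp: field_simps)
      qed
      show "((\<lambda>t. C * \<bar>t\<bar>) \<longlongrightarrow> 0) (at 0)" by (auto intro!: tendsto_eq_intros)
    qed
    then show ?thesis using 3 by (simp add: has_field_derivative_iff flat_def)
  qed
qed

lemma smooth_on_flat: "smooth_on UNIV (flat n)"
proof -
  have "Ck_param k {0::real} UNIV (\<lambda>_. flat n)" for k n
  proof (induction k arbitrary: n)
    case 0
    have "continuous_on UNIV (flat n)"
      using flat_has_derivative by (intro continuous_at_imp_continuous_on) (blast intro: DERIV_isCont)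
    then show ?case unfolding Ck_param_iff_Ck_on[OF open_UNIV] by simp
  next
    case (Suc k)
    show ?case
    proof (rule Ck_param_SucI[where D="\<lambda>_ t v. (flat (n + 2) t + - real n * flat (n + 1) t) * v"])
      show "continuous_on ({0} \<times> UNIV) (\<lambda>(t::real, x). flat n x)"
        using Suc[THEN Ck_param_continuous_on] by simp
      show "(flat n has_derivative (\<lambda>v. (flat (n + 2) x + - real n * flat (n + 1) x) * v)) (at x)" for x
        using flat_has_derivative[of n x] by (simp add: has_field_derivative_def)
      show "Ck_param k {0::real} UNIV (\<lambda>t x. (flat (n + 2) x + - real n * flat (n + 1) x) * v)" for v
        by (intro Ck_param_mult Ck_param_add Ck_param_const Suc continuous_on_const open_UNIV)
    qed simp
  qed
  then show ?thesis unfolding smooth_on_param[OF open_UNIV] by blast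
qed

lemma euclidean_bump:
  fixes x0 :: "'e::euclidean_space"
  assumes "r > 0"
  obtains b :: "'e \<Rightarrow> real" where "smooth_on UNIV b" "\<And>x. dist x0 x \<le> r / 2 \<Longrightarrow> b x = 1"
    "\<And>x. dist x0 x \<ge> r \<Longrightarrow> b x = 0"
proof -
  \<comment> \<open>The squared distance is smooth also at the centre. The two summands of the
    denominator below cannot vanish together, because \<open>q x < r\<^sup>2\<close> or
    \<open>q x > (r / 2)\<^sup>2\<close> always holds.\<close>
  define q where "q x = (x - x0) \<bullet> (x - x0)" for x
  define b where "b x = flat 0 (r\<^sup>2 - q x) / (flat 0 (r\<^sup>2 - q x) + flat 0 (q x - (r / 2)\<^sup>2))" for x
  have q: "q x = (dist x0 x)\<^sup>2" for x by (simp add: q_def dist_norm power2_norm_eq_inner inner_diff_left inner_diff_right inner_commute)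
  have sq: "smooth_on UNIV q" unfolding q_def[abs_def]
    by (intro smooth_on_inner smooth_on_diff smooth_on_const smooth_on_linear bounded_linear_ident open_UNIV)
  have s1: "smooth_on UNIV (\<lambda>x. flat 0 (r\<^sup>2 - q x))"
    by (rule smooth_on_compose[OF _ _ _ _ smooth_on_flat])
      (auto intro!: smooth_on_diff smooth_on_const sq)
  have s2: "smooth_on UNIV (\<lambda>x. flat 0 (q x - (r / 2)\<^sup>2))"
    by (rule smooth_on_compose[OF _ _ _ _ smooth_on_flat])
      (auto intro!: smooth_on_diff smooth_on_const sq)
  have nn: "0 \<le> flat 0 t" "t > 0 \<Longrightarrow> 0 < flat 0 t" "t \<le> 0 \<Longrightarrow> flat 0 t = 0" for t
    by (auto simp: flat_def)
  have pos: "flat 0 (r\<^sup>2 - q x) + flat 0 (q x - (r / 2)\<^sup>2) > 0" for x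
  proof (cases "q x < r\<^sup>2")
    case True then show ?thesis using nn by (simp add: add_pos_nonneg)
  next
    case False
    moreover have "(r / 2)\<^sup>2 < r\<^sup>2" using assms by (simp add: power_divide)
    ultimately show ?thesis using nn by (simp add: add_nonneg_pos)
  qed
  show ?thesis
  proof (rule that[of b])
    show "smooth_on UNIV b" unfolding b_def[abs_def]
      by (intro smooth_on_divide smooth_on_add s1 s2 open_UNIV) (use pos in \<open>auto simp: less_le\<close>)
    show "b x = 1" if "dist x0 x \<le> r / 2" for x
    proof -
      have "q x \<le> (r / 2)\<^sup>2" unfolding q using that by (intro power_mono) auto
      then show ?thesis using pos[of x] nn(3)[of "q x - (r / 2)\<^sup>2"] by (simp add: b_def)
    qed
    show "b x = 0" if "dist x0 x \<ge> r" for x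
    proof -
      have "q x \<ge> r\<^sup>2" unfolding q using that assms by (intro power_mono) auto
      then show ?thesis by (simp add: b_def nn)
    qed
  qed
qed

text \<open>Gronwall-type bound; the smallness of the Lipschitz constant replaces the exponential.\<close>

lemma integral_equation_bound:
  fixes r g :: "real \<Rightarrow> 'a::banach"
  assumes "continuous_on {0..1} r" "continuous_on {0..1} g"
    and "\<And>s. s \<in> {0..1} \<Longrightarrow> r s = p + integral {0..s} g"
    and "\<And>t. t \<in> {0..1} \<Longrightarrow> norm (g t) \<le> \<kappa> + 1 / 2 * norm (r t)" "\<kappa> \<ge> 0"
    and "s \<in> {0..1}"
  shows "norm (r s) \<le> 2 * (norm p + \<kappa>)"
proof -
  obtain m where m: "m \<in> {0..1}" "\<And>t. t \<in> {0..1} \<Longrightarrow> norm (r t) \<le> norm (r m)"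
    using continuous_attains_sup[OF compact_Icc _ continuous_on_norm[OF assms(1)]] by auto
  have "norm (integral {0..m} g) \<le> (\<kappa> + 1 / 2 * norm (r m)) * (m - 0)"
  proof (rule integral_bound)
    show "continuous_on {0..m} g" using assms(2) m by (auto intro: continuous_on_subset)
    fix t assume "t \<in> {0..m}"
    then have t: "t \<in> {0..1}" using m by auto
    show "norm (g t) \<le> \<kappa> + 1 / 2 * norm (r m)"
      using assms(4)[OF t] m(2)[OF t] by simp
  qed (use m in simp)
  also have "\<dots> \<le> \<kappa> + 1 / 2 * norm (r m)"
    using m assms(5) by (intro mult_left_le) auto
  finally have "norm (r m) \<le> norm p + (\<kappa> + 1 / 2 * norm (r m))"
    using assms(3)[OF m(1)] norm_triangle_ineq[of p "integral {0..m} g"] by simp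
  then show ?thesis using m(2)[OF assms(6)] by argo
qed

text \<open>Picard iteration on the unit interval: with Lipschitz constant 1/2 the integral operator
  is a contraction for the supremum norm on the whole interval, without subdivision.\<close>

lemma integral_equation_exists:
  fixes H :: "real \<Rightarrow> 'e::euclidean_space \<Rightarrow> 'e"
  assumes cont: "continuous_on ({0..1} \<times> UNIV) (\<lambda>(t, z). H t z)"
    and lip: "\<And>t y z. t \<in> {0..1} \<Longrightarrow> norm (H t y - H t z) \<le> 1 / 2 * norm (y - z)"
  obtains z where "continuous_on {0..1} z" "\<And>s. s \<in> {0..1} \<Longrightarrow> z s = w + integral {0..s} (\<lambda>t. H t (z t))"
proof -
  \<comment> \<open>Clamping the time to [0,1] extends the iterates to bounded continuous functions
    on the whole line, which form a complete metric space.\<close>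
  define c where "c s = max 0 (min 1 s)" for s :: real
  have c01: "c s \<in> {0..1}" for s by (auto simp: c_def)
  have cc: "continuous_on UNIV c" unfolding c_def[abs_def] by (intro continuous_intros)
  have Hc: "continuous_on {0..1} (\<lambda>t. H t (y t))" if "continuous_on {0..1} y" for y
  proof -
    have "continuous_on {0..1} (\<lambda>t. (\<lambda>(t, z). H t z) (t, y t))"
      by (rule continuous_on_compose2[OF cont]) (use that in \<open>auto intro!: continuous_intros\<close>)
    then show ?thesis by simp
  qed
  define T where "T y = (\<lambda>s. w + integral {0..c s} (\<lambda>t. H t (apply_bcontfun y t)))" for y :: "real \<Rightarrow>\<^sub>C 'e"
  have yc: "continuous_on A (apply_bcontfun y)" for y :: "real \<Rightarrow>\<^sub>C 'e" and A
    using apply_bcontfun[of y] by (auto simp: bcontfun_def intro: continuous_on_subset)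
  have T: "T y \<in> bcontfun" for y
  proof -
    have i: "continuous_on {0..1} (\<lambda>s. w + integral {0..s} (\<lambda>t. H t (apply_bcontfun y t)))"
      by (intro continuous_intros indefinite_integral_continuous_1 integrable_continuous_real Hc yc)
    have "continuous_on UNIV (T y)" unfolding T_def
      by (rule continuous_on_compose2[OF i cc]) (use c01 in auto)
    moreover have "bounded (range (T y))"
    proof -
      have "compact ((\<lambda>s. w + integral {0..s} (\<lambda>t. H t (apply_bcontfun y t))) ` {0..1})"
        by (rule compact_continuous_image[OF i]) simp
      then have "bounded ((\<lambda>s. w + integral {0..s} (\<lambda>t. H t (apply_bcontfun y t))) ` {0..1})"
        by (rule compact_imp_bounded)
      then show ?thesis
        by (rule bounded_subset) (use c01 in \<open>auto simp: T_def\<close>)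
    qed
    ultimately show ?thesis by (simp add: bcontfun_def)
  qed
  have d: "dist (Bcontfun (T y)) (Bcontfun (T z)) \<le> 1 / 2 * dist y z" for y z
  proof (rule dist_bound)
    fix s
    have "norm (integral {0..c s} (\<lambda>t. H t (apply_bcontfun y t) - H t (apply_bcontfun z t))) \<le> (1 / 2 * dist y z) * (c s - 0)"
    proof (rule integral_bound)
      show "continuous_on {0..c s} (\<lambda>t. H t (apply_bcontfun y t) - H t (apply_bcontfun z t))"
        by (rule continuous_on_subset[OF continuous_on_diff[OF Hc[OF yc] Hc[OF yc]]]) (use c01[of s] in auto)
      fix t assume "t \<in> {0..c s}"
      then have "t \<in> {0..1}" using c01[of s] by auto
      then show "norm (H t (apply_bcontfun y t) - H t (apply_bcontfun z t)) \<le> 1 / 2 * dist y z"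
        using lip[of t "apply_bcontfun y t" "apply_bcontfun z t"] dist_bounded[of y t z]
        by (simp add: dist_norm)
    qed (use c01 in auto)
    also have "\<dots> \<le> 1 / 2 * dist y z" using c01[of s] by (intro mult_left_le) auto
    finally have *: "norm (integral {0..c s} (\<lambda>t. H t (apply_bcontfun y t) - H t (apply_bcontfun z t))) \<le> 1 / 2 * dist y z" .
    have int: "(\<lambda>t. H t (apply_bcontfun y t)) integrable_on {0..c s}" for y
      by (rule integrable_continuous_real, rule continuous_on_subset[OF Hc[OF yc]]) (use c01[of s] in auto)
    have "dist (T y s) (T z s) = norm (integral {0..c s} (\<lambda>t. H t (apply_bcontfun y t) - H t (apply_bcontfun z t)))"
      by (simp add: dist_norm T_def Henstock_Kurzweil_Integration.integral_diff[OF int int])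
    then show "dist (apply_bcontfun (Bcontfun (T y)) s) (apply_bcontfun (Bcontfun (T z)) s) \<le> 1 / 2 * dist y z"
      using * by (simp only: Bcontfun_inverse[OF T])
  qed
  obtain z where z: "Bcontfun (T z) = z"
    using banach_fix_type[of "1 / 2" "\<lambda>y. Bcontfun (T y)"] d by auto
  show ?thesis
  proof (rule that[of "apply_bcontfun z"])
    show "continuous_on {0..1} (apply_bcontfun z)" by (rule yc)
    fix s :: real assume s: "s \<in> {0..1}"
    then have "c s = s" by (auto simp: c_def)
    moreover have "apply_bcontfun z s = T z s" using Bcontfun_inverse[OF T[of z]] z by metis
    ultimately show "apply_bcontfun z s = w + integral {0..s} (\<lambda>t. H t (apply_bcontfun z t))"
      by (simp add: T_def)
  qed
qed

text \<open>Compactness of the product of [0,1] with a small closed ball makes continuity in the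
  parameter uniform in time.\<close>

lemma unif_cont_slice:
  fixes k :: "real \<Rightarrow> 'p::euclidean_space \<Rightarrow> 'b::real_normed_vector"
  assumes "continuous_on ({0..1} \<times> B) (\<lambda>(t, c). k t c)" "open B" "c \<in> B" "e > 0"
  obtains d where "d > 0" "ball c d \<subseteq> B"
    "\<And>t c'. t \<in> {0..1} \<Longrightarrow> dist c c' < d \<Longrightarrow> norm (k t c' - k t c) < e"
proof -
  obtain r where r: "r > 0" "cball c r \<subseteq> B" using assms open_contains_cball by blast
  have "uniformly_continuous_on ({0..1} \<times> cball c r) (\<lambda>(t, c). k t c)"
    using r by (intro compact_uniformly_continuous compact_Times continuous_on_subset[OF assms(1)]) auto
  then obtain d where d: "d > 0" "\<And>a b. a \<in> {0..1} \<times> cball c r \<Longrightarrow> b \<in> {0..1} \<times> cball c r \<Longrightarrow>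
      dist b a < d \<Longrightarrow> dist ((\<lambda>(t, c). k t c) b) ((\<lambda>(t, c). k t c) a) < e"
    using \<open>e > 0\<close> unfolding uniformly_continuous_on_def by metis
  show ?thesis
  proof (rule that[of "min d r"])
    fix t :: real and c' assume t: "t \<in> {0..1}" and "dist c c' < min d r"
    then show "norm (k t c' - k t c) < e"
      using d(2)[of "(t, c)" "(t, c')"] r by (simp add: dist_Pair_Pair dist_norm norm_minus_commute)
  qed (use d r in auto)
qed

lemma continuous_on_Times_unif:
  fixes z :: "'t::metric_space \<Rightarrow> 'p::metric_space \<Rightarrow> 'b::real_normed_vector"
  assumes "\<And>c. c \<in> B \<Longrightarrow> continuous_on T (\<lambda>t. z t c)"
    and "\<And>c e. c \<in> B \<Longrightarrow> e > 0 \<Longrightarrow> \<exists>d>0. \<forall>c'\<in>B. dist c c' < d \<longrightarrow> (\<forall>t\<in>T. norm (z t c' - z t c) < e)"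
  shows "continuous_on (T \<times> B) (\<lambda>(t, c). z t c)"
  unfolding continuous_on_iff
proof (intro ballI allI impI)
  fix x and e :: real assume "x \<in> T \<times> B" and "e > 0"
  then obtain t c where x: "x = (t, c)" and tc: "t \<in> T" "c \<in> B" "e > 0" by auto
  obtain d where d: "d > 0" "\<And>c' t. c' \<in> B \<Longrightarrow> dist c c' < d \<Longrightarrow> t \<in> T \<Longrightarrow> norm (z t c' - z t c) < e / 2"
    using assms(2)[of c "e / 2"] tc by (metis half_gt_zero)
  obtain d' where d': "d' > 0" "\<And>t'. t' \<in> T \<Longrightarrow> dist t' t < d' \<Longrightarrow> dist (z t' c) (z t c) < e / 2"
    using assms(1)[OF tc(2)] tc unfolding continuous_on_iff by (metis half_gt_zero)
  show "\<exists>d>0. \<forall>x'\<in>T \<times> B. dist x' x < d \<longrightarrow> dist (case x' of (t, c) \<Rightarrow> z t c) (case x of (t, c) \<Rightarrow> z t c) < e"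
    unfolding x
  proof (intro exI[of _ "min d d'"] conjI ballI impI)
    fix x' assume x': "x' \<in> T \<times> B" "dist x' (t, c) < min d d'"
    obtain t' c' where [simp]: "x' = (t', c')" by fastforce
    have "dist t' t < d'" "dist c c' < d"
      using x' dist_fst_le[of x' "(t, c)"] dist_snd_le[of x' "(t, c)"] by (auto simp: dist_commute)
    then have "dist (z t' c') (z t' c) < e / 2" "dist (z t' c) (z t c) < e / 2"
      using d(2)[of c' t'] d'(2)[of t'] x' by (auto simp: dist_norm)
    then show "dist (case x' of (t, c) \<Rightarrow> z t c) (case (t, c) of (t, c) \<Rightarrow> z t c) < e"
      using dist_triangle_half_l[of "z t' c'" "z t' c" e "z t c"] by (simp add: dist_commute)
  qed (use d d' in auto)
qed


section \<open>Dependence of integral equations on parameters\<close>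

lemma finite_uniform_pos:
  fixes Q :: "'b \<Rightarrow> real \<Rightarrow> bool"
  assumes "finite I" "\<And>b. b \<in> I \<Longrightarrow> \<exists>d>0. Q b d"
    "\<And>b d d'. b \<in> I \<Longrightarrow> Q b d \<Longrightarrow> 0 < d' \<Longrightarrow> d' \<le> d \<Longrightarrow> Q b d'"
  shows "\<exists>d>0. \<forall>b\<in>I. Q b d"
  using assms
proof (induction I)
  case empty then show ?case by (auto intro: exI[of _ 1])
next
  case (insert b I)
  have "\<exists>d>0. \<forall>b\<in>I. Q b d"
    by (rule insert.IH) (use insert.prems in blast)+
  then obtain d where d: "d > 0" "\<And>b. b \<in> I \<Longrightarrow> Q b d" by blast
  obtain e where e: "e > 0" "Q b e" using insert.prems(1)[of b] by blast
  have "Q b (min d e)" using insert.prems(2)[of b e "min d e"] d e by auto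
  moreover have "Q i (min d e)" if "i \<in> I" for i
    using insert.prems(2)[of i d "min d e"] d e that by auto
  ultimately show ?case using d(1) e(1) by (intro exI[of _ "min d e"]) auto
qed

lemma linear_bound_Basis:
  fixes L :: "'e::euclidean_space \<Rightarrow> 'b::real_normed_vector"
  assumes "linear L" "\<And>b. b \<in> Basis \<Longrightarrow> norm (L b) \<le> m b"
  shows "norm (L v) \<le> (\<Sum>b\<in>Basis. m b) * norm v"
proof -
  have "L v = L (\<Sum>b\<in>Basis. (v \<bullet> b) *\<^sub>R b)" by (simp only: euclidean_representation)
  also have "\<dots> = (\<Sum>b\<in>Basis. (v \<bullet> b) *\<^sub>R L b)"
    by (simp only: linear_sum[OF assms(1)] linear_scale[OF assms(1)])
  also have "norm \<dots> \<le> (\<Sum>b\<in>Basis. norm v * m b)"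
  proof (rule sum_norm_le)
    fix b :: 'e assume b: "b \<in> Basis"
    show "norm ((v \<bullet> b) *\<^sub>R L b) \<le> norm v * m b"
      using assms(2)[OF b] Basis_le_norm[OF b, of v] by (auto intro!: mult_mono)
  qed
  finally show ?thesis by (simp add: sum_distrib_left[symmetric] mult.commute)
qed

lemma linear_eq_sum_Basis:
  fixes L :: "'e::euclidean_space \<Rightarrow> 'b::real_vector"
  assumes "linear L"
  shows "L v = (\<Sum>b\<in>Basis. (v \<bullet> b) *\<^sub>R L b)"
proof -
  have "L v = L (\<Sum>b\<in>Basis. (v \<bullet> b) *\<^sub>R b)" by (simp only: euclidean_representation)
  also have "\<dots> = (\<Sum>b\<in>Basis. (v \<bullet> b) *\<^sub>R L b)"
    by (simp only: linear_sum[OF assms(1)] linear_scale[OF assms(1)])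
  finally show ?thesis .
qed

lemma integrable_on_initial:
  fixes f :: "real \<Rightarrow> 'b::banach"
  assumes "continuous_on {0..1} f" "s \<in> {0..1}"
  shows "f integrable_on {0..s}"
  by (rule integrable_continuous_real, rule continuous_on_subset[OF assms(1)]) (use assms(2) in auto)

text \<open>Parameter and state are paired in one argument of \<open>H\<close>, so that
  \<open>H'\<close> contains both partial derivatives; \<open>small\<close> bounds only the state
  derivative. Convexity of \<open>Z\<close> serves the mean value inequality. The initial value
  \<open>w\<close> is kept general: it is the identity for the flow itself and constant for the
  linear equations satisfied by derivatives.\<close>

locale param_integral_equation =
  fixes B Z :: "'e::euclidean_space set" and H :: "real \<Rightarrow> 'e \<times> 'e \<Rightarrow> 'e"
    and H' :: "real \<Rightarrow> 'e \<times> 'e \<Rightarrow> 'e \<times> 'e \<Rightarrow> 'e"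
    and z :: "real \<Rightarrow> 'e \<Rightarrow> 'e" and w :: "'e \<Rightarrow> 'e" and w' :: "'e \<Rightarrow> 'e \<Rightarrow> 'e"
  assumes open_B: "open B" and open_Z: "open Z" and convex_Z: "convex Z"
    and H_deriv: "\<And>t p. t \<in> {0..1} \<Longrightarrow> p \<in> B \<times> Z \<Longrightarrow> (H t has_derivative H' t p) (at p)"
    and H_cont: "continuous_on ({0..1} \<times> (B \<times> Z)) (\<lambda>(t, p). H t p)"
    and H'_cont: "\<And>v. continuous_on ({0..1} \<times> (B \<times> Z)) (\<lambda>(t, p). H' t p v)"
    and small: "\<And>t p v. t \<in> {0..1} \<Longrightarrow> p \<in> B \<times> Z \<Longrightarrow> norm (H' t p (0, v)) \<le> 1 / 2 * norm v"
    and z_cont: "\<And>c. c \<in> B \<Longrightarrow> continuous_on {0..1} (\<lambda>t. z t c)"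
    and z_in: "\<And>t c. t \<in> {0..1} \<Longrightarrow> c \<in> B \<Longrightarrow> z t c \<in> Z"
    and z_eq: "\<And>s c. s \<in> {0..1} \<Longrightarrow> c \<in> B \<Longrightarrow> z s c = w c + integral {0..s} (\<lambda>t. H t (c, z t c))"
    and w_deriv: "\<And>c. c \<in> B \<Longrightarrow> (w has_derivative w' c) (at c)"
begin

lemma lin: "t \<in> {0..1} \<Longrightarrow> p \<in> B \<times> Z \<Longrightarrow> linear (H' t p)"
  using H_deriv has_derivative_linear by blast

lemma lipschitz:
  assumes "t \<in> {0..1}" "c \<in> B" "y \<in> Z" "y' \<in> Z"
  shows "norm (H t (c, y) - H t (c, y')) \<le> 1 / 2 * norm (y - y')"
proof (rule differentiable_bound[OF convex_Z _ _ assms(3,4)])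
  fix x assume x: "x \<in> Z"
  have "(Pair c has_derivative Pair 0) (at x within Z)"
    by (auto intro!: derivative_eq_intros)
  then show "((\<lambda>y. H t (c, y)) has_derivative (\<lambda>v. H' t (c, x) (0, v))) (at x within Z)"
    using has_derivative_compose[of "Pair c" "Pair 0" x Z "H t" "H' t (c, x)"] H_deriv[OF assms(1), of "(c, x)"] x assms(2)
    by simp
  show "onorm (\<lambda>v. H' t (c, x) (0, v)) \<le> 1 / 2"
    using small[OF assms(1), of "(c, x)"] x assms(2) by (intro onorm_le) auto
qed

lemma path_cont:
  assumes "continuous_on ({0..1} \<times> (B \<times> Z)) (\<lambda>(t, p). K t p)" "c' \<in> B" "c \<in> B"
  shows "continuous_on {0..1} (\<lambda>t. K t (c', z t c))"
proof -
  have "continuous_on {0..1} (\<lambda>t. (\<lambda>(t, p). K t p) (t, (c', z t c)))"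
    by (rule continuous_on_compose2[OF assms(1)])
      (use z_cont[OF assms(3)] z_in assms in \<open>auto intro!: continuous_intros\<close>)
  then show ?thesis by simp
qed

text \<open>The change of \<open>H\<close> splits into a change of state, controlled by the
  Lipschitz constant 1/2 and absorbed by \<open>integral_equation_bound\<close>, and a change of
  parameter along the fixed curve of \<open>c\<close>, bounded by \<open>\<kappa>\<close>.\<close>

lemma difference_bound:
  assumes "c \<in> B" "c' \<in> B" "\<kappa> \<ge> 0"
    and k: "\<And>t. t \<in> {0..1} \<Longrightarrow> norm (H t (c', z t c) - H t (c, z t c)) \<le> \<kappa>"
    and "s \<in> {0..1}"
  shows "norm (z s c' - z s c) \<le> 2 * (norm (w c' - w c) + \<kappa>)"
proof (rule integral_equation_bound[where g="\<lambda>t. H t (c', z t c') - H t (c, z t c)"])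
  show "continuous_on {0..1} (\<lambda>s. z s c' - z s c)"
    using z_cont assms by (intro continuous_intros) auto
  show "continuous_on {0..1} (\<lambda>t. H t (c', z t c') - H t (c, z t c))"
    using path_cont[OF H_cont] assms by (intro continuous_intros) auto
  show "z s c' - z s c = w c' - w c + integral {0..s} (\<lambda>t. H t (c', z t c') - H t (c, z t c))"
    if s: "s \<in> {0..1}" for s
  proof -
    have i: "(\<lambda>t. H t (c, z t c)) integrable_on {0..s}" if "c \<in> B" for c
      using path_cont[OF H_cont that that] s by (rule integrable_on_initial)
    show ?thesis
      using z_eq[OF s assms(1)] z_eq[OF s assms(2)]
        Henstock_Kurzweil_Integration.integral_diff[OF i[OF assms(2)] i[OF assms(1)]] by simp
  qed
  show "norm (H t (c', z t c') - H t (c, z t c)) \<le> \<kappa> + 1 / 2 * norm (z t c' - z t c)"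
    if t: "t \<in> {0..1}" for t
  proof -
    have "norm (H t (c', z t c') - H t (c', z t c)) \<le> 1 / 2 * norm (z t c' - z t c)"
      using t assms z_in by (intro lipschitz) auto
    moreover have "H t (c', z t c') - H t (c, z t c) =
        (H t (c', z t c') - H t (c', z t c)) + (H t (c', z t c) - H t (c, z t c))" by simp
    ultimately show ?thesis using k[OF t] norm_triangle_le
      by (metis add.commute add_mono)
  qed
qed (use assms in auto)

lemma z_unif:
  assumes "c \<in> B" "e > 0"
  shows "\<exists>d>0. ball c d \<subseteq> B \<and> (\<forall>c'. dist c c' < d \<longrightarrow> (\<forall>t\<in>{0..1}. norm (z t c' - z t c) < e))"
proof -
  have "continuous_on ({0..1} \<times> B) (\<lambda>x. (\<lambda>(t, p). H t p) (fst x, (snd x, z (fst x) c)))"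
  proof (rule continuous_on_compose2[OF H_cont])
    have "continuous_on ({0..1} \<times> B) (\<lambda>x. z (fst x) c)"
      by (rule continuous_on_compose2[OF z_cont[OF assms(1)]]) (auto intro!: continuous_intros)
    then show "continuous_on ({0..1} \<times> B) (\<lambda>x. (fst x, (snd x, z (fst x) c)))"
      by (intro continuous_intros)
  qed (use z_in assms in auto)
  then have "continuous_on ({0..1} \<times> B) (\<lambda>(t, c'). H t (c', z t c))"
    by (simp add: split_beta)
  \<comment> \<open>The final estimate is twice the sum of two contributions of at most
    \<open>e / 8\<close> each, hence below \<open>e\<close>.\<close>
  moreover have "e / 8 > 0" using assms by simp
  ultimately obtain d where d: "d > 0" "ball c d \<subseteq> B"
    "\<And>t c'. t \<in> {0..1} \<Longrightarrow> dist c c' < d \<Longrightarrow> norm (H t (c', z t c) - H t (c, z t c)) < e / 8"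
    using unif_cont_slice[OF _ open_B assms(1)] by blast
  have "continuous (at c) w" using w_deriv[OF assms(1)] by (rule has_derivative_continuous)
  then obtain d' where d': "d' > 0" "\<And>c'. dist c' c < d' \<Longrightarrow> dist (w c') (w c) < e / 8"
    using \<open>e / 8 > 0\<close> unfolding continuous_at_eps_delta by metis
  show ?thesis
  proof (intro exI[of _ "min d d'"] conjI allI impI ballI)
    fix c' t assume *: "dist c c' < min d d'" "t \<in> {0..1::real}"
    have "norm (z t c' - z t c) \<le> 2 * (norm (w c' - w c) + e / 8)"
      using d * assms less_imp_le[OF d(3)] by (intro difference_bound) auto
    also have "\<dots> < e"
    proof -
      have "dist c' c < d'" using * by (simp add: dist_commute)
      from d'(2)[OF this] have "norm (w c' - w c) < e / 8" by (simp only: dist_norm)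
      then show ?thesis using assms by argo
    qed
    finally show "norm (z t c' - z t c) < e" .
  qed (use d d' in auto)
qed

lemma z_joint: "continuous_on ({0..1} \<times> B) (\<lambda>(t, c). z t c)"
proof (rule continuous_on_Times_unif[OF z_cont])
  fix c and e :: real assume "c \<in> B" "e > 0"
  from z_unif[OF this] show "\<exists>d>0. \<forall>c'\<in>B. dist c c' < d \<longrightarrow> (\<forall>t\<in>{0..1}. norm (z t c' - z t c) < e)"
    by blast
qed

lemma path_compact:
  assumes "c \<in> B" shows "compact ((\<lambda>t. (c, z t c)) ` {0..1})"
  by (rule compact_continuous_image) (use z_cont[OF assms] in \<open>auto intro!: continuous_intros\<close>)

text \<open>The solution curve is compact, so it has a neighbourhood of uniform width inside
  \<open>B \<times> Z\<close> on which the finitely many basis derivatives of \<open>H\<close> are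
  close, uniformly in time, to their values on the curve. The mean value inequality for
  \<open>H\<close> minus its linearization then gives the error bound.\<close>

lemma unif_linearization:
  assumes "c \<in> B" "e > 0"
  shows "\<exists>d>0. \<forall>t\<in>{0..1}. \<forall>\<zeta>. norm \<zeta> < d \<longrightarrow> (c, z t c) + \<zeta> \<in> B \<times> Z \<and>
    norm (H t ((c, z t c) + \<zeta>) - H t (c, z t c) - H' t (c, z t c) \<zeta>) \<le> e * norm \<zeta>"
proof -
  have "open (B \<times> Z)" using open_B open_Z by (rule open_Times)
  moreover have "(\<lambda>t. (c, z t c)) ` {0..1} \<subseteq> B \<times> Z" using z_in assms by auto
  ultimately obtain \<epsilon> where \<epsilon>: "\<epsilon> > 0" "(\<Union>x\<in>(\<lambda>t. (c, z t c)) ` {0..1}. ball x \<epsilon>) \<subseteq> B \<times> Z"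
    using compact_subset_open_imp_ball_epsilon_subset[OF path_compact[OF assms(1)], of "B \<times> Z"]
    by metis
  have nbhd: "(c, z t c) + \<zeta> \<in> B \<times> Z" if "norm \<zeta> < \<epsilon>" "t \<in> {0..1}" for t \<zeta>
  proof -
    have "(c, z t c) + \<zeta> \<in> ball (c, z t c) \<epsilon>" using that by (simp add: dist_norm)
    then show ?thesis using \<epsilon>(2) that(2) by blast
  qed
  \<comment> \<open>\<open>linear_bound_Basis\<close> adds one bound per basis vector of the product
    space, hence the division by its dimension.\<close>
  define e' where "e' = e / DIM('e \<times> 'e)"
  have e': "e' > 0" using assms by (simp add: e'_def)
  \<comment> \<open>The clause \<open>norm \<zeta> < \<epsilon>\<close> makes each admissible radius
    respect the neighbourhood found above. The predicate passes to smaller radii, as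
    \<open>finite_uniform_pos\<close> requires.\<close>
  define Q where "Q b d \<longleftrightarrow> (\<forall>t\<in>{0..1}. \<forall>\<zeta>. norm \<zeta> < d \<longrightarrow> norm \<zeta> < \<epsilon> \<and>
    norm (H' t ((c, z t c) + \<zeta>) b - H' t (c, z t c) b) \<le> e')" for b d
  have "\<exists>d>0. Q b d" for b
  proof -
    have "continuous_on ({0..1} \<times> ball 0 \<epsilon>) (\<lambda>x. (\<lambda>(t, p). H' t p b) (fst x, (c, z (fst x) c) + snd x))"
    proof (rule continuous_on_compose2[OF H'_cont])
      have "continuous_on ({0..1} \<times> ball 0 \<epsilon>) (\<lambda>x::real \<times> 'e \<times> 'e. z (fst x) c)"
        by (rule continuous_on_compose2[OF z_cont[OF assms(1)]]) (auto intro!: continuous_intros)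
      then show "continuous_on ({0..1} \<times> ball 0 \<epsilon>) (\<lambda>x. (fst x, (c, z (fst x) c) + snd x))"
        by (intro continuous_intros)
    qed (use nbhd in force)
    then have "continuous_on ({0..1} \<times> ball 0 \<epsilon>) (\<lambda>(t, \<zeta>). H' t ((c, z t c) + \<zeta>) b)"
      by (simp add: split_beta)
    from unif_cont_slice[OF this open_ball _ e', of 0] \<epsilon>(1)
    obtain d where "d > 0" "ball 0 d \<subseteq> ball (0::'e \<times> 'e) \<epsilon>"
      "\<And>t \<zeta>. t \<in> {0..1} \<Longrightarrow> dist 0 \<zeta> < d \<Longrightarrow> norm (H' t ((c, z t c) + \<zeta>) b - H' t ((c, z t c) + 0) b) < e'"
      by (metis centre_in_ball)
    then show ?thesis unfolding Q_def
      by (intro exI[of _ d]) (force intro: less_imp_le)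
  qed
  then have "\<exists>d>0. \<forall>b\<in>Basis. Q b d"
    by (intro finite_uniform_pos) (auto simp: Q_def)
  then obtain d where d: "d > 0" "\<And>b. b \<in> Basis \<Longrightarrow> Q b d" by blast
  have de: "norm \<zeta> < \<epsilon>" if "norm \<zeta> < d" for \<zeta> :: "'e \<times> 'e"
  proof -
    have "(0::real) \<in> {0..1}" by simp
    then show ?thesis using d(2)[OF SOME_Basis] that unfolding Q_def by blast
  qed
  show ?thesis
  proof (intro exI[of _ d] conjI ballI allI impI d(1))
    fix t :: real and \<zeta> :: "'e \<times> 'e"
    assume t: "t \<in> {0..1}" and \<zeta>: "norm \<zeta> < d"
    show "(c, z t c) + \<zeta> \<in> B \<times> Z" using nbhd de \<zeta> t by blast
    let ?\<gamma> = "(c, z t c)"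
    have \<gamma>: "?\<gamma> \<in> B \<times> Z" using z_in t assms by auto
    have "norm ((H t (?\<gamma> + \<zeta>) - H' t ?\<gamma> (?\<gamma> + \<zeta>)) - (H t ?\<gamma> - H' t ?\<gamma> ?\<gamma>)) \<le> e * norm ((?\<gamma> + \<zeta>) - ?\<gamma>)"
    proof (rule differentiable_bound[where S="ball ?\<gamma> d" and f'="\<lambda>p v. H' t p v - H' t ?\<gamma> v"])
      fix p assume p: "p \<in> ball ?\<gamma> d"
      then have n: "norm (p - ?\<gamma>) < d" by (simp add: dist_norm norm_minus_commute)
      have pB: "p \<in> B \<times> Z" using nbhd[OF de[OF n] t] by simp
      have "bounded_linear (H' t ?\<gamma>)" using lin[OF t \<gamma>] by (simp add: linear_conv_bounded_linear)
      then show "((\<lambda>p. H t p - H' t ?\<gamma> p) has_derivative (\<lambda>v. H' t p v - H' t ?\<gamma> v)) (at p within ball ?\<gamma> d)"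
        by (intro has_derivative_diff has_derivative_at_withinI[OF H_deriv[OF t pB]] bounded_linear_imp_has_derivative)
      show "onorm (\<lambda>v. H' t p v - H' t ?\<gamma> v) \<le> e"
      proof (rule onorm_le)
        fix v
        have "norm (H' t p v - H' t ?\<gamma> v) \<le> (\<Sum>b\<in>(Basis::('e \<times> 'e) set). e') * norm v"
        proof (rule linear_bound_Basis)
          show "linear (\<lambda>v. H' t p v - H' t ?\<gamma> v)"
            using lin[OF t \<gamma>] lin[OF t pB] by (rule linear_compose_sub[rotated])
          show "norm (H' t p b - H' t ?\<gamma> b) \<le> e'" if "b \<in> Basis" for b
            using d(2)[OF that] t n unfolding Q_def by (metis add.commute diff_add_cancel)
        qed
        then show "norm (H' t p v - H' t ?\<gamma> v) \<le> e * norm v" by (simp add: e'_def)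
      qed
    qed (use \<zeta> d in \<open>auto simp: dist_norm\<close>)
    then show "norm (H t (?\<gamma> + \<zeta>) - H t ?\<gamma> - H' t ?\<gamma> \<zeta>) \<le> e * norm \<zeta>"
      using linear_add[OF lin[OF t \<gamma>], of ?\<gamma> \<zeta>] by (simp add: algebra_simps)
  qed
qed

lemma H'_bound:
  assumes "c \<in> B"
  shows "\<exists>C\<ge>0. \<forall>t\<in>{0..1}. \<forall>v. norm (H' t (c, z t c) v) \<le> C * norm v"
proof -
  have "\<exists>m. \<forall>t\<in>{0..1}. norm (H' t (c, z t c) b) \<le> m" for b
  proof -
    have "bounded ((\<lambda>t. H' t (c, z t c) b) ` {0..1})"
      by (intro compact_imp_bounded compact_continuous_image path_cont H'_cont assms) auto
    then show ?thesis unfolding bounded_iff by auto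
  qed
  then obtain m where m: "\<And>b t. t \<in> {0..1} \<Longrightarrow> norm (H' t (c, z t c) b) \<le> m b" by metis
  have "norm (H' t (c, z t c) v) \<le> (\<Sum>b\<in>Basis. \<bar>m b\<bar>) * norm v" if t: "t \<in> {0..1}" for t v
  proof (rule linear_bound_Basis)
    show "linear (H' t (c, z t c))" using lin[OF t] z_in[OF t] assms by auto
    show "norm (H' t (c, z t c) b) \<le> \<bar>m b\<bar>" for b using m[OF t, of b] by linarith
  qed
  then show ?thesis by (intro exI[of _ "\<Sum>b\<in>Basis. \<bar>m b\<bar>"]) (auto intro: sum_nonneg)
qed

text \<open>The linearization error of \<open>H\<close> is measured by the size of the pair (change
  of parameter, change of solution). A Lipschitz bound for the solution makes this error small
  relative to the change of parameter alone, which is what differentiability asks for.\<close>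

lemma z_lipschitz:
  assumes "c \<in> B"
  shows "\<exists>C\<ge>0. \<exists>d>0. ball c d \<subseteq> B \<and> (\<forall>c'. dist c c' < d \<longrightarrow> (\<forall>t\<in>{0..1}. norm (z t c' - z t c) \<le> C * norm (c' - c)))"
proof -
  obtain d where d: "d > 0" "\<And>t \<zeta>. t \<in> {0..1} \<Longrightarrow> norm \<zeta> < d \<Longrightarrow> (c, z t c) + \<zeta> \<in> B \<times> Z \<and>
    norm (H t ((c, z t c) + \<zeta>) - H t (c, z t c) - H' t (c, z t c) \<zeta>) \<le> 1 * norm \<zeta>"
    using unif_linearization[OF assms, of 1] by auto
  obtain C where C: "C \<ge> 0" "\<And>t v. t \<in> {0..1} \<Longrightarrow> norm (H' t (c, z t c) v) \<le> C * norm v"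
    using H'_bound[OF assms] by blast
  obtain K where K: "K \<ge> 0" "\<And>v. norm (w' c v) \<le> K * norm v"
    using bounded_linear.nonneg_bounded[OF has_derivative_bounded_linear[OF w_deriv[OF assms]]]
    by (auto simp: mult.commute)
  obtain d' where d': "d' > 0" "\<And>c'. norm (c' - c) < d' \<Longrightarrow> norm (w c' - w c - w' c (c' - c)) \<le> 1 * norm (c' - c)"
    using w_deriv[OF assms] unfolding has_derivative_at_alt by (metis zero_less_one)
  \<comment> \<open>Linearization with relative error 1 turns the bounds \<open>K\<close> and
    \<open>C\<close> for the derivatives into \<open>K + 1\<close> and \<open>C + 1\<close>; the
    factor 2 comes from \<open>difference_bound\<close>.\<close>
  have "\<exists>d>0. ball c d \<subseteq> B \<and> (\<forall>c'. dist c c' < d \<longrightarrow> (\<forall>t\<in>{0..1}. norm (z t c' - z t c) \<le> 2 * (K + 1 + (C + 1)) * norm (c' - c)))"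
  proof (intro exI[of _ "min d d'"] conjI allI impI ballI)
    show "ball c (min d d') \<subseteq> B"
    proof
      fix c' assume "c' \<in> ball c (min d d')"
      then have "norm (c' - c, 0::'e) < d" by (simp add: norm_Pair dist_norm norm_minus_commute)
      from d(2)[OF _ this, of 0] show "c' \<in> B" by auto
    qed
    fix c' t assume c': "dist c c' < min d d'" and t: "t \<in> {0..1::real}"
    then have n: "norm (c' - c) < d" "norm (c' - c) < d'" by (auto simp: dist_norm norm_minus_commute)
    then have n': "norm (c' - c, 0::'e) < d" by (simp add: norm_Pair)
    have c'B: "c' \<in> B" using d(2)[OF _ n', of 0] by auto
    have "norm (z t c' - z t c) \<le> 2 * (norm (w c' - w c) + (C + 1) * norm (c' - c))"
    proof (rule difference_bound[OF assms c'B _ _ t])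
      fix t :: real assume t: "t \<in> {0..1}"
      have "norm (H t (c', z t c) - H t (c, z t c) - H' t (c, z t c) (c' - c, 0)) \<le> norm (c' - c)"
        using d(2)[OF t n'] by (simp add: norm_Pair)
      moreover have "norm (H' t (c, z t c) (c' - c, 0)) \<le> C * norm (c' - c)"
        using C(2)[OF t, of "(c' - c, 0)"] by (simp add: norm_Pair)
      ultimately show "norm (H t (c', z t c) - H t (c, z t c)) \<le> (C + 1) * norm (c' - c)"
        using norm_triangle_sub[of "H t (c', z t c) - H t (c, z t c)" "H' t (c, z t c) (c' - c, 0)"]
        by (simp add: algebra_simps)
    qed (use C in auto)
    moreover have "norm (w c' - w c) \<le> (K + 1) * norm (c' - c)"
      using d'(2)[OF n(2)] K(2)[of "c' - c"] norm_triangle_sub[of "w c' - w c" "w' c (c' - c)"]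
      by (simp add: algebra_simps)
    ultimately show "norm (z t c' - z t c) \<le> 2 * (K + 1 + (C + 1)) * norm (c' - c)"
      by (simp add: algebra_simps)
  qed (use d d' in auto)
  then show ?thesis using C K by (intro exI[of _ "2 * (K + 1 + (C + 1))"]) auto
qed

lemma H'_split:
  assumes "t \<in> {0..1}" "p \<in> B \<times> Z"
  shows "H' t p (v, y) = H' t p (v, 0) + H' t p (0, y)"
  using linear_add[OF lin[OF assms], of "(v, 0)" "(0, y)"] by simp

text \<open>Continuity of \<open>H'\<close> is given for fixed directions. The moving direction
  \<open>y t\<close> is therefore expanded over \<open>Basis\<close>.\<close>

lemma variation_cont:
  assumes "c \<in> B" "continuous_on {0..1} y"
  shows "continuous_on {0..1} (\<lambda>t. H' t (c, z t c) (v, y t))"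
proof -
  have 1: "continuous_on {0..1} (\<lambda>t. H' t (c, z t c) (v, 0) + (\<Sum>b\<in>Basis. (y t \<bullet> b) *\<^sub>R H' t (c, z t c) (0, b)))"
    using path_cont[OF H'_cont assms(1) assms(1)] assms(2) by (intro continuous_intros) auto
  have 2: "H' t (c, z t c) (v, y t) = H' t (c, z t c) (v, 0) + (\<Sum>b\<in>Basis. (y t \<bullet> b) *\<^sub>R H' t (c, z t c) (0, b))"
    if t: "t \<in> {0..1}" for t
  proof -
    have p: "(c, z t c) \<in> B \<times> Z" using z_in t assms by auto
    have "linear (\<lambda>y. H' t (c, z t c) (0, y))"
      using linear_compose[OF _ lin[OF t p], of "Pair 0"]
      by (simp add: o_def linear_iff)
    from linear_eq_sum_Basis[OF this, of "y t"] H'_split[OF t p, of v "y t"] show ?thesis by simp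
  qed
  show ?thesis by (rule continuous_on_eq[OF 1]) (rule 2[symmetric])
qed

text \<open>The difference of two solutions satisfies a homogeneous equation with Lipschitz constant
  1/2, for which \<open>integral_equation_bound\<close> yields the bound 0.\<close>

lemma variation_unique:
  assumes "c \<in> B" "continuous_on {0..1} y1" "continuous_on {0..1} y2"
    and "\<And>s. s \<in> {0..1} \<Longrightarrow> y1 s = q + integral {0..s} (\<lambda>t. H' t (c, z t c) (v, y1 t))"
    and "\<And>s. s \<in> {0..1} \<Longrightarrow> y2 s = q + integral {0..s} (\<lambda>t. H' t (c, z t c) (v, y2 t))"
    and "s \<in> {0..1}"
  shows "y1 s = y2 s"
proof -
  have "norm (y1 s - y2 s) \<le> 2 * (norm (0::'e) + 0)"
  proof (rule integral_equation_bound[where g="\<lambda>t. H' t (c, z t c) (v, y1 t) - H' t (c, z t c) (v, y2 t)"])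
    show "continuous_on {0..1} (\<lambda>t. H' t (c, z t c) (v, y1 t) - H' t (c, z t c) (v, y2 t))"
      by (intro continuous_intros variation_cont assms)
    show "y1 s - y2 s = 0 + integral {0..s} (\<lambda>t. H' t (c, z t c) (v, y1 t) - H' t (c, z t c) (v, y2 t))"
      if s: "s \<in> {0..1}" for s
    proof -
      have i: "(\<lambda>t. H' t (c, z t c) (v, y t)) integrable_on {0..s}" if "continuous_on {0..1} y" for y
        using variation_cont[OF assms(1) that] s by (rule integrable_on_initial)
      show ?thesis
        using assms(4,5)[OF s] Henstock_Kurzweil_Integration.integral_diff[OF i[OF assms(2)] i[OF assms(3)]]
        by simp
    qed
    show "norm (H' t (c, z t c) (v, y1 t) - H' t (c, z t c) (v, y2 t)) \<le> 0 + 1 / 2 * norm (y1 t - y2 t)"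
      if t: "t \<in> {0..1}" for t
    proof -
      have p: "(c, z t c) \<in> B \<times> Z" using z_in t assms by auto
      show ?thesis
        using small[OF t p, of "y1 t - y2 t"] linear_diff[OF lin[OF t p], of "(v, y1 t)" "(v, y2 t)"] by simp
    qed
  qed (use assms in \<open>auto intro!: continuous_intros\<close>)
  then show ?thesis by simp
qed

text \<open>The candidate derivative solves the linearized equation, and uniqueness for that
  equation makes it linear in \<open>v\<close>. The remainder
  \<open>z s c' - z s c - U (c' - c) s\<close> again satisfies an integral equation whose
  inhomogeneity is a linearization error, so \<open>integral_equation_bound\<close> makes it of
  smaller order than the increment.\<close>

lemma z_has_derivative:
  assumes c: "c \<in> B" and Uc: "\<And>v. continuous_on {0..1} (U v)"
    and U: "\<And>v s. s \<in> {0..1} \<Longrightarrow> U v s = w' c v + integral {0..s} (\<lambda>t. H' t (c, z t c) (v, U v t))"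
    and s: "s \<in> {0..1}"
  shows "(z s has_derivative (\<lambda>v. U v s)) (at c)"
proof -
  have lw: "linear (w' c)" using w_deriv[OF c] has_derivative_linear by blast
  have int: "(\<lambda>t. H' t (c, z t c) (v, y t)) integrable_on {0..s}"
    if "continuous_on {0..1} y" "s \<in> {0..1}" for y v s
    using variation_cont[OF c that(1)] that(2) by (rule integrable_on_initial)
  have p: "(c, z t c) \<in> B \<times> Z" if "t \<in> {0..1}" for t using z_in that c by auto
  have "linear (\<lambda>v. U v s)"
  proof (rule linearI)
    fix u v
    show "U (u + v) s = U u s + U v s"
    proof (rule variation_unique[OF c Uc, where ?y2.0="\<lambda>s. U u s + U v s"])
      show "continuous_on {0..1} (\<lambda>s. U u s + U v s)" by (intro continuous_intros Uc)
      show "U u s + U v s = w' c (u + v) + integral {0..s} (\<lambda>t. H' t (c, z t c) (u + v, U u t + U v t))"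
        if s: "s \<in> {0..1}" for s
      proof -
        have "integral {0..s} (\<lambda>t. H' t (c, z t c) (u + v, U u t + U v t)) =
          integral {0..s} (\<lambda>t. H' t (c, z t c) (u, U u t) + H' t (c, z t c) (v, U v t))"
        proof (rule integral_cong)
          fix t assume "t \<in> {0..s}"
          then have t: "t \<in> {0..1}" using s by auto
          show "H' t (c, z t c) (u + v, U u t + U v t) = H' t (c, z t c) (u, U u t) + H' t (c, z t c) (v, U v t)"
            using linear_add[OF lin[OF t p[OF t]], of "(u, U u t)" "(v, U v t)"] by simp
        qed
        then show ?thesis
          using U[OF s, of u] U[OF s, of v] Henstock_Kurzweil_Integration.integral_add[OF int[OF Uc s] int[OF Uc s], of u u v v]
          by (simp add: linear_add[OF lw])
      qed
    qed (use U s in auto)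
  next
    fix r u
    show "U (r *\<^sub>R u) s = r *\<^sub>R U u s"
    proof (rule variation_unique[OF c Uc, where ?y2.0="\<lambda>s. r *\<^sub>R U u s"])
      show "continuous_on {0..1} (\<lambda>s. r *\<^sub>R U u s)" by (intro continuous_intros Uc)
      show "r *\<^sub>R U u s = w' c (r *\<^sub>R u) + integral {0..s} (\<lambda>t. H' t (c, z t c) (r *\<^sub>R u, r *\<^sub>R U u t))"
        if s: "s \<in> {0..1}" for s
      proof -
        have "integral {0..s} (\<lambda>t. H' t (c, z t c) (r *\<^sub>R u, r *\<^sub>R U u t)) =
          integral {0..s} (\<lambda>t. r *\<^sub>R H' t (c, z t c) (u, U u t))"
        proof (rule integral_cong)
          fix t assume "t \<in> {0..s}"
          then have t: "t \<in> {0..1}" using s by auto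
          show "H' t (c, z t c) (r *\<^sub>R u, r *\<^sub>R U u t) = r *\<^sub>R H' t (c, z t c) (u, U u t)"
            using linear_scale[OF lin[OF t p[OF t]], of r "(u, U u t)"] by simp
        qed
        then show ?thesis
          using U[OF s, of u] by (simp add: linear_scale[OF lw] scaleR_add_right)
      qed
    qed (use U s in auto)
  qed
  then have bl: "bounded_linear (\<lambda>v. U v s)" by (simp add: linear_conv_bounded_linear)
  obtain C d1 where C: "C \<ge> 0" "d1 > 0" "ball c d1 \<subseteq> B"
    "\<And>c' t. dist c c' < d1 \<Longrightarrow> t \<in> {0..1} \<Longrightarrow> norm (z t c' - z t c) \<le> C * norm (c' - c)"
    using z_lipschitz[OF c] by blast
  show ?thesis unfolding has_derivative_at_alt
  proof (intro conjI bl allI impI)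
    fix e :: real assume e: "e > 0"
    \<comment> \<open>Chosen so that the final bound, 2 (\<epsilon> + \<epsilon> (1 + C)) times the
      increment, equals \<open>e\<close> times the increment.\<close>
    define \<epsilon> where "\<epsilon> = e / (2 * (2 + C))"
    have \<epsilon>: "\<epsilon> > 0" using e C by (simp add: \<epsilon>_def)
    obtain d2 where d2: "d2 > 0" "\<And>t \<zeta>. t \<in> {0..1} \<Longrightarrow> norm \<zeta> < d2 \<Longrightarrow> (c, z t c) + \<zeta> \<in> B \<times> Z \<and>
      norm (H t ((c, z t c) + \<zeta>) - H t (c, z t c) - H' t (c, z t c) \<zeta>) \<le> \<epsilon> * norm \<zeta>"
      using unif_linearization[OF c \<epsilon>] by auto
    obtain d3 where d3: "d3 > 0" "\<And>c'. norm (c' - c) < d3 \<Longrightarrow> norm (w c' - w c - w' c (c' - c)) \<le> \<epsilon> * norm (c' - c)"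
      using w_deriv[OF c] \<epsilon> unfolding has_derivative_at_alt by metis
    \<comment> \<open>The quotient \<open>d2 / (1 + C)\<close> guarantees that the joint increment
      of parameter and solution stays below \<open>d2\<close>.\<close>
    define d where "d = min d1 (min (d2 / (1 + C)) d3)"
    show "\<exists>d>0. \<forall>y. norm (y - c) < d \<longrightarrow> norm (z s y - z s c - U (y - c) s) \<le> e * norm (y - c)"
    proof (intro exI[of _ d] conjI allI impI)
      show "d > 0" using C d2 d3 by (simp add: d_def)
      fix c' assume "norm (c' - c) < d"
      then have n: "norm (c' - c) < d1" "(1 + C) * norm (c' - c) < d2" "norm (c' - c) < d3"
        using C by (auto simp: d_def pos_less_divide_eq mult.commute)
      then have dc: "dist c c' < d1" by (simp add: dist_norm norm_minus_commute)
      then have c': "c' \<in> B" using C(3) by auto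
      have \<zeta>: "norm (c' - c, z t c' - z t c) \<le> (1 + C) * norm (c' - c)" if "t \<in> {0..1}" for t
        using norm_Pair_le[of "c' - c" "z t c' - z t c"] C(4)[OF dc that] by (simp add: algebra_simps)
      let ?h = "c' - c"
      have "norm (z s c' - z s c - U ?h s) \<le> 2 * (norm (w c' - w c - w' c ?h) + \<epsilon> * ((1 + C) * norm ?h))"
      proof (rule integral_equation_bound[where r="\<lambda>s. z s c' - z s c - U ?h s" and
            g="\<lambda>t. H t (c', z t c') - H t (c, z t c) - H' t (c, z t c) (?h, U ?h t)"])
        show "continuous_on {0..1} (\<lambda>s. z s c' - z s c - U ?h s)"
          by (intro continuous_intros z_cont c c' Uc)
        show "continuous_on {0..1} (\<lambda>t. H t (c', z t c') - H t (c, z t c) - H' t (c, z t c) (?h, U ?h t))"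
          by (intro continuous_intros path_cont H_cont c c' variation_cont Uc)
        show "z s c' - z s c - U ?h s = w c' - w c - w' c ?h + integral {0..s} (\<lambda>t. H t (c', z t c') - H t (c, z t c) - H' t (c, z t c) (?h, U ?h t))"
          if s: "s \<in> {0..1}" for s
        proof -
          have i: "(\<lambda>t. H t (c, z t c)) integrable_on {0..s}" if "c \<in> B" for c
            using path_cont[OF H_cont that that] s by (rule integrable_on_initial)
          show ?thesis
            using z_eq[OF s c'] z_eq[OF s c] U[OF s, of ?h]
            by (simp add: Henstock_Kurzweil_Integration.integral_diff integrable_diff i c c' int[OF Uc s])
        qed
        show "norm (H t (c', z t c') - H t (c, z t c) - H' t (c, z t c) (?h, U ?h t))
            \<le> \<epsilon> * ((1 + C) * norm ?h) + 1 / 2 * norm (z t c' - z t c - U ?h t)" if t: "t \<in> {0..1}" for t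
        proof -
          let ?\<zeta> = "(?h, z t c' - z t c)"
          have "norm ?\<zeta> < d2" using \<zeta>[OF t] n(2) by linarith
          from d2(2)[OF t this]
          have "norm (H t (c', z t c') - H t (c, z t c) - H' t (c, z t c) ?\<zeta>) \<le> \<epsilon> * norm ?\<zeta>" by simp
          also have "\<dots> \<le> \<epsilon> * ((1 + C) * norm ?h)" using \<zeta>[OF t] \<epsilon> by (intro mult_left_mono) auto
          finally have 1: "norm (H t (c', z t c') - H t (c, z t c) - H' t (c, z t c) ?\<zeta>) \<le> \<epsilon> * ((1 + C) * norm ?h)" .
          \<comment> \<open>Replacing the true increment of the solution by the candidate changes
            only the state component, so the difference is controlled by
            \<open>small\<close>.\<close>
          have 2: "H' t (c, z t c) ?\<zeta> - H' t (c, z t c) (?h, U ?h t) = H' t (c, z t c) (0, z t c' - z t c - U ?h t)"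
            using linear_diff[OF lin[OF t p[OF t]], of ?\<zeta> "(?h, U ?h t)"] by simp
          have "H t (c', z t c') - H t (c, z t c) - H' t (c, z t c) (?h, U ?h t) =
            (H t (c', z t c') - H t (c, z t c) - H' t (c, z t c) ?\<zeta>) + H' t (c, z t c) (0, z t c' - z t c - U ?h t)"
            unfolding 2[symmetric] by simp
          then show ?thesis
            using norm_triangle_mono[OF 1 small[OF t p[OF t], of "z t c' - z t c - U ?h t"]]
            by (simp only:)
        qed
      qed (use \<epsilon> C s in auto)
      also have "\<dots> \<le> 2 * (\<epsilon> * norm ?h + \<epsilon> * ((1 + C) * norm ?h))"
        using d3(2)[OF n(3)] by simp
      also have "\<dots> = 2 * \<epsilon> * (2 + C) * norm ?h" by (simp add: algebra_simps)
      also have "2 * \<epsilon> * (2 + C) = e" using C(1) by (simp add: \<epsilon>_def field_simps)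
      finally show "norm (z s c' - z s c - U ?h s) \<le> e * norm ?h" .
    qed
  qed
qed

lemma variation_exists:
  assumes c: "c \<in> B"
  obtains y where "continuous_on {0..1} y"
    "\<And>s. s \<in> {0..1} \<Longrightarrow> y s = q + integral {0..s} (\<lambda>t. H' t (c, z t c) (v, y t))"
proof -
  have p: "(c, z t c) \<in> B \<times> Z" if "t \<in> {0..1}" for t using z_in that c by auto
  \<comment> \<open>Along the solution curve \<open>H'\<close> is rewritten by its values on basis
    vectors, which are continuous in time. This gives joint continuity in time and state on the
    whole space, as \<open>integral_equation_exists\<close> demands.\<close>
  define K where "K t y = H' t (c, z t c) (v, 0) + (\<Sum>b\<in>Basis. (y \<bullet> b) *\<^sub>R H' t (c, z t c) (0, b))" for t y
  have K: "K t y = H' t (c, z t c) (v, y)" if t: "t \<in> {0..1}" for t y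
  proof -
    have "linear (\<lambda>y. H' t (c, z t c) (0, y))"
      using linear_compose[OF _ lin[OF t p[OF t]], of "Pair 0"] by (simp add: o_def linear_iff)
    from linear_eq_sum_Basis[OF this, of y] H'_split[OF t p[OF t], of v y] show ?thesis by (simp add: K_def)
  qed
  have "continuous_on ({0..1} \<times> UNIV) (\<lambda>x. H' (fst x) (c, z (fst x) c) u)" for u
    by (rule continuous_on_compose2[OF path_cont[OF H'_cont c c]]) (auto intro!: continuous_intros)
  then have "continuous_on ({0..1} \<times> UNIV) (\<lambda>(t, y). K t y)"
    unfolding K_def split_beta by (intro continuous_intros)
  moreover have "norm (K t y - K t y') \<le> 1 / 2 * norm (y - y')" if t: "t \<in> {0..1}" for t y y'
    unfolding K[OF t] using small[OF t p[OF t], of "y - y'"] linear_diff[OF lin[OF t p[OF t]], of "(v, y)" "(v, y')"]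
    by simp
  ultimately obtain y where y: "continuous_on {0..1} y"
    "\<And>s. s \<in> {0..1} \<Longrightarrow> y s = q + integral {0..s} (\<lambda>t. K t (y t))"
    using integral_equation_exists[of K q] by blast
  have "integral {0..s} (\<lambda>t. K t (y t)) = integral {0..s} (\<lambda>t. H' t (c, z t c) (v, y t))" if "s \<in> {0..1}" for s
    by (rule integral_cong) (use that K in auto)
  with y show ?thesis by (intro that[of y]) auto
qed

text \<open>The third claim lets the smoothness argument iterate: the derivative in a fixed
  direction solves a linear integral equation along the curve.\<close>

lemma z_derivative:
  assumes c: "c \<in> B"
  shows "s \<in> {0..1} \<Longrightarrow> (z s has_derivative frechet_derivative (z s) (at c)) (at c)"
    and "continuous_on {0..1} (\<lambda>s. frechet_derivative (z s) (at c) v)"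
    and "s \<in> {0..1} \<Longrightarrow> frechet_derivative (z s) (at c) v =
      w' c v + integral {0..s} (\<lambda>t. H' t (c, z t c) (v, frechet_derivative (z t) (at c) v))"
proof -
  have "\<exists>y. continuous_on {0..1} y \<and>
    (\<forall>s\<in>{0..1}. y s = w' c v + integral {0..s} (\<lambda>t. H' t (c, z t c) (v, y t)))" for v
    using variation_exists[OF c, of "w' c v" v] by metis
  then obtain U where U: "\<And>v. continuous_on {0..1} (U v)"
    "\<And>v s. s \<in> {0..1} \<Longrightarrow> U v s = w' c v + integral {0..s} (\<lambda>t. H' t (c, z t c) (v, U v t))"
    by metis
  have d: "(z s has_derivative (\<lambda>v. U v s)) (at c)" if "s \<in> {0..1}" for s
    using z_has_derivative[OF c U that] .
  have f: "frechet_derivative (z s) (at c) = (\<lambda>v. U v s)" if "s \<in> {0..1}" for s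
    using frechet_derivative_at[OF d[OF that]] by simp
  show "s \<in> {0..1} \<Longrightarrow> (z s has_derivative frechet_derivative (z s) (at c)) (at c)"
    using d f by simp
  show "continuous_on {0..1} (\<lambda>s. frechet_derivative (z s) (at c) v)"
    by (rule continuous_on_eq[OF U(1)[of v]]) (simp add: f)
  show "frechet_derivative (z s) (at c) v =
      w' c v + integral {0..s} (\<lambda>t. H' t (c, z t c) (v, frechet_derivative (z t) (at c) v))" if s: "s \<in> {0..1}"
  proof -
    have "integral {0..s} (\<lambda>t. H' t (c, z t c) (v, frechet_derivative (z t) (at c) v)) =
      integral {0..s} (\<lambda>t. H' t (c, z t c) (v, U v t))"
      by (rule integral_cong) (use s f in auto)
    then show ?thesis using U(2)[OF s, of v] f[OF s] by simp
  qed
qed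

end

section \<open>Smooth dependence to all orders\<close>

lemma has_derivative_frechet_eq:
  "(f has_derivative f') (at x) \<Longrightarrow> frechet_derivative f (at x) v = f' v"
  using frechet_derivative_at[of f f' x] by simp

lemma Ck_param_Pair:
  fixes F :: "'t::topological_space \<Rightarrow> 'e::euclidean_space \<Rightarrow> 'b::real_normed_vector"
    and G :: "'t \<Rightarrow> 'e \<Rightarrow> 'c::real_normed_vector"
  assumes "open S" "Ck_param k T S F" "Ck_param k T S G"
  shows "Ck_param k T S (\<lambda>t x. (F t x, G t x))"
proof -
  have l: "bounded_linear (\<lambda>y::'b. (y, 0::'c))"
    by (intro bounded_linear_Pair bounded_linear_ident bounded_linear_zero)
  have r: "bounded_linear (\<lambda>y::'c. (0::'b, y))"
    by (intro bounded_linear_Pair bounded_linear_ident bounded_linear_zero)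
  from Ck_param_add[OF assms(1) Ck_param_bounded_linear[OF l assms(1,2)] Ck_param_bounded_linear[OF r assms(1,3)]]
  show ?thesis by simp
qed

lemma Ck_param_slice: "Ck_param k T S F \<Longrightarrow> t \<in> T \<Longrightarrow> Ck_on k S (F t)"
proof (induction k arbitrary: F)
  case 0
  have "continuous_on S (\<lambda>x. (\<lambda>(t, x). F t x) (t, x))"
    by (rule continuous_on_compose2[of "T \<times> S"]) (use 0 in \<open>auto intro!: continuous_intros\<close>)
  then show ?case by simp
next
  case (Suc k)
  have "Ck_on k S (\<lambda>x. frechet_derivative (F t) (at x) v)" for v
    by (rule Suc.IH) (use Suc.prems in auto)
  with Suc.prems show ?case by simp
qed

text \<open>This is the order-0 case of the regularity of linear equations, where the coefficients
  are only continuous in \<open>c\<close> and the differentiable setting of the locale is not at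
  hand.\<close>

lemma linear_equation_continuous:
  fixes W :: "real \<Rightarrow> 'e::euclidean_space \<Rightarrow> 'e"
  assumes "open B"
    and a: "\<And>b. b \<in> Basis \<Longrightarrow> continuous_on ({0..1} \<times> B) (\<lambda>(t, c). a b t c)"
    and small: "\<And>t c y. t \<in> {0..1} \<Longrightarrow> c \<in> B \<Longrightarrow> norm (\<Sum>b\<in>Basis. (y \<bullet> b) *\<^sub>R a b t c) \<le> 1 / 2 * norm y"
    and \<beta>: "continuous_on ({0..1} \<times> B) (\<lambda>(t, c). \<beta> t c)"
    and Wc: "\<And>c. c \<in> B \<Longrightarrow> continuous_on {0..1} (\<lambda>t. W t c)"
    and W: "\<And>s c. s \<in> {0..1} \<Longrightarrow> c \<in> B \<Longrightarrow>
      W s c = w0 + integral {0..s} (\<lambda>t. (\<Sum>b\<in>Basis. (W t c \<bullet> b) *\<^sub>R a b t c) + \<beta> t c)"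
  shows "continuous_on ({0..1} \<times> B) (\<lambda>(t, c). W t c)"
proof (rule continuous_on_Times_unif[OF Wc])
  fix c and e :: real assume c: "c \<in> B" and e: "e > 0"
  define k where "k t c' y = (\<Sum>b\<in>Basis. (y \<bullet> b) *\<^sub>R a b t c') + \<beta> t c'" for t c' y
  have sl: "continuous_on {0..1} (\<lambda>t. f t c')" if "continuous_on ({0..1} \<times> B) (\<lambda>(t, c). f t c)" "c' \<in> B"
    for f :: "real \<Rightarrow> 'e \<Rightarrow> 'e" and c'
  proof -
    have "continuous_on {0..1} (\<lambda>t. (\<lambda>(t, c). f t c) (t, c'))"
      by (rule continuous_on_compose2[OF that(1)]) (use that in \<open>auto intro!: continuous_intros\<close>)
    then show ?thesis by simp
  qed
  have kc: "continuous_on {0..1} (\<lambda>t. k t c' (W t c''))" if "c' \<in> B" "c'' \<in> B" for c' c''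
    unfolding k_def by (intro continuous_intros Wc that sl a \<beta>)
  have "continuous_on ({0..1} \<times> B) (\<lambda>x. W (fst x) c)"
    by (rule continuous_on_compose2[OF Wc[OF c]]) (auto intro!: continuous_intros)
  then have "continuous_on ({0..1} \<times> B) (\<lambda>(t, c'). k t c' (W t c))"
    using a \<beta> unfolding k_def split_beta by (intro continuous_intros) auto
  moreover have "e / 8 > 0" using e by simp
  ultimately obtain d where d: "d > 0" "ball c d \<subseteq> B"
    "\<And>t c'. t \<in> {0..1} \<Longrightarrow> dist c c' < d \<Longrightarrow> norm (k t c' (W t c) - k t c (W t c)) < e / 8"
    using unif_cont_slice[OF _ \<open>open B\<close> c] by blast
  have "norm (W s c' - W s c) < e" if c': "c' \<in> B" "dist c c' < d" and s: "s \<in> {0..1}" for s c'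
  proof -
    have "norm (W s c' - W s c) \<le> 2 * (norm (0::'e) + e / 8)"
    proof (rule integral_equation_bound[where g="\<lambda>t. k t c' (W t c') - k t c (W t c)"])
      show "continuous_on {0..1} (\<lambda>s. W s c' - W s c)" by (intro continuous_intros Wc c c')
      show "continuous_on {0..1} (\<lambda>t. k t c' (W t c') - k t c (W t c))"
        by (intro continuous_intros kc c c')
      show "W s c' - W s c = 0 + integral {0..s} (\<lambda>t. k t c' (W t c') - k t c (W t c))" if s: "s \<in> {0..1}" for s
        using W[OF s c] W[OF s c'(1)]
          Henstock_Kurzweil_Integration.integral_diff[OF integrable_on_initial[OF kc[OF c'(1) c'(1)] s]
            integrable_on_initial[OF kc[OF c c] s]]
        by (simp add: k_def)
      show "norm (k t c' (W t c') - k t c (W t c)) \<le> e / 8 + 1 / 2 * norm (W t c' - W t c)"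
        if t: "t \<in> {0..1}" for t
      proof -
        have "k t c' (W t c') - k t c' (W t c) = (\<Sum>b\<in>Basis. ((W t c' - W t c) \<bullet> b) *\<^sub>R a b t c')"
          by (simp add: k_def inner_diff_left scaleR_diff_left sum_subtractf)
        then have "norm (k t c' (W t c') - k t c' (W t c)) \<le> 1 / 2 * norm (W t c' - W t c)"
          using small[OF t c'(1)] by simp
        moreover have "norm (k t c' (W t c) - k t c (W t c)) < e / 8" using d(3)[OF t c'(2)] .
        moreover have "norm (k t c' (W t c') - k t c (W t c)) \<le>
          norm (k t c' (W t c) - k t c (W t c)) + norm (k t c' (W t c') - k t c' (W t c))"
          using norm_triangle_ineq[of "k t c' (W t c) - k t c (W t c)" "k t c' (W t c') - k t c' (W t c)"] by simp
        ultimately show ?thesis by argo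
      qed
    qed (use e s in auto)
    then show ?thesis using e by (simp add: field_simps)
  qed
  with d(1) show "\<exists>d>0. \<forall>c'\<in>B. dist c c' < d \<longrightarrow> (\<forall>t\<in>{0..1}. norm (W t c' - W t c) < e)"
    by blast
qed

text \<open>Differentiating the equation in \<open>c\<close> gives an equation with the same
  coefficients \<open>a\<close>; derivatives of \<open>a\<close> and \<open>\<beta>\<close> enter
  only the inhomogeneity, together with \<open>W\<close>. For this reason the induction varies
  \<open>\<beta>\<close>, \<open>w0\<close> and \<open>W\<close> while \<open>a\<close> stays
  fixed.\<close>

lemma linear_equation_Ck:
  fixes W :: "real \<Rightarrow> 'e::euclidean_space \<Rightarrow> 'e"
  assumes "open B"
    and a: "\<And>b. b \<in> Basis \<Longrightarrow> Ck_param k {0..1} B (a b)"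
    and small: "\<And>t c y. t \<in> {0..1} \<Longrightarrow> c \<in> B \<Longrightarrow> norm (\<Sum>b\<in>Basis. (y \<bullet> b) *\<^sub>R a b t c) \<le> 1 / 2 * norm y"
    and \<beta>: "Ck_param k {0..1} B \<beta>"
    and Wc: "\<And>c. c \<in> B \<Longrightarrow> continuous_on {0..1} (\<lambda>t. W t c)"
    and W: "\<And>s c. s \<in> {0..1} \<Longrightarrow> c \<in> B \<Longrightarrow>
      W s c = w0 + integral {0..s} (\<lambda>t. (\<Sum>b\<in>Basis. (W t c \<bullet> b) *\<^sub>R a b t c) + \<beta> t c)"
  shows "Ck_param k {0..1} B W"
  using a \<beta> Wc W
proof (induction k arbitrary: \<beta> w0 W)
  case 0
  show ?case
    using linear_equation_continuous[OF \<open>open B\<close> 0(1)[unfolded Ck_param.simps] small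
        0(2)[unfolded Ck_param.simps] 0(3) 0(4)] by simp
next
  case (Suc k)
  have ak: "Ck_param k {0..1} B (a b)" if "b \<in> Basis" for b using Ck_param_SucD[OF Suc.prems(1)[OF that]] .
  \<comment> \<open>Regularity of order \<open>k\<close> for \<open>W\<close> itself comes first,
    because \<open>W\<close> occurs in the inhomogeneity of the differentiated equation.\<close>
  have Wk: "Ck_param k {0..1} B W"
    by (rule Suc.IH[OF ak Ck_param_SucD[OF Suc.prems(2)] Suc.prems(3) Suc.prems(4)])
  define Da where "Da b t c = frechet_derivative (a b t) (at c)" for b t c
  define D\<beta> where "D\<beta> t c = frechet_derivative (\<beta> t) (at c)" for t c
  have Da: "(a b t has_derivative Da b t c) (at c)" if "b \<in> Basis" "t \<in> {0..1}" "c \<in> B" for b t c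
    unfolding Da_def using Ck_param_has_derivative[OF Suc.prems(1)[OF that(1)] that(2,3)] .
  have D\<beta>: "(\<beta> t has_derivative D\<beta> t c) (at c)" if "t \<in> {0..1}" "c \<in> B" for t c
    unfolding D\<beta>_def using Ck_param_has_derivative[OF Suc.prems(2) that] .
  have Dak: "Ck_param k {0..1} B (\<lambda>t c. Da b t c v)" if "b \<in> Basis" for b v
    unfolding Da_def using Ck_param_derivative[OF Suc.prems(1)[OF that]] .
  have D\<beta>k: "Ck_param k {0..1} B (\<lambda>t c. D\<beta> t c v)" for v
    unfolding D\<beta>_def using Ck_param_derivative[OF Suc.prems(2)] .
  have lift: "continuous_on ({0..1} \<times> (B \<times> UNIV)) (\<lambda>x::real \<times> 'e \<times> 'e. f (fst x) (fst (snd x)))"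
    if "Ck_param m {0..1} B f" for f :: "real \<Rightarrow> 'e \<Rightarrow> 'e" and m
  proof -
    have "continuous_on ({0..1} \<times> (B \<times> UNIV)) (\<lambda>x::real \<times> 'e \<times> 'e. (\<lambda>(t, c). f t c) (fst x, fst (snd x)))"
      by (rule continuous_on_compose2[OF Ck_param_continuous_on[OF that]]) (auto intro!: continuous_intros)
    then show ?thesis by simp
  qed
  \<comment> \<open>A linear equation is an instance of the general one with the whole space as
    state set; its differentiability in \<open>c\<close> is then supplied by the locale.\<close>
  interpret param_integral_equation B UNIV "\<lambda>t p. (\<Sum>b\<in>Basis. (snd p \<bullet> b) *\<^sub>R a b t (fst p)) + \<beta> t (fst p)"
    "\<lambda>t p q. (\<Sum>b\<in>Basis. (snd p \<bullet> b) *\<^sub>R Da b t (fst p) (fst q) + (snd q \<bullet> b) *\<^sub>R a b t (fst p)) + D\<beta> t (fst p) (fst q)"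
    W "\<lambda>_. w0" "\<lambda>_ _. 0"
  proof
    fix t :: real and p :: "'e \<times> 'e" assume tp: "t \<in> {0..1}" "p \<in> B \<times> UNIV"
    then have c: "fst p \<in> B" by auto
    have 1: "((\<lambda>p. a b t (fst p)) has_derivative (\<lambda>q. Da b t (fst p) (fst q))) (at p)" if "b \<in> Basis" for b
      by (rule has_derivative_compose[OF has_derivative_fst[OF has_derivative_ident] Da[OF that tp(1) c]])
    have 2: "((\<lambda>p. \<beta> t (fst p)) has_derivative (\<lambda>q. D\<beta> t (fst p) (fst q))) (at p)"
      by (rule has_derivative_compose[OF has_derivative_fst[OF has_derivative_ident] D\<beta>[OF tp(1) c]])
    have 3: "((\<lambda>p. snd p \<bullet> b) has_derivative (\<lambda>q. snd q \<bullet> b)) (at p)" for b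
      by (intro bounded_linear_imp_has_derivative bounded_linear_inner_left_comp bounded_linear_snd)
    show "((\<lambda>p. (\<Sum>b\<in>Basis. (snd p \<bullet> b) *\<^sub>R a b t (fst p)) + \<beta> t (fst p)) has_derivative
      (\<lambda>q. (\<Sum>b\<in>Basis. (snd p \<bullet> b) *\<^sub>R Da b t (fst p) (fst q) + (snd q \<bullet> b) *\<^sub>R a b t (fst p)) + D\<beta> t (fst p) (fst q))) (at p)"
      by (intro has_derivative_add has_derivative_sum has_derivative_scaleR 1 2 3)
    have z: "Da b t (fst p) 0 = 0" if "b \<in> Basis" for b
      using linear_0[OF has_derivative_linear[OF Da[OF that tp(1) c]]] .
    have z2: "D\<beta> t (fst p) 0 = 0" using linear_0[OF has_derivative_linear[OF D\<beta>[OF tp(1) c]]] .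
    show "norm ((\<Sum>b\<in>Basis. (snd p \<bullet> b) *\<^sub>R Da b t (fst p) (fst (0, v)) + (snd (0, v) \<bullet> b) *\<^sub>R a b t (fst p)) + D\<beta> t (fst p) (fst (0, v)))
      \<le> 1 / 2 * norm v" for v :: 'e
      using small[OF tp(1) c, of v] by (simp add: z z2)
  next
    have s: "continuous_on ({0..1} \<times> (B \<times> UNIV)) (\<lambda>x. snd (snd x) \<bullet> b)" for b :: 'e
      by (intro continuous_intros)
    show "continuous_on ({0..1} \<times> B \<times> UNIV) (\<lambda>(t, p). (\<Sum>b\<in>Basis. (snd p \<bullet> b) *\<^sub>R a b t (fst p)) + \<beta> t (fst p))"
      unfolding split_beta
      by (intro continuous_on_add continuous_on_sum continuous_on_scaleR s lift[OF ak] lift[OF Suc.prems(2)])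
    show "continuous_on ({0..1} \<times> B \<times> UNIV) (\<lambda>(t, p). (\<Sum>b\<in>Basis. (snd p \<bullet> b) *\<^sub>R Da b t (fst p) (fst q) + (snd q \<bullet> b) *\<^sub>R a b t (fst p)) + D\<beta> t (fst p) (fst q))" for q
      unfolding split_beta
      by (intro continuous_on_add continuous_on_sum continuous_on_scaleR s continuous_on_const lift[OF ak] lift[OF Dak] lift[OF D\<beta>k])
    show "W s c = w0 + integral {0..s} (\<lambda>t. (\<Sum>b\<in>Basis. (snd (c, W t c) \<bullet> b) *\<^sub>R a b t (fst (c, W t c))) + \<beta> t (fst (c, W t c)))"
      if "s \<in> {0..1}" "c \<in> B" for s c
      using Suc.prems(4)[OF that] by simp
  qed (use Suc.prems \<open>open B\<close> in auto)
  show ?case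
  proof (rule Ck_param_SucI[OF \<open>open B\<close> z_joint])
    show "(W t has_derivative frechet_derivative (W t) (at c)) (at c)" if "t \<in> {0..1}" "c \<in> B" for t c
      using z_derivative(1) that by blast
    \<comment> \<open>The initial value \<open>w0\<close> does not depend on \<open>c\<close>, so
      the differentiated equation starts at 0.\<close>
    show "Ck_param k {0..1} B (\<lambda>t c. frechet_derivative (W t) (at c) v)" for v
    proof (rule Suc.IH[where \<beta>="\<lambda>t c. (\<Sum>b\<in>Basis. (W t c \<bullet> b) *\<^sub>R Da b t c v) + D\<beta> t c v" and ?w0.0=0])
      show "Ck_param k {0..1} B (\<lambda>t c. (\<Sum>b\<in>Basis. (W t c \<bullet> b) *\<^sub>R Da b t c v) + D\<beta> t c v)"
        by (intro Ck_param_add Ck_param_sum Ck_param_scaleR Ck_param_inner Wk Ck_param_const Dak D\<beta>k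
            continuous_on_const \<open>open B\<close>)
      show "frechet_derivative (W s) (at c) v = 0 + integral {0..s} (\<lambda>t. (\<Sum>b\<in>Basis. (frechet_derivative (W t) (at c) v \<bullet> b) *\<^sub>R a b t c) +
        ((\<Sum>b\<in>Basis. (W t c \<bullet> b) *\<^sub>R Da b t c v) + D\<beta> t c v))" if "s \<in> {0..1}" "c \<in> B" for s c
        using z_derivative(3)[OF that(2,1), of v] by (simp add: sum.distrib algebra_simps)
    qed (use ak z_derivative(2) in auto)
  qed
qed

text \<open>If \<open>z\<close> has order \<open>k\<close>, the partial derivatives of
  \<open>G\<close> along \<open>(c, z t c)\<close> have order \<open>k\<close> too. They are the
  coefficients of the linear equation for the derivative of \<open>z\<close>; hence that derivative
  has order \<open>k\<close> and \<open>z\<close> has order \<open>k + 1\<close>.\<close>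

lemma solution_Ck:
  fixes G :: "'e::euclidean_space \<times> 'e \<Rightarrow> 'e"
  assumes "param_integral_equation B Z (\<lambda>_. G) (\<lambda>_ p. frechet_derivative G (at p)) z (\<lambda>c. c) (\<lambda>_ v. v)"
    and G: "smooth_on (B \<times> Z) G"
  shows "Ck_param k {0..1} B z"
proof (induction k)
  interpret param_integral_equation B Z "\<lambda>_. G" "\<lambda>_ p. frechet_derivative G (at p)" z "\<lambda>c. c" "\<lambda>_ v. v"
    by fact
  case 0
  show ?case using z_joint by simp
next
  interpret param_integral_equation B Z "\<lambda>_. G" "\<lambda>_ p. frechet_derivative G (at p)" z "\<lambda>c. c" "\<lambda>_ v. v"
    by fact
  case (Suc k)
  have p: "(c, z t c) \<in> B \<times> Z" if "t \<in> {0..1}" "c \<in> B" for t c using z_in that by auto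
  have pk: "Ck_param k {0..1} B (\<lambda>t c. (c, z t c))"
    by (intro Ck_param_Pair Suc Ck_param_linear bounded_linear_ident open_B)
  have gk: "Ck_param k {0..1} B (\<lambda>t c. frechet_derivative G (at (c, z t c)) u)" for u
  proof (rule Ck_param_compose[where g="\<lambda>p. frechet_derivative G (at p) u" and U="B \<times> Z"])
    show "Ck_on k (B \<times> Z) (\<lambda>p. frechet_derivative G (at p) u)"
      using smooth_on_derivative[OF G] by (simp add: smooth_on_def)
  qed (use pk p open_B open_Z in \<open>auto intro: open_Times\<close>)
  have split: "frechet_derivative G (at (c, z t c)) (v, y) =
    (\<Sum>b\<in>Basis. (y \<bullet> b) *\<^sub>R frechet_derivative G (at (c, z t c)) (0, b)) + frechet_derivative G (at (c, z t c)) (v, 0)"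
    if "t \<in> {0..1}" "c \<in> B" for t c v y
  proof -
    have "linear (\<lambda>y. frechet_derivative G (at (c, z t c)) (0, y))"
      using linear_compose[OF _ lin[OF that(1) p[OF that]], of "Pair 0"] by (simp add: o_def linear_iff)
    from linear_eq_sum_Basis[OF this, of y] H'_split[OF that(1) p[OF that], of v y] show ?thesis by simp
  qed
  show ?case
  proof (rule Ck_param_SucI[OF open_B z_joint])
    show "(z t has_derivative frechet_derivative (z t) (at c)) (at c)" if "t \<in> {0..1}" "c \<in> B" for t c
      using z_derivative(1) that by blast
    show "Ck_param k {0..1} B (\<lambda>t c. frechet_derivative (z t) (at c) v)" for v
    proof (rule linear_equation_Ck[OF open_B, where a="\<lambda>b t c. frechet_derivative G (at (c, z t c)) (0, b)"
          and \<beta>="\<lambda>t c. frechet_derivative G (at (c, z t c)) (v, 0)" and ?w0.0=v])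
      show "norm (\<Sum>b\<in>Basis. (y \<bullet> b) *\<^sub>R frechet_derivative G (at (c, z t c)) (0, b)) \<le> 1 / 2 * norm y"
        if "t \<in> {0..1}" "c \<in> B" for t c y
        using split[OF that, of 0 y] small[OF that(1) p[OF that], of y] linear_0[OF lin[OF that(1) p[OF that]]]
        by (simp add: zero_prod_def)
      show "frechet_derivative (z s) (at c) v = v + integral {0..s} (\<lambda>t.
        (\<Sum>b\<in>Basis. (frechet_derivative (z t) (at c) v \<bullet> b) *\<^sub>R frechet_derivative G (at (c, z t c)) (0, b)) +
        frechet_derivative G (at (c, z t c)) (v, 0))" if s: "s \<in> {0..1}" and c: "c \<in> B" for s c
      proof -
        have "integral {0..s} (\<lambda>t. frechet_derivative G (at (c, z t c)) (v, frechet_derivative (z t) (at c) v)) =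
          integral {0..s} (\<lambda>t. (\<Sum>b\<in>Basis. (frechet_derivative (z t) (at c) v \<bullet> b) *\<^sub>R frechet_derivative G (at (c, z t c)) (0, b)) +
            frechet_derivative G (at (c, z t c)) (v, 0))"
          by (rule integral_cong, rule split) (use s c in auto)
        then show ?thesis using z_derivative(3)[OF c s, of v] by simp
      qed
    qed (use gk z_derivative(2) in auto)
  qed
qed

section \<open>Time-one maps of radial fields\<close>

lemma linear_smooth_derivative:
  fixes \<Phi> :: "'e::euclidean_space \<Rightarrow> 'e \<Rightarrow> 'e"
  assumes "open U" "\<And>x. x \<in> U \<Longrightarrow> linear (\<Phi> x)" "\<And>\<xi>. smooth_on U (\<lambda>x. \<Phi> x \<xi>)" "y \<in> U"
  shows "frechet_derivative (\<lambda>x. \<Phi> x \<xi>) (at y) u =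
    (\<Sum>b\<in>Basis. (\<xi> \<bullet> b) *\<^sub>R frechet_derivative (\<lambda>x. \<Phi> x b) (at y) u)"
proof -
  have "((\<lambda>x. \<Sum>b\<in>Basis. (\<xi> \<bullet> b) *\<^sub>R \<Phi> x b) has_derivative
      (\<lambda>u. \<Sum>b\<in>Basis. (\<xi> \<bullet> b) *\<^sub>R frechet_derivative (\<lambda>x. \<Phi> x b) (at y) u)) (at y)"
    by (intro has_derivative_sum has_derivative_scaleR_right smooth_on_has_derivative[OF assms(3,4)])
  then have "((\<lambda>x. \<Phi> x \<xi>) has_derivative
      (\<lambda>u. \<Sum>b\<in>Basis. (\<xi> \<bullet> b) *\<^sub>R frechet_derivative (\<lambda>x. \<Phi> x b) (at y) u)) (at y)"
    by (rule has_derivative_transform_within_open[OF _ assms(1,4)])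
      (rule linear_eq_sum_Basis[OF assms(2), symmetric])
  then show ?thesis by (rule has_derivative_frechet_eq)
qed

lemma compact_linear_bound:
  fixes f :: "'e::euclidean_space \<Rightarrow> 'e \<Rightarrow> 'b::real_normed_vector"
  assumes "compact K" "\<And>y. y \<in> K \<Longrightarrow> linear (f y)" "\<And>b. continuous_on K (\<lambda>y. f y b)"
  obtains C where "C \<ge> 0" "\<And>y v. y \<in> K \<Longrightarrow> norm (f y v) \<le> C * norm v"
proof -
  have "\<exists>m. \<forall>y\<in>K. norm (f y b) \<le> m" for b
    using compact_imp_bounded[OF compact_continuous_image[OF assms(3,1)]] unfolding bounded_iff by auto
  then obtain m where m: "\<And>b y. y \<in> K \<Longrightarrow> norm (f y b) \<le> m b" by metis
  have "norm (f y v) \<le> (\<Sum>b\<in>Basis. \<bar>m b\<bar>) * norm v" if y: "y \<in> K" for y v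
  proof (rule linear_bound_Basis[OF assms(2)[OF y]])
    show "norm (f y b) \<le> \<bar>m b\<bar>" for b using m[OF y, of b] by linarith
  qed
  then show ?thesis by (intro that[of "\<Sum>b\<in>Basis. \<bar>m b\<bar>"]) (auto intro: sum_nonneg)
qed

text \<open>The point \<open>c\<close> is both the initial value and, through \<open>c - x0\<close>,
  the direction fed into \<open>\<Phi>\<close>; near \<open>x0\<close> the field is therefore small
  and the curve exists up to time 1. In the last conclusion any solution \<open>Q\<close> of the
  linearized equation determines the derivative of the time-one map, so that an explicit guess
  suffices in applications.\<close>

lemma radial_flow:
  fixes \<Phi> :: "'e::euclidean_space \<Rightarrow> 'e \<Rightarrow> 'e"
  assumes U: "open U" "x0 \<in> U" and lin: "\<And>x. x \<in> U \<Longrightarrow> linear (\<Phi> x)"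
    and sm: "\<And>\<xi>. smooth_on U (\<lambda>x. \<Phi> x \<xi>)"
  obtains \<delta> and z :: "real \<Rightarrow> 'e \<Rightarrow> 'e" where "\<delta> > 0" "ball x0 \<delta> \<subseteq> U"
    "\<And>c. c \<in> ball x0 \<delta> \<Longrightarrow> continuous_on {0..1} (\<lambda>t. z t c)"
    "\<And>c t. c \<in> ball x0 \<delta> \<Longrightarrow> t \<in> {0..1} \<Longrightarrow> z t c \<in> U"
    "\<And>c s. c \<in> ball x0 \<delta> \<Longrightarrow> s \<in> {0..1} \<Longrightarrow> z s c = c + integral {0..s} (\<lambda>t. \<Phi> (z t c) (c - x0))"
    "smooth_on (ball x0 \<delta>) (z 1)"
    "\<And>c v (Q :: real \<Rightarrow> 'e). c \<in> ball x0 \<delta> \<Longrightarrow> continuous_on {0..1} Q \<Longrightarrow>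
      (\<And>s. s \<in> {0..1} \<Longrightarrow> Q s = v + integral {0..s} (\<lambda>t.
        frechet_derivative (\<lambda>x. \<Phi> x (c - x0)) (at (z t c)) (Q t) + \<Phi> (z t c) v)) \<Longrightarrow>
      frechet_derivative (z 1) (at c) v = Q 1"
proof -
  obtain R where R: "R > 0" "cball x0 R \<subseteq> U" using U open_contains_cball by blast
  define D where "D \<xi> y = frechet_derivative (\<lambda>x. \<Phi> x \<xi>) (at y)" for \<xi> y
  have D: "((\<lambda>x. \<Phi> x \<xi>) has_derivative D \<xi> y) (at y)" if "y \<in> U" for \<xi> y
    unfolding D_def by (rule smooth_on_has_derivative[OF sm that])
  have linD: "linear (D \<xi> y)" if "y \<in> U" for \<xi> y using has_derivative_linear[OF D[OF that]] .
  have Dsum: "D \<xi> y u = (\<Sum>b\<in>Basis. (\<xi> \<bullet> b) *\<^sub>R D b y u)" if "y \<in> U" for \<xi> y u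
    unfolding D_def by (rule linear_smooth_derivative[OF U(1) lin sm that])
  have cont: "continuous_on (cball x0 R) f" if "smooth_on U f" for f :: "'e \<Rightarrow> 'e"
    using smooth_on_continuous[OF that] R(2) by (rule continuous_on_subset)
  obtain C where C: "C \<ge> 0" "\<And>y v. y \<in> cball x0 R \<Longrightarrow> norm (\<Phi> y v) \<le> C * norm v"
    by (rule compact_linear_bound[of "cball x0 R" \<Phi>]) (use lin R cont[OF sm] in auto)
  have "\<exists>L\<ge>0. \<forall>y\<in>cball x0 R. \<forall>u. norm (D b y u) \<le> L * norm u" for b
  proof -
    have Dc: "continuous_on (cball x0 R) (\<lambda>y. D b y u)" for u
      unfolding D_def by (intro cont smooth_on_derivative sm)
    have "linear (D b y)" if "y \<in> cball x0 R" for y using linD R(2) that by blast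
    from compact_linear_bound[OF compact_cball this Dc] show ?thesis by metis
  qed
  then obtain Lb where Lb: "\<And>b. Lb b \<ge> 0" "\<And>b y u. y \<in> cball x0 R \<Longrightarrow> norm (D b y u) \<le> Lb b * norm u"
    by metis
  define L where "L = (\<Sum>b\<in>(Basis::'e set). Lb b)"
  have L: "L \<ge> 0" unfolding L_def by (intro sum_nonneg Lb)
  have DL: "norm (D \<xi> y u) \<le> L * norm \<xi> * norm u" if y: "y \<in> cball x0 R" for \<xi> y u
  proof -
    have "D \<xi> y u = (\<Sum>b\<in>Basis. (\<xi> \<bullet> b) *\<^sub>R D b y u)" using Dsum y R by auto
    also have "norm \<dots> \<le> (\<Sum>b\<in>Basis. norm \<xi> * (Lb b * norm u))"
    proof (rule sum_norm_le)
      fix b :: 'e assume b: "b \<in> Basis"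
      show "norm ((\<xi> \<bullet> b) *\<^sub>R D b y u) \<le> norm \<xi> * (Lb b * norm u)"
        using Lb(2)[OF y, of b u] Basis_le_norm[OF b, of \<xi>] by (auto intro!: mult_mono)
    qed
    also have "\<dots> = L * norm \<xi> * norm u"
      by (simp add: L_def sum_distrib_left sum_distrib_right mult_ac)
    finally show ?thesis .
  qed
  \<comment> \<open>The first bound gives \<delta> + C \<delta> \<le> R / 2, which confines the
    curves to the ball of radius \<open>R / 2\<close>; the second gives L \<delta> \<le> 1/2, the
    Lipschitz constant required of the field.\<close>
  define \<delta> where "\<delta> = min (R / (2 * (1 + C))) (1 / (2 * (1 + L)))"
  have \<delta>: "\<delta> > 0" using R C L by (simp add: \<delta>_def)
  have \<delta>R: "\<delta> + C * \<delta> \<le> R / 2"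
  proof -
    have "\<delta> \<le> R / (2 * (1 + C))" by (simp add: \<delta>_def)
    then have "\<delta> * (2 * (1 + C)) \<le> R" using C by (simp add: pos_le_divide_eq)
    then show ?thesis by (simp add: algebra_simps)
  qed
  have \<delta>L: "L * \<delta> \<le> 1 / 2"
  proof -
    have "\<delta> \<le> 1 / (2 * (1 + L))" by (simp add: \<delta>_def)
    then have "\<delta> * (2 * (1 + L)) \<le> 1" using L by (simp add: pos_le_divide_eq)
    then show ?thesis using \<delta> by (simp add: algebra_simps)
  qed
  have \<delta>le: "\<delta> \<le> R" using \<delta>R \<delta> C R by (smt (verit) mult_nonneg_nonneg field_sum_of_halves)
  have small: "norm (D (c - x0) y u) \<le> 1 / 2 * norm u" if "c \<in> ball x0 \<delta>" "y \<in> cball x0 R" for c y u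
  proof -
    have "L * norm (c - x0) \<le> L * \<delta>"
      using that L by (intro mult_left_mono) (auto simp: dist_norm norm_minus_commute)
    then have "L * norm (c - x0) \<le> 1 / 2" using \<delta>L by linarith
    then show ?thesis using DL[OF that(2), of "c - x0" u] mult_right_mono[of "L * norm (c - x0)" "1 / 2" "norm u"]
      by simp
  qed
  \<comment> \<open>The field is composed with the nearest-point projection onto the closed ball of
    radius \<open>R / 2\<close>, which makes it globally Lipschitz. The solution turns out to stay
    in that ball, where \<open>P\<close> is the identity.\<close>
  define P where "P = closest_point (cball x0 (R / 2))"
  have P: "P y \<in> cball x0 (R / 2)" for y unfolding P_def by (rule closest_point_in_set) (use R in auto)
  have P': "P y \<in> cball x0 R" for y
    using P[of y] R(1) by auto
  have PL: "norm (P y - P y') \<le> norm (y - y')" for y y'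
    using closest_point_lipschitz[of "cball x0 (R / 2)" y y'] R by (simp add: P_def dist_norm)
  define sol where "sol c y \<longleftrightarrow> continuous_on {0..1} y \<and> (\<forall>s\<in>{0..1}. y s \<in> cball x0 (R / 2)) \<and>
      (\<forall>s\<in>{0..1}. y s = c + integral {0..s} (\<lambda>t. \<Phi> (y t) (c - x0)))" for c and y :: "real \<Rightarrow> 'e"
  have "\<exists>y. sol c y" if c: "c \<in> ball x0 \<delta>" for c
  proof -
    have lip: "norm (\<Phi> (P y) (c - x0) - \<Phi> (P y') (c - x0)) \<le> 1 / 2 * norm (y - y')" for y y'
    proof -
      have "norm (\<Phi> (P y) (c - x0) - \<Phi> (P y') (c - x0)) \<le> 1 / 2 * norm (P y - P y')"
      proof (rule differentiable_bound[where S="cball x0 R" and f'="D (c - x0)"])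
        show "((\<lambda>y. \<Phi> y (c - x0)) has_derivative D (c - x0) x) (at x within cball x0 R)" if "x \<in> cball x0 R" for x
          by (rule has_derivative_at_withinI[OF D[OF subsetD[OF R(2) that]]])
        show "onorm (D (c - x0) x) \<le> 1 / 2" if "x \<in> cball x0 R" for x
          using small[OF c that] by (rule onorm_le)
      qed (use P' in auto)
      also have "\<dots> \<le> 1 / 2 * norm (y - y')" using PL[of y y'] by simp
      finally show ?thesis .
    qed
    have "continuous_on ({0..1::real} \<times> UNIV) (\<lambda>(t, y). \<Phi> (P y) (c - x0))"
      unfolding split_beta
    proof (rule continuous_on_compose2[OF cont[OF sm]])
      show "continuous_on ({0..1::real} \<times> UNIV) (\<lambda>x. P (snd x))"
        unfolding P_def
        by (rule continuous_on_compose2[OF continuous_on_closest_point[of _ UNIV]])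
          (use R in \<open>auto intro!: continuous_intros\<close>)
    qed (use P' in auto)
    then show ?thesis
    proof (rule integral_equation_exists[of "\<lambda>t y. \<Phi> (P y) (c - x0)" c, OF _ lip])
    fix y :: "real \<Rightarrow> 'e" assume y: "continuous_on {0..1} y"
      "\<And>s. s \<in> {0..1} \<Longrightarrow> y s = c + integral {0..s} (\<lambda>t. \<Phi> (P (y t)) (c - x0))"
    have yc: "continuous_on {0..1} (\<lambda>t. \<Phi> (P (y t)) (c - x0))"
    proof (rule continuous_on_compose2[OF cont[OF sm]])
      show "continuous_on {0..1} (\<lambda>t. P (y t))"
        unfolding P_def
        by (rule continuous_on_compose2[OF continuous_on_closest_point[of _ UNIV] y(1)]) (use R in auto)
    qed (use P' in auto)
    have cd: "norm (c - x0) \<le> \<delta>" using c by (simp add: dist_norm norm_minus_commute)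
    have yin: "y s \<in> cball x0 (R / 2)" if s: "s \<in> {0..1}" for s
    proof -
      have "norm (integral {0..s} (\<lambda>t. \<Phi> (P (y t)) (c - x0))) \<le> (C * \<delta>) * (s - 0)"
      proof (rule integral_bound)
        show "continuous_on {0..s} (\<lambda>t. \<Phi> (P (y t)) (c - x0))"
          by (rule continuous_on_subset[OF yc]) (use s in auto)
        show "norm (\<Phi> (P (y t)) (c - x0)) \<le> C * \<delta>" for t
          using C(2)[OF P', of "y t" "c - x0"] mult_left_mono[OF cd C(1)] by linarith
      qed (use s in auto)
      also have "\<dots> \<le> C * \<delta>" using s C \<delta> by (intro mult_left_le) auto
      finally have "norm (y s - c) \<le> C * \<delta>" using y(2)[OF s] by simp
      moreover have "norm (y s - x0) \<le> norm (y s - c) + norm (c - x0)"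
        using norm_triangle_ineq[of "y s - c" "c - x0"] by simp
      ultimately have "norm (y s - x0) \<le> C * \<delta> + \<delta>" using cd by argo
      then show ?thesis using \<delta>R by (simp add: dist_norm norm_minus_commute)
    qed
    then have Py: "P (y s) = y s" if "s \<in> {0..1}" for s using that by (simp add: P_def closest_point_self)
    have yeq: "y s = c + integral {0..s} (\<lambda>t. \<Phi> (y t) (c - x0))" if s: "s \<in> {0..1}" for s
    proof -
      have "integral {0..s} (\<lambda>t. \<Phi> (P (y t)) (c - x0)) = integral {0..s} (\<lambda>t. \<Phi> (y t) (c - x0))"
        by (rule integral_cong) (use s Py in auto)
      then show ?thesis using y(2)[OF s] by simp
    qed
    have "sol c y" unfolding sol_def
      by (intro conjI ballI) (rule y(1) yin yeq; assumption)+
    then show ?thesis by blast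
    qed
  qed
  then obtain zz where sol: "\<And>c. c \<in> ball x0 \<delta> \<Longrightarrow> sol c (zz c)" by metis
  have zz: "\<And>c. c \<in> ball x0 \<delta> \<Longrightarrow> continuous_on {0..1} (zz c)"
    "\<And>c s. c \<in> ball x0 \<delta> \<Longrightarrow> s \<in> {0..1} \<Longrightarrow> zz c s \<in> cball x0 (R / 2)"
    "\<And>c s. c \<in> ball x0 \<delta> \<Longrightarrow> s \<in> {0..1} \<Longrightarrow> zz c s = c + integral {0..s} (\<lambda>t. \<Phi> (zz c t) (c - x0))"
    using sol unfolding sol_def by blast+
  define z where "z t c = zz c t" for t c
  define G where "G p = \<Phi> (snd p) (fst p - x0)" for p
  \<comment> \<open>The open ball of radius \<open>R\<close> is convex and contains the closed ball
    of radius \<open>R / 2\<close> in which all curves stay, so it can serve as the state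
    set.\<close>
  let ?B = "ball x0 \<delta>" and ?Z = "ball x0 R"
  have ZU: "?Z \<subseteq> U" using R by auto
  have Zc: "?Z \<subseteq> cball x0 R" by auto
  have oBZ: "open (?B \<times> ?Z)" by (intro open_Times open_ball)
  have Gsum: "G p = (\<Sum>b\<in>Basis. ((fst p - x0) \<bullet> b) *\<^sub>R \<Phi> (snd p) b)" if "p \<in> ?B \<times> ?Z" for p
    unfolding G_def by (rule linear_eq_sum_Basis[OF lin]) (use that ZU in auto)
  have sfst: "smooth_on (?B \<times> ?Z) (\<lambda>p. (fst p - x0) \<bullet> b)" for b
    by (intro smooth_on_inner smooth_on_diff smooth_on_const smooth_on_linear bounded_linear_fst oBZ)
  have ssnd: "smooth_on (?B \<times> ?Z) (\<lambda>p. \<Phi> (snd p) b)" for b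
    by (rule smooth_on_compose[OF oBZ U(1) _ _ sm])
      (use ZU in \<open>auto intro!: smooth_on_linear bounded_linear_snd oBZ\<close>)
  have sG: "smooth_on (?B \<times> ?Z) G"
    by (rule smooth_on_cong[OF oBZ Gsum[symmetric]]) (auto intro!: smooth_on_sum smooth_on_scaleR sfst ssnd oBZ)
  have DG: "frechet_derivative G (at p) q = D (fst p - x0) (snd p) (snd q) + \<Phi> (snd p) (fst q)" if p: "p \<in> ?B \<times> ?Z" for p q
  proof -
    have sp: "snd p \<in> U" using p ZU by auto
    have 1: "((\<lambda>p. (fst p - x0) \<bullet> b) has_derivative (\<lambda>q. fst q \<bullet> b)) (at p)" for b
      by (auto intro!: derivative_eq_intros)
    have 2: "((\<lambda>p. \<Phi> (snd p) b) has_derivative (\<lambda>q. D b (snd p) (snd q))) (at p)" for b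
      by (rule has_derivative_compose[OF has_derivative_snd[OF has_derivative_ident] D[OF sp]])
    have "((\<lambda>p. \<Sum>b\<in>Basis. ((fst p - x0) \<bullet> b) *\<^sub>R \<Phi> (snd p) b) has_derivative
      (\<lambda>q. \<Sum>b\<in>Basis. ((fst p - x0) \<bullet> b) *\<^sub>R D b (snd p) (snd q) + (fst q \<bullet> b) *\<^sub>R \<Phi> (snd p) b)) (at p)"
      by (intro has_derivative_sum has_derivative_scaleR 1 2)
    then have "(G has_derivative (\<lambda>q. \<Sum>b\<in>Basis. ((fst p - x0) \<bullet> b) *\<^sub>R D b (snd p) (snd q) + (fst q \<bullet> b) *\<^sub>R \<Phi> (snd p) b)) (at p)"
      by (rule has_derivative_transform_within_open[OF _ oBZ p]) (rule Gsum[symmetric])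
    then have "frechet_derivative G (at p) q = (\<Sum>b\<in>Basis. ((fst p - x0) \<bullet> b) *\<^sub>R D b (snd p) (snd q) + (fst q \<bullet> b) *\<^sub>R \<Phi> (snd p) b)"
      by (rule has_derivative_frechet_eq)
    then show ?thesis
      unfolding sum.distrib Dsum[OF sp, of "fst p - x0", symmetric] linear_eq_sum_Basis[OF lin[OF sp], of "fst q", symmetric] .
  qed
  have zR: "z t c \<in> ?Z" if "t \<in> {0..1}" "c \<in> ?B" for t c
    using zz(2)[OF that(2,1)] R(1) by (auto simp: z_def)
  have "param_integral_equation ?B ?Z (\<lambda>_. G) (\<lambda>_ p. frechet_derivative G (at p)) z (\<lambda>c. c) (\<lambda>_ v. v)"
  proof
    show "(G has_derivative frechet_derivative G (at p)) (at p)" if "p \<in> ?B \<times> ?Z" for p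
      by (rule smooth_on_has_derivative[OF sG that])
    have lift: "continuous_on ({0..1::real} \<times> ?B \<times> ?Z) (\<lambda>(t, p). f p)" if "smooth_on (?B \<times> ?Z) f" for f :: "'e \<times> 'e \<Rightarrow> 'e"
      unfolding split_beta by (rule continuous_on_compose2[OF smooth_on_continuous[OF that]]) (auto intro!: continuous_intros)
    show "continuous_on ({0..1::real} \<times> ?B \<times> ?Z) (\<lambda>(t, p). G p)" by (rule lift[OF sG])
    show "continuous_on ({0..1::real} \<times> ?B \<times> ?Z) (\<lambda>(t, p). frechet_derivative G (at p) v)" for v
      by (rule lift[OF smooth_on_derivative[OF sG]])
    show "norm (frechet_derivative G (at p) (0, v)) \<le> 1 / 2 * norm v" if p: "p \<in> ?B \<times> ?Z" for p v
    proof -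
      have "snd p \<in> U" "fst p \<in> ?B" "snd p \<in> cball x0 R" using p ZU by auto
      then show ?thesis using small[of "fst p" "snd p" v] linear_0[OF lin[of "snd p"]] by (simp add: DG[OF p])
    qed
    show "z s c = c + integral {0..s} (\<lambda>t. G (c, z t c))" if "s \<in> {0..1}" "c \<in> ?B" for s c
      using zz(3)[OF that(2,1)] by (simp add: z_def G_def)
    show "continuous_on {0..1} (\<lambda>t. z t c)" if "c \<in> ?B" for c
      using zz(1)[OF that] by (simp add: z_def)
  qed (use zR in auto)
  then interpret param_integral_equation ?B ?Z "\<lambda>_. G" "\<lambda>_ p. frechet_derivative G (at p)" z "\<lambda>c. c" "\<lambda>_ v. v" .
  show ?thesis
  proof (rule that[of \<delta> z])
    show "ball x0 \<delta> \<subseteq> U" using \<delta>le ZU by auto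
    show "continuous_on {0..1} (\<lambda>t. z t c)" if "c \<in> ?B" for c by (rule z_cont[OF that])
    show "z t c \<in> U" if "c \<in> ?B" "t \<in> {0..1}" for t c using zR[OF that(2,1)] ZU by blast
    show "z s c = c + integral {0..s} (\<lambda>t. \<Phi> (z t c) (c - x0))" if "c \<in> ?B" "s \<in> {0..1}" for s c
      using z_eq[OF that(2,1)] by (simp add: G_def)
    show "smooth_on ?B (z 1)"
      unfolding smooth_on_def using Ck_param_slice[OF solution_Ck[OF param_integral_equation_axioms sG], of 1] by auto
    show "frechet_derivative (z 1) (at c) v = Q 1" if c: "c \<in> ?B" and Q: "continuous_on {0..1} Q"
      "\<And>s. s \<in> {0..1} \<Longrightarrow> Q s = v + integral {0..s} (\<lambda>t.
        frechet_derivative (\<lambda>x. \<Phi> x (c - x0)) (at (z t c)) (Q t) + \<Phi> (z t c) v)" for c v and Q :: "real \<Rightarrow> 'e"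
    proof (rule variation_unique[OF c z_derivative(2)[OF c] Q(1) z_derivative(3)[OF c]])
      show "Q s = v + integral {0..s} (\<lambda>t. frechet_derivative G (at (c, z t c)) (v, Q t))" if s: "s \<in> {0..1}" for s
      proof -
        have "integral {0..s} (\<lambda>t. frechet_derivative (\<lambda>x. \<Phi> x (c - x0)) (at (z t c)) (Q t) + \<Phi> (z t c) v) =
          integral {0..s} (\<lambda>t. frechet_derivative G (at (c, z t c)) (v, Q t))"
          by (rule integral_cong) (use s zR c DG in \<open>auto simp: D_def\<close>)
        then show ?thesis using Q(2)[OF s] by simp
      qed
    qed auto
  qed (rule \<delta>)
qed


section \<open>The Frobenius theorem in a chart\<close>

text \<open>Premise \<open>proj\<close> says that the maps \<open>A x\<close> are projections with a
  common kernel. Premise \<open>sym\<close> says that the vector fields \<open>A x u\<close> and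
  \<open>A x v\<close>, as functions of \<open>x\<close>, commute, which expresses integrability of
  the images.\<close>

lemma frobenius_core:
  fixes A :: "'e::euclidean_space \<Rightarrow> 'e \<Rightarrow> 'e"
  assumes U: "open U" "x0 \<in> U" and lin: "\<And>x. x \<in> U \<Longrightarrow> linear (A x)"
    and sm: "\<And>v. smooth_on U (\<lambda>x. A x v)"
    and proj: "\<And>x y v. x \<in> U \<Longrightarrow> y \<in> U \<Longrightarrow> A x (A y v) = A x v"
    and sym: "\<And>x u v. x \<in> U \<Longrightarrow> frechet_derivative (\<lambda>y. A y v) (at x) (A x u) = frechet_derivative (\<lambda>y. A y u) (at x) (A x v)"
  obtains \<delta> F where "\<delta> > 0" "ball x0 \<delta> \<subseteq> U" "smooth_on (ball x0 \<delta>) F"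
    "\<And>c v. c \<in> ball x0 \<delta> \<Longrightarrow> frechet_derivative F (at c) (A c v) = 0"
    "\<And>v. frechet_derivative F (at x0) v = v - A x0 v"
proof -
  have lin': "linear (\<lambda>\<xi>. - A x \<xi>)" if "x \<in> U" for x using linear_compose_neg[OF lin[OF that]] .
  have sm': "smooth_on U (\<lambda>x. - A x \<xi>)" for \<xi> by (rule smooth_on_minus[OF U(1) sm])
  show ?thesis
  proof (rule radial_flow[OF U lin' sm'])
  fix \<delta> :: real and z :: "real \<Rightarrow> 'e \<Rightarrow> 'e"
  assume \<delta>: "\<delta> > 0" "ball x0 \<delta> \<subseteq> U"
    and zc: "\<And>c. c \<in> ball x0 \<delta> \<Longrightarrow> continuous_on {0..1} (\<lambda>t. z t c)"
    and zU: "\<And>c t. c \<in> ball x0 \<delta> \<Longrightarrow> t \<in> {0..1} \<Longrightarrow> z t c \<in> U"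
    and zeq: "\<And>c s. c \<in> ball x0 \<delta> \<Longrightarrow> s \<in> {0..1} \<Longrightarrow> z s c = c + integral {0..s} (\<lambda>t. - A (z t c) (c - x0))"
    and sz: "smooth_on (ball x0 \<delta>) (z 1)"
    and Q: "\<And>c v (Q :: real \<Rightarrow> 'e). c \<in> ball x0 \<delta> \<Longrightarrow> continuous_on {0..1} Q \<Longrightarrow>
      (\<And>s. s \<in> {0..1} \<Longrightarrow> Q s = v + integral {0..s} (\<lambda>t.
        frechet_derivative (\<lambda>x. - A x (c - x0)) (at (z t c)) (Q t) + - A (z t c) v)) \<Longrightarrow>
      frechet_derivative (z 1) (at c) v = Q 1"
  have neg: "frechet_derivative (\<lambda>x. - A x \<xi>) (at x) u = - frechet_derivative (\<lambda>x. A x \<xi>) (at x) u"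
    if "x \<in> U" for \<xi> x u
    by (rule has_derivative_frechet_eq[OF has_derivative_minus[OF smooth_on_has_derivative[OF sm that]]])
  have 1: "frechet_derivative (z 1) (at c) (A c v) = 0" if c: "c \<in> ball x0 \<delta>" for c v
  proof -
    have cU: "c \<in> U" using c \<delta> by blast
    define V where "V = A c v"
    \<comment> \<open>The explicit solution of the linearized equation along the curve from
      \<open>c\<close> in the direction \<open>V\<close>. It ends at 0, which is the claim.\<close>
    define q where "q s = (1 - s) *\<^sub>R A (z s c) V" for s :: real
    define D where "D \<xi> x = frechet_derivative (\<lambda>y. A y \<xi>) (at x)" for \<xi> x
    have D: "((\<lambda>y. A y \<xi>) has_derivative D \<xi> x) (at x)" if "x \<in> U" for \<xi> x
      unfolding D_def by (rule smooth_on_has_derivative[OF sm that])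
    have Ac: "continuous_on {0..1} (\<lambda>t. A (z t c) \<xi>)" for \<xi>
      by (rule continuous_on_compose2[OF smooth_on_continuous[OF sm] zc[OF c]]) (use zU c in auto)
    have z': "((\<lambda>t. z t c) has_vector_derivative - A (z t c) (c - x0)) (at t within {0..1})" if t: "t \<in> {0..1}" for t
    proof -
      have "((\<lambda>s. integral {0..s} (\<lambda>t. - A (z t c) (c - x0))) has_vector_derivative - A (z t c) (c - x0)) (at t within {0..1})"
        by (rule integral_has_vector_derivative[OF _ t]) (intro continuous_intros Ac)
      from has_vector_derivative_add[OF has_vector_derivative_const[of c] this]
      have "((\<lambda>s. c + integral {0..s} (\<lambda>t. - A (z t c) (c - x0))) has_vector_derivative - A (z t c) (c - x0)) (at t within {0..1})"
        by simp
      then show ?thesis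
        by (rule has_vector_derivative_transform[OF t, rotated]) (rule zeq[OF c])
    qed
    have q': "(q has_vector_derivative (frechet_derivative (\<lambda>x. - A x (c - x0)) (at (z t c)) (q t) + - A (z t c) V)) (at t within {0..1})"
      if t: "t \<in> {0..1}" for t
    proof -
      have zt: "z t c \<in> U" using zU c t by blast
      have "((\<lambda>t. A (z t c) V) has_derivative (\<lambda>r. D V (z t c) (r *\<^sub>R (- A (z t c) (c - x0))))) (at t within {0..1})"
        using has_derivative_compose[OF z'[OF t, unfolded has_vector_derivative_def] D[OF zt]] .
      then have AV: "((\<lambda>t. A (z t c) V) has_vector_derivative D V (z t c) (- A (z t c) (c - x0))) (at t within {0..1})"
        unfolding has_vector_derivative_def
        by (simp add: linear_scale[OF has_derivative_linear[OF D[OF zt]]]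
            linear_neg[OF has_derivative_linear[OF D[OF zt]]])
      have "((\<lambda>t. 1 - t) has_vector_derivative (- 1)) (at t within {0..1::real})"
        by (auto intro!: derivative_eq_intros simp: has_vector_derivative_def)
      from bounded_bilinear.has_vector_derivative[OF bounded_bilinear_scaleR this AV]
      have "(q has_vector_derivative ((1 - t) *\<^sub>R D V (z t c) (- A (z t c) (c - x0)) + (- 1) *\<^sub>R A (z t c) V)) (at t within {0..1})"
        by (simp add: q_def[abs_def])
      \<comment> \<open>Commutation exchanges \<open>V\<close> and \<open>c - x0\<close>: the
        derivative of \<open>A V\<close> along the curve becomes a derivative of the field of the
        flow in the direction \<open>A V\<close>, as in the linearized equation.\<close>
      moreover have "(1 - t) *\<^sub>R D V (z t c) (- A (z t c) (c - x0)) = - D (c - x0) (z t c) (q t)"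
        using sym[OF zt, of V "c - x0"] has_derivative_linear[OF D[OF zt, of V]] has_derivative_linear[OF D[OF zt, of "c - x0"]]
        unfolding D_def[symmetric] q_def by (simp add: linear_neg linear_scale)
      ultimately show ?thesis by (simp add: neg[OF zt] D_def)
    qed
    have "frechet_derivative (z 1) (at c) V = q 1"
    proof (rule Q[OF c])
      show "continuous_on {0..1} q"
        using q' by (rule continuous_on_vector_derivative)
      fix s :: real assume s: "s \<in> {0..1}"
      have "((\<lambda>t. frechet_derivative (\<lambda>x. - A x (c - x0)) (at (z t c)) (q t) + - A (z t c) V) has_integral q s - q 0) {0..s}"
      proof (rule fundamental_theorem_of_calculus)
        fix x assume "x \<in> {0..s}"
        then have x: "x \<in> {0..1}" using s by auto
        show "(q has_vector_derivative frechet_derivative (\<lambda>x. - A x (c - x0)) (at (z x c)) (q x) + - A (z x c) V) (at x within {0..s})"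
          by (rule has_vector_derivative_within_subset[OF q'[OF x]]) (use s in auto)
      qed (use s in auto)
      \<comment> \<open>\<open>A c\<close> is idempotent and therefore fixes
        \<open>V = A c v\<close>.\<close>
      moreover have "q 0 = V"
        using zeq[OF c, of 0] proj[OF cU cU, of v] by (simp add: q_def V_def)
      ultimately show "q s = V + integral {0..s} (\<lambda>t. frechet_derivative (\<lambda>x. - A x (c - x0)) (at (z t c)) (q t) + - A (z t c) V)"
        by (simp add: integral_unique)
    qed
    then show ?thesis by (simp add: V_def q_def)
  qed
  have 2: "frechet_derivative (z 1) (at x0) v = v - A x0 v" for v
  proof -
    have x0: "x0 \<in> ball x0 \<delta>" using \<delta> by simp
    have A0: "A x 0 = 0" if "x \<in> U" for x using linear_0[OF lin[OF that]] .
    \<comment> \<open>For \<open>c = x0\<close> the field vanishes, the curve is constant, and the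
      linearized equation has the affine solution used below.\<close>
    have zx: "z t x0 = x0" if t: "t \<in> {0..1}" for t
    proof -
      have "integral {0..t} (\<lambda>t. - A (z t x0) (x0 - x0)) = integral {0..t} (\<lambda>t. 0::'e)"
        by (rule integral_cong) (use t zU[OF x0] A0 in auto)
      then show ?thesis using zeq[OF x0 t] by simp
    qed
    have "((\<lambda>x. 0::'e) has_derivative (\<lambda>_. 0)) (at x0)" by simp
    then have "((\<lambda>x. - A x (x0 - x0)) has_derivative (\<lambda>_. 0)) (at x0)"
      by (rule has_derivative_transform_within_open[OF _ U]) (simp add: A0)
    then have D0: "frechet_derivative (\<lambda>x. - A x (x0 - x0)) (at x0) u = 0" for u
      by (rule has_derivative_frechet_eq)
    have "frechet_derivative (z 1) (at x0) v = (\<lambda>s. v - s *\<^sub>R A x0 v) 1"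
    proof (rule Q[OF x0])
      show "continuous_on {0..1::real} (\<lambda>s. v - s *\<^sub>R A x0 v)" by (intro continuous_intros)
      fix s :: real assume s: "s \<in> {0..1}"
      have "integral {0..s} (\<lambda>t. frechet_derivative (\<lambda>x. - A x (x0 - x0)) (at (z t x0)) (v - t *\<^sub>R A x0 v) + - A (z t x0) v)
        = integral {0..s} (\<lambda>t. - A x0 v)"
        by (rule integral_cong) (use s zx D0 in auto)
      then show "v - s *\<^sub>R A x0 v = v + integral {0..s} (\<lambda>t. frechet_derivative (\<lambda>x. - A x (x0 - x0)) (at (z t x0)) (v - t *\<^sub>R A x0 v) + - A (z t x0) v)"
        using s by simp
    qed
    then show ?thesis by simp
  qed
  show ?thesis by (rule that[OF \<delta> sz 1 2])
  qed
qed

section \<open>Dual frames\<close>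

lemma dual_independent:
  fixes X :: "'i \<Rightarrow> 'v::real_vector" and \<phi> :: "'i \<Rightarrow> 'v \<Rightarrow> real"
  assumes "\<And>a. a \<in> I \<Longrightarrow> linear (\<phi> a)"
    and "\<And>a b. a \<in> I \<Longrightarrow> b \<in> I \<Longrightarrow> \<phi> a (X b) = (if a = b then 1 else 0)"
  shows "inj_on X I" "independent (X ` I)"
proof -
  show inj: "inj_on X I"
    by (rule inj_onI) (metis assms(2) zero_neq_one)
  show "independent (X ` I)"
  proof
    assume "dependent (X ` I)"
    then obtain a where a: "a \<in> I" "X a \<in> span (X ` I - {X a})" unfolding dependent_def by auto
    have "\<phi> a y = 0" if "y \<in> span (X ` I - {X a})" for y
      using that
    proof (induction rule: span_induct)
      case base
      show ?case using linear_0[OF assms(1)[OF a(1)]] linear_add[OF assms(1)[OF a(1)]]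
          linear_scale[OF assms(1)[OF a(1)]] by (auto simp: subspace_def)
    next
      case (step y)
      then show ?case using assms(2) a by auto
    qed
    from this[OF a(2)] assms(2)[OF a(1) a(1)] show False by simp
  qed
qed

text \<open>The dual vectors are combinations of fixed vectors \<open>e b\<close> with smooth
  coefficients. Keeping the span of the \<open>e b\<close> fixed provides the common complement of
  all annihilators near \<open>x0\<close>. The induction adds one form at a time, in the manner of
  Gram-Schmidt orthogonalization.\<close>

lemma dual_frame_ex:
  fixes w :: "nat \<Rightarrow> 'e::euclidean_space \<Rightarrow> 'e \<Rightarrow> real"
  assumes "open U" "x0 \<in> U"
    and lin: "\<And>a x. a < r \<Longrightarrow> x \<in> U \<Longrightarrow> linear (w a x)"
    and sm: "\<And>a v. a < r \<Longrightarrow> smooth_on U (\<lambda>x. w a x v)"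
    and ind: "\<And>c. (\<And>v. (\<Sum>a<r. c a * w a x0 v) = 0) \<Longrightarrow> (\<forall>a<r. c a = 0)"
  shows "\<exists>U' e h. open U' \<and> x0 \<in> U' \<and> U' \<subseteq> U \<and>
    (\<forall>a<r. \<forall>b<r. smooth_on U' (h b a)) \<and>
    (\<forall>x\<in>U'. \<forall>a<r. \<forall>c<r. w c x (\<Sum>b<r. h b a x *\<^sub>R e b) = (if a = c then 1 else 0))"
  using lin sm ind
proof (induction r)
  case 0
  then show ?case using assms by (intro exI[of _ U]) auto
next
  case (Suc r)
  have "\<exists>U' e h. open U' \<and> x0 \<in> U' \<and> U' \<subseteq> U \<and>
    (\<forall>a<r. \<forall>b<r. smooth_on U' (h b a)) \<and>
    (\<forall>x\<in>U'. \<forall>a<r. \<forall>c<r. w c x (\<Sum>b<r. h b a x *\<^sub>R e b) = (if a = c then 1 else 0))"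
  proof (rule Suc.IH)
    fix c assume c: "\<And>v. (\<Sum>a<r. c a * w a x0 v) = 0"
    have "(\<Sum>a<Suc r. (c(r := 0)) a * w a x0 v) = 0" for v using c[of v] by simp
    from Suc.prems(3)[OF this] have "\<forall>a<Suc r. (c(r := 0)) a = 0" .
    then show "\<forall>a<r. c a = 0" by (metis fun_upd_other less_Suc_eq less_irrefl)
  qed (use Suc.prems in auto)
  then obtain U1 e h where U1: "open U1" "x0 \<in> U1" "U1 \<subseteq> U"
    and h0: "\<forall>a<r. \<forall>b<r. smooth_on U1 (h b a)"
    and dual0: "\<forall>x\<in>U1. \<forall>a<r. \<forall>c<r. w c x (\<Sum>b<r. h b a x *\<^sub>R e b) = (if a = c then 1 else 0)"
    by (elim exE conjE) (rule that)
  have h: "\<And>a b. a < r \<Longrightarrow> b < r \<Longrightarrow> smooth_on U1 (h b a)" using h0 by blast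
  define X where "X a x = (\<Sum>b<r. h b a x *\<^sub>R e b)" for a x
  have lw: "linear (w a x)" if "a \<le> r" "x \<in> U1" for a x using Suc.prems(1)[of a x] that U1 by auto
  have sw: "smooth_on U1 (\<lambda>x. w a x v)" if "a \<le> r" for a v
    using smooth_on_subset[OF U1(1,3) assms(1) Suc.prems(2)[of a v]] that by auto
  have dX: "w c x (X a x) = (if a = c then 1 else 0)" if "x \<in> U1" "a < r" "c < r" for x a c
    using dual0 that by (simp add: X_def)
  have wX: "w r x (X a x) = (\<Sum>b<r. h b a x * w r x (e b))" if "x \<in> U1" for x a
    unfolding X_def by (simp add: linear_sum[OF lw[OF order_refl that]] linear_scale[OF lw[OF order_refl that]])
  have swX: "smooth_on U1 (\<lambda>x. w r x (X a x))" if "a < r" for a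
    by (rule smooth_on_cong[OF U1(1) wX[symmetric]]) (use that in \<open>auto intro!: smooth_on_sum smooth_on_mult h sw U1\<close>)
  \<comment> \<open>The value of the new form on the part of \<open>v\<close> annihilated by the
    earlier forms. If it vanished at \<open>x0\<close> for every \<open>v\<close>, the new form
    would depend on the others there.\<close>
  define g where "g v x = w r x v - (\<Sum>a<r. w r x (X a x) * w a x v)" for v x
  have "\<exists>v. g v x0 \<noteq> 0"
  proof (rule ccontr)
    assume "\<not> ?thesis"
    then have g0: "g v x0 = 0" for v by blast
    have "(\<Sum>a<Suc r. (\<lambda>a. if a = r then 1 else - w r x0 (X a x0)) a * w a x0 v) = 0" for v
      using g0[of v] by (simp add: g_def sum_negf)
    from Suc.prems(3)[OF this] show False by auto
  qed
  then obtain v where v: "g v x0 \<noteq> 0" by blast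
  have sg: "smooth_on U1 (g v)"
    unfolding g_def by (intro smooth_on_diff smooth_on_sum smooth_on_mult sw swX U1) auto
  define U' where "U' = U1 \<inter> g v -` (- {0})"
  have U': "open U'" "x0 \<in> U'" "U' \<subseteq> U1"
    using continuous_open_preimage[OF smooth_on_continuous[OF sg] U1(1), of "- {0}"] U1 v by (auto simp: U'_def)
  have g0: "g v x \<noteq> 0" if "x \<in> U'" for x using that by (simp add: U'_def)
  \<comment> \<open>\<open>q\<close> lists the coefficients over \<open>e'\<close> of the new dual
    vector \<open>Y\<close>: the part of \<open>v\<close> annihilated by the earlier forms, scaled
    to give the new form the value 1. The earlier dual vectors are corrected by multiples of
    \<open>Y\<close>, and \<open>h'\<close> records the result.\<close>
  define q where "q b x = (if b = r then 1 else - (\<Sum>a<r. w a x v * h b a x)) / g v x" for b x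
  define h' where "h' b a x = (if a = r then q b x else (if b = r then 0 else h b a x) - w r x (X a x) * q b x)" for b a x
  define e' where "e' = e(r := v)"
  define Y where "Y x = (1 / g v x) *\<^sub>R (v - (\<Sum>a<r. w a x v *\<^sub>R X a x))" for x
  have Y: "(\<Sum>b<Suc r. q b x *\<^sub>R e' b) = Y x" for x
  proof -
    have "(\<Sum>b<r. (\<Sum>a<r. w a x v * h b a x) *\<^sub>R e b) = (\<Sum>a<r. w a x v *\<^sub>R X a x)"
      unfolding X_def scaleR_sum_left scaleR_sum_right
      by (subst sum.swap) simp
    moreover have "(\<Sum>b<r. q b x *\<^sub>R e b) = - (1 / g v x) *\<^sub>R (\<Sum>b<r. (\<Sum>a<r. w a x v * h b a x) *\<^sub>R e b)"
      unfolding scaleR_sum_right by (rule sum.cong) (auto simp: q_def)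
    ultimately show ?thesis by (simp add: Y_def e'_def q_def scaleR_diff_right)
  qed
  have X': "(\<Sum>b<Suc r. h' b a x *\<^sub>R e' b) = (if a = r then Y x else X a x - w r x (X a x) *\<^sub>R Y x)" for a x
  proof (cases "a = r")
    case True then show ?thesis using Y[of x] by (simp add: h'_def)
  next
    case False
    have "(\<Sum>b<Suc r. (if b = r then 0 else h b a x) *\<^sub>R e' b) = X a x"
      by (simp add: X_def e'_def)
    then show ?thesis using False Y[of x, symmetric]
      by (simp add: h'_def scaleR_diff_left sum_subtractf scaleR_sum_right scaleR_add_right del: sum.lessThan_Suc)
  qed
  have wY: "w c x (Y x) = (if c = r then 1 else 0)" if x: "x \<in> U'" and c: "c \<le> r" for c x
  proof -
    have xU: "x \<in> U1" using x U' by blast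
    have "w c x (Y x) = (1 / g v x) * (w c x v - (\<Sum>a<r. w a x v * w c x (X a x)))"
      unfolding Y_def by (simp add: linear_scale[OF lw[OF c xU]] linear_diff[OF lw[OF c xU]] linear_sum[OF lw[OF c xU]])
    also have "\<dots> = (if c = r then 1 else 0)"
    proof (cases "c = r")
      case True then show ?thesis using g0[OF x] by (simp add: g_def mult.commute)
    next
      case False
      then have "(\<Sum>a<r. w a x v * w c x (X a x)) = (\<Sum>a<r. if a = c then w a x v else 0)"
        using c dX[OF xU] by (intro sum.cong) auto
      also have "\<dots> = w c x v" using False c by simp
      finally show ?thesis using False by simp
    qed
    finally show ?thesis .
  qed
  show ?case
  proof (intro exI[of _ U'] exI[of _ e'] exI[of _ h'] conjI allI ballI impI)
    fix a b assume ab: "a < Suc r" "b < Suc r"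
    have sm': "smooth_on U' f" if "smooth_on U1 f" for f :: "'e \<Rightarrow> real"
      using smooth_on_subset[OF U'(1,3) U1(1) that] .
    have sq: "smooth_on U' (q b)"
    proof (cases "b = r")
      case True
      then show ?thesis unfolding q_def
        using g0 U' by (auto intro!: smooth_on_divide smooth_on_const sm'[OF sg])
    next
      case False
      then have "b < r" using ab by simp
      with False show ?thesis unfolding q_def
        using g0 U'(1) U1(1)
        by (auto intro!: smooth_on_divide smooth_on_minus smooth_on_sum smooth_on_mult sm'[OF sg] sm'[OF sw] sm'[OF h])
    qed
    show "smooth_on U' (h' b a)"
    proof (cases "a = r")
      case True then show ?thesis using sq by (simp add: h'_def[abs_def])
    next
      case False
      then have a: "a < r" using ab by simp
      have "smooth_on U' (\<lambda>x. (if b = r then 0 else h b a x))"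
        using ab a U'(1) by (cases "b = r") (auto intro!: smooth_on_const sm'[OF h])
      then show ?thesis using False a unfolding h'_def
        by (auto intro!: smooth_on_diff smooth_on_mult sm'[OF swX] sq U'(1))
    qed
  next
    fix x a c assume x: "x \<in> U'" and ac: "a < Suc r" "c < Suc r"
    have xU: "x \<in> U1" using x U' by blast
    have c: "c \<le> r" using ac by simp
    show "w c x (\<Sum>b<Suc r. h' b a x *\<^sub>R e' b) = (if a = c then 1 else 0)"
    proof (cases "a = r")
      case True then show ?thesis using wY[OF x c] unfolding X' by auto
    next
      case False
      then have "w c x (X a x - w r x (X a x) *\<^sub>R Y x) = w c x (X a x) - w r x (X a x) * (if c = r then 1 else 0)"
        using wY[OF x c] by (simp add: linear_diff[OF lw[OF c xU]] linear_scale[OF lw[OF c xU]])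
      then show ?thesis using False ac dX[OF xU, of a c] unfolding X' by (cases "c = r") auto
    qed
  qed (use U' U1 in auto)
qed

text \<open>The \<open>r\<close> independent vectors \<open>X a\<close> lie in the span of
  \<open>r\<close> vectors, so they span it; the expansion then has to be checked only on the
  \<open>X a\<close>.\<close>

lemma dual_frame_span:
  fixes w :: "nat \<Rightarrow> 'e::euclidean_space \<Rightarrow> real"
  assumes lin: "\<And>a. a < r \<Longrightarrow> linear (w a)"
    and dual: "\<And>a c. a < r \<Longrightarrow> c < r \<Longrightarrow> w c (X a) = (if a = c then 1 else 0)"
    and X: "\<And>a. a < r \<Longrightarrow> X a \<in> span (e ` {..<r})"
    and u: "u \<in> span (e ` {..<r})"
  shows "u = (\<Sum>a<r. w a u *\<^sub>R X a)"
proof -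
  have i: "inj_on X {..<r}" "independent (X ` {..<r})"
    using dual_independent[of "{..<r}" w X] lin dual by auto
  have "dim (span (e ` {..<r})) \<le> card (e ` {..<r})"
    using dim_le_card'[of "e ` {..<r}"] by (simp add: dim_span)
  also have "\<dots> \<le> r" using card_image_le[of "{..<r}" e] by simp
  also have "r = card (X ` {..<r})" using i(1) by (simp add: card_image)
  finally have "span (e ` {..<r}) \<subseteq> span (X ` {..<r})"
    using card_ge_dim_independent[OF _ i(2), of "span (e ` {..<r})"] X by auto
  with u have "u \<in> span (X ` {..<r})" by blast
  moreover define L where "L u = (\<Sum>a<r. w a u *\<^sub>R X a)" for u
  have l: "linear L"
    unfolding L_def
    by (rule linearI) (simp_all add: linear_add lin linear_scale scaleR_add_left sum.distrib scaleR_sum_right)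
  ultimately have "L u = u"
  proof (induction rule: span_induct)
    case base
    show ?case
      by (simp add: subspace_def linear_0[OF l] linear_add[OF l] linear_scale[OF l])
  next
    case (step y)
    then obtain b where b: "b < r" "y = X b" by auto
    have "(\<Sum>a<r. w a (X b) *\<^sub>R X a) = (\<Sum>a<r. if a = b then X a else 0)"
      by (rule sum.cong) (use dual b in auto)
    then show ?case using b by (simp add: L_def)
  qed
  then show ?thesis by (simp add: L_def)
qed

text \<open>Premise \<open>closed\<close> is the Frobenius condition in coordinates: the
  differential of each form vanishes on the common kernel of all the forms. The projection onto this
  kernel along the fixed span of the vectors \<open>e b\<close> satisfies the premises of
  \<open>frobenius_core\<close>.\<close>

lemma frobenius_first_integrals:
  fixes w :: "nat \<Rightarrow> 'e::euclidean_space \<Rightarrow> 'e \<Rightarrow> real"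
  assumes U: "open U" "x0 \<in> U"
    and lin: "\<And>a x. a < r \<Longrightarrow> x \<in> U \<Longrightarrow> linear (w a x)"
    and sm: "\<And>a v. a < r \<Longrightarrow> smooth_on U (\<lambda>x. w a x v)"
    and ind: "\<And>c. (\<And>v. (\<Sum>a<r. c a * w a x0 v) = 0) \<Longrightarrow> (\<forall>a<r. c a = 0)"
    and closed: "\<And>x u v c. x \<in> U \<Longrightarrow> c < r \<Longrightarrow> (\<And>a. a < r \<Longrightarrow> w a x u = 0) \<Longrightarrow> (\<And>a. a < r \<Longrightarrow> w a x v = 0) \<Longrightarrow>
      frechet_derivative (\<lambda>y. w c y v) (at x) u = frechet_derivative (\<lambda>y. w c y u) (at x) v"
  obtains U' f where "open U'" "x0 \<in> U'" "U' \<subseteq> U" "\<And>a. a < r \<Longrightarrow> smooth_on U' (f a)"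
    "\<And>a x. a < r \<Longrightarrow> x \<in> U' \<Longrightarrow> \<exists>k. \<forall>v. frechet_derivative (f a) (at x) v = (\<Sum>b<r. k b * w b x v)"
    "\<And>a v. a < r \<Longrightarrow> frechet_derivative (f a) (at x0) v = w a x0 v"
proof -
  have "\<exists>U' e h. open U' \<and> x0 \<in> U' \<and> U' \<subseteq> U \<and>
    (\<forall>a<r. \<forall>b<r. smooth_on U' (h b a)) \<and>
    (\<forall>x\<in>U'. \<forall>a<r. \<forall>c<r. w c x (\<Sum>b<r. h b a x *\<^sub>R e b) = (if a = c then 1 else 0))"
    by (rule dual_frame_ex) (fact U lin sm ind)+
  then obtain U1 e h where U1: "open U1" "x0 \<in> U1" "U1 \<subseteq> U"
    and h0: "\<forall>a<r. \<forall>b<r. smooth_on U1 (h b a)"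
    and dual0: "\<forall>x\<in>U1. \<forall>a<r. \<forall>c<r. w c x (\<Sum>b<r. h b a x *\<^sub>R e b) = (if a = c then 1 else 0)"
    by (elim exE conjE) (rule that)
  have h: "\<And>a b. a < r \<Longrightarrow> b < r \<Longrightarrow> smooth_on U1 (h b a)" using h0 by blast
  define X where "X a x = (\<Sum>b<r. h b a x *\<^sub>R e b)" for a x
  define A where "A x v = v - (\<Sum>a<r. w a x v *\<^sub>R X a x)" for x v
  have lw: "linear (w a x)" if "a < r" "x \<in> U1" for a x using lin[of a x] that U1 by auto
  have sw: "smooth_on U1 (\<lambda>x. w a x v)" if "a < r" for a v
    using smooth_on_subset[OF U1(1,3) U(1) sm[of a v]] that by auto
  have dX: "w c x (X a x) = (if a = c then 1 else 0)" if "x \<in> U1" "a < r" "c < r" for x a c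
    using dual0 that by (simp add: X_def)
  have sX: "smooth_on U1 (X a)" if "a < r" for a
    unfolding X_def using that by (intro smooth_on_sum smooth_on_scaleR smooth_on_const h U1) auto
  have XE: "X a x \<in> span (e ` {..<r})" for a x
    unfolding X_def by (intro span_sum span_scale span_base) auto
  have lA: "linear (A x)" if "x \<in> U1" for x
    unfolding A_def
    by (rule linearI)
      (simp_all add: linear_add[OF lw[OF _ that]] linear_scale[OF lw[OF _ that]] scaleR_add_left sum.distrib scaleR_sum_right scaleR_diff_right)
  have sA: "smooth_on U1 (\<lambda>x. A x v)" for v
    unfolding A_def by (intro smooth_on_diff smooth_on_const smooth_on_sum smooth_on_scaleR sw sX U1) auto
  have AE: "A x u = 0" if "x \<in> U1" "u \<in> span (e ` {..<r})" for x u
    using dual_frame_span[of r "\<lambda>a. w a x" "\<lambda>a. X a x" e u] lw dX XE that by (simp add: A_def)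
  have proj: "A x (A y v) = A x v" if "x \<in> U1" "y \<in> U1" for x y v
  proof -
    have "A x (\<Sum>a<r. w a y v *\<^sub>R X a y) = 0"
      by (rule AE[OF that(1)]) (intro span_sum span_scale XE)
    then show ?thesis unfolding A_def[of y] by (simp add: linear_diff[OF lA[OF that(1)]])
  qed
  have wA: "w c x (A x v) = 0" if "x \<in> U1" "c < r" for x c v
  proof -
    have "(\<Sum>a<r. w a x v * w c x (X a x)) = (\<Sum>a<r. if a = c then w a x v else 0)"
      by (rule sum.cong) (use dX that in auto)
    then show ?thesis
      unfolding A_def using that(2)
      by (simp add: linear_diff[OF lw[OF that(2,1)]] linear_sum[OF lw[OF that(2,1)]] linear_scale[OF lw[OF that(2,1)]])
  qed
  define D where "D a v x = frechet_derivative (\<lambda>y. w a y v) (at x)" for a v x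
  \<comment> \<open>Since \<open>A y v = A y (A x v)\<close>, the vector may be projected first. At
    \<open>x\<close> all forms vanish on the projected vector, so the derivative of the dual frame
    drops out and only derivatives of the forms remain; the symmetry then follows from
    \<open>closed\<close>.\<close>
  have DA: "frechet_derivative (\<lambda>y. A y v) (at x) u = - (\<Sum>a<r. D a (A x v) x u *\<^sub>R X a x)" if x: "x \<in> U1" for x u v
  proof -
    have "((\<lambda>y. A x v - (\<Sum>a<r. w a y (A x v) *\<^sub>R X a y)) has_derivative
      (\<lambda>u. 0 - (\<Sum>a<r. w a x (A x v) *\<^sub>R frechet_derivative (X a) (at x) u + D a (A x v) x u *\<^sub>R X a x))) (at x)"
      unfolding D_def
      by (intro has_derivative_diff has_derivative_const has_derivative_sum has_derivative_scaleR
          smooth_on_has_derivative[OF sX x] smooth_on_has_derivative[OF sw x]) auto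
    then have "((\<lambda>y. A y v) has_derivative
      (\<lambda>u. 0 - (\<Sum>a<r. w a x (A x v) *\<^sub>R frechet_derivative (X a) (at x) u + D a (A x v) x u *\<^sub>R X a x))) (at x)"
    proof (rule has_derivative_transform_within_open[OF _ U1(1) x])
      show "A x v - (\<Sum>a<r. w a y (A x v) *\<^sub>R X a y) = A y v" if "y \<in> U1" for y
        using proj[OF that x, of v] by (simp add: A_def[of y "A x v"])
    qed
    then have "frechet_derivative (\<lambda>y. A y v) (at x) u =
      0 - (\<Sum>a<r. w a x (A x v) *\<^sub>R frechet_derivative (X a) (at x) u + D a (A x v) x u *\<^sub>R X a x)"
      by (rule has_derivative_frechet_eq)
    then show ?thesis using wA[OF x] by simp
  qed
  have sym: "frechet_derivative (\<lambda>y. A y v) (at x) (A x u) = frechet_derivative (\<lambda>y. A y u) (at x) (A x v)"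
    if x: "x \<in> U1" for x u v
  proof -
    have "D a (A x v) x (A x u) = D a (A x u) x (A x v)" if "a < r" for a
      unfolding D_def using x U1 that by (intro closed wA) auto
    then show ?thesis unfolding DA[OF x] by simp
  qed
  show ?thesis
  proof (rule frobenius_core[OF U1(1,2) lA sA proj sym])
  fix \<delta> and F :: "'e \<Rightarrow> 'e"
  assume \<delta>: "\<delta> > 0" "ball x0 \<delta> \<subseteq> U1" and F: "smooth_on (ball x0 \<delta>) F"
    "\<And>c v. c \<in> ball x0 \<delta> \<Longrightarrow> frechet_derivative F (at c) (A c v) = 0"
    "\<And>v. frechet_derivative F (at x0) v = v - A x0 v"
  \<comment> \<open>The derivative of \<open>F\<close> at \<open>x0\<close> is the identity minus
    \<open>A x0\<close>, and \<open>w a x0\<close> vanishes on the image of \<open>A x0\<close>;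
    hence the differential of \<open>f a\<close> at \<open>x0\<close> is
    \<open>w a x0\<close>.\<close>
  define f where "f a x = w a x0 (F x)" for a x
  have bl: "bounded_linear (w a x0)" if "a < r" for a
    using lw[OF that U1(2)] by (simp add: linear_conv_bounded_linear)
  have x0: "x0 \<in> ball x0 \<delta>" using \<delta> by simp
  have sf: "smooth_on (ball x0 \<delta>) (f a)" if "a < r" for a
    unfolding f_def by (rule smooth_on_bounded_linear[OF bl[OF that] open_ball F(1)])
  have Df: "frechet_derivative (f a) (at x) v = w a x0 (frechet_derivative F (at x) v)"
    if "a < r" "x \<in> ball x0 \<delta>" for a x v
  proof -
    have "(f a has_derivative (\<lambda>v. w a x0 (frechet_derivative F (at x) v))) (at x)"
      unfolding f_def by (rule bounded_linear.has_derivative[OF bl[OF that(1)] smooth_on_has_derivative[OF F(1) that(2)]])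
    then show ?thesis by (rule has_derivative_frechet_eq)
  qed
  show ?thesis
  proof (rule that[of "ball x0 \<delta>" f])
    show "ball x0 \<delta> \<subseteq> U" using \<delta> U1 by blast
    fix a assume a: "a < r"
    show "frechet_derivative (f a) (at x0) v = w a x0 v" for v
      using Df[OF a x0, of v] F(3)[of v] wA[OF U1(2) a, of v] linear_diff[OF lw[OF a U1(2)]] by simp
    \<comment> \<open>The differential of \<open>f a\<close> vanishes on the image of
      \<open>A x\<close>, and \<open>v\<close> minus its projection is a combination of the dual
      vectors. The values of the differential on the dual vectors are therefore its
      coefficients.\<close>
    show "\<exists>k. \<forall>v. frechet_derivative (f a) (at x) v = (\<Sum>b<r. k b * w b x v)" if x: "x \<in> ball x0 \<delta>" for x
    proof (intro exI[of _ "\<lambda>b. frechet_derivative (f a) (at x) (X b x)"] allI)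
      fix v
      have l: "linear (frechet_derivative (f a) (at x))" by (rule smooth_on_linear_derivative[OF sf[OF a] x])
      have "frechet_derivative (f a) (at x) (A x v) = 0"
        using Df[OF a x] F(2)[OF x] linear_0[OF lw[OF a U1(2)]] by simp
      then have "frechet_derivative (f a) (at x) v = frechet_derivative (f a) (at x) (\<Sum>b<r. w b x v *\<^sub>R X b x)"
        unfolding A_def by (simp add: linear_diff[OF l])
      then show "frechet_derivative (f a) (at x) v = (\<Sum>b<r. frechet_derivative (f a) (at x) (X b x) * w b x v)"
        by (simp add: linear_sum[OF l] linear_scale[OF l] mult.commute)
    qed
  qed (use x0 sf in auto)
  qed
qed


section \<open>Forms on manifolds\<close>

lemma sum_fun_apply: "(\<Sum>i\<in>I. f i) x = (\<Sum>i\<in>I. f i x)"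
  for f :: "'i \<Rightarrow> 'a \<Rightarrow> 'b::comm_monoid_add"
  by (induction I rule: infinite_finite_induct) auto

lemma scaleR_fun_apply [simp]: "(r *\<^sub>R f) x = r *\<^sub>R f x" for f :: "'a \<Rightarrow> 'b::real_vector"
  by (simp add: scaleR_fun_def)

definition dform :: "('m, 'e::euclidean_space) manifold \<Rightarrow> ('m \<Rightarrow> real) \<Rightarrow> ('m, 'e) form1" where
  "dform M f p = (\<lambda>\<kappa> u. if \<kappa> \<in> charts_at M p then
     frechet_derivative (\<lambda>x. f (chart_inv \<kappa> x)) (at (map_of_chart \<kappa> p)) u else 0)"

locale smooth_mfd =
  fixes M :: "('m, 'e::euclidean_space) manifold"
  assumes smooth_manifold: "smooth_manifold M"
begin

lemma hausdorff: "Hausdorff_space (mtop M)"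
  using smooth_manifold by (simp add: smooth_manifold_def)

lemma
  assumes "\<kappa> \<in> atlas M"
  shows openin_dom: "openin (mtop M) (dom_of \<kappa>)"
    and open_chart_image: "open (map_of_chart \<kappa> ` dom_of \<kappa>)"
    and homeo: "homeomorphic_map (subtopology (mtop M) (dom_of \<kappa>))
          (top_of_set (map_of_chart \<kappa> ` dom_of \<kappa>)) (map_of_chart \<kappa>)"
  using assms smooth_manifold by (auto simp: smooth_manifold_def)

lemma chart_cover: "p \<in> points M \<Longrightarrow> \<exists>\<kappa>. \<kappa> \<in> charts_at M p"
proof -
  assume "p \<in> points M"
  then have "p \<in> (\<Union>\<kappa>\<in>atlas M. dom_of \<kappa>)" using smooth_manifold by (simp only: smooth_manifold_def)
  then show ?thesis unfolding charts_at_def by blast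
qed

lemma dom_subset: "\<kappa> \<in> atlas M \<Longrightarrow> dom_of \<kappa> \<subseteq> points M"
  using openin_dom openin_subset by blast

lemma inj_chart: "\<kappa> \<in> atlas M \<Longrightarrow> inj_on (map_of_chart \<kappa>) (dom_of \<kappa>)"
  using homeomorphic_imp_injective_map[OF homeo] dom_subset
  by (simp add: Int_absorb1)

lemma chart_inv_map [simp]: "\<kappa> \<in> atlas M \<Longrightarrow> p \<in> dom_of \<kappa> \<Longrightarrow> chart_inv \<kappa> (map_of_chart \<kappa> p) = p"
  by (simp add: chart_inv_def inv_into_f_f inj_chart)

lemma chart_inv_image: "\<kappa> \<in> atlas M \<Longrightarrow> W \<subseteq> dom_of \<kappa> \<Longrightarrow> x \<in> map_of_chart \<kappa> ` W \<Longrightarrow>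
    chart_inv \<kappa> x \<in> W \<and> map_of_chart \<kappa> (chart_inv \<kappa> x) = x"
  by (auto dest: subsetD)

lemma open_image:
  assumes "\<kappa> \<in> atlas M" "openin (mtop M) W"
  shows "open (map_of_chart \<kappa> ` (dom_of \<kappa> \<inter> W))"
proof -
  have "openin (subtopology (mtop M) (dom_of \<kappa>)) (dom_of \<kappa> \<inter> W)"
    using assms(2) by (rule openin_subtopology_Int2)
  then have "openin (top_of_set (map_of_chart \<kappa> ` dom_of \<kappa>)) (map_of_chart \<kappa> ` (dom_of \<kappa> \<inter> W))"
    using homeomorphic_imp_open_map[OF homeo[OF assms(1)]] by (simp add: open_map_def)
  then show ?thesis using open_chart_image[OF assms(1)] openin_open_trans by blast
qed

lemma openin_preimage:
  assumes "\<kappa> \<in> atlas M" "open S"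
  shows "openin (mtop M) {p \<in> dom_of \<kappa>. map_of_chart \<kappa> p \<in> S}"
proof -
  have c: "continuous_map (subtopology (mtop M) (dom_of \<kappa>)) (top_of_set (map_of_chart \<kappa> ` dom_of \<kappa>)) (map_of_chart \<kappa>)"
    by (rule homeomorphic_imp_continuous_map[OF homeo[OF assms(1)]])
  have "openin (top_of_set (map_of_chart \<kappa> ` dom_of \<kappa>)) (map_of_chart \<kappa> ` dom_of \<kappa> \<inter> S)"
    using assms(2) by (rule openin_open_Int)
  from openin_continuous_map_preimage[OF c this]
  have "openin (subtopology (mtop M) (dom_of \<kappa>)) {p \<in> dom_of \<kappa>. map_of_chart \<kappa> p \<in> S}"
    using dom_subset[OF assms(1)] by (simp add: Int_absorb1 conj_commute cong: conj_cong)
  then show ?thesis using openin_dom[OF assms(1)] openin_trans_full by blast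
qed

lemma transition_eq:
  "\<kappa> \<in> atlas M \<Longrightarrow> p \<in> dom_of \<kappa> \<Longrightarrow> transition \<kappa> \<kappa>' (map_of_chart \<kappa> p) = map_of_chart \<kappa>' p"
  by (simp add: transition_def)

lemma smooth_transition:
  assumes "\<kappa> \<in> atlas M" "\<kappa>' \<in> atlas M"
  shows "smooth_on (map_of_chart \<kappa> ` (dom_of \<kappa> \<inter> dom_of \<kappa>')) (transition \<kappa> \<kappa>')"
  using assms smooth_manifold by (simp add: smooth_manifold_def)

lemma smooth_funD: "smooth_fun M W f \<Longrightarrow> \<kappa> \<in> atlas M \<Longrightarrow>
    smooth_on (map_of_chart \<kappa> ` (dom_of \<kappa> \<inter> W)) (\<lambda>x. f (chart_inv \<kappa> x))"
  by (simp add: smooth_fun_def)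

text \<open>One chart covering \<open>W\<close> suffices, because every other chart differs from it
  by a smooth change of coordinates.\<close>

lemma smooth_fun_chart:
  assumes "\<kappa>0 \<in> atlas M" "openin (mtop M) W" "W \<subseteq> dom_of \<kappa>0"
    and "smooth_on (map_of_chart \<kappa>0 ` W) (\<lambda>x. f (chart_inv \<kappa>0 x))"
  shows "smooth_fun M W f"
  unfolding smooth_fun_def
proof
  fix \<kappa> assume \<kappa>: "\<kappa> \<in> atlas M"
  let ?S = "map_of_chart \<kappa> ` (dom_of \<kappa> \<inter> W)"
  have W0: "dom_of \<kappa>0 \<inter> W = W" using assms(3) by auto
  have oS: "open ?S" by (rule open_image[OF \<kappa> assms(2)])
  have oW: "open (map_of_chart \<kappa>0 ` W)" using open_image[OF assms(1,2)] W0 by simp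
  have "smooth_on ?S (\<lambda>x. f (chart_inv \<kappa>0 (transition \<kappa> \<kappa>0 x)))"
  proof (rule smooth_on_compose[OF oS oW _ _ assms(4)])
    show "transition \<kappa> \<kappa>0 ` ?S \<subseteq> map_of_chart \<kappa>0 ` W"
      using \<kappa> by (auto simp: transition_eq)
    show "smooth_on ?S (transition \<kappa> \<kappa>0)"
      by (rule smooth_on_subset[OF oS _ open_image[OF \<kappa> openin_dom[OF assms(1)]] smooth_transition[OF \<kappa> assms(1)]])
        (use assms(3) in auto)
  qed
  then show "smooth_on ?S (\<lambda>x. f (chart_inv \<kappa> x))"
    by (rule smooth_on_cong[OF oS, rotated]) (use \<kappa> assms(1,3) in \<open>auto simp: transition_eq subset_iff\<close>)
qed

lemma smooth_fun_subset:
  assumes "smooth_fun M W f" "openin (mtop M) W" "openin (mtop M) W'" "W' \<subseteq> W"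
  shows "smooth_fun M W' f"
  unfolding smooth_fun_def
proof
  fix \<kappa> assume \<kappa>: "\<kappa> \<in> atlas M"
  show "smooth_on (map_of_chart \<kappa> ` (dom_of \<kappa> \<inter> W')) (\<lambda>x. f (chart_inv \<kappa> x))"
    by (rule smooth_on_subset[OF open_image[OF \<kappa> assms(3)] _ open_image[OF \<kappa> assms(2)] smooth_funD[OF assms(1) \<kappa>]])
      (use assms(4) in auto)
qed

lemma smooth_fun_cong:
  assumes "openin (mtop M) W" "\<And>p. p \<in> W \<Longrightarrow> f p = g p" "smooth_fun M W f"
  shows "smooth_fun M W g"
  unfolding smooth_fun_def
proof
  fix \<kappa> assume \<kappa>: "\<kappa> \<in> atlas M"
  show "smooth_on (map_of_chart \<kappa> ` (dom_of \<kappa> \<inter> W)) (\<lambda>x. g (chart_inv \<kappa> x))"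
    by (rule smooth_on_cong[OF open_image[OF \<kappa> assms(1)] _ smooth_funD[OF assms(3) \<kappa>]])
      (use \<kappa> assms(2) in auto)
qed

lemma smooth_fun_local:
  assumes "\<And>p. p \<in> W \<Longrightarrow> \<exists>N. openin (mtop M) N \<and> p \<in> N \<and> smooth_fun M N f"
  shows "smooth_fun M W f"
  unfolding smooth_fun_def
proof
  fix \<kappa> assume \<kappa>: "\<kappa> \<in> atlas M"
  show "smooth_on (map_of_chart \<kappa> ` (dom_of \<kappa> \<inter> W)) (\<lambda>x. f (chart_inv \<kappa> x))"
  proof (rule smooth_on_local)
    fix x assume "x \<in> map_of_chart \<kappa> ` (dom_of \<kappa> \<inter> W)"
    then obtain p where p: "x = map_of_chart \<kappa> p" "p \<in> dom_of \<kappa>" "p \<in> W" by auto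
    obtain N where N: "openin (mtop M) N" "p \<in> N" "smooth_fun M N f" using assms[OF p(3)] by blast
    show "\<exists>N. open N \<and> x \<in> N \<and> smooth_on N (\<lambda>x. f (chart_inv \<kappa> x))"
      by (intro exI[of _ "map_of_chart \<kappa> ` (dom_of \<kappa> \<inter> N)"] conjI open_image[OF \<kappa> N(1)] smooth_funD[OF N(3) \<kappa>])
        (use p N in auto)
  qed
qed

lemma smooth_fun_const: "openin (mtop M) W \<Longrightarrow> smooth_fun M W (\<lambda>p. c)"
  by (auto simp: smooth_fun_def intro!: smooth_on_const open_image)

lemma smooth_fun_mult: "openin (mtop M) W \<Longrightarrow> smooth_fun M W f \<Longrightarrow> smooth_fun M W g \<Longrightarrow> smooth_fun M W (\<lambda>p. f p * g p)"
  by (auto simp: smooth_fun_def intro!: smooth_on_mult open_image)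

lemma smooth_fun_minus: "openin (mtop M) W \<Longrightarrow> smooth_fun M W f \<Longrightarrow> smooth_fun M W (\<lambda>p. - f p)"
  by (auto simp: smooth_fun_def intro!: smooth_on_minus open_image)

lemma smooth_fun_sum: "openin (mtop M) W \<Longrightarrow> (\<And>i. i \<in> I \<Longrightarrow> smooth_fun M W (f i)) \<Longrightarrow> smooth_fun M W (\<lambda>p. \<Sum>i\<in>I. f i p)"
  by (auto simp: smooth_fun_def intro!: smooth_on_sum open_image)

section \<open>Covectors and smooth sections\<close>

lemma charts_atD: "\<kappa> \<in> charts_at M p \<Longrightarrow> \<kappa> \<in> atlas M \<and> p \<in> dom_of \<kappa>"
  by (simp add: charts_at_def)

lemma cotangent_linear: "\<xi> \<in> cotangent_space M p \<Longrightarrow> \<kappa> \<in> charts_at M p \<Longrightarrow> linear (\<xi> \<kappa>)"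
  unfolding cotangent_space_def mem_Collect_eq by blast

lemma cotangent_transform:
  "\<xi> \<in> cotangent_space M p \<Longrightarrow> \<kappa> \<in> charts_at M p \<Longrightarrow> \<kappa>' \<in> charts_at M p \<Longrightarrow>
    \<xi> \<kappa> v = \<xi> \<kappa>' (frechet_derivative (transition \<kappa> \<kappa>') (at (map_of_chart \<kappa> p)) v)"
  unfolding cotangent_space_def mem_Collect_eq by blast

lemma cotangent_outside: "\<xi> \<in> cotangent_space M p \<Longrightarrow> \<kappa> \<notin> charts_at M p \<Longrightarrow> \<xi> \<kappa> = 0"
  unfolding cotangent_space_def mem_Collect_eq by blast

lemma cotangentI:
  assumes "\<And>\<kappa>. \<kappa> \<in> charts_at M p \<Longrightarrow> linear (\<xi> \<kappa>)"
    "\<And>\<kappa> \<kappa>' v. \<kappa> \<in> charts_at M p \<Longrightarrow> \<kappa>' \<in> charts_at M p \<Longrightarrow>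
      \<xi> \<kappa> v = \<xi> \<kappa>' (frechet_derivative (transition \<kappa> \<kappa>') (at (map_of_chart \<kappa> p)) v)"
    "\<And>\<kappa>. \<kappa> \<notin> charts_at M p \<Longrightarrow> \<xi> \<kappa> = 0"
  shows "\<xi> \<in> cotangent_space M p"
  unfolding cotangent_space_def mem_Collect_eq
  by (intro conjI ballI allI impI) (rule assms; assumption)+

lemma subspace_cotangent: "subspace (cotangent_space M p)"
proof (rule subspaceI)
  show "0 \<in> cotangent_space M p"
    by (rule cotangentI) (simp_all add: linear_iff)
  fix \<xi> \<zeta> :: "('m, 'e) covector" and r :: real
  assume \<xi>: "\<xi> \<in> cotangent_space M p"
  have r: "(r *\<^sub>R \<xi>) \<kappa> = (\<lambda>v. r * \<xi> \<kappa> v)" for \<kappa> by (simp add: fun_eq_iff)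
  show "r *\<^sub>R \<xi> \<in> cotangent_space M p"
  proof (rule cotangentI)
    show "linear ((r *\<^sub>R \<xi>) \<kappa>)" if "\<kappa> \<in> charts_at M p" for \<kappa>
      unfolding r using linear_compose_scale_right[OF cotangent_linear[OF \<xi> that], of r] by simp
    show "(r *\<^sub>R \<xi>) \<kappa> v = (r *\<^sub>R \<xi>) \<kappa>' (frechet_derivative (transition \<kappa> \<kappa>') (at (map_of_chart \<kappa> p)) v)"
      if "\<kappa> \<in> charts_at M p" "\<kappa>' \<in> charts_at M p" for \<kappa> \<kappa>' v
      unfolding r by (subst cotangent_transform[OF \<xi> that]) (rule refl)
  qed (simp add: cotangent_outside[OF \<xi>] r fun_eq_iff)
  assume \<zeta>: "\<zeta> \<in> cotangent_space M p"
  have a: "(\<xi> + \<zeta>) \<kappa> = (\<lambda>v. \<xi> \<kappa> v + \<zeta> \<kappa> v)" for \<kappa> by (simp add: fun_eq_iff)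
  show "\<xi> + \<zeta> \<in> cotangent_space M p"
  proof (rule cotangentI)
    show "linear ((\<xi> + \<zeta>) \<kappa>)" if "\<kappa> \<in> charts_at M p" for \<kappa>
      unfolding a by (rule linear_compose_add[OF cotangent_linear[OF \<xi> that] cotangent_linear[OF \<zeta> that]])
    show "(\<xi> + \<zeta>) \<kappa> v = (\<xi> + \<zeta>) \<kappa>' (frechet_derivative (transition \<kappa> \<kappa>') (at (map_of_chart \<kappa> p)) v)"
      if "\<kappa> \<in> charts_at M p" "\<kappa>' \<in> charts_at M p" for \<kappa> \<kappa>' v
      unfolding a
      by (subst cotangent_transform[OF \<xi> that], subst cotangent_transform[OF \<zeta> that]) (rule refl)
  qed (simp add: cotangent_outside[OF \<xi>] cotangent_outside[OF \<zeta>] a fun_eq_iff)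
qed

text \<open>The transformation law determines a covector by its representation in a single chart, so
  identities may be checked there.\<close>

lemma cotangent_eqI:
  assumes "\<xi> \<in> cotangent_space M p" "\<zeta> \<in> cotangent_space M p" "\<kappa> \<in> charts_at M p" "\<And>v. \<xi> \<kappa> v = \<zeta> \<kappa> v"
  shows "\<xi> = \<zeta>"
proof (intro ext)
  fix \<kappa>' v
  show "\<xi> \<kappa>' v = \<zeta> \<kappa>' v"
  proof (cases "\<kappa>' \<in> charts_at M p")
    case True
    show ?thesis
      unfolding cotangent_transform[OF assms(1) True assms(3)] cotangent_transform[OF assms(2) True assms(3)]
      by (rule assms(4))
  next
    case False
    then show ?thesis using cotangent_outside assms by metis
  qed
qed

lemma Omega1_iff: "\<omega> \<in> Omega1 M W V \<longleftrightarrow> (\<forall>p\<in>W. \<omega> p \<in> cotangent_space M p \<and> \<omega> p \<in> V p) \<and>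
     (\<forall>\<kappa>\<in>atlas M. \<forall>u. smooth_fun M (W \<inter> dom_of \<kappa>) (\<lambda>p. \<omega> p \<kappa> u))"
  by (simp add: Omega1_def)

lemma Omega1_mono: "\<omega> \<in> Omega1 M W V \<Longrightarrow> (\<And>p. p \<in> W \<Longrightarrow> \<omega> p \<in> V' p) \<Longrightarrow> \<omega> \<in> Omega1 M W V'"
  by (simp add: Omega1_iff)

lemma Omega1_cotangent: "\<omega> \<in> Omega1 M W V \<Longrightarrow> \<omega> \<in> Omega1 M W (cotangent_space M)"
  by (simp add: Omega1_iff)

lemma Omega1_subset:
  assumes "\<omega> \<in> Omega1 M W V" "openin (mtop M) W" "openin (mtop M) W'" "W' \<subseteq> W"
  shows "\<omega> \<in> Omega1 M W' V"
proof -
  have "smooth_fun M (W' \<inter> dom_of \<kappa>) (\<lambda>p. \<omega> p \<kappa> u)" if \<kappa>: "\<kappa> \<in> atlas M" for \<kappa> u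
  proof (rule smooth_fun_subset[of "W \<inter> dom_of \<kappa>"])
    show "smooth_fun M (W \<inter> dom_of \<kappa>) (\<lambda>p. \<omega> p \<kappa> u)" using assms(1) \<kappa> by (simp add: Omega1_iff)
  qed (use assms openin_dom[OF \<kappa>] in auto)
  with assms show ?thesis by (auto simp: Omega1_iff)
qed

lemma Omega1_comb:
  assumes W: "openin (mtop M) W" and \<omega>: "\<And>i. i \<in> I \<Longrightarrow> \<omega> i \<in> Omega1 M W V"
    and c: "\<And>i. i \<in> I \<Longrightarrow> smooth_fun M W (c i)"
    and V: "\<And>p. p \<in> W \<Longrightarrow> subspace (V p)"
  shows "(\<lambda>p. \<Sum>i\<in>I. c i p *\<^sub>R \<omega> i p) \<in> Omega1 M W V"
proof -
  have "(\<Sum>i\<in>I. c i p *\<^sub>R \<omega> i p) \<in> cotangent_space M p \<and> (\<Sum>i\<in>I. c i p *\<^sub>R \<omega> i p) \<in> V p" if p: "p \<in> W" for p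
    using \<omega> p V[OF p] subspace_cotangent
    by (auto simp: Omega1_iff intro!: subspace_sum subspace_scale)
  moreover have "smooth_fun M (W \<inter> dom_of \<kappa>) (\<lambda>p. (\<Sum>i\<in>I. c i p *\<^sub>R \<omega> i p) \<kappa> u)" if \<kappa>: "\<kappa> \<in> atlas M" for \<kappa> u
  proof -
    have o: "openin (mtop M) (W \<inter> dom_of \<kappa>)" using W openin_dom[OF \<kappa>] by (rule openin_Int)
    have "smooth_fun M (W \<inter> dom_of \<kappa>) (\<lambda>p. \<Sum>i\<in>I. c i p * \<omega> i p \<kappa> u)"
      using \<omega> \<kappa> smooth_fun_subset[OF c W o]
      by (intro smooth_fun_sum smooth_fun_mult o) (auto simp: Omega1_iff)
    then show ?thesis by (simp add: sum_fun_apply)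
  qed
  ultimately show ?thesis by (simp add: Omega1_iff)
qed

lemma Omega1_scale:
  assumes W: "openin (mtop M) W" and "\<omega> \<in> Omega1 M W V" "smooth_fun M W c"
    and V: "\<And>p. p \<in> W \<Longrightarrow> subspace (V p)"
  shows "(\<lambda>p. c p *\<^sub>R \<omega> p) \<in> Omega1 M W V"
  using Omega1_comb[OF W, of "{()}" "\<lambda>_. \<omega>" V "\<lambda>_. c"] assms by simp

lemma Omega1_chart_smooth:
  assumes "\<omega> \<in> Omega1 M W V" "\<kappa> \<in> atlas M"
  shows "smooth_on (map_of_chart \<kappa> ` (dom_of \<kappa> \<inter> W)) (\<lambda>x. \<omega> (chart_inv \<kappa> x) \<kappa> u)"
proof -
  have "smooth_on (map_of_chart \<kappa> ` (dom_of \<kappa> \<inter> (W \<inter> dom_of \<kappa>))) (\<lambda>x. \<omega> (chart_inv \<kappa> x) \<kappa> u)"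
    using assms by (intro smooth_funD) (auto simp: Omega1_iff)
  moreover have "dom_of \<kappa> \<inter> (W \<inter> dom_of \<kappa>) = dom_of \<kappa> \<inter> W" by auto
  ultimately show ?thesis by simp
qed

section \<open>Exact forms and the exterior derivative\<close>

lemma dform_chart:
  "\<kappa> \<in> charts_at M p \<Longrightarrow> dform M f p \<kappa> u = frechet_derivative (\<lambda>x. f (chart_inv \<kappa> x)) (at (map_of_chart \<kappa> p)) u"
  by (simp add: dform_def)

text \<open>The transformation law of covectors is here the chain rule for the change of
  coordinates.\<close>

lemma dform_Omega1:
  assumes W: "openin (mtop M) W" and f: "smooth_fun M W f"
  shows "dform M f \<in> Omega1 M W (cotangent_space M)"
proof -
  have "dform M f p \<in> cotangent_space M p" if p: "p \<in> W" for p
  proof (rule cotangentI)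
    fix \<kappa> assume \<kappa>: "\<kappa> \<in> charts_at M p"
    then have a: "\<kappa> \<in> atlas M" "p \<in> dom_of \<kappa>" by (auto dest: charts_atD)
    have "linear (frechet_derivative (\<lambda>x. f (chart_inv \<kappa> x)) (at (map_of_chart \<kappa> p)))"
      by (rule smooth_on_linear_derivative[OF smooth_funD[OF f a(1)]]) (use a p in auto)
    then show "linear (dform M f p \<kappa>)" using \<kappa> by (simp add: dform_def)
    fix \<kappa>' v assume \<kappa>': "\<kappa>' \<in> charts_at M p"
    then have a': "\<kappa>' \<in> atlas M" "p \<in> dom_of \<kappa>'" by (auto dest: charts_atD)
    let ?x = "map_of_chart \<kappa> p"
    have 1: "(transition \<kappa> \<kappa>' has_derivative frechet_derivative (transition \<kappa> \<kappa>') (at ?x)) (at ?x)"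
      by (rule smooth_on_has_derivative[OF smooth_transition[OF a(1) a'(1)]]) (use a a' in auto)
    have 2: "((\<lambda>x. f (chart_inv \<kappa>' x)) has_derivative frechet_derivative (\<lambda>x. f (chart_inv \<kappa>' x)) (at (map_of_chart \<kappa>' p)))
        (at (transition \<kappa> \<kappa>' ?x))"
      unfolding transition_eq[OF a] by (rule smooth_on_has_derivative[OF smooth_funD[OF f a'(1)]]) (use a' p in auto)
    have "((\<lambda>x. f (chart_inv \<kappa>' (transition \<kappa> \<kappa>' x))) has_derivative
      (\<lambda>v. frechet_derivative (\<lambda>x. f (chart_inv \<kappa>' x)) (at (map_of_chart \<kappa>' p)) (frechet_derivative (transition \<kappa> \<kappa>') (at ?x) v))) (at ?x)"
      by (rule has_derivative_compose[OF 1 2])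
    then have "((\<lambda>x. f (chart_inv \<kappa> x)) has_derivative
      (\<lambda>v. frechet_derivative (\<lambda>x. f (chart_inv \<kappa>' x)) (at (map_of_chart \<kappa>' p)) (frechet_derivative (transition \<kappa> \<kappa>') (at ?x) v))) (at ?x)"
    proof (rule has_derivative_transform_within_open)
      show "open (map_of_chart \<kappa> ` (dom_of \<kappa> \<inter> dom_of \<kappa>'))" by (rule open_image[OF a(1) openin_dom[OF a'(1)]])
    qed (use a a' in \<open>auto simp: transition_eq\<close>)
    from has_derivative_frechet_eq[OF this]
    show "dform M f p \<kappa> v = dform M f p \<kappa>' (frechet_derivative (transition \<kappa> \<kappa>') (at ?x) v)"
      using \<kappa> \<kappa>' by (simp add: dform_def)
  qed (auto simp: dform_def fun_eq_iff)
  moreover have "smooth_fun M (W \<inter> dom_of \<kappa>) (\<lambda>p. dform M f p \<kappa> u)" if \<kappa>: "\<kappa> \<in> atlas M" for \<kappa> u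
  proof (rule smooth_fun_chart[OF \<kappa>])
    show o: "openin (mtop M) (W \<inter> dom_of \<kappa>)" using W openin_dom[OF \<kappa>] by (rule openin_Int)
    have e: "W \<inter> dom_of \<kappa> = dom_of \<kappa> \<inter> W" by auto
    show "smooth_on (map_of_chart \<kappa> ` (W \<inter> dom_of \<kappa>)) (\<lambda>x. dform M f (chart_inv \<kappa> x) \<kappa> u)"
      unfolding e
      by (rule smooth_on_cong[OF open_image[OF \<kappa> W] _ smooth_on_derivative[OF smooth_funD[OF f \<kappa>], of u]])
        (use \<kappa> in \<open>auto simp: dform_def charts_at_def\<close>)
  qed auto
  ultimately show ?thesis by (simp add: Omega1_iff)
qed

lemma ext_d_chart:
  "\<kappa> \<in> charts_at M p \<Longrightarrow> ext_d M \<omega> p \<kappa> u v =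
     frechet_derivative (\<lambda>x. \<omega> (chart_inv \<kappa> x) \<kappa> v) (at (map_of_chart \<kappa> p)) u
     - frechet_derivative (\<lambda>x. \<omega> (chart_inv \<kappa> x) \<kappa> u) (at (map_of_chart \<kappa> p)) v"
  by (simp add: ext_d_def)

text \<open>In each chart this is the symmetry of second derivatives.\<close>

lemma ext_d_dform:
  assumes W: "openin (mtop M) W" and f: "smooth_fun M W f" and p: "p \<in> W"
  shows "ext_d M (dform M f) p = 0"
proof (intro ext)
  fix \<kappa> u v
  show "ext_d M (dform M f) p \<kappa> u v = 0 \<kappa> u v"
  proof (cases "\<kappa> \<in> charts_at M p")
    case True
    then have a: "\<kappa> \<in> atlas M" "p \<in> dom_of \<kappa>" by (auto dest: charts_atD)
    let ?x = "map_of_chart \<kappa> p" and ?S = "map_of_chart \<kappa> ` (dom_of \<kappa> \<inter> W)" and ?g = "\<lambda>x. f (chart_inv \<kappa> x)"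
    have S: "open ?S" "?x \<in> ?S" "smooth_on ?S ?g" using open_image[OF a(1) W] a p smooth_funD[OF f a(1)] by auto
    have "frechet_derivative (\<lambda>x. dform M f (chart_inv \<kappa> x) \<kappa> v) (at ?x) u =
      frechet_derivative (\<lambda>x. frechet_derivative ?g (at x) v) (at ?x) u" for u v
    proof (rule has_derivative_frechet_eq, rule has_derivative_transform_within_open[OF _ S(1,2)])
      show "((\<lambda>x. frechet_derivative ?g (at x) v) has_derivative frechet_derivative (\<lambda>x. frechet_derivative ?g (at x) v) (at ?x)) (at ?x)"
        by (rule smooth_on_has_derivative[OF smooth_on_derivative[OF S(3)] S(2)])
    qed (use a in \<open>auto simp: dform_def charts_at_def\<close>)
    then show ?thesis
      using mixed_partials_commute[OF S(1,3,2), of u v] True by (simp add: ext_d_chart)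
  qed (simp add: ext_d_def)
qed

lemma ext_d_cong:
  assumes W: "openin (mtop M) W" and p: "p \<in> W" and eq: "\<And>q. q \<in> W \<Longrightarrow> \<omega> q = \<omega>' q"
    and \<omega>: "\<omega> \<in> Omega1 M W V"
  shows "ext_d M \<omega> p = ext_d M \<omega>' p"
proof (intro ext)
  fix \<kappa> u v
  show "ext_d M \<omega> p \<kappa> u v = ext_d M \<omega>' p \<kappa> u v"
  proof (cases "\<kappa> \<in> charts_at M p")
    case True
    then have a: "\<kappa> \<in> atlas M" "p \<in> dom_of \<kappa>" by (auto dest: charts_atD)
    let ?x = "map_of_chart \<kappa> p" and ?S = "map_of_chart \<kappa> ` (dom_of \<kappa> \<inter> W)"
    have S: "open ?S" "?x \<in> ?S" using open_image[OF a(1) W] a p by auto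
    have "frechet_derivative (\<lambda>x. \<omega>' (chart_inv \<kappa> x) \<kappa> v) (at ?x) u =
      frechet_derivative (\<lambda>x. \<omega> (chart_inv \<kappa> x) \<kappa> v) (at ?x) u" for u v
      by (rule has_derivative_frechet_eq, rule has_derivative_transform_within_open[OF
            smooth_on_has_derivative[OF Omega1_chart_smooth[OF \<omega> a(1)] S(2)] S])
        (use a eq in auto)
    then show ?thesis using True by (simp add: ext_d_chart)
  qed (simp add: ext_d_def)
qed

lemma ext_d_comb:
  assumes W: "openin (mtop M) W" and p: "p \<in> W" and \<omega>: "\<And>i. i \<in> I \<Longrightarrow> \<omega> i \<in> Omega1 M W V"
    and c: "\<And>i. i \<in> I \<Longrightarrow> smooth_fun M W (c i)"
  shows "ext_d M (\<lambda>p. \<Sum>i\<in>I. c i p *\<^sub>R \<omega> i p) p = (\<Sum>i\<in>I. dform M (c i) p \<and>\<^sub>w \<omega> i p + c i p *\<^sub>R ext_d M (\<omega> i) p)"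
proof (intro ext)
  fix \<kappa> u v
  show "ext_d M (\<lambda>p. \<Sum>i\<in>I. c i p *\<^sub>R \<omega> i p) p \<kappa> u v = (\<Sum>i\<in>I. dform M (c i) p \<and>\<^sub>w \<omega> i p + c i p *\<^sub>R ext_d M (\<omega> i) p) \<kappa> u v"
  proof (cases "\<kappa> \<in> charts_at M p")
    case True
    then have a: "\<kappa> \<in> atlas M" "p \<in> dom_of \<kappa>" by (auto dest: charts_atD)
    let ?x = "map_of_chart \<kappa> p" and ?S = "map_of_chart \<kappa> ` (dom_of \<kappa> \<inter> W)"
    have S: "open ?S" "?x \<in> ?S" using open_image[OF a(1) W] a p by auto
    have "frechet_derivative (\<lambda>x. (\<Sum>i\<in>I. c i (chart_inv \<kappa> x) *\<^sub>R \<omega> i (chart_inv \<kappa> x)) \<kappa> v) (at ?x) u =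
      (\<Sum>i\<in>I. c i p * frechet_derivative (\<lambda>x. \<omega> i (chart_inv \<kappa> x) \<kappa> v) (at ?x) u +
        dform M (c i) p \<kappa> u * \<omega> i p \<kappa> v)" for u v
    proof -
      have "((\<lambda>x. \<Sum>i\<in>I. c i (chart_inv \<kappa> x) * \<omega> i (chart_inv \<kappa> x) \<kappa> v) has_derivative
        (\<lambda>u. \<Sum>i\<in>I. c i (chart_inv \<kappa> ?x) * frechet_derivative (\<lambda>x. \<omega> i (chart_inv \<kappa> x) \<kappa> v) (at ?x) u +
          frechet_derivative (\<lambda>x. c i (chart_inv \<kappa> x)) (at ?x) u * \<omega> i (chart_inv \<kappa> ?x) \<kappa> v)) (at ?x)"
        by (intro has_derivative_sum has_derivative_mult smooth_on_has_derivative[OF _ S(2)]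
            Omega1_chart_smooth[OF \<omega> a(1)] smooth_funD[OF c a(1)])
      from has_derivative_frechet_eq[OF this, of u] show ?thesis
        using a True by (simp add: sum_fun_apply dform_chart)
    qed
    then show ?thesis using True
      by (simp add: ext_d_chart sum_fun_apply wedge_def sum_subtractf[symmetric] algebra_simps)
  next
    case False
    then have "dform M (c i) p \<kappa> = (\<lambda>u. 0)" for i by (simp add: dform_def)
    with False show ?thesis by (simp add: ext_d_def sum_fun_apply wedge_def)
  qed
qed

lemma ext_d_scale:
  assumes W: "openin (mtop M) W" "p \<in> W" and "\<omega> \<in> Omega1 M W V" "smooth_fun M W c"
  shows "ext_d M (\<lambda>p. c p *\<^sub>R \<omega> p) p = dform M c p \<and>\<^sub>w \<omega> p + c p *\<^sub>R ext_d M \<omega> p"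
  using ext_d_comb[OF W, of "{()}" "\<lambda>_. \<omega>" V "\<lambda>_. c"] assms by simp

end


section \<open>Bases, cut-offs and dual fields\<close>

text \<open>Covectors are families of functions over all charts, and their type as a whole has
  infinite dimension; rank is therefore witnessed by a finite basis.\<close>

definition has_rank :: "nat \<Rightarrow> 'v::real_vector set \<Rightarrow> bool" where
  "has_rank r S \<longleftrightarrow> (\<exists>B. finite B \<and> independent B \<and> card B = r \<and> span B = S)"

definition basis_list :: "'v::real_vector list \<Rightarrow> 'v set \<Rightarrow> bool" where
  "basis_list xs S \<longleftrightarrow> distinct xs \<and> independent (set xs) \<and> span (set xs) = S"

lemma has_rank_subspace: "has_rank r S \<Longrightarrow> subspace S"
  by (auto simp: has_rank_def)

lemma basis_list_has_rank: "basis_list xs S \<Longrightarrow> has_rank (length xs) S"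
  unfolding has_rank_def basis_list_def by (metis List.finite_set distinct_card)

lemma has_rank_unique: "has_rank r S \<Longrightarrow> has_rank s S \<Longrightarrow> r = s"
  unfolding has_rank_def by (metis independent_span_bound le_antisym span_superset)

lemma basis_list_length: "basis_list xs S \<Longrightarrow> has_rank r S \<Longrightarrow> length xs = r"
  using basis_list_has_rank has_rank_unique by blast

lemma independent_spans:
  assumes "finite B" "independent C" "C \<subseteq> span B" "card B \<le> card C"
  shows "span C = span B"
proof
  show "span C \<subseteq> span B" using assms(3) by (simp add: span_minimal)
  show "span B \<subseteq> span C"
  proof (rule ccontr)
    assume "\<not> ?thesis"
    then obtain x where x: "x \<in> span B" "x \<notin> span C" by blast
    have "finite (insert x C) \<and> card (insert x C) \<le> card B"
      using x assms by (intro independent_span_bound independent_insertI) auto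
    moreover have "x \<notin> C" using x(2) span_base by blast
    ultimately show False using assms(4) by auto
  qed
qed

lemma basis_listI_independent:
  assumes "distinct xs" "independent (set xs)" "set xs \<subseteq> S" "has_rank (length xs) S"
  shows "basis_list xs S"
proof -
  obtain B where B: "finite B" "card B = length xs" "span B = S" using assms(4) by (auto simp: has_rank_def)
  have "span (set xs) = span B"
    by (rule independent_spans) (use assms B distinct_card[of xs] in auto)
  with B assms show ?thesis by (simp add: basis_list_def)
qed

lemma basis_listI_spanning:
  assumes "span (set xs) = S" "has_rank (length xs) S"
  shows "basis_list xs S"
proof -
  obtain B where B: "finite B" "independent B" "card B = length xs" "span B = S" using assms(2) by (auto simp: has_rank_def)
  obtain C where C: "C \<subseteq> set xs" "independent C" "set xs \<subseteq> span C"
    by (rule maximal_independent_subset)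
  have fC: "finite C" using C(1) finite_subset by blast
  have "span (set xs) \<subseteq> span C" using C(3) by (simp add: span_minimal)
  then have "B \<subseteq> span C" using B(4) assms(1) span_superset[of B] by blast
  then have "card B \<le> card C" using independent_span_bound[OF fC B(2)] by blast
  moreover have "card C \<le> card (set xs)" using C(1) by (simp add: card_mono)
  moreover have "card (set xs) \<le> length xs" by (rule card_length)
  ultimately have "card C = card (set xs)" "card (set xs) = length xs" using B(3) by auto
  then have "C = set xs" "distinct xs"
    using card_subset_eq[OF List.finite_set C(1)] card_distinct by auto
  then show ?thesis using C(2) assms(1) by (simp add: basis_list_def)
qed

text \<open>Steinitz exchange with bookkeeping: \<open>g\<close> takes a form or a function to a
  covector at one point, and \<open>zs\<close> retains the forms or functions themselves rather than
  only those covectors.\<close>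

lemma extend_to_basis:
  assumes "distinct xs" "independent (set xs)"
  shows "\<exists>zs. set zs \<subseteq> set ys \<and> distinct (xs @ map g zs) \<and> independent (set (xs @ map g zs)) \<and>
    g ` set ys \<subseteq> span (set (xs @ map g zs))"
proof (induction ys)
  case Nil
  then show ?case using assms by (intro exI[of _ "[]"]) auto
next
  case (Cons y ys)
  then obtain zs where zs: "set zs \<subseteq> set ys" "distinct (xs @ map g zs)" "independent (set (xs @ map g zs))"
    "g ` set ys \<subseteq> span (set (xs @ map g zs))" by blast
  show ?case
  proof (cases "g y \<in> span (set (xs @ map g zs))")
    case True
    then show ?thesis using zs by (intro exI[of _ zs]) auto
  next
    case False
    then have "g y \<notin> set (xs @ map g zs)" using span_base by blast
    moreover have eq: "set (xs @ map g (y # zs)) = insert (g y) (set (xs @ map g zs))" by auto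
    moreover have "span (set (xs @ map g zs)) \<subseteq> span (set (xs @ map g (y # zs)))"
      unfolding eq by (rule span_mono) auto
    moreover have "independent (set (xs @ map g (y # zs)))"
      unfolding eq using False zs(3) by (rule independent_insertI)
    moreover have "g y \<in> span (set (xs @ map g (y # zs)))" by (rule span_base) simp
    ultimately show ?thesis using zs by (intro exI[of _ "y # zs"]) auto
  qed
qed

lemma dual_expansion:
  fixes X :: "'i \<Rightarrow> 'v::real_vector" and \<phi> :: "'i \<Rightarrow> 'v \<Rightarrow> real"
  assumes I: "finite I" and lin: "\<And>a. a \<in> I \<Longrightarrow> linear (\<phi> a)"
    and dual: "\<And>a b. a \<in> I \<Longrightarrow> b \<in> I \<Longrightarrow> \<phi> a (X b) = (if a = b then 1 else 0)"
    and u: "u \<in> span (X ` I)"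
  shows "u = (\<Sum>a\<in>I. \<phi> a u *\<^sub>R X a)"
proof -
  define L where "L u = (\<Sum>a\<in>I. \<phi> a u *\<^sub>R X a)" for u
  have l: "linear L"
    unfolding L_def
    by (rule linearI) (simp_all add: linear_add lin linear_scale scaleR_add_left sum.distrib scaleR_sum_right)
  from u have "L u = u"
  proof (induction rule: span_induct)
    case base
    show ?case
      by (simp add: subspace_def linear_0[OF l] linear_add[OF l] linear_scale[OF l])
  next
    case (step y)
    then obtain b where b: "b \<in> I" "y = X b" by auto
    have "(\<Sum>a\<in>I. \<phi> a (X b) *\<^sub>R X a) = (\<Sum>a\<in>I. if a = b then X a else 0)"
      by (rule sum.cong) (use dual b in auto)
    then show ?case using b I by (simp add: L_def)
  qed
  then show ?thesis by (simp add: L_def)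
qed

lemma independent_list_coeffs:
  fixes xs :: "'v::real_vector list"
  assumes "distinct xs" "independent (set xs)" "(\<Sum>a<length xs. c a *\<^sub>R xs ! a) = 0" "a < length xs"
  shows "c a = 0"
proof -
  have inj: "inj_on ((!) xs) {..<length xs}" using assms(1) by (simp add: inj_on_nth)
  have im: "(!) xs ` {..<length xs} = set xs" by (auto simp: set_conv_nth)
  define u where "u v = c (the_inv_into {..<length xs} ((!) xs) v)" for v
  have u: "u (xs ! b) = c b" if "b < length xs" for b
    using that by (simp add: u_def the_inv_into_f_f[OF inj])
  have "(\<Sum>v\<in>set xs. u v *\<^sub>R v) = (\<Sum>a<length xs. u (xs ! a) *\<^sub>R xs ! a)"
    unfolding im[symmetric] by (simp add: sum.reindex[OF inj])
  also have "\<dots> = 0" using assms(3) u by simp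
  finally have "u (xs ! a) = 0" using independentD[OF assms(2), of "set xs" u "xs ! a"] assms(4) by simp
  then show ?thesis using u assms(4) by simp
qed

section \<open>Rank of Pfaffian systems\<close>

lemma pfaffian_has_rank:
  assumes "pfaffian_system M V"
  obtains r where "\<And>p. p \<in> points M \<Longrightarrow> has_rank r (V p)"
proof -
  obtain r where r: "\<And>p. p \<in> points M \<Longrightarrow> \<exists>W \<omega>s. openin (mtop M) W \<and> p \<in> W \<and> length \<omega>s = r \<and> local_frame M W \<omega>s V"
    using assms unfolding pfaffian_system_def by blast
  have "has_rank r (V p)" if p: "p \<in> points M" for p
  proof -
    obtain W \<omega>s where "p \<in> W" "length \<omega>s = r" "local_frame M W \<omega>s V" using r[OF p] by blast
    then have "basis_list (map (\<lambda>\<omega>. \<omega> p) \<omega>s) (V p)" "length (map (\<lambda>\<omega>. \<omega> p) \<omega>s) = r"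
      by (auto simp: local_frame_def basis_list_def)
    then show ?thesis using basis_list_has_rank by metis
  qed
  then show ?thesis using that by blast
qed

lemma pfaffian_subspace: "pfaffian_system M V \<Longrightarrow> p \<in> points M \<Longrightarrow> subspace (V p)"
  by (metis pfaffian_has_rank has_rank_subspace)

lemma local_frame_iff:
  "local_frame M W \<omega>s V \<longleftrightarrow> set \<omega>s \<subseteq> Omega1 M W V \<and> (\<forall>p\<in>W. basis_list (map (\<lambda>\<omega>. \<omega> p) \<omega>s) (V p))"
  by (auto simp: local_frame_def basis_list_def)

lemma derived_subset: "subspace (V p) \<Longrightarrow> p \<in> points M \<Longrightarrow> derived M V p \<subseteq> V p"
  unfolding derived_def by (rule span_minimal) (auto simp: Omega1_def)

lemma linear_eval: "linear (\<lambda>\<alpha>::('m, 'e) covector. \<alpha> \<kappa> u)"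
  by (rule linearI) simp_all

context smooth_mfd
begin

lemma bump:
  assumes W: "openin (mtop M) W" "p \<in> W"
  obtains \<psi> W' C where "openin (mtop M) W'" "p \<in> W'" "W' \<subseteq> C" "smooth_fun M (points M) \<psi>"
    "\<And>q. q \<in> W' \<Longrightarrow> \<psi> q = 1" "closedin (mtop M) C" "C \<subseteq> W" "\<And>q. q \<notin> C \<Longrightarrow> \<psi> q = 0"
proof -
  have "p \<in> points M" using W openin_subset by blast
  then obtain \<kappa> where "\<kappa> \<in> charts_at M p" using chart_cover by blast
  then have \<kappa>: "\<kappa> \<in> atlas M" "p \<in> dom_of \<kappa>" by (auto dest: charts_atD)
  let ?S = "map_of_chart \<kappa> ` (dom_of \<kappa> \<inter> W)" and ?x = "map_of_chart \<kappa> p"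
  have "open ?S" "?x \<in> ?S" using open_image[OF \<kappa>(1) W(1)] \<kappa> W by auto
  then obtain r where r: "r > 0" "cball ?x r \<subseteq> ?S" using open_contains_cball by blast
  obtain b :: "'e \<Rightarrow> real" where b: "smooth_on UNIV b" "\<And>x. dist ?x x \<le> r / 2 \<Longrightarrow> b x = 1" "\<And>x. dist ?x x \<ge> r \<Longrightarrow> b x = 0"
    using euclidean_bump[OF r(1)] by metis
  define \<psi> where "\<psi> q = (if q \<in> dom_of \<kappa> then b (map_of_chart \<kappa> q) else 0)" for q
  \<comment> \<open>The set \<open>C\<close> corresponds to a closed ball in the chart. It is
    compact, hence closed in M by the Hausdorff property, so the extension of the bump function by 0
    is smooth on all of M.\<close>
  define C where "C = {q \<in> dom_of \<kappa>. map_of_chart \<kappa> q \<in> cball ?x r}"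
  define W' where "W' = {q \<in> dom_of \<kappa>. map_of_chart \<kappa> q \<in> ball ?x (r / 2)}"
  have CW: "C \<subseteq> W"
  proof
    fix q assume "q \<in> C"
    then have q: "q \<in> dom_of \<kappa>" "map_of_chart \<kappa> q \<in> ?S" using r by (auto simp: C_def)
    then obtain q' where "q' \<in> dom_of \<kappa>" "q' \<in> W" "map_of_chart \<kappa> q = map_of_chart \<kappa> q'" by auto
    then show "q \<in> W" using q(1) chart_inv_map[OF \<kappa>(1)] by metis
  qed
  have closed: "closedin (mtop M) C"
  proof -
    obtain g where g: "homeomorphic_maps (subtopology (mtop M) (dom_of \<kappa>)) (top_of_set (map_of_chart \<kappa> ` dom_of \<kappa>)) (map_of_chart \<kappa>) g"
      using homeo[OF \<kappa>(1)] homeomorphic_map_maps by blast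
    then have gi: "\<And>q. q \<in> dom_of \<kappa> \<Longrightarrow> g (map_of_chart \<kappa> q) = q"
      and gc: "continuous_map (top_of_set (map_of_chart \<kappa> ` dom_of \<kappa>)) (subtopology (mtop M) (dom_of \<kappa>)) g"
      using dom_subset[OF \<kappa>(1)] by (auto simp: homeomorphic_maps_def)
    have "cball ?x r \<subseteq> map_of_chart \<kappa> ` dom_of \<kappa>" using r by auto
    then have "compactin (top_of_set (map_of_chart \<kappa> ` dom_of \<kappa>)) (cball ?x r)"
      by (simp add: compactin_subtopology)
    from image_compactin[OF this gc] have "compactin (mtop M) (g ` cball ?x r)"
      by (simp add: compactin_subtopology)
    moreover have "g ` cball ?x r = C"
    proof
      show "g ` cball ?x r \<subseteq> C"
      proof
        fix q assume "q \<in> g ` cball ?x r"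
        then obtain y where y: "q = g y" "y \<in> cball ?x r" by blast
        then obtain q' where "q' \<in> dom_of \<kappa>" "y = map_of_chart \<kappa> q'" using r(2) by blast
        then show "q \<in> C" using y gi by (simp add: C_def)
      qed
      show "C \<subseteq> g ` cball ?x r"
      proof
        fix q assume "q \<in> C"
        then show "q \<in> g ` cball ?x r" using gi by (intro image_eqI[of _ _ "map_of_chart \<kappa> q"]) (auto simp: C_def)
      qed
    qed
    ultimately show ?thesis using compactin_imp_closedin[OF hausdorff] by simp
  qed
  have \<psi>0: "\<psi> q = 0" if "q \<notin> C" for q
    using that b(3)[of "map_of_chart \<kappa> q"] by (auto simp: \<psi>_def C_def)
  show ?thesis
  proof (rule that[of W' C \<psi>])
    show "openin (mtop M) W'" unfolding W'_def by (rule openin_preimage[OF \<kappa>(1) open_ball])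
    show "smooth_fun M (points M) \<psi>"
    proof (rule smooth_fun_local)
      fix q assume q: "q \<in> points M"
      show "\<exists>N. openin (mtop M) N \<and> q \<in> N \<and> smooth_fun M N \<psi>"
      proof (cases "q \<in> dom_of \<kappa>")
        case True
        have "smooth_fun M (dom_of \<kappa>) \<psi>"
        proof (rule smooth_fun_chart[OF \<kappa>(1) openin_dom[OF \<kappa>(1)] order_refl])
          show "smooth_on (map_of_chart \<kappa> ` dom_of \<kappa>) (\<lambda>x. \<psi> (chart_inv \<kappa> x))"
            by (rule smooth_on_cong[OF open_chart_image[OF \<kappa>(1)] _ smooth_on_subset[OF open_chart_image[OF \<kappa>(1)] _ open_UNIV b(1)]])
              (use \<kappa> in \<open>auto simp: \<psi>_def\<close>)
        qed
        then show ?thesis using True openin_dom[OF \<kappa>(1)] by blast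
      next
        case False
        have o: "openin (mtop M) (points M - C)" using closed by blast
        have "smooth_fun M (points M - C) \<psi>"
          by (rule smooth_fun_cong[OF o _ smooth_fun_const[OF o, of 0]]) (use \<psi>0 in auto)
        moreover have "q \<in> points M - C" using False q by (auto simp: C_def)
        ultimately show ?thesis using o by blast
      qed
    qed
    show "\<psi> q = 1" if "q \<in> W'" for q using that b(2) by (auto simp: W'_def \<psi>_def)
  qed (use CW closed \<psi>0 \<kappa> r in \<open>auto simp: W'_def C_def\<close>)
qed

lemma cutoff_Omega1:
  assumes W: "openin (mtop M) W" and \<omega>: "\<omega> \<in> Omega1 M W V"
    and \<psi>: "smooth_fun M (points M) \<psi>" and C: "closedin (mtop M) C" "C \<subseteq> W" "\<And>q. q \<notin> C \<Longrightarrow> \<psi> q = 0"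
    and V: "\<And>q. q \<in> points M \<Longrightarrow> subspace (V q)"
  shows "(\<lambda>q. if q \<in> W then \<psi> q *\<^sub>R \<omega> q else 0) \<in> Omega1 M (points M) V" (is "?\<omega> \<in> _")
proof -
  have Wp: "W \<subseteq> points M" using W openin_subset by blast
  have "?\<omega> q \<in> cotangent_space M q \<and> ?\<omega> q \<in> V q" if q: "q \<in> points M" for q
    using \<omega> V[OF q] subspace_cotangent[of q] by (auto simp: Omega1_iff subspace_scale subspace_0)
  moreover have "smooth_fun M (points M \<inter> dom_of \<kappa>) (\<lambda>q. ?\<omega> q \<kappa> u)" if \<kappa>: "\<kappa> \<in> atlas M" for \<kappa> u
  proof (rule smooth_fun_local)
    fix q assume q: "q \<in> points M \<inter> dom_of \<kappa>"
    show "\<exists>N. openin (mtop M) N \<and> q \<in> N \<and> smooth_fun M N (\<lambda>q. ?\<omega> q \<kappa> u)"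
    proof (cases "q \<in> W")
      case True
      have o: "openin (mtop M) (W \<inter> dom_of \<kappa>)" using W openin_dom[OF \<kappa>] by (rule openin_Int)
      have "smooth_fun M (W \<inter> dom_of \<kappa>) (\<lambda>q. \<psi> q * \<omega> q \<kappa> u)"
      proof (rule smooth_fun_mult[OF o])
        show "smooth_fun M (W \<inter> dom_of \<kappa>) \<psi>" using smooth_fun_subset[OF \<psi> openin_topspace o] Wp by blast
        show "smooth_fun M (W \<inter> dom_of \<kappa>) (\<lambda>q. \<omega> q \<kappa> u)" using \<omega> \<kappa> by (simp add: Omega1_iff)
      qed
      then have "smooth_fun M (W \<inter> dom_of \<kappa>) (\<lambda>q. ?\<omega> q \<kappa> u)"
        by (rule smooth_fun_cong[OF o, rotated]) auto
      then show ?thesis using o True q by blast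
    next
      case False
      have o: "openin (mtop M) (points M - C)" using C(1) by blast
      have "smooth_fun M (points M - C) (\<lambda>q. ?\<omega> q \<kappa> u)"
        by (rule smooth_fun_cong[OF o _ smooth_fun_const[OF o, of 0]]) (use C(3) in auto)
      moreover have "q \<in> points M - C" using False q C(2) by blast
      ultimately show ?thesis using o by blast
    qed
  qed
  ultimately show ?thesis by (simp add: Omega1_iff)
qed

text \<open>Derived systems and condition (iii) of a Darboux pair quantify over sections on all of
  M; this brings local sections within their reach.\<close>

lemma extend_form:
  assumes W: "openin (mtop M) W" "p \<in> W" and \<omega>: "\<omega> \<in> Omega1 M W V"
    and V: "\<And>q. q \<in> points M \<Longrightarrow> subspace (V q)"
  obtains \<omega>' W' where "\<omega>' \<in> Omega1 M (points M) V" "openin (mtop M) W'" "p \<in> W'" "W' \<subseteq> W"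
    "\<And>q. q \<in> W' \<Longrightarrow> \<omega>' q = \<omega> q"
proof -
  obtain \<psi> W' C where \<psi>: "openin (mtop M) W'" "p \<in> W'" "W' \<subseteq> C" "smooth_fun M (points M) \<psi>"
    "\<And>q. q \<in> W' \<Longrightarrow> \<psi> q = 1" "closedin (mtop M) C" "C \<subseteq> W" "\<And>q. q \<notin> C \<Longrightarrow> \<psi> q = 0"
    using bump[OF W] by metis
  show ?thesis
    by (rule that[OF cutoff_Omega1[OF W(1) \<omega> \<psi>(4,6,7,8) V] \<psi>(1,2)]) (use \<psi> in auto)
qed

text \<open>For a bump function \<psi> and a closed form \<omega> the differential of \<psi>
  \<omega> is d\<psi> \<and> \<omega>, whose factor \<omega> lives only on \<open>W\<close>. A
  second factor \<psi> repairs this: d(\<psi> \<psi> \<omega>) = 2 \<psi> d\<psi> \<and> \<omega> =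
  (\<psi> \<omega>) \<and> (-2 d\<psi>), and \<psi> \<omega> is a section of the system over all of
  M.\<close>

lemma closed_in_derived:
  assumes W: "openin (mtop M) W" "p \<in> W" and \<omega>: "\<omega> \<in> Omega1 M W V"
    and closed: "\<And>q. q \<in> W \<Longrightarrow> ext_d M \<omega> q = 0"
    and V: "\<And>q. q \<in> points M \<Longrightarrow> subspace (V q)"
  shows "\<omega> p \<in> derived M V p"
proof -
  obtain \<psi> W' C where \<psi>: "openin (mtop M) W'" "p \<in> W'" "W' \<subseteq> C" "smooth_fun M (points M) \<psi>"
    "\<And>q. q \<in> W' \<Longrightarrow> \<psi> q = 1" "closedin (mtop M) C" "C \<subseteq> W" "\<And>q. q \<notin> C \<Longrightarrow> \<psi> q = 0"
    using bump[OF W] by metis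
  define \<omega>1 where "\<omega>1 q = (if q \<in> W then \<psi> q *\<^sub>R \<omega> q else 0)" for q
  have \<omega>1: "\<omega>1 \<in> Omega1 M (points M) V"
    unfolding \<omega>1_def by (rule cutoff_Omega1[OF W(1) \<omega> \<psi>(4,6,7,8) V])
  define \<omega>2 where "\<omega>2 q = \<psi> q *\<^sub>R \<omega>1 q" for q
  have \<omega>2: "\<omega>2 \<in> Omega1 M (points M) V"
    unfolding \<omega>2_def by (rule Omega1_scale[OF openin_topspace \<omega>1 \<psi>(4) V])
  define \<beta> where "\<beta> q = (- 2) *\<^sub>R dform M \<psi> q" for q
  have \<beta>: "\<beta> \<in> Omega1 M (points M) (cotangent_space M)"
    unfolding \<beta>_def
    by (rule Omega1_scale[OF openin_topspace dform_Omega1[OF openin_topspace \<psi>(4)] smooth_fun_const[OF openin_topspace] subspace_cotangent])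
  have Wp: "W \<subseteq> points M" using W(1) openin_subset by blast
  \<comment> \<open>Outside \<open>W\<close> the values of \<psi> and \<open>\<omega>1\<close> are
    0, so the product rule gives 0 there whatever the differential of \<open>\<omega>1\<close>
    is.\<close>
  have d: "ext_d M \<omega>2 q = \<omega>1 q \<and>\<^sub>w \<beta> q" if q: "q \<in> points M" for q
  proof -
    have e2: "ext_d M \<omega>2 q = dform M \<psi> q \<and>\<^sub>w \<omega>1 q + \<psi> q *\<^sub>R ext_d M \<omega>1 q"
      unfolding \<omega>2_def by (rule ext_d_scale[OF openin_topspace q \<omega>1 \<psi>(4)])
    show ?thesis
    proof (cases "q \<in> W")
      case True
      have s: "smooth_fun M W \<psi>" by (rule smooth_fun_subset[OF \<psi>(4) openin_topspace W(1) Wp])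
      have "ext_d M \<omega>1 q = ext_d M (\<lambda>q. \<psi> q *\<^sub>R \<omega> q) q"
        by (rule ext_d_cong[OF W(1) True _ Omega1_subset[OF \<omega>1 openin_topspace W(1) Wp]]) (simp add: \<omega>1_def)
      also have "\<dots> = dform M \<psi> q \<and>\<^sub>w \<omega> q"
        using ext_d_scale[OF W(1) True \<omega> s] closed[OF True] by simp
      finally have e1: "ext_d M \<omega>1 q = dform M \<psi> q \<and>\<^sub>w \<omega> q" .
      show ?thesis unfolding e2 e1 using True
        by (auto simp: \<omega>1_def \<beta>_def wedge_def fun_eq_iff algebra_simps)
    next
      case False
      then have qC: "q \<in> points M - C" using q \<psi>(7) by blast
      then show ?thesis unfolding e2 using False \<psi>(8)[of q]
        by (auto simp: \<omega>1_def wedge_def fun_eq_iff)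
    qed
  qed
  have "ext_d M \<omega>2 \<in> ideal2 M (points M) (Omega1 M (points M) V)"
    unfolding ideal2_def mem_Collect_eq
    using \<omega>1 \<beta> d by (intro exI[of _ "1::nat"] exI[of _ "\<lambda>_. \<omega>1"] exI[of _ "\<lambda>_. \<beta>"]) auto
  moreover have "\<omega>2 p = \<omega> p" using \<psi>(2,5) W by (simp add: \<omega>2_def \<omega>1_def)
  ultimately show ?thesis unfolding derived_def using \<omega>2 by (intro span_base CollectI exI[of _ \<omega>2]) auto
qed

section \<open>Contraction with dual vector fields\<close>

lemma ext_d_bilinear:
  assumes W: "openin (mtop M) W" "p \<in> W" and \<omega>: "\<omega> \<in> Omega1 M W V" and \<kappa>: "\<kappa> \<in> charts_at M p"
  shows "linear (ext_d M \<omega> p \<kappa> u)" "linear (\<lambda>u. ext_d M \<omega> p \<kappa> u v)"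
proof -
  have a: "\<kappa> \<in> atlas M" "p \<in> dom_of \<kappa>" using \<kappa> by (auto dest: charts_atD)
  let ?x = "map_of_chart \<kappa> p" and ?S = "map_of_chart \<kappa> ` (dom_of \<kappa> \<inter> W)"
  have S: "open ?S" "?x \<in> ?S" using open_image[OF a(1) W(1)] a W by auto
  let ?g = "\<lambda>v x. \<omega> (chart_inv \<kappa> x) \<kappa> v"
  have d: "(?g v has_derivative frechet_derivative (?g v) (at ?x)) (at ?x)" for v
    by (rule smooth_on_has_derivative[OF Omega1_chart_smooth[OF \<omega> a(1)] S(2)])
  have l: "linear (\<lambda>v. ?g v x)" if "x \<in> ?S" for x
  proof -
    obtain q where "q \<in> dom_of \<kappa>" "q \<in> W" "x = map_of_chart \<kappa> q" using \<open>x \<in> ?S\<close> by blast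
    then show ?thesis using \<omega> a cotangent_linear[of "\<omega> q" q \<kappa>] by (simp add: Omega1_iff charts_at_def)
  qed
  have l1: "linear (\<lambda>v. frechet_derivative (?g v) (at ?x) u)" for u
  proof (rule linearI)
    fix v v' :: 'e and r :: real
    show "frechet_derivative (?g (v + v')) (at ?x) u = frechet_derivative (?g v) (at ?x) u + frechet_derivative (?g v') (at ?x) u"
      by (rule has_derivative_frechet_eq[OF has_derivative_transform_within_open[OF has_derivative_add[OF d[of v] d[of v']] S]])
        (simp add: linear_add[OF l])
    show "frechet_derivative (?g (r *\<^sub>R v)) (at ?x) u = r *\<^sub>R frechet_derivative (?g v) (at ?x) u"
      by (rule has_derivative_frechet_eq[OF has_derivative_transform_within_open[OF has_derivative_scaleR_right[OF d[of v]] S]])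
        (simp add: linear_scale[OF l])
  qed
  have l2: "linear (frechet_derivative (?g v) (at ?x))" for v by (rule has_derivative_linear[OF d])
  show "linear (ext_d M \<omega> p \<kappa> u)"
    using linear_compose_sub[OF l1[of u] l2[of u]] by (simp add: ext_d_chart[OF \<kappa>, abs_def])
  show "linear (\<lambda>u. ext_d M \<omega> p \<kappa> u v)"
    using linear_compose_sub[OF l2[of v] l1[of v]] by (simp add: ext_d_chart[OF \<kappa>])
qed

lemma Omega1_component_smooth:
  assumes "\<omega> \<in> Omega1 M W V" "\<kappa> \<in> atlas M" "W \<subseteq> dom_of \<kappa>"
  shows "smooth_fun M W (\<lambda>p. \<omega> p \<kappa> u)"
proof -
  have "smooth_fun M (W \<inter> dom_of \<kappa>) (\<lambda>p. \<omega> p \<kappa> u)" using assms by (simp add: Omega1_iff)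
  moreover have "W \<inter> dom_of \<kappa> = W" using assms(3) by blast
  ultimately show ?thesis by simp
qed

lemma ext_d_component_smooth:
  assumes W: "openin (mtop M) W" and \<omega>: "\<omega> \<in> Omega1 M W V" and \<kappa>: "\<kappa> \<in> atlas M" "W \<subseteq> dom_of \<kappa>"
  shows "smooth_fun M W (\<lambda>p. ext_d M \<omega> p \<kappa> u v)"
proof (rule smooth_fun_chart[OF \<kappa>(1) W \<kappa>(2)])
  have e: "dom_of \<kappa> \<inter> W = W" using \<kappa> by auto
  have o: "open (map_of_chart \<kappa> ` W)" using open_image[OF \<kappa>(1) W] e by simp
  have s: "smooth_on (map_of_chart \<kappa> ` W) (\<lambda>x. \<omega> (chart_inv \<kappa> x) \<kappa> v)" for v
    using Omega1_chart_smooth[OF \<omega> \<kappa>(1), of v] e by simp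
  show "smooth_on (map_of_chart \<kappa> ` W) (\<lambda>x. ext_d M \<omega> (chart_inv \<kappa> x) \<kappa> u v)"
    by (rule smooth_on_cong[OF o _ smooth_on_diff[OF o smooth_on_derivative[OF s[of v], of u] smooth_on_derivative[OF s[of u], of v]]])
      (use \<kappa> in \<open>auto simp: ext_d_def charts_at_def\<close>)
qed

text \<open>Vector fields are represented by maps into the model space, read in one chart
  \<open>\<kappa>\<close>. Coefficients of forms over the coframe are contractions with the dual
  fields, so the two smoothness conclusions are the source of all smooth coefficients later
  on.\<close>

lemma dual_fields:
  assumes W: "openin (mtop M) W" "p0 \<in> W" and \<omega>s: "set \<omega>s \<subseteq> Omega1 M W (cotangent_space M)"
    and \<kappa>: "\<kappa> \<in> charts_at M p0"
    and ind: "distinct (map (\<lambda>\<omega>. \<omega> p0) \<omega>s)" "independent (set (map (\<lambda>\<omega>. \<omega> p0) \<omega>s))"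
  obtains W' X where "openin (mtop M) W'" "p0 \<in> W'" "W' \<subseteq> W" "W' \<subseteq> dom_of \<kappa>"
    "\<And>p a c. p \<in> W' \<Longrightarrow> a < length \<omega>s \<Longrightarrow> c < length \<omega>s \<Longrightarrow> (\<omega>s ! c) p \<kappa> (X a p) = (if a = c then 1 else 0)"
    "\<And>W'' \<alpha> V a. a < length \<omega>s \<Longrightarrow> openin (mtop M) W'' \<Longrightarrow> W'' \<subseteq> W' \<Longrightarrow> \<alpha> \<in> Omega1 M W'' V \<Longrightarrow>
      smooth_fun M W'' (\<lambda>p. \<alpha> p \<kappa> (X a p))"
    "\<And>W'' \<alpha> V a b. a < length \<omega>s \<Longrightarrow> b < length \<omega>s \<Longrightarrow> openin (mtop M) W'' \<Longrightarrow> W'' \<subseteq> W' \<Longrightarrow> \<alpha> \<in> Omega1 M W'' V \<Longrightarrow>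
      smooth_fun M W'' (\<lambda>p. ext_d M \<alpha> p \<kappa> (X a p) (X b p))"
proof -
  have k: "\<kappa> \<in> atlas M" "p0 \<in> dom_of \<kappa>" using \<kappa> by (auto dest: charts_atD)
  let ?n = "length \<omega>s"
  let ?U = "map_of_chart \<kappa> ` (dom_of \<kappa> \<inter> W)" and ?x0 = "map_of_chart \<kappa> p0"
  define w where "w a x v = (\<omega>s ! a) (chart_inv \<kappa> x) \<kappa> v" for a x v
  have \<omega>O: "\<omega>s ! a \<in> Omega1 M W (cotangent_space M)" if "a < ?n" for a using \<omega>s that by auto
  have U: "open ?U" "?x0 \<in> ?U" using open_image[OF k(1) W(1)] k W by auto
  have lin: "linear (w a x)" if "a < ?n" "x \<in> ?U" for a x
  proof -
    obtain q where "q \<in> dom_of \<kappa>" "q \<in> W" "x = map_of_chart \<kappa> q" using \<open>x \<in> ?U\<close> by blast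
    then show ?thesis using \<omega>O[OF that(1)] k cotangent_linear[of "(\<omega>s ! a) q" q \<kappa>]
      by (simp add: Omega1_iff charts_at_def w_def[abs_def])
  qed
  have sm: "smooth_on ?U (\<lambda>x. w a x v)" if "a < ?n" for a v
    unfolding w_def by (rule Omega1_chart_smooth[OF \<omega>O[OF that] k(1)])
  \<comment> \<open>A linear relation among the representations in the chart \<open>\<kappa>\<close>
    at \<open>p0\<close> is one among the covectors themselves.\<close>
  have ind': "\<forall>a<?n. c a = 0" if c: "\<And>v. (\<Sum>a<?n. c a * w a ?x0 v) = 0" for c
  proof -
    have "(\<Sum>a<?n. c a *\<^sub>R (\<omega>s ! a) p0) = 0"
    proof (rule cotangent_eqI[OF _ _ \<kappa>])
      show "(\<Sum>a<?n. c a *\<^sub>R (\<omega>s ! a) p0) \<in> cotangent_space M p0"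
        using \<omega>O W(2) subspace_cotangent by (intro subspace_sum subspace_scale) (auto simp: Omega1_iff)
      show "(\<Sum>a<?n. c a *\<^sub>R (\<omega>s ! a) p0) \<kappa> v = 0 \<kappa> v" for v
        using c[of v] k by (simp add: sum_fun_apply w_def)
    qed (simp add: subspace_0 subspace_cotangent)
    then have "(\<Sum>a<length (map (\<lambda>\<omega>. \<omega> p0) \<omega>s). c a *\<^sub>R map (\<lambda>\<omega>. \<omega> p0) \<omega>s ! a) = 0" by simp
    from independent_list_coeffs[OF ind this] show ?thesis by simp
  qed
  have "\<exists>U' e h. open U' \<and> ?x0 \<in> U' \<and> U' \<subseteq> ?U \<and>
    (\<forall>a<?n. \<forall>b<?n. smooth_on U' (h b a)) \<and>
    (\<forall>x\<in>U'. \<forall>a<?n. \<forall>c<?n. w c x (\<Sum>b<?n. h b a x *\<^sub>R e b) = (if a = c then 1 else 0))"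
    by (rule dual_frame_ex) (fact U lin sm ind')+
  then obtain U' e h where U': "open U'" "?x0 \<in> U'" "U' \<subseteq> ?U"
    and h0: "\<forall>a<?n. \<forall>b<?n. smooth_on U' (h b a)"
    and dual0: "\<forall>x\<in>U'. \<forall>a<?n. \<forall>c<?n. w c x (\<Sum>b<?n. h b a x *\<^sub>R e b) = (if a = c then 1 else 0)"
    by (elim exE conjE) (rule that)
  define W' where "W' = {p \<in> dom_of \<kappa>. map_of_chart \<kappa> p \<in> U'}"
  define X where "X a p = (\<Sum>b<?n. h b a (map_of_chart \<kappa> p) *\<^sub>R e b)" for a p
  have oW': "openin (mtop M) W'" unfolding W'_def by (rule openin_preimage[OF k(1) U'(1)])
  have W'd: "W' \<subseteq> dom_of \<kappa>" by (auto simp: W'_def)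
  have W'W: "W' \<subseteq> W"
  proof
    fix q assume "q \<in> W'"
    then have q: "q \<in> dom_of \<kappa>" "map_of_chart \<kappa> q \<in> ?U" using U' by (auto simp: W'_def)
    then obtain q' where "q' \<in> dom_of \<kappa>" "q' \<in> W" "map_of_chart \<kappa> q = map_of_chart \<kappa> q'" by auto
    then show "q \<in> W" using q(1) chart_inv_map[OF k(1)] by metis
  qed
  have im: "map_of_chart \<kappa> ` W' \<subseteq> U'" by (auto simp: W'_def)
  have oi: "open (map_of_chart \<kappa> ` W')" using open_image[OF k(1) oW'] W'd by (simp add: Int_absorb1)
  have hs: "smooth_fun M W' (\<lambda>p. h b a (map_of_chart \<kappa> p))" if "a < ?n" "b < ?n" for a b
  proof (rule smooth_fun_chart[OF k(1) oW' W'd])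
    have "smooth_on U' (h b a)" using h0 that by blast
    then have "smooth_on (map_of_chart \<kappa> ` W') (h b a)" using smooth_on_subset[OF oi im U'(1)] by blast
    then show "smooth_on (map_of_chart \<kappa> ` W') (\<lambda>x. h b a (map_of_chart \<kappa> (chart_inv \<kappa> x)))"
      by (rule smooth_on_cong[OF oi, rotated]) (use W'd k in auto)
  qed
  show ?thesis
  proof (rule that[of W' X])
    show "p0 \<in> W'" using k U' by (simp add: W'_def)
    show "(\<omega>s ! c) p \<kappa> (X a p) = (if a = c then 1 else 0)" if "p \<in> W'" "a < ?n" "c < ?n" for p a c
      using dual0[rule_format, of "map_of_chart \<kappa> p" a c] that k by (simp add: W'_def X_def w_def)
    show "smooth_fun M W'' (\<lambda>p. \<alpha> p \<kappa> (X a p))"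
      if "a < ?n" "openin (mtop M) W''" "W'' \<subseteq> W'" "\<alpha> \<in> Omega1 M W'' V" for W'' \<alpha> V a
    proof -
      have "smooth_fun M W'' (\<lambda>p. \<Sum>b<?n. h b a (map_of_chart \<kappa> p) * \<alpha> p \<kappa> (e b))"
        using that W'd smooth_fun_subset[OF hs oW' that(2,3)]
        by (intro smooth_fun_sum smooth_fun_mult Omega1_component_smooth[OF that(4) k(1)]) auto
      then show ?thesis
      proof (rule smooth_fun_cong[OF that(2), rotated])
        fix p assume p: "p \<in> W''"
        then have \<kappa>p: "\<kappa> \<in> charts_at M p" using that(3) W'd k by (auto simp: charts_at_def)
        have "\<alpha> p \<in> cotangent_space M p" using that(4) p by (simp add: Omega1_iff)
        then have l: "linear (\<alpha> p \<kappa>)" using \<kappa>p by (rule cotangent_linear)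
        show "(\<Sum>b<?n. h b a (map_of_chart \<kappa> p) * \<alpha> p \<kappa> (e b)) = \<alpha> p \<kappa> (X a p)"
          by (simp add: X_def linear_sum[OF l] linear_scale[OF l])
      qed
    qed
    show "smooth_fun M W'' (\<lambda>p. ext_d M \<alpha> p \<kappa> (X a p) (X b p))"
      if "a < ?n" "b < ?n" "openin (mtop M) W''" "W'' \<subseteq> W'" "\<alpha> \<in> Omega1 M W'' V" for W'' \<alpha> V a b
    proof -
      have "smooth_fun M W'' (\<lambda>p. \<Sum>i<?n. \<Sum>j<?n. h i a (map_of_chart \<kappa> p) * (h j b (map_of_chart \<kappa> p) * ext_d M \<alpha> p \<kappa> (e i) (e j)))"
        using that W'd smooth_fun_subset[OF hs oW' that(3,4)]
        by (intro smooth_fun_sum smooth_fun_mult ext_d_component_smooth[OF _ that(5) k(1)]) auto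
      then show ?thesis
      proof (rule smooth_fun_cong[OF that(3), rotated])
        fix p assume p: "p \<in> W''"
        then have \<kappa>p: "\<kappa> \<in> charts_at M p" using that(4) W'd k by (auto simp: charts_at_def)
        note l = ext_d_bilinear[OF that(3) p that(5) \<kappa>p]
        show "(\<Sum>i<?n. \<Sum>j<?n. h i a (map_of_chart \<kappa> p) * (h j b (map_of_chart \<kappa> p) * ext_d M \<alpha> p \<kappa> (e i) (e j))) = ext_d M \<alpha> p \<kappa> (X a p) (X b p)"
          unfolding X_def
          by (simp add: linear_sum[OF l(1)] linear_scale[OF l(1)] linear_sum[OF l(2)] linear_scale[OF l(2)]
              sum_distrib_left)
            (subst sum.swap, simp add: mult_ac)
      qed
    qed
  qed (use oW' W'W W'd in auto)
qed

end


section \<open>Integrable systems\<close>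

lemma set_conv_image_nth: "set xs = (!) xs ` {..<length xs}"
  by (auto simp: set_conv_nth)

lemma sum_lessThan_add: "(\<Sum>b<n + m. f b) = (\<Sum>b<n. f b) + (\<Sum>b<m. f (n + b))"
  for f :: "nat \<Rightarrow> 'a::comm_monoid_add"
  by (induction m) (simp_all add: add.assoc)

lemma add_cancel_summand: "t = s + r \<Longrightarrow> u = - s \<Longrightarrow> t + u = r" for t :: "'a::ab_group_add"
  by simp

text \<open>Dual vectors certify independence at every point where they exist, which transports a
  frame from \<open>p0\<close> to a neighbourhood.\<close>

lemma dual_list_independent:
  fixes X :: "nat \<Rightarrow> 'e" and \<omega>s :: "('m, 'e) form1 list"
  assumes dual: "\<And>a c. a < length \<omega>s \<Longrightarrow> c < length \<omega>s \<Longrightarrow> (\<omega>s ! c) p \<kappa> (X a) = (if a = c then 1 else 0)"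
  shows "distinct (map (\<lambda>\<omega>. \<omega> p) \<omega>s)" "independent (set (map (\<lambda>\<omega>. \<omega> p) \<omega>s))"
proof -
  have im: "set (map (\<lambda>\<omega>. \<omega> p) \<omega>s) = (\<lambda>a. (\<omega>s ! a) p) ` {..<length \<omega>s}"
    using set_conv_image_nth[of \<omega>s] by (simp add: image_image)
  have d: "inj_on (\<lambda>a. (\<omega>s ! a) p) {..<length \<omega>s}" "independent ((\<lambda>a. (\<omega>s ! a) p) ` {..<length \<omega>s})"
    using dual_independent[of "{..<length \<omega>s}" "\<lambda>a \<alpha>. \<alpha> \<kappa> (X a)" "\<lambda>a. (\<omega>s ! a) p", OF linear_eval] dual
    by auto
  show "independent (set (map (\<lambda>\<omega>. \<omega> p) \<omega>s))" unfolding im by (rule d(2))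
  show "distinct (map (\<lambda>\<omega>. \<omega> p) \<omega>s)"
    using d(1) by (auto simp: distinct_conv_nth inj_on_def)
qed

lemma basis_list_dual:
  fixes X :: "nat \<Rightarrow> 'e" and \<omega>s :: "('m, 'e) form1 list"
  assumes dual: "\<And>a c. a < length \<omega>s \<Longrightarrow> c < length \<omega>s \<Longrightarrow> (\<omega>s ! c) p \<kappa> (X a) = (if a = c then 1 else 0)"
    and "\<And>\<omega>. \<omega> \<in> set \<omega>s \<Longrightarrow> \<omega> p \<in> S" "has_rank (length \<omega>s) S"
  shows "basis_list (map (\<lambda>\<omega>. \<omega> p) \<omega>s) S"
  using dual_list_independent[OF dual] assms(2,3) by (intro basis_listI_independent) auto

lemma basis_list_expansion:
  fixes X :: "nat \<Rightarrow> 'e" and \<omega>s :: "('m, 'e) form1 list"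
  assumes dual: "\<And>a c. a < length \<omega>s \<Longrightarrow> c < length \<omega>s \<Longrightarrow> (\<omega>s ! c) p \<kappa> (X a) = (if a = c then 1 else 0)"
    and "\<alpha> \<in> span (set (map (\<lambda>\<omega>. \<omega> p) \<omega>s))"
  shows "\<alpha> = (\<Sum>a<length \<omega>s. \<alpha> \<kappa> (X a) *\<^sub>R (\<omega>s ! a) p)"
proof -
  have im: "set (map (\<lambda>\<omega>. \<omega> p) \<omega>s) = (\<lambda>a. (\<omega>s ! a) p) ` {..<length \<omega>s}"
    using set_conv_image_nth[of \<omega>s] by (simp add: image_image)
  show ?thesis
    by (rule dual_expansion[of "{..<length \<omega>s}" "\<lambda>a \<alpha>. \<alpha> \<kappa> (X a)" "\<lambda>a. (\<omega>s ! a) p" \<alpha>, OF finite_lessThan linear_eval])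
      (use assms(2) dual in \<open>auto simp only: im lessThan_iff\<close>)
qed

context smooth_mfd
begin

text \<open>Stability means that the system at \<open>p0\<close> is spanned by values of sections
  whose differentials lie in the ideal of the system. A basis among them remains a frame nearby, and
  the ideal condition gives the Frobenius condition. The differentials of the first integrals agree
  at \<open>p0\<close> with the chosen basis.\<close>

lemma first_integral_coframe:
  assumes V: "pfaffian_system M V" and stable: "\<And>p. p \<in> points M \<Longrightarrow> derived M V p = V p"
    and p0: "p0 \<in> points M"
  obtains W fs where "openin (mtop M) W" "p0 \<in> W"
    "\<And>f. f \<in> set fs \<Longrightarrow> smooth_fun M W f \<and> dform M f \<in> Omega1 M W V"
    "basis_list (map (\<lambda>f. dform M f p0) fs) (V p0)"
proof -
  obtain r where r: "\<And>p. p \<in> points M \<Longrightarrow> has_rank r (V p)" using pfaffian_has_rank[OF V] by blast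
  define S where "S = {\<omega> p0 | \<omega>. \<omega> \<in> Omega1 M (points M) V \<and>
     ext_d M \<omega> \<in> ideal2 M (points M) (Omega1 M (points M) V)}"
  have SV: "span S = V p0" using stable[OF p0] by (simp add: derived_def S_def)
  obtain B where B: "B \<subseteq> S" "independent B" "S \<subseteq> span B" by (rule maximal_independent_subset)
  have "span B \<subseteq> span S" using B(1) by (rule span_mono)
  moreover have "span S \<subseteq> span B" using B(3) by (simp add: span_minimal)
  ultimately have BV: "span B = V p0" using SV by simp
  obtain B' where B': "finite B'" "span B' = V p0" using r[OF p0] by (auto simp: has_rank_def)
  have "finite B"
    using independent_span_bound[OF B'(1) B(2)] B'(2) BV span_superset[of B] by auto
  then obtain bs where bs: "set bs = B" "distinct bs" using finite_distinct_list by blast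
  have bb: "basis_list bs (V p0)" using bs B(2) BV by (simp add: basis_list_def)
  have lbs: "length bs = r" by (rule basis_list_length[OF bb r[OF p0]])
  have "\<exists>\<omega>. \<omega> \<in> Omega1 M (points M) V \<and> ext_d M \<omega> \<in> ideal2 M (points M) (Omega1 M (points M) V) \<and> \<omega> p0 = b"
    if "b \<in> B" for b using that B(1) by (auto simp: S_def)
  then obtain g where g: "\<And>b. b \<in> B \<Longrightarrow> g b \<in> Omega1 M (points M) V"
    "\<And>b. b \<in> B \<Longrightarrow> ext_d M (g b) \<in> ideal2 M (points M) (Omega1 M (points M) V)"
    "\<And>b. b \<in> B \<Longrightarrow> g b p0 = b" by metis
  define \<omega>s where "\<omega>s = map g bs"
  have len: "length \<omega>s = r" using lbs by (simp add: \<omega>s_def)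
  have at0: "map (\<lambda>\<omega>. \<omega> p0) \<omega>s = bs"
    using g(3) bs(1) by (auto simp: \<omega>s_def intro!: map_idI)
  have \<omega>V: "\<omega> \<in> Omega1 M (points M) V" "ext_d M \<omega> \<in> ideal2 M (points M) (Omega1 M (points M) V)" if "\<omega> \<in> set \<omega>s" for \<omega>
    using that g bs(1) by (auto simp: \<omega>s_def)
  obtain \<kappa> where \<kappa>: "\<kappa> \<in> charts_at M p0" using chart_cover[OF p0] by blast
  then have k: "\<kappa> \<in> atlas M" "p0 \<in> dom_of \<kappa>" by (auto dest: charts_atD)
  have sub: "set \<omega>s \<subseteq> Omega1 M (points M) (cotangent_space M)" using \<omega>V(1) Omega1_cotangent by blast
  have ind: "distinct (map (\<lambda>\<omega>. \<omega> p0) \<omega>s)" "independent (set (map (\<lambda>\<omega>. \<omega> p0) \<omega>s))"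
    using at0 bb by (auto simp: basis_list_def)
  show ?thesis
  proof (rule dual_fields[OF openin_topspace p0 sub \<kappa> ind])
    fix W1 X assume W1: "openin (mtop M) W1" "p0 \<in> W1" "W1 \<subseteq> points M" "W1 \<subseteq> dom_of \<kappa>"
      and dual: "\<And>p a c. p \<in> W1 \<Longrightarrow> a < length \<omega>s \<Longrightarrow> c < length \<omega>s \<Longrightarrow> (\<omega>s ! c) p \<kappa> (X a p) = (if a = c then 1 else 0)"
    \<comment> \<open>Duality keeps the sections independent on \<open>W1\<close>, and constant rank
      then makes them a basis of \<open>V p\<close>.\<close>
    have bp: "basis_list (map (\<lambda>\<omega>. \<omega> p) \<omega>s) (V p)" if p: "p \<in> W1" for p
    proof (rule basis_list_dual[where X="\<lambda>a. X a p" and \<kappa>=\<kappa>])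
      show "\<omega> p \<in> V p" if "\<omega> \<in> set \<omega>s" for \<omega> using \<omega>V(1)[OF that] p W1 by (auto simp: Omega1_iff)
      show "has_rank (length \<omega>s) (V p)" using r p W1 len by auto
    qed (rule dual[OF p])
    let ?U = "map_of_chart \<kappa> ` (dom_of \<kappa> \<inter> W1)" and ?x0 = "map_of_chart \<kappa> p0"
    define w where "w a x v = (\<omega>s ! a) (chart_inv \<kappa> x) \<kappa> v" for a x v
    have \<omega>W: "\<omega>s ! a \<in> Omega1 M W1 V" if "a < r" for a
      using that len by (intro Omega1_subset[OF \<omega>V(1) openin_topspace W1(1,3)]) simp
    have U: "open ?U" "?x0 \<in> ?U" using open_image[OF k(1) W1(1)] k W1 by auto
    have Uq: "\<exists>q\<in>W1. x = map_of_chart \<kappa> q \<and> chart_inv \<kappa> x = q \<and> \<kappa> \<in> charts_at M q" if "x \<in> ?U" for x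
      using that k(1) by (auto simp: charts_at_def)
    have lin: "linear (w a x)" if a: "a < r" and x: "x \<in> ?U" for a x
    proof -
      obtain q where q: "q \<in> W1" "chart_inv \<kappa> x = q" "\<kappa> \<in> charts_at M q" using Uq[OF x] by blast
      then have "(\<omega>s ! a) q \<in> cotangent_space M q" using \<omega>W[OF a] by (simp add: Omega1_iff)
      from cotangent_linear[OF this q(3)] show ?thesis using q(2) by (simp add: w_def[abs_def])
    qed
    have sm: "smooth_on ?U (\<lambda>x. w a x v)" if "a < r" for a v
      unfolding w_def by (rule Omega1_chart_smooth[OF \<omega>W[OF that] k(1)])
    have ind': "\<forall>a<r. c a = 0" if c: "\<And>v. (\<Sum>a<r. c a * w a ?x0 v) = 0" for c
    proof (intro allI impI)
      fix a assume a: "a < r"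
      have "(\<Sum>b<r. c b * w b ?x0 (X a p0)) = (\<Sum>b<r. if b = a then c b else 0)"
        using dual[OF W1(2)] a len k by (intro sum.cong) (auto simp: w_def)
      then show "c a = 0" using c[of "X a p0"] a by simp
    qed
    have closed: "frechet_derivative (\<lambda>y. w c y v) (at x) u = frechet_derivative (\<lambda>y. w c y u) (at x) v"
      if x: "x \<in> ?U" and c: "c < r" and u: "\<And>a. a < r \<Longrightarrow> w a x u = 0" and v: "\<And>a. a < r \<Longrightarrow> w a x v = 0" for x u v c
    proof -
      obtain q where q: "q \<in> W1" "x = map_of_chart \<kappa> q" "chart_inv \<kappa> x = q" "\<kappa> \<in> charts_at M q" using Uq[OF x] by blast
      have qM: "q \<in> points M" using q(1) W1(3) by blast
      \<comment> \<open>The sections span \<open>V q\<close>, so a vector on which they vanish is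
        annihilated by all of \<open>V q\<close>, including the generators in the ideal
        representation of the differential.\<close>
      have kill: "\<alpha> \<kappa> z = 0" if \<alpha>: "\<alpha> \<in> V q" and z: "\<And>a. a < r \<Longrightarrow> w a x z = 0" for \<alpha> z
      proof -
        have "\<alpha> \<in> span (set (map (\<lambda>\<omega>. \<omega> q) \<omega>s))" using bp[OF q(1)] \<alpha> by (simp add: basis_list_def)
        then show ?thesis
        proof (induction rule: span_induct)
          case base show ?case by (simp add: subspace_def)
        next
          case (step y)
          then obtain a where "a < r" "y = (\<omega>s ! a) q" using len by (auto simp: in_set_conv_nth)
          then show ?case using z[of a] q(3) by (simp add: w_def)
        qed
      qed
      obtain n and \<tau> \<beta> :: "nat \<Rightarrow> ('m, 'e) form1" where \<tau>: "\<And>i. i < n \<Longrightarrow> \<tau> i \<in> Omega1 M (points M) V"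
        and d: "\<And>p. p \<in> points M \<Longrightarrow> ext_d M (\<omega>s ! c) p = (\<Sum>i<n. \<tau> i p \<and>\<^sub>w \<beta> i p)"
      proof -
        have "ext_d M (\<omega>s ! c) \<in> ideal2 M (points M) (Omega1 M (points M) V)" using \<omega>V(2) c len by simp
        then show thesis unfolding ideal2_def using that by blast
      qed
      have "\<tau> i q \<kappa> u = 0" "\<tau> i q \<kappa> v = 0" if "i < n" for i
        using kill[OF _ u] kill[OF _ v] \<tau>[OF that] qM by (simp_all add: Omega1_iff)
      then have "ext_d M (\<omega>s ! c) q \<kappa> u v = 0"
        unfolding d[OF qM] by (simp add: sum_fun_apply wedge_def)
      then show ?thesis using q by (simp add: ext_d_chart w_def)
    qed
    show ?thesis
    proof (rule frobenius_first_integrals[of ?U ?x0 r w])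
      fix U' f assume U': "open U'" "?x0 \<in> U'" "U' \<subseteq> ?U" and f: "\<And>a. a < r \<Longrightarrow> smooth_on U' (f a)"
        and fI: "\<And>a x. a < r \<Longrightarrow> x \<in> U' \<Longrightarrow> \<exists>k. \<forall>v. frechet_derivative (f a) (at x) v = (\<Sum>b<r. k b * w b x v)"
        and f0: "\<And>a v. a < r \<Longrightarrow> frechet_derivative (f a) (at ?x0) v = w a ?x0 v"
      define W2 where "W2 = {p \<in> dom_of \<kappa>. map_of_chart \<kappa> p \<in> U'}"
      define F where "F a p = f a (map_of_chart \<kappa> p)" for a p
      have W2: "openin (mtop M) W2" "p0 \<in> W2" "W2 \<subseteq> dom_of \<kappa>"
        using openin_preimage[OF k(1) U'(1)] k U' by (auto simp: W2_def)
      have W21: "W2 \<subseteq> W1"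
      proof
        fix q assume "q \<in> W2"
        then have q: "q \<in> dom_of \<kappa>" "map_of_chart \<kappa> q \<in> ?U" using U' by (auto simp: W2_def)
        then obtain q' where "q' \<in> dom_of \<kappa>" "q' \<in> W1" "map_of_chart \<kappa> q = map_of_chart \<kappa> q'" by auto
        then show "q \<in> W1" using q(1) chart_inv_map[OF k(1)] by metis
      qed
      have im: "map_of_chart \<kappa> ` W2 = U'"
      proof
        show "U' \<subseteq> map_of_chart \<kappa> ` W2" using U'(3) by (auto simp: W2_def)
      qed (auto simp: W2_def)
      have Finv: "F a (chart_inv \<kappa> x) = f a x" if "x \<in> U'" for a x
      proof -
        have "x \<in> map_of_chart \<kappa> ` W2" using that im by simp
        from chart_inv_image[OF k(1) W2(3) this] show ?thesis by (simp add: F_def)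
      qed
      have sF: "smooth_fun M W2 (F a)" if a: "a < r" for a
      proof (rule smooth_fun_chart[OF k(1) W2(1,3)])
        show "smooth_on (map_of_chart \<kappa> ` W2) (\<lambda>x. F a (chart_inv \<kappa> x))"
          unfolding im by (rule smooth_on_cong[OF U'(1) _ f[OF a]]) (simp add: Finv)
      qed
      have dF: "dform M (F a) p \<kappa> v = frechet_derivative (f a) (at (map_of_chart \<kappa> p)) v"
        if a: "a < r" and p: "p \<in> W2" for a p v
      proof -
        have \<kappa>p: "\<kappa> \<in> charts_at M p" using p W2(3) k by (auto simp: charts_at_def)
        have x: "map_of_chart \<kappa> p \<in> U'" using p by (simp add: W2_def)
        show ?thesis unfolding dform_chart[OF \<kappa>p]
          by (rule has_derivative_frechet_eq[OF has_derivative_transform_within_open[OF smooth_on_has_derivative[OF f[OF a] x] U'(1) x]])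
            (simp add: Finv)
      qed
      have cot: "dform M (F a) \<in> Omega1 M W2 (cotangent_space M)" if "a < r" for a
        by (rule dform_Omega1[OF W2(1) sF[OF that]])
      have in_V: "dform M (F a) p \<in> V p" if a: "a < r" and p: "p \<in> W2" for a p
      proof -
        have \<kappa>p: "\<kappa> \<in> charts_at M p" using p W2(3) k by (auto simp: charts_at_def)
        have pW: "p \<in> W1" using p W21 by blast
        obtain c where c: "\<And>v. frechet_derivative (f a) (at (map_of_chart \<kappa> p)) v = (\<Sum>b<r. c b * w b (map_of_chart \<kappa> p) v)"
          using fI[OF a, of "map_of_chart \<kappa> p"] p by (auto simp: W2_def)
        have s: "(\<Sum>b<r. c b *\<^sub>R (\<omega>s ! b) p) \<in> V p"
          using \<omega>W pW W1(3) pfaffian_subspace[OF V, of p]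
          by (intro subspace_sum subspace_scale) (auto simp: Omega1_iff)
        have "dform M (F a) p = (\<Sum>b<r. c b *\<^sub>R (\<omega>s ! b) p)"
        proof (rule cotangent_eqI[OF _ _ \<kappa>p])
          show "dform M (F a) p \<in> cotangent_space M p" using cot[OF a] p by (simp add: Omega1_iff)
          show "(\<Sum>b<r. c b *\<^sub>R (\<omega>s ! b) p) \<in> cotangent_space M p"
            using \<omega>W pW subspace_cotangent by (intro subspace_sum subspace_scale) (auto simp: Omega1_iff)
          show "dform M (F a) p \<kappa> v = (\<Sum>b<r. c b *\<^sub>R (\<omega>s ! b) p) \<kappa> v" for v
            using dF[OF a p, of v] c[of v] charts_atD[OF \<kappa>p] by (simp add: sum_fun_apply w_def)
        qed
        then show ?thesis using s by simp
      qed
      have dF0: "dform M (F a) p0 = bs ! a" if a: "a < r" for a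
      proof -
        have b: "(\<omega>s ! a) p0 = bs ! a" using arg_cong[OF at0, of "\<lambda>l. l ! a"] a len by simp
        have "dform M (F a) p0 = (\<omega>s ! a) p0"
        proof (rule cotangent_eqI[OF _ _ \<kappa>])
          show "dform M (F a) p0 \<in> cotangent_space M p0" using cot[OF a] W2(2) by (simp add: Omega1_iff)
          show "(\<omega>s ! a) p0 \<in> cotangent_space M p0" using \<omega>W[OF a] W1(2) by (simp add: Omega1_iff)
          show "dform M (F a) p0 \<kappa> v = (\<omega>s ! a) p0 \<kappa> v" for v
            using dF[OF a W2(2), of v] f0[OF a, of v] k by (simp add: w_def)
        qed
        then show ?thesis using b by simp
      qed
      show ?thesis
      proof (rule that[OF W2(1,2), of "map F [0..<r]"])
        show "smooth_fun M W2 f \<and> dform M f \<in> Omega1 M W2 V" if f: "f \<in> set (map F [0..<r])" for f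
        proof -
          obtain a where a: "a < r" "f = F a" using f by auto
          then show ?thesis using sF[OF a(1)] Omega1_mono[OF cot[OF a(1)] in_V[OF a(1)]] by simp
        qed
        have "map (\<lambda>f. dform M f p0) (map F [0..<r]) = bs"
          using dF0 lbs by (intro nth_equalityI) auto
        then show "basis_list (map (\<lambda>f. dform M f p0) (map F [0..<r])) (V p0)" using bb by simp
      qed
    qed (fact U lin sm ind' closed)+
  qed
qed

lemma dform_const: "dform M (\<lambda>_. c) p = 0"
  by (auto simp: dform_def fun_eq_iff)

text \<open>Two exchanges are made among the exact forms: a frame of \<open>K\<close> at
  \<open>p0\<close> is completed by exact forms \<sigma>, and these are completed by further exact
  forms \<tau>. Counting gives as many \<tau> as the frame of \<open>K\<close> has members, and
  subtracting from each \<tau> its \<sigma>-components moves it into \<open>K\<close>.\<close>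

lemma half_coframe:
  assumes V: "pfaffian_system M V" and stable: "\<And>p. p \<in> points M \<Longrightarrow> derived M V p = V p"
    and K: "pfaffian_system M K" "\<And>p. p \<in> points M \<Longrightarrow> K p \<subseteq> V p"
    and p0: "p0 \<in> points M"
  obtains W \<sigma> \<eta> e where "openin (mtop M) W" "p0 \<in> W" "set \<sigma> \<subseteq> Omega1 M W V" "set \<eta> \<subseteq> Omega1 M W K"
    "basis_list (map (\<lambda>\<omega>. \<omega> p0) (\<sigma> @ \<eta>)) (V p0)" "basis_list (map (\<lambda>\<omega>. \<omega> p0) \<eta>) (K p0)"
    "\<And>s p. s \<in> set \<sigma> \<Longrightarrow> p \<in> W \<Longrightarrow> ext_d M s p = 0"
    "\<And>a b. a < length \<eta> \<Longrightarrow> b < length \<sigma> \<Longrightarrow> smooth_fun M W (e a b)"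
    "\<And>a p. a < length \<eta> \<Longrightarrow> p \<in> W \<Longrightarrow> ext_d M (\<eta> ! a) p = (\<Sum>b<length \<sigma>. dform M (e a b) p \<and>\<^sub>w (\<sigma> ! b) p)"
proof (rule first_integral_coframe[OF V stable p0])
  fix W1 fs assume W1: "openin (mtop M) W1" "p0 \<in> W1"
    and fs: "\<And>f. f \<in> set fs \<Longrightarrow> smooth_fun M W1 f \<and> dform M f \<in> Omega1 M W1 V"
    and fs0: "basis_list (map (\<lambda>f. dform M f p0) fs) (V p0)"
  obtain r where r: "\<And>p. p \<in> points M \<Longrightarrow> has_rank r (V p)" using pfaffian_has_rank[OF V] by blast
  obtain W2 \<eta>0 where W2: "openin (mtop M) W2" "p0 \<in> W2" and \<eta>0: "local_frame M W2 \<eta>0 K"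
    using K(1) p0 unfolding pfaffian_system_def by metis
  define W where "W = W1 \<inter> W2"
  have W: "openin (mtop M) W" "p0 \<in> W" using W1 W2 by (auto simp: W_def)
  have WM: "W \<subseteq> points M" using W(1) openin_subset by blast
  have fsW: "smooth_fun M W f" "dform M f \<in> Omega1 M W V" if "f \<in> set fs" for f
    using fs[OF that] smooth_fun_subset[OF _ W1(1) W(1)] Omega1_subset[OF _ W1(1) W(1)] by (auto simp: W_def)
  have \<eta>0W: "set \<eta>0 \<subseteq> Omega1 M W K" "\<And>p. p \<in> W \<Longrightarrow> basis_list (map (\<lambda>\<omega>. \<omega> p) \<eta>0) (K p)"
    using \<eta>0 Omega1_subset[OF _ W2(1) W(1)] by (auto simp: local_frame_iff W_def)
  let ?g = "\<lambda>f. dform M f p0"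
  have gV: "?g ` set fs \<subseteq> V p0" "span (?g ` set fs) = V p0"
    using fs0 span_superset[of "?g ` set fs"] by (auto simp: basis_list_def)
  have V0: "subspace (V p0)" using pfaffian_subspace[OF V p0] .
  have span_eq: "span (set xs) = V p0" if "?g ` set fs \<subseteq> span (set xs)" "set xs \<subseteq> V p0" for xs
    using span_mono[OF that(1)] gV(2) span_minimal[OF that(2) V0] by (simp add: span_span)
  obtain \<sigma>f where \<sigma>f: "set \<sigma>f \<subseteq> set fs" "distinct (map (\<lambda>\<omega>. \<omega> p0) \<eta>0 @ map ?g \<sigma>f)"
    "independent (set (map (\<lambda>\<omega>. \<omega> p0) \<eta>0 @ map ?g \<sigma>f))" "?g ` set fs \<subseteq> span (set (map (\<lambda>\<omega>. \<omega> p0) \<eta>0 @ map ?g \<sigma>f))"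
    using extend_to_basis[of "map (\<lambda>\<omega>. \<omega> p0) \<eta>0" fs ?g] \<eta>0W(2)[OF W(2)] unfolding basis_list_def by blast
  have "set (map (\<lambda>\<omega>. \<omega> p0) \<eta>0) \<subseteq> K p0"
    using \<eta>0W(2)[OF W(2)] span_superset unfolding basis_list_def by blast
  then have "set (map (\<lambda>\<omega>. \<omega> p0) \<eta>0 @ map ?g \<sigma>f) \<subseteq> V p0"
    using K(2)[OF p0] \<sigma>f(1) gV(1) unfolding set_append set_map by blast
  from span_eq[OF \<sigma>f(4) this]
  have b1: "basis_list (map (\<lambda>\<omega>. \<omega> p0) \<eta>0 @ map ?g \<sigma>f) (V p0)"
    using \<sigma>f(2,3) unfolding basis_list_def by blast
  have ind\<sigma>: "distinct (map ?g \<sigma>f)" "independent (set (map ?g \<sigma>f))"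
    using \<sigma>f(2) independent_mono[OF \<sigma>f(3)] by auto
  obtain \<tau>f where \<tau>f: "set \<tau>f \<subseteq> set fs" "distinct (map ?g \<sigma>f @ map ?g \<tau>f)"
    "independent (set (map ?g \<sigma>f @ map ?g \<tau>f))" "?g ` set fs \<subseteq> span (set (map ?g \<sigma>f @ map ?g \<tau>f))"
    using extend_to_basis[OF ind\<sigma>, of fs ?g] by blast
  have "set (map ?g \<sigma>f @ map ?g \<tau>f) \<subseteq> V p0" using \<sigma>f(1) \<tau>f(1) gV(1) by auto
  from span_eq[OF \<tau>f(4) this]
  have b2: "basis_list (map ?g \<sigma>f @ map ?g \<tau>f) (V p0)"
    using \<tau>f(2,3) unfolding basis_list_def by blast
  have lens: "length \<eta>0 + length \<sigma>f = r" "length \<tau>f = length \<eta>0"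
    using basis_list_length[OF b1 r[OF p0]] basis_list_length[OF b2 r[OF p0]] by auto
  define \<sigma> where "\<sigma> = map (dform M) \<sigma>f"
  have \<sigma>V: "set \<sigma> \<subseteq> Omega1 M W V" using fsW(2) \<sigma>f(1) by (auto simp: \<sigma>_def)
  have \<eta>0V: "set \<eta>0 \<subseteq> Omega1 M W V"
  proof
    fix \<omega> assume "\<omega> \<in> set \<eta>0"
    then have \<omega>: "\<omega> \<in> Omega1 M W K" using \<eta>0W(1) by blast
    show "\<omega> \<in> Omega1 M W V"
    proof (rule Omega1_mono[OF \<omega>])
      fix p assume p: "p \<in> W"
      then have "\<omega> p \<in> K p" using \<omega> by (simp add: Omega1_iff)
      moreover have "K p \<subseteq> V p" using K(2) WM p by (simp add: subset_iff)
      ultimately show "\<omega> p \<in> V p" by (rule subsetD[rotated])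
    qed
  qed
  define L where "L = \<sigma> @ \<eta>0"
  have LV: "set L \<subseteq> Omega1 M W V" using \<sigma>V \<eta>0V by (simp add: L_def)
  have L0: "map (\<lambda>\<omega>. \<omega> p0) L = map ?g \<sigma>f @ map (\<lambda>\<omega>. \<omega> p0) \<eta>0" by (simp add: L_def \<sigma>_def)
  have indL: "distinct (map (\<lambda>\<omega>. \<omega> p0) L)" "independent (set (map (\<lambda>\<omega>. \<omega> p0) L))"
    unfolding L0 using \<sigma>f(2,3) by (auto simp: Un_commute)
  have lenL: "length L = r" using lens by (simp add: L_def \<sigma>_def)
  obtain \<kappa> where \<kappa>: "\<kappa> \<in> charts_at M p0" using chart_cover[OF p0] by blast
  then have k: "\<kappa> \<in> atlas M" "p0 \<in> dom_of \<kappa>" by (auto dest: charts_atD)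
  have LC: "set L \<subseteq> Omega1 M W (cotangent_space M)" using LV Omega1_cotangent by blast
  show ?thesis
  proof (rule dual_fields[OF W LC \<kappa> indL])
    fix W' X assume W': "openin (mtop M) W'" "p0 \<in> W'" "W' \<subseteq> W" "W' \<subseteq> dom_of \<kappa>"
      and dual: "\<And>p a c. p \<in> W' \<Longrightarrow> a < length L \<Longrightarrow> c < length L \<Longrightarrow> (L ! c) p \<kappa> (X a p) = (if a = c then 1 else 0)"
      and sX: "\<And>W'' \<alpha> V a. a < length L \<Longrightarrow> openin (mtop M) W'' \<Longrightarrow> W'' \<subseteq> W' \<Longrightarrow> \<alpha> \<in> Omega1 M W'' V \<Longrightarrow>
        smooth_fun M W'' (\<lambda>p. \<alpha> p \<kappa> (X a p))"
    have W'M: "p \<in> points M" if "p \<in> W'" for p using that W'(3) WM by blast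
    let ?n = "length \<sigma>" and ?m = "length \<eta>0"
    have bp: "basis_list (map (\<lambda>\<omega>. \<omega> p) L) (V p)" if p: "p \<in> W'" for p
    proof (rule basis_list_dual[where X="\<lambda>a. X a p" and \<kappa>=\<kappa>])
      show "\<omega> p \<in> V p" if "\<omega> \<in> set L" for \<omega>
      proof -
        have "\<omega> \<in> Omega1 M W V" "p \<in> W" using LV that p W'(3) by blast+
        then show ?thesis by (simp add: Omega1_iff)
      qed
      show "has_rank (length L) (V p)" using r W'M[OF p] lenL by simp
    qed (rule dual[OF p])
    have \<tau>V: "dform M f \<in> Omega1 M W' V" if "f \<in> set \<tau>f" for f
      using fsW(2)[of f] that \<tau>f(1) Omega1_subset[OF _ W(1) W'(1,3)] by blast
    have \<sigma>V': "\<sigma> ! b \<in> Omega1 M W' V" if "b < ?n" for b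
      using that \<sigma>V Omega1_subset[OF _ W(1) W'(1,3)] nth_mem by blast
    have \<eta>0K': "\<eta>0 ! b \<in> Omega1 M W' K" if "b < ?m" for b
      using that \<eta>0W(1) Omega1_subset[OF _ W(1) W'(1,3)] nth_mem by blast
    \<comment> \<open>Minus the component of the exact form along \<open>\<sigma> ! b\<close>, read
      off by the dual vector; adding this multiple of \<open>\<sigma> ! b\<close> removes the
      component.\<close>
    define e where "e a b p = - dform M (\<tau>f ! a) p \<kappa> (X b p)" for a b p
    have se: "smooth_fun M W' (e a b)" if "a < ?m" "b < ?n" for a b
      unfolding e_def
      using that lens by (intro smooth_fun_minus[OF W'(1)] sX[OF _ W'(1) order_refl \<tau>V]) (auto simp: L_def)
    \<comment> \<open>The exact form itself is treated as the summand with index \<open>?n\<close>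
      and constant coefficient 1. Then one rule for linear combinations covers smoothness and the
      differential, and this summand contributes 0 to the differential.\<close>
    define c where "c a b p = (if b = ?n then 1 else e a b p)" for a b p
    define \<omega> where "\<omega> a b = (if b = ?n then dform M (\<tau>f ! a) else \<sigma> ! b)" for a b
    define \<eta>a where "\<eta>a a p = (\<Sum>b\<le>?n. c a b p *\<^sub>R \<omega> a b p)" for a p
    have sc: "smooth_fun M W' (c a b)" if "a < ?m" "b \<in> {..?n}" for a b
      using that se smooth_fun_const[OF W'(1), of 1] unfolding c_def[abs_def] by (cases "b = ?n") auto
    have \<omega>V: "\<omega> a b \<in> Omega1 M W' V" if "a < ?m" "b \<in> {..?n}" for a b
      using that \<tau>V \<sigma>V' lens by (auto simp: \<omega>_def)
    have \<eta>aV: "\<eta>a a \<in> Omega1 M W' V" if "a < ?m" for a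
      unfolding \<eta>a_def using W'M
      by (intro Omega1_comb[OF W'(1) \<omega>V[OF that] sc[OF that] pfaffian_subspace[OF V]])
    have \<eta>a_eq: "\<eta>a a p = dform M (\<tau>f ! a) p + (\<Sum>b<?n. e a b p *\<^sub>R (\<sigma> ! b) p)" for a p
    proof -
      have "\<eta>a a p = c a ?n p *\<^sub>R \<omega> a ?n p + (\<Sum>b<?n. c a b p *\<^sub>R \<omega> a b p)"
        unfolding \<eta>a_def by (simp add: lessThan_Suc_atMost[symmetric])
      also have "(\<Sum>b<?n. c a b p *\<^sub>R \<omega> a b p) = (\<Sum>b<?n. e a b p *\<^sub>R (\<sigma> ! b) p)"
        by (rule sum.cong) (auto simp: c_def \<omega>_def)
      also have "c a ?n p *\<^sub>R \<omega> a ?n p = dform M (\<tau>f ! a) p" by (simp add: c_def \<omega>_def)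
      finally show ?thesis .
    qed
    \<comment> \<open>Expanded over \<sigma> and the frame of \<open>K\<close>, the exact form loses
      its \<sigma>-part by the correction, so only a combination of members of \<open>K\<close>
      remains.\<close>
    have \<eta>aK: "\<eta>a a p \<in> K p" if a: "a < ?m" and p: "p \<in> W'" for a p
    proof -
      have "dform M (\<tau>f ! a) p \<in> V p" using \<tau>V[of "\<tau>f ! a"] a lens p by (auto simp: Omega1_iff)
      then have "dform M (\<tau>f ! a) p \<in> span (set (map (\<lambda>\<omega>. \<omega> p) L))" using bp[OF p] by (simp add: basis_list_def)
      from basis_list_expansion[OF dual[OF p] this]
      have "dform M (\<tau>f ! a) p = (\<Sum>b<?n + ?m. dform M (\<tau>f ! a) p \<kappa> (X b p) *\<^sub>R (L ! b) p)"
        by (simp add: L_def)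
      also have "\<dots> = (\<Sum>b<?n. dform M (\<tau>f ! a) p \<kappa> (X b p) *\<^sub>R (L ! b) p) +
          (\<Sum>b<?m. dform M (\<tau>f ! a) p \<kappa> (X (?n + b) p) *\<^sub>R (L ! (?n + b)) p)"
        by (rule sum_lessThan_add)
      finally have "dform M (\<tau>f ! a) p = (\<Sum>b<?n. dform M (\<tau>f ! a) p \<kappa> (X b p) *\<^sub>R (\<sigma> ! b) p) +
          (\<Sum>b<?m. dform M (\<tau>f ! a) p \<kappa> (X (?n + b) p) *\<^sub>R (\<eta>0 ! b) p)"
        by (simp add: L_def nth_append)
      moreover have "(\<Sum>b<?n. e a b p *\<^sub>R (\<sigma> ! b) p) = - (\<Sum>b<?n. dform M (\<tau>f ! a) p \<kappa> (X b p) *\<^sub>R (\<sigma> ! b) p)"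
        by (simp add: e_def sum_negf)
      ultimately have "\<eta>a a p = (\<Sum>b<?m. dform M (\<tau>f ! a) p \<kappa> (X (?n + b) p) *\<^sub>R (\<eta>0 ! b) p)"
        unfolding \<eta>a_eq by (rule add_cancel_summand)
      moreover have "\<dots> \<in> K p"
        using \<eta>0K' p pfaffian_subspace[OF K(1) W'M[OF p]]
        by (intro subspace_sum subspace_scale) (auto simp: Omega1_iff)
      ultimately show ?thesis by simp
    qed
    define \<eta> where "\<eta> = map \<eta>a [0..<?m]"
    have \<sigma>0: "(\<lambda>\<omega>. \<omega> p0) ` set \<sigma> \<subseteq> span (set (map (\<lambda>\<omega>. \<omega> p0) (\<sigma> @ \<eta>)))"
      by (auto intro: span_base)
    \<comment> \<open>Conversely each exact form \<tau> is recovered from \<eta> and \<sigma>, so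
      these span \<open>V p0\<close>; their number equals the rank, hence they form a basis.\<close>
    have \<tau>0: "?g ` set \<tau>f \<subseteq> span (set (map (\<lambda>\<omega>. \<omega> p0) (\<sigma> @ \<eta>)))"
    proof
      fix x assume "x \<in> ?g ` set \<tau>f"
      then obtain a where a: "a < ?m" "x = dform M (\<tau>f ! a) p0" using lens by (auto simp: in_set_conv_nth)
      then have "x = \<eta>a a p0 - (\<Sum>b<?n. e a b p0 *\<^sub>R (\<sigma> ! b) p0)" by (simp add: \<eta>a_eq)
      also have "\<dots> \<in> span (set (map (\<lambda>\<omega>. \<omega> p0) (\<sigma> @ \<eta>)))"
        using a(1) by (intro span_diff span_sum span_scale span_base) (auto simp: \<eta>_def)
      finally show "x \<in> span (set (map (\<lambda>\<omega>. \<omega> p0) (\<sigma> @ \<eta>)))" .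
    qed
    have sp: "V p0 \<subseteq> span (set (map (\<lambda>\<omega>. \<omega> p0) (\<sigma> @ \<eta>)))"
    proof -
      have "V p0 = span (set (map ?g \<sigma>f @ map ?g \<tau>f))" using b2 by (simp add: basis_list_def)
      also have "\<dots> \<subseteq> span (set (map (\<lambda>\<omega>. \<omega> p0) (\<sigma> @ \<eta>)))"
        using \<sigma>0 \<tau>0 by (intro span_minimal) (auto simp: \<sigma>_def)
      finally show ?thesis .
    qed
    have "set (map (\<lambda>\<omega>. \<omega> p0) (\<sigma> @ \<eta>)) \<subseteq> V p0"
      using \<sigma>V W(2) \<eta>aV W'(2) by (auto simp: Omega1_iff \<eta>_def)
    then have "span (set (map (\<lambda>\<omega>. \<omega> p0) (\<sigma> @ \<eta>))) = V p0"
      using sp span_minimal[OF _ V0] by blast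
    then have B1: "basis_list (map (\<lambda>\<omega>. \<omega> p0) (\<sigma> @ \<eta>)) (V p0)"
      by (rule basis_listI_spanning) (use r[OF p0] lens in \<open>simp add: \<sigma>_def \<eta>_def add.commute\<close>)
    have B2: "basis_list (map (\<lambda>\<omega>. \<omega> p0) \<eta>) (K p0)"
    proof (rule basis_listI_independent)
      show "distinct (map (\<lambda>\<omega>. \<omega> p0) \<eta>)" using B1 by (simp add: basis_list_def)
      have "independent (set (map (\<lambda>\<omega>. \<omega> p0) (\<sigma> @ \<eta>)))" using B1 by (simp add: basis_list_def)
      then show "independent (set (map (\<lambda>\<omega>. \<omega> p0) \<eta>))" by (rule independent_mono) auto
      show "set (map (\<lambda>\<omega>. \<omega> p0) \<eta>) \<subseteq> K p0" using \<eta>aK W'(2) by (auto simp: \<eta>_def)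
      show "has_rank (length (map (\<lambda>\<omega>. \<omega> p0) \<eta>)) (K p0)"
        using basis_list_has_rank[OF \<eta>0W(2)[OF W(2)]] by (simp add: \<eta>_def)
    qed
    have closed: "ext_d M (dform M f) p = 0" if "f \<in> set fs" "p \<in> W'" for f p
      using ext_d_dform[OF W(1) fsW(1)[OF that(1)], of p] that W' by blast
    show ?thesis
    proof (rule that[OF W'(1,2) _ _ B1 B2])
      show "set \<sigma> \<subseteq> Omega1 M W' V" using \<sigma>V' by (auto simp: in_set_conv_nth)
      show "set \<eta> \<subseteq> Omega1 M W' K" using Omega1_mono[OF \<eta>aV \<eta>aK] by (auto simp: \<eta>_def)
      show "ext_d M s p = 0" if "s \<in> set \<sigma>" "p \<in> W'" for s p
        using that closed \<sigma>f(1) by (auto simp: \<sigma>_def)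
      show "smooth_fun M W' (e a b)" if "a < length \<eta>" "b < ?n" for a b
        using se that by (simp add: \<eta>_def)
      show "ext_d M (\<eta> ! a) p = (\<Sum>b<?n. dform M (e a b) p \<and>\<^sub>w (\<sigma> ! b) p)" if a: "a < length \<eta>" and p: "p \<in> W'" for a p
      proof -
        have a': "a < ?m" using a by (simp add: \<eta>_def)
        have d0: "ext_d M (\<omega> a b) p = 0" if "b \<in> {..?n}" for b
          using that closed[OF _ p] \<sigma>f(1) \<tau>f(1) a' lens by (auto simp: \<omega>_def \<sigma>_def subset_iff)
        have "ext_d M (\<eta>a a) p = (\<Sum>b\<le>?n. dform M (c a b) p \<and>\<^sub>w \<omega> a b p + c a b p *\<^sub>R ext_d M (\<omega> a b) p)"
          unfolding \<eta>a_def by (rule ext_d_comb[OF W'(1) p \<omega>V[OF a'] sc[OF a']])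
        also have "\<dots> = (\<Sum>b\<le>?n. dform M (c a b) p \<and>\<^sub>w \<omega> a b p)"
          by (rule sum.cong) (simp_all add: d0)
        also have "\<dots> = dform M (c a ?n) p \<and>\<^sub>w \<omega> a ?n p + (\<Sum>b<?n. dform M (c a b) p \<and>\<^sub>w \<omega> a b p)"
          by (simp add: lessThan_Suc_atMost[symmetric])
        also have "dform M (c a ?n) p \<and>\<^sub>w \<omega> a ?n p = 0"
          using dform_const[of 1 p] by (simp add: c_def[abs_def] wedge_def fun_eq_iff)
        also have "(\<Sum>b<?n. dform M (c a b) p \<and>\<^sub>w \<omega> a b p) = (\<Sum>b<?n. dform M (e a b) p \<and>\<^sub>w (\<sigma> ! b) p)"
          by (rule sum.cong) (auto simp: c_def[abs_def] \<omega>_def)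
        finally show ?thesis using a' by (simp add: \<eta>_def)
      qed
    qed
  qed
qed

end


section \<open>Darboux pairs\<close>

lemma basis_list_perm: "mset xs = mset ys \<Longrightarrow> basis_list xs S \<Longrightarrow> basis_list ys S"
  unfolding basis_list_def using mset_eq_imp_distinct_iff mset_eq_setD by metis

lemma independent_append:
  assumes "basis_list xs A" "basis_list ys B" "A \<inter> B \<subseteq> {0}"
  shows "distinct (xs @ ys)" "independent (set (xs @ ys))"
proof -
  have x: "distinct xs" "independent (set xs)" "span (set xs) = A" using assms(1) by (auto simp: basis_list_def)
  have y: "distinct ys" "independent (set ys)" "span (set ys) = B" using assms(2) by (auto simp: basis_list_def)
  have sA: "subspace A" and sB: "subspace B" using x(3) y(3) by auto
  have "set xs \<subseteq> A" "set ys \<subseteq> B" using x(3) y(3) span_superset by blast+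
  then have "set xs \<inter> set ys \<subseteq> {0}" using assms(3) by blast
  moreover have "0 \<notin> set xs" using x(2) dependent_zero by blast
  ultimately have disj: "set xs \<inter> set ys = {}" by blast
  then show "distinct (xs @ ys)" using x y by simp
  \<comment> \<open>If a member \<open>z\<close> of \<open>C\<close> depends on the remaining
    vectors, the dependence splits between \<open>C - {z}\<close> and \<open>D\<close>. The part
    from \<open>D\<close> lies in both spans and is 0, so \<open>z\<close> already depends on the
    rest of \<open>C\<close>.\<close>
  have key: False if "z \<in> C" "independent C" "z \<in> span ((C \<union> D) - {z})" "z \<notin> D" "span C \<inter> span D \<subseteq> {0}"
    for z :: 'a and C D
  proof -
    have "(C \<union> D) - {z} = (C - {z}) \<union> D" using that(4) by blast
    then have "z \<in> {x + y |x y. x \<in> span (C - {z}) \<and> y \<in> span D}" using that(3) span_Un[of "C - {z}" D] by auto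
    then obtain a b where ab: "z = a + b" "a \<in> span (C - {z})" "b \<in> span D" by blast
    have "a \<in> span C" using ab(2) span_mono[of "C - {z}" C] by blast
    moreover have "z \<in> span C" using that(1) by (rule span_base)
    ultimately have "z - a \<in> span C" by (rule span_diff[rotated])
    moreover have "z - a = b" using ab(1) by simp
    ultimately have "b = 0" using ab(3) that(5) by auto
    then have "z \<in> span (C - {z})" using ab by simp
    then show False using that(1,2) unfolding dependent_def by blast
  qed
  show "independent (set (xs @ ys))"
  proof
    assume "dependent (set (xs @ ys))"
    then obtain z where z: "z \<in> set xs \<union> set ys" "z \<in> span (set xs \<union> set ys - {z})" unfolding dependent_def by auto
    show False
    proof (cases "z \<in> set xs")
      case True
      show False by (rule key[OF True x(2) z(2)]) (use True disj x y assms(3) in auto)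
    next
      case False
      then have zy: "z \<in> set ys" using z(1) by blast
      have z': "z \<in> span (set ys \<union> set xs - {z})" using z(2) by (simp add: Un_commute)
      show False by (rule key[OF zy y(2) z' False]) (use x y assms(3) in auto)
    qed
  qed
qed

lemma independent_span_Int:
  assumes "distinct (xs @ ys)" "independent (set (xs @ ys))"
  shows "span (set xs) \<inter> span (set ys) \<subseteq> {0}"
proof
  fix z assume z: "z \<in> span (set xs) \<inter> span (set ys)"
  obtain u where u: "z = (\<Sum>v\<in>set xs. u v *\<^sub>R v)" using z span_finite[of "set xs"] by auto
  obtain w where w: "z = (\<Sum>v\<in>set ys. w v *\<^sub>R v)" using z span_finite[of "set ys"] by auto
  have disj: "set xs \<inter> set ys = {}" using assms(1) by simp
  define c where "c v = (if v \<in> set xs then u v else - w v)" for v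
  have "(\<Sum>v\<in>set xs \<union> set ys. c v *\<^sub>R v) = (\<Sum>v\<in>set xs. c v *\<^sub>R v) + (\<Sum>v\<in>set ys. c v *\<^sub>R v)"
    by (rule sum.union_disjoint) (use disj in auto)
  also have "(\<Sum>v\<in>set xs. c v *\<^sub>R v) = z" unfolding u by (rule sum.cong) (auto simp: c_def)
  also have "(\<Sum>v\<in>set ys. c v *\<^sub>R v) = - z" unfolding w sum_negf[symmetric]
    by (rule sum.cong) (use disj in \<open>auto simp: c_def\<close>)
  finally have "(\<Sum>v\<in>set xs \<union> set ys. c v *\<^sub>R v) = 0" by (simp only: add.right_inverse)
  then have "c v = 0" if "v \<in> set xs" for v
    using independentD[OF assms(2), of "set xs \<union> set ys" c v] that by simp
  then have "z = 0" unfolding u by (intro sum.neutral) (auto simp: c_def)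
  then show "z \<in> {0}" by simp
qed

lemma pfaffian_length_rank:
  assumes "pfaffian_system M V" "p0 \<in> points M" "basis_list xs (V p0)" "p \<in> points M"
  shows "has_rank (length xs) (V p)"
proof -
  obtain r where r: "\<And>p. p \<in> points M \<Longrightarrow> has_rank r (V p)" using pfaffian_has_rank[OF assms(1)] by blast
  then have "length xs = r" using basis_list_length[OF assms(3)] assms(2) by blast
  then show ?thesis using r[OF assms(4)] by simp
qed

text \<open>The ranks do not depend on the point and do not increase along the flag, so two
  consecutive ones agree; inclusion with equal rank is equality, at all points for the same
  index.\<close>

lemma derived_stabilizes:
  assumes pf: "\<And>k. pfaffian_system M ((derived M ^^ k) V)" and p0: "p0 \<in> points M"
  shows "\<exists>N. \<forall>p\<in>points M. (derived M ^^ Suc N) V p = (derived M ^^ N) V p"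
proof -
  have "\<exists>r. \<forall>p\<in>points M. has_rank r ((derived M ^^ k) V p)" for k
  proof (rule pfaffian_has_rank[OF pf[of k]])
    fix r assume "\<And>p. p \<in> points M \<Longrightarrow> has_rank r ((derived M ^^ k) V p)"
    then show ?thesis by (intro exI[of _ r] ballI)
  qed
  then obtain rk where rk: "\<And>k p. p \<in> points M \<Longrightarrow> has_rank (rk k) ((derived M ^^ k) V p)" by metis
  have sub: "(derived M ^^ Suc k) V p \<subseteq> (derived M ^^ k) V p" if "p \<in> points M" for k p
    using derived_subset[where V="(derived M ^^ k) V" and p=p, OF pfaffian_subspace[OF pf[of k] that] that] by simp
  have mono: "rk (Suc k) \<le> rk k" for k
  proof -
    obtain B where B: "finite B" "card B = rk k" "span B = (derived M ^^ k) V p0"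
      using rk[OF p0, of k] by (auto simp: has_rank_def)
    obtain C where C: "finite C" "independent C" "card C = rk (Suc k)" "span C = (derived M ^^ Suc k) V p0"
      using rk[OF p0, of "Suc k"] by (auto simp: has_rank_def)
    have "C \<subseteq> span B" using sub[OF p0, of k] B(3) C(4) span_superset[of C] by blast
    from independent_span_bound[OF B(1) C(2) this] show ?thesis using B C by simp
  qed
  have "\<exists>N. rk (Suc N) = rk N"
  proof (rule ccontr)
    assume "\<not> ?thesis"
    then have "rk (Suc k) < rk k" for k using mono[of k] by (simp add: order_less_le)
    then have "rk k + k \<le> rk 0" for k
    proof (induction k)
      case (Suc k)
      then show ?case using Suc.prems[of k] Suc.IH by fastforce
    qed simp
    from this[of "Suc (rk 0)"] show False by simp
  qed
  then obtain N where N: "rk (Suc N) = rk N" by blast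
  have "(derived M ^^ Suc N) V p = (derived M ^^ N) V p" if p: "p \<in> points M" for p
  proof -
    obtain B where B: "finite B" "card B = rk N" "span B = (derived M ^^ N) V p"
      using rk[OF p, of N] by (auto simp: has_rank_def)
    obtain C where C: "finite C" "independent C" "card C = rk (Suc N)" "span C = (derived M ^^ Suc N) V p"
      using rk[OF p, of "Suc N"] by (auto simp: has_rank_def)
    have "C \<subseteq> span B" using sub[OF p, of N] B(3) C(4) span_superset[of C] by blast
    then have "span C = span B" using independent_spans[OF B(1) C(2)] B C N by simp
    then show ?thesis using B C by simp
  qed
  then show ?thesis by blast
qed

lemma last_derived_facts:
  assumes pf: "\<And>k. pfaffian_system M ((derived M ^^ k) V)" and p0: "p0 \<in> points M"
  shows "pfaffian_system M (last_derived M V)"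
    and "\<And>p. p \<in> points M \<Longrightarrow> derived M (last_derived M V) p = last_derived M V p"
    and "\<And>p. p \<in> points M \<Longrightarrow> last_derived M V p \<subseteq> V p"
proof -
  define N where "N = (LEAST N. \<forall>p\<in>points M. (derived M ^^ Suc N) V p = (derived M ^^ N) V p)"
  have L: "last_derived M V = (derived M ^^ N) V" by (simp add: last_derived_def N_def)
  show "pfaffian_system M (last_derived M V)" unfolding L by (rule pf)
  have "\<forall>p\<in>points M. (derived M ^^ Suc N) V p = (derived M ^^ N) V p"
    unfolding N_def by (rule LeastI_ex[OF derived_stabilizes[OF pf p0]])
  then show "derived M (last_derived M V) p = last_derived M V p" if "p \<in> points M" for p
    using that by (simp add: L)
  show "last_derived M V p \<subseteq> V p" if p: "p \<in> points M" for p
  proof -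
    have "(derived M ^^ k) V p \<subseteq> V p" for k
    proof (induction k)
      case (Suc k)
      then show ?case using derived_subset[where V="(derived M ^^ k) V" and p=p, OF pfaffian_subspace[OF pf[of k] p] p] by auto
    qed simp
    then show ?thesis by (simp add: L)
  qed
qed

section \<open>Exterior square of a space of covectors\<close>

lemma Lambda2_kill:
  assumes "\<xi> \<in> Lambda2 S" "\<And>\<alpha>. \<alpha> \<in> S \<Longrightarrow> \<alpha> \<kappa> u = 0"
  shows "\<xi> \<kappa> u v = 0" "\<xi> \<kappa> v u = 0"
proof -
  have "\<xi> \<kappa> u v = 0 \<and> \<xi> \<kappa> v u = 0"
    using assms(1) unfolding Lambda2_def
  proof (induction rule: span_induct)
    case base
    show ?case by (auto simp: subspace_def)
  next
    case (step y)
    then obtain \<alpha> \<beta> where y: "y = \<alpha> \<and>\<^sub>w \<beta>" "\<alpha> \<in> S" "\<beta> \<in> S" by blast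
    then show ?case using assms(2)[OF y(2)] assms(2)[OF y(3)] by (simp add: wedge_def)
  qed
  then show "\<xi> \<kappa> u v = 0" "\<xi> \<kappa> v u = 0" by auto
qed

lemma Lambda2_mono: "S \<subseteq> S' \<Longrightarrow> Lambda2 S \<subseteq> Lambda2 S'"
  unfolding Lambda2_def by (rule span_mono) blast

lemma wedge_expansion_real:
  fixes a b l m :: "nat \<Rightarrow> real"
  shows "(\<Sum>i<n. \<Sum>j<n. (1 / 2 * (a i * b j - a j * b i)) * (l i * m j - m i * l j)) =
    (\<Sum>i<n. a i * l i) * (\<Sum>j<n. b j * m j) - (\<Sum>i<n. a i * m i) * (\<Sum>j<n. b j * l j)"
proof -
  have p: "(\<Sum>i<n. \<Sum>j<n. f i * g j) = (\<Sum>i<n. f i) * (\<Sum>j<n. g j)" for f g :: "nat \<Rightarrow> real"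
    by (simp add: sum_product)
  have "(\<Sum>i<n. \<Sum>j<n. (1 / 2 * (a i * b j - a j * b i)) * (l i * m j - m i * l j)) =
    1 / 2 * ((\<Sum>i<n. \<Sum>j<n. (a i * l i) * (b j * m j)) - (\<Sum>i<n. \<Sum>j<n. (a i * m i) * (b j * l j))
      - (\<Sum>i<n. \<Sum>j<n. (b i * l i) * (a j * m j)) + (\<Sum>i<n. \<Sum>j<n. (b i * m i) * (a j * l j)))"
    unfolding sum_subtractf[symmetric] sum.distrib[symmetric] sum_distrib_left
    by (intro sum.cong refl) (simp add: algebra_simps)
  then show ?thesis unfolding p by (simp add: algebra_simps)
qed

text \<open>Both \<open>(i, j)\<close> and \<open>(j, i)\<close> occur in the double sum, hence the
  factor 1/2. Both sides are linear in \<open>\<xi>\<close>, so it suffices to treat products of two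
  covectors, where the identity is \<open>wedge_expansion_real\<close>.\<close>

lemma Lambda2_expansion:
  fixes X :: "nat \<Rightarrow> 'e" and \<omega>s :: "('m, 'e) form1 list"
  assumes dual: "\<And>a c. a < length \<omega>s \<Longrightarrow> c < length \<omega>s \<Longrightarrow> (\<omega>s ! c) p \<kappa> (X a) = (if a = c then 1 else 0)"
    and S: "S \<subseteq> span (set (map (\<lambda>\<omega>. \<omega> p) \<omega>s))" and \<xi>: "\<xi> \<in> Lambda2 S"
  shows "\<xi> = (\<Sum>i<length \<omega>s. \<Sum>j<length \<omega>s. (1 / 2 * \<xi> \<kappa> (X i) (X j)) *\<^sub>R ((\<omega>s ! i) p \<and>\<^sub>w (\<omega>s ! j) p))"
proof -
  define L where "L \<xi> = (\<Sum>i<length \<omega>s. \<Sum>j<length \<omega>s. (1 / 2 * \<xi> \<kappa> (X i) (X j)) *\<^sub>R ((\<omega>s ! i) p \<and>\<^sub>w (\<omega>s ! j) p))"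
    for \<xi> :: "('m, 'e) covector2"
  have l: "linear L"
    unfolding L_def
    by (rule linearI) (simp_all add: scaleR_add_left sum.distrib scaleR_sum_right distrib_left mult.left_commute)
  have "L \<xi> = \<xi>"
    using \<xi> unfolding Lambda2_def
  proof (induction rule: span_induct)
    case base
    show ?case by (simp add: subspace_def linear_0[OF l] linear_add[OF l] linear_scale[OF l])
  next
    case (step y)
    then obtain \<alpha> \<beta> where y: "y = \<alpha> \<and>\<^sub>w \<beta>" "\<alpha> \<in> S" "\<beta> \<in> S" by blast
    have \<alpha>: "\<alpha> = (\<Sum>a<length \<omega>s. \<alpha> \<kappa> (X a) *\<^sub>R (\<omega>s ! a) p)" and \<beta>: "\<beta> = (\<Sum>a<length \<omega>s. \<beta> \<kappa> (X a) *\<^sub>R (\<omega>s ! a) p)"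
      using basis_list_expansion[OF dual] S y by blast+
    have a: "\<alpha> \<kappa>' u = (\<Sum>a<length \<omega>s. \<alpha> \<kappa> (X a) * (\<omega>s ! a) p \<kappa>' u)" for \<kappa>' u
      using fun_cong[OF fun_cong[OF \<alpha>], of \<kappa>' u] by (simp only: sum_fun_apply scaleR_fun_apply real_scaleR_def)
    have b: "\<beta> \<kappa>' u = (\<Sum>a<length \<omega>s. \<beta> \<kappa> (X a) * (\<omega>s ! a) p \<kappa>' u)" for \<kappa>' u
      using fun_cong[OF fun_cong[OF \<beta>], of \<kappa>' u] by (simp only: sum_fun_apply scaleR_fun_apply real_scaleR_def)
    show ?case
    proof (intro ext)
      fix \<kappa>' u v
      have "L y \<kappa>' u v = (\<Sum>i<length \<omega>s. \<Sum>j<length \<omega>s. (1 / 2 * (\<alpha> \<kappa> (X i) * \<beta> \<kappa> (X j) - \<alpha> \<kappa> (X j) * \<beta> \<kappa> (X i))) *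
        ((\<omega>s ! i) p \<kappa>' u * (\<omega>s ! j) p \<kappa>' v - (\<omega>s ! i) p \<kappa>' v * (\<omega>s ! j) p \<kappa>' u))"
        unfolding L_def y(1) by (simp only: sum_fun_apply scaleR_fun_apply real_scaleR_def wedge_def)
      also have "\<dots> = \<alpha> \<kappa>' u * \<beta> \<kappa>' v - \<alpha> \<kappa>' v * \<beta> \<kappa>' u"
        unfolding wedge_expansion_real a[of \<kappa>' u] a[of \<kappa>' v] b[of \<kappa>' u] b[of \<kappa>' v] ..
      finally show "L y \<kappa>' u v = y \<kappa>' u v" by (simp add: y(1) wedge_def)
    qed
  qed
  then show ?thesis by (simp add: L_def)
qed

lemma wedge_sum_left: "(\<Sum>i\<in>I. c i *\<^sub>R \<alpha> i) \<and>\<^sub>w \<beta> = (\<Sum>i\<in>I. c i *\<^sub>R (\<alpha> i \<and>\<^sub>w \<beta>))"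
  by (intro ext) (simp add: wedge_def sum_fun_apply sum_distrib_right sum_subtractf[symmetric] algebra_simps sum_distrib_left)

lemma wedge_sum_right: "\<alpha> \<and>\<^sub>w (\<Sum>i\<in>I. c i *\<^sub>R \<beta> i) = (\<Sum>i\<in>I. c i *\<^sub>R (\<alpha> \<and>\<^sub>w \<beta> i))"
  by (intro ext) (simp add: wedge_def sum_fun_apply sum_distrib_right sum_subtractf[symmetric] algebra_simps sum_distrib_left)

lemma wedge_add_left: "(\<alpha> + \<alpha>') \<and>\<^sub>w \<beta> = \<alpha> \<and>\<^sub>w \<beta> + \<alpha>' \<and>\<^sub>w \<beta>"
  by (intro ext) (simp add: wedge_def algebra_simps)

lemma span_kill: "\<alpha> \<in> span S \<Longrightarrow> (\<And>\<beta>. \<beta> \<in> S \<Longrightarrow> \<beta> \<kappa> u = 0) \<Longrightarrow> \<alpha> \<kappa> u = 0"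
  for \<alpha> :: "('m, 'e) covector"
proof (induction rule: span_induct)
  case base
  show ?case by (simp add: subspace_def)
qed

context smooth_mfd
begin

text \<open>By induction along the flag: \<open>closed_in_derived\<close> passes a closed section of
  each term on to the next.\<close>

lemma closed_in_last_derived:
  assumes pf: "\<And>k. pfaffian_system M ((derived M ^^ k) V)"
    and W: "openin (mtop M) W" and \<omega>: "\<omega> \<in> Omega1 M W V"
    and closed: "\<And>q. q \<in> W \<Longrightarrow> ext_d M \<omega> q = 0"
  shows "\<omega> \<in> Omega1 M W (last_derived M V)"
proof -
  have "\<omega> \<in> Omega1 M W ((derived M ^^ k) V)" for k
  proof (induction k)
    case (Suc k)
    show ?case
      by (rule Omega1_mono[OF Suc])
        (use closed_in_derived[OF W _ Suc closed pfaffian_subspace[OF pf[of k]]] in auto)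
  qed (use \<omega> in simp)
  then show ?thesis by (simp add: last_derived_def)
qed

text \<open>The covectors that vanish on \<open>Z p\<close> are those of \<open>V p\<close>.
  Evaluating the differential of an \<eta> on \<open>z\<close> in \<open>Z p\<close> and on the dual
  vector of a \<sigma> gives 0 by the splitting, since \<open>V p\<close> annihilates
  \<open>z\<close> and \<open>V' p\<close> annihilates the dual vector. By \<open>d\<eta>\<close>
  the same value is that of \<open>dform M (e a b)\<close> on \<open>z\<close>. So this closed form
  lies in \<open>V\<close>, hence in the last derived system, and its expansion over \<sigma> and
  \<eta> yields the coefficients.\<close>

lemma eta_structure:
  fixes Y :: "nat \<Rightarrow> 'm \<Rightarrow> 'e"
  assumes pf: "\<And>k. pfaffian_system M ((derived M ^^ k) V)"
    and W: "openin (mtop M) W" "W \<subseteq> dom_of \<kappa>" "\<kappa> \<in> atlas M"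
    and \<sigma>: "\<And>p s. p \<in> W \<Longrightarrow> s \<in> set \<sigma> \<Longrightarrow> s p \<in> V p"
    and span: "\<And>p. p \<in> W \<Longrightarrow> last_derived M V p \<subseteq> span (set (map (\<lambda>\<omega>. \<omega> p) (\<sigma> @ \<eta>)))"
    and e: "\<And>a b. a < length \<eta> \<Longrightarrow> b < length \<sigma> \<Longrightarrow> smooth_fun M W (e a b)"
    and d\<eta>: "\<And>a p. a < length \<eta> \<Longrightarrow> p \<in> W \<Longrightarrow> ext_d M (\<eta> ! a) p = (\<Sum>b<length \<sigma>. dform M (e a b) p \<and>\<^sub>w (\<sigma> ! b) p)"
    and dual: "\<And>p a c. p \<in> W \<Longrightarrow> a < length (\<sigma> @ \<eta>) \<Longrightarrow> c < length (\<sigma> @ \<eta>) \<Longrightarrow> ((\<sigma> @ \<eta>) ! c) p \<kappa> (Y a p) = (if a = c then 1 else 0)"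
    and sY: "\<And>\<alpha> a V. a < length (\<sigma> @ \<eta>) \<Longrightarrow> \<alpha> \<in> Omega1 M W V \<Longrightarrow> smooth_fun M W (\<lambda>p. \<alpha> p \<kappa> (Y a p))"
    and split: "\<And>a p. a < length \<eta> \<Longrightarrow> p \<in> W \<Longrightarrow> \<exists>\<xi>\<in>Lambda2 (V p). \<exists>\<zeta>\<in>Lambda2 (V' p). ext_d M (\<eta> ! a) p = \<xi> + \<zeta>"
    and Z1: "\<And>p \<alpha>. p \<in> W \<Longrightarrow> \<alpha> \<in> cotangent_space M p \<Longrightarrow> (\<And>z. z \<in> Z p \<Longrightarrow> \<alpha> \<kappa> z = 0) \<Longrightarrow> \<alpha> \<in> V p"
    and Z2: "\<And>p \<alpha> z. p \<in> W \<Longrightarrow> \<alpha> \<in> V p \<Longrightarrow> z \<in> Z p \<Longrightarrow> \<alpha> \<kappa> z = 0"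
    and Y': "\<And>p \<alpha> b. p \<in> W \<Longrightarrow> \<alpha> \<in> V' p \<Longrightarrow> b < length \<sigma> \<Longrightarrow> \<alpha> \<kappa> (Y b p) = 0"
  shows "\<exists>E F. smooth_coeffs M W E \<and> smooth_coeffs M W F \<and>
    (\<forall>a<length \<eta>. \<forall>p\<in>W. ext_d M (\<eta> ! a) p = wedge_comb (E a) \<eta> \<sigma> p + wedge_comb (F a) \<sigma> \<sigma> p)"
proof -
  let ?n = "length \<sigma>" and ?m = "length \<eta>"
  have de_V: "dform M (e a b) p \<in> V p" if a: "a < ?m" and b: "b < ?n" and p: "p \<in> W" for a b p
  proof (rule Z1[OF p])
    show "dform M (e a b) p \<in> cotangent_space M p"
      using dform_Omega1[OF W(1) e[OF a b]] p by (simp add: Omega1_iff)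
    fix z assume z: "z \<in> Z p"
    obtain \<xi> \<zeta> where x: "\<xi> \<in> Lambda2 (V p)" "\<zeta> \<in> Lambda2 (V' p)" "ext_d M (\<eta> ! a) p = \<xi> + \<zeta>"
      using split[OF a p] by blast
    have "\<xi> \<kappa> z (Y b p) = 0"
      by (rule Lambda2_kill(1)[OF x(1)], rule Z2[OF p _ z], assumption)
    moreover have "\<zeta> \<kappa> z (Y b p) = 0"
      by (rule Lambda2_kill(2)[OF x(2)], rule Y'[OF p _ b], assumption)
    ultimately have "ext_d M (\<eta> ! a) p \<kappa> z (Y b p) = 0" by (simp add: x(3))
    moreover have "ext_d M (\<eta> ! a) p \<kappa> z (Y b p) =
      (\<Sum>c<?n. dform M (e a c) p \<kappa> z * (\<sigma> ! c) p \<kappa> (Y b p) - dform M (e a c) p \<kappa> (Y b p) * (\<sigma> ! c) p \<kappa> z)"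
      by (simp add: d\<eta>[OF a p] sum_fun_apply wedge_def)
    moreover have "\<dots> = (\<Sum>c<?n. if c = b then dform M (e a c) p \<kappa> z else 0)"
    proof (rule sum.cong)
      fix c assume "c \<in> {..<?n}"
      then have c: "c < ?n" by simp
      have "(\<sigma> ! c) p \<kappa> z = 0" using Z2[OF p \<sigma>[OF p] z] c by simp
      moreover have "(\<sigma> ! c) p \<kappa> (Y b p) = (if b = c then 1 else 0)"
        using dual[OF p, of b c] b c by (simp add: nth_append)
      ultimately show "dform M (e a c) p \<kappa> z * (\<sigma> ! c) p \<kappa> (Y b p) - dform M (e a c) p \<kappa> (Y b p) * (\<sigma> ! c) p \<kappa> z =
        (if c = b then dform M (e a c) p \<kappa> z else 0)" by simp
    qed simp
    ultimately show "dform M (e a b) p \<kappa> z = 0" using b by simp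
  qed
  have de_I: "dform M (e a b) \<in> Omega1 M W (last_derived M V)" if a: "a < ?m" and b: "b < ?n" for a b
  proof (rule closed_in_last_derived[OF pf W(1)])
    show "dform M (e a b) \<in> Omega1 M W V"
      by (rule Omega1_mono[OF dform_Omega1[OF W(1) e[OF a b]] de_V[OF a b]])
    show "ext_d M (dform M (e a b)) q = 0" if "q \<in> W" for q by (rule ext_d_dform[OF W(1) e[OF a b] that])
  qed
  \<comment> \<open>Coefficients outside the index ranges are set to 0, because
    \<open>smooth_coeffs\<close> asks for smoothness at all indices. \<open>E\<close> uses dual
    vectors shifted by \<open>?n\<close>, the positions of \<eta> in the list
    \<open>\<sigma> @ \<eta>\<close>.\<close>
  define E where "E a i j p = (if a < ?m \<and> i < ?m \<and> j < ?n then dform M (e a j) p \<kappa> (Y (?n + i) p) else 0)" for a i j p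
  define F where "F a i j p = (if a < ?m \<and> i < ?n \<and> j < ?n then dform M (e a j) p \<kappa> (Y i p) else 0)" for a i j p
  have "smooth_coeffs M W E" unfolding smooth_coeffs_def
  proof (intro allI)
    fix a i j
    show "smooth_fun M W (E a i j)"
    proof (cases "a < ?m \<and> i < ?m \<and> j < ?n")
      case True
      then show ?thesis using sY[OF _ de_I, of "?n + i" a j] by (simp add: E_def[abs_def])
    next
      case False
      then have "E a i j = (\<lambda>p. 0)" by (auto simp: E_def[abs_def])
      then show ?thesis using smooth_fun_const[OF W(1)] by simp
    qed
  qed
  moreover have "smooth_coeffs M W F" unfolding smooth_coeffs_def
  proof (intro allI)
    fix a i j
    show "smooth_fun M W (F a i j)"
    proof (cases "a < ?m \<and> i < ?n \<and> j < ?n")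
      case True
      then show ?thesis using sY[OF _ de_I, of i a j] by (simp add: F_def[abs_def])
    next
      case False
      then have "F a i j = (\<lambda>p. 0)" by (auto simp: F_def[abs_def])
      then show ?thesis using smooth_fun_const[OF W(1)] by simp
    qed
  qed
  moreover have "ext_d M (\<eta> ! a) p = wedge_comb (E a) \<eta> \<sigma> p + wedge_comb (F a) \<sigma> \<sigma> p" if a: "a < ?m" and p: "p \<in> W" for a p
  proof -
    have "dform M (e a j) p \<and>\<^sub>w (\<sigma> ! j) p =
      (\<Sum>i<?n. F a i j p *\<^sub>R ((\<sigma> ! i) p \<and>\<^sub>w (\<sigma> ! j) p)) + (\<Sum>i<?m. E a i j p *\<^sub>R ((\<eta> ! i) p \<and>\<^sub>w (\<sigma> ! j) p))" if j: "j < ?n" for j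
    proof -
      have "dform M (e a j) p \<in> span (set (map (\<lambda>\<omega>. \<omega> p) (\<sigma> @ \<eta>)))"
        using de_I[OF a j] p span[OF p] by (auto simp: Omega1_iff)
      from basis_list_expansion[OF dual[OF p] this]
      have "dform M (e a j) p = (\<Sum>i<?n + ?m. dform M (e a j) p \<kappa> (Y i p) *\<^sub>R ((\<sigma> @ \<eta>) ! i) p)" by simp
      also have "\<dots> = (\<Sum>i<?n. dform M (e a j) p \<kappa> (Y i p) *\<^sub>R ((\<sigma> @ \<eta>) ! i) p) +
          (\<Sum>i<?m. dform M (e a j) p \<kappa> (Y (?n + i) p) *\<^sub>R ((\<sigma> @ \<eta>) ! (?n + i)) p)"
        by (rule sum_lessThan_add)
      also have "(\<Sum>i<?n. dform M (e a j) p \<kappa> (Y i p) *\<^sub>R ((\<sigma> @ \<eta>) ! i) p) = (\<Sum>i<?n. F a i j p *\<^sub>R (\<sigma> ! i) p)"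
        by (rule sum.cong) (use a j in \<open>auto simp: F_def nth_append\<close>)
      also have "(\<Sum>i<?m. dform M (e a j) p \<kappa> (Y (?n + i) p) *\<^sub>R ((\<sigma> @ \<eta>) ! (?n + i)) p) = (\<Sum>i<?m. E a i j p *\<^sub>R (\<eta> ! i) p)"
        by (rule sum.cong) (use a j in \<open>auto simp: E_def\<close>)
      finally have de: "dform M (e a j) p = (\<Sum>i<?n. F a i j p *\<^sub>R (\<sigma> ! i) p) + (\<Sum>i<?m. E a i j p *\<^sub>R (\<eta> ! i) p)" .
      show ?thesis by (subst de) (simp only: wedge_add_left wedge_sum_left)
    qed
    then have "ext_d M (\<eta> ! a) p = (\<Sum>j<?n. (\<Sum>i<?n. F a i j p *\<^sub>R ((\<sigma> ! i) p \<and>\<^sub>w (\<sigma> ! j) p)) + (\<Sum>i<?m. E a i j p *\<^sub>R ((\<eta> ! i) p \<and>\<^sub>w (\<sigma> ! j) p)))"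
      unfolding d\<eta>[OF a p] by (intro sum.cong) auto
    also have "\<dots> = wedge_comb (F a) \<sigma> \<sigma> p + wedge_comb (E a) \<eta> \<sigma> p"
      unfolding sum.distrib wedge_comb_def by (intro arg_cong2[where f="(+)"] sum.swap)
    also have "\<dots> = wedge_comb (E a) \<eta> \<sigma> p + wedge_comb (F a) \<sigma> \<sigma> p" by (rule add.commute)
    finally show ?thesis .
  qed
  ultimately show ?thesis by blast
qed

end

section \<open>The structure equation of \<theta>\<close>

lemma sum_symmetric_blocks:
  fixes f :: "nat \<Rightarrow> nat \<Rightarrow> 'a::real_vector"
  assumes "\<And>i j. f i j = f j i"
  shows "(\<Sum>i<m + k. \<Sum>j<m + k. f i j) =
    (\<Sum>i<m. (\<Sum>j<m. f i j) + (\<Sum>j<k. 2 *\<^sub>R f i (m + j))) + (\<Sum>i<k. \<Sum>j<k. f (m + i) (m + j))"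
proof -
  \<comment> \<open>By symmetry the two mixed blocks are equal, which accounts for the factor
    2.\<close>
  have 1: "(\<Sum>i<k. \<Sum>j<m. f (m + i) j) = (\<Sum>i<m. \<Sum>j<k. f i (m + j))"
    by (subst sum.swap) (simp only: assms[of "m + _"])
  have 2: "(\<Sum>j<k. 2 *\<^sub>R f i (m + j)) = (\<Sum>j<k. f i (m + j)) + (\<Sum>j<k. f i (m + j))" for i
    by (simp only: scaleR_2 sum.distrib)
  show ?thesis
    unfolding 2 sum_lessThan_add sum.distrib 1 by (simp only: add.assoc)
qed

lemma sum_diagonal_blocks:
  fixes f :: "nat \<Rightarrow> nat \<Rightarrow> 'a::comm_monoid_add"
  assumes "\<And>i j. i < k \<Longrightarrow> j < l \<Longrightarrow> f i (k + j) = 0" "\<And>i j. i < k \<Longrightarrow> j < l \<Longrightarrow> f (k + j) i = 0"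
  shows "(\<Sum>i<k + l. \<Sum>j<k + l. f i j) = (\<Sum>i<k. \<Sum>j<k. f i j) + (\<Sum>i<l. \<Sum>j<l. f (k + i) (k + j))"
  unfolding sum_lessThan_add sum.distrib using assms by simp

lemma diff_eq_of_eq_add: "t = s + r \<Longrightarrow> t - r = s" for t :: "'a::ab_group_add"
  by simp

context smooth_mfd
begin

lemma ext_d_antisym: "ext_d M \<omega> p \<kappa> u v = - ext_d M \<omega> p \<kappa> v u"
  by (simp add: ext_d_def)

text \<open>Over the full coframe, terms with a factor in \<open>G\<close> belong to the ideal. Of
  the rest, mixed terms in \<sigma> and \<tau> vanish: of the two dual vectors one is annihilated by
  \<open>V p\<close> and the other by \<open>V' p\<close>, so both parts of the splitting are 0 on
  the pair.\<close>

lemma theta_structure: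
  fixes X :: "nat \<Rightarrow> 'm \<Rightarrow> 'e"
  assumes W: "openin (mtop M) W"
    and L: "L = G @ \<sigma> @ \<tau>" "set L \<subseteq> Omega1 M W (cotangent_space M)"
    and dual: "\<And>p a c. p \<in> W \<Longrightarrow> a < length L \<Longrightarrow> c < length L \<Longrightarrow> (L ! c) p \<kappa> (X a p) = (if a = c then 1 else 0)"
    and span: "\<And>p. p \<in> W \<Longrightarrow> cotangent_space M p \<subseteq> span (set (map (\<lambda>\<omega>. \<omega> p) L))"
    and sX: "\<And>a b. a < length L \<Longrightarrow> b < length L \<Longrightarrow> smooth_fun M W (\<lambda>p. ext_d M \<theta> p \<kappa> (X a p) (X b p))"
    and split: "\<And>p. p \<in> W \<Longrightarrow> \<exists>\<xi>\<in>Lambda2 (V p). \<exists>\<zeta>\<in>Lambda2 (V' p). ext_d M \<theta> p = \<xi> + \<zeta>"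
    and VV': "\<And>p. p \<in> W \<Longrightarrow> V p \<subseteq> cotangent_space M p" "\<And>p. p \<in> W \<Longrightarrow> V' p \<subseteq> cotangent_space M p"
    and V: "\<And>p \<alpha> j. p \<in> W \<Longrightarrow> \<alpha> \<in> V p \<Longrightarrow> j < length \<tau> \<Longrightarrow> \<alpha> \<kappa> (X (length G + (length \<sigma> + j)) p) = 0"
    and V': "\<And>p \<alpha> i. p \<in> W \<Longrightarrow> \<alpha> \<in> V' p \<Longrightarrow> i < length \<sigma> \<Longrightarrow> \<alpha> \<kappa> (X (length G + i) p) = 0"
  shows "\<exists>A B. (\<forall>i j. smooth_fun M W (A i j)) \<and> (\<forall>i j. smooth_fun M W (B i j)) \<and>
    (\<lambda>p. ext_d M \<theta> p - (wedge_comb A \<sigma> \<sigma> p + wedge_comb B \<tau> \<tau> p)) \<in> ideal2 M W (set G)"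
proof -
  let ?m = "length G" and ?k = "length \<sigma>" and ?l = "length \<tau>"
  define n where "n = ?m + (?k + ?l)"
  have n: "length L = n" by (simp add: L n_def)
  define c where "c i j p = 1 / 2 * ext_d M \<theta> p \<kappa> (X i p) (X j p)" for i j p
  have c_smooth: "smooth_fun M W (c i j)" if "i < n" "j < n" for i j
    unfolding c_def[abs_def] using that n by (intro smooth_fun_mult[OF W smooth_fun_const[OF W] sX]) auto
  have c_anti: "c i j p = - c j i p" for i j p
    unfolding c_def using ext_d_antisym[of \<theta> p \<kappa> "X i p" "X j p"] by simp
  have expansion: "ext_d M \<theta> p = (\<Sum>i<n. \<Sum>j<n. c i j p *\<^sub>R ((L ! i) p \<and>\<^sub>w (L ! j) p))" if p: "p \<in> W" for p
  proof -
    obtain \<xi> \<zeta> where x: "\<xi> \<in> Lambda2 (V p)" "\<zeta> \<in> Lambda2 (V' p)" "ext_d M \<theta> p = \<xi> + \<zeta>"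
      using split[OF p] by blast
    have "\<xi> \<in> Lambda2 (cotangent_space M p)" "\<zeta> \<in> Lambda2 (cotangent_space M p)"
      using x(1,2) Lambda2_mono[OF VV'(1)[OF p]] Lambda2_mono[OF VV'(2)[OF p]] by blast+
    then have "ext_d M \<theta> p \<in> Lambda2 (cotangent_space M p)"
      unfolding x(3) Lambda2_def by (rule span_add)
    from Lambda2_expansion[OF dual[OF p] span[OF p] this] show ?thesis by (simp only: n c_def)
  qed
  have cross: "c (?m + i) (?m + (?k + j)) p = 0" if p: "p \<in> W" and i: "i < ?k" and j: "j < ?l" for i j p
  proof -
    obtain \<xi> \<zeta> where x: "\<xi> \<in> Lambda2 (V p)" "\<zeta> \<in> Lambda2 (V' p)" "ext_d M \<theta> p = \<xi> + \<zeta>"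
      using split[OF p] by blast
    have "\<xi> \<kappa> (X (?m + i) p) (X (?m + (?k + j)) p) = 0"
      by (rule Lambda2_kill(2)[OF x(1)], rule V[OF p _ j], assumption)
    moreover have "\<zeta> \<kappa> (X (?m + i) p) (X (?m + (?k + j)) p) = 0"
      by (rule Lambda2_kill(1)[OF x(2)], rule V'[OF p _ i], assumption)
    ultimately show ?thesis by (simp add: c_def x(3))
  qed
  define A where "A i j p = (if i < ?k \<and> j < ?k then c (?m + i) (?m + j) p else 0)" for i j p
  define B where "B i j p = (if i < ?l \<and> j < ?l then c (?m + (?k + i)) (?m + (?k + j)) p else 0)" for i j p
  have sA: "smooth_fun M W (A i j)" for i j
  proof (cases "i < ?k \<and> j < ?k")
    case True
    then show ?thesis using c_smooth[of "?m + i" "?m + j"] by (simp add: A_def[abs_def] n_def)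
  next
    case False
    then have "A i j = (\<lambda>p. 0)" by (auto simp: A_def[abs_def])
    then show ?thesis using smooth_fun_const[OF W] by simp
  qed
  have sB: "smooth_fun M W (B i j)" for i j
  proof (cases "i < ?l \<and> j < ?l")
    case True
    then show ?thesis using c_smooth[of "?m + (?k + i)" "?m + (?k + j)"] by (simp add: B_def[abs_def] n_def)
  next
    case False
    then have "B i j = (\<lambda>p. 0)" by (auto simp: B_def[abs_def])
    then show ?thesis using smooth_fun_const[OF W] by simp
  qed
  \<comment> \<open>In the double sum a term with exactly one factor in \<open>G\<close> occurs as
    \<open>(g, j)\<close> and as \<open>(j, g)\<close>; both are collected under \<open>g\<close>,
    hence the weight 2. If both factors are in \<open>G\<close>, the two occurrences are collected
    under different members of \<open>G\<close>.\<close>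
  define k where "k g j p = (if j < ?m then 1 else 2) * c g j p" for g j p
  define \<beta> where "\<beta> g p = (\<Sum>j<n. k g j p *\<^sub>R (L ! j) p)" for g p
  have \<beta>: "\<beta> g \<in> Omega1 M W (cotangent_space M)" if g: "g < ?m" for g
    unfolding \<beta>_def
  proof (rule Omega1_comb[OF W _ _ subspace_cotangent])
    show "L ! j \<in> Omega1 M W (cotangent_space M)" if "j \<in> {..<n}" for j
      using that n L(2) by auto
    show "smooth_fun M W (k g j)" if "j \<in> {..<n}" for j
      unfolding k_def[abs_def]
      using that g by (intro smooth_fun_mult[OF W smooth_fun_const[OF W] c_smooth]) (auto simp: n_def)
  qed
  have main: "ext_d M \<theta> p = (\<Sum>g<?m. (G ! g) p \<and>\<^sub>w \<beta> g p) + (wedge_comb A \<sigma> \<sigma> p + wedge_comb B \<tau> \<tau> p)" if p: "p \<in> W" for p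
  proof -
    define f where "f i j = c i j p *\<^sub>R ((L ! i) p \<and>\<^sub>w (L ! j) p)" for i j
    \<comment> \<open>Antisymmetric coefficients times antisymmetric products give symmetric
      summands.\<close>
    have f_sym: "f i j = f j i" for i j
      unfolding f_def using c_anti[of i j p] by (auto simp: wedge_def fun_eq_iff algebra_simps)
    have "ext_d M \<theta> p = (\<Sum>i<n. \<Sum>j<n. f i j)" unfolding expansion[OF p] f_def ..
    also have "\<dots> = (\<Sum>i<?m. (\<Sum>j<?m. f i j) + (\<Sum>j<?k + ?l. 2 *\<^sub>R f i (?m + j))) +
        (\<Sum>i<?k + ?l. \<Sum>j<?k + ?l. f (?m + i) (?m + j))"
      unfolding n_def by (rule sum_symmetric_blocks[OF f_sym])
    also have "(\<Sum>i<?k + ?l. \<Sum>j<?k + ?l. f (?m + i) (?m + j)) =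
        (\<Sum>i<?k. \<Sum>j<?k. f (?m + i) (?m + j)) + (\<Sum>i<?l. \<Sum>j<?l. f (?m + (?k + i)) (?m + (?k + j)))"
    proof (rule sum_diagonal_blocks)
      show z: "f (?m + i) (?m + (?k + j)) = 0" if "i < ?k" "j < ?l" for i j
        unfolding f_def cross[OF p that] by simp
      show "f (?m + (?k + j)) (?m + i) = 0" if "i < ?k" "j < ?l" for i j
        using z[OF that] f_sym by metis
    qed
    also have "(\<Sum>i<?k. \<Sum>j<?k. f (?m + i) (?m + j)) = wedge_comb A \<sigma> \<sigma> p"
      unfolding wedge_comb_def by (intro sum.cong refl) (simp add: f_def A_def L nth_append)
    also have "(\<Sum>i<?l. \<Sum>j<?l. f (?m + (?k + i)) (?m + (?k + j))) = wedge_comb B \<tau> \<tau> p"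
      unfolding wedge_comb_def by (intro sum.cong refl) (simp add: f_def B_def L nth_append)
    also have "(\<Sum>i<?m. (\<Sum>j<?m. f i j) + (\<Sum>j<?k + ?l. 2 *\<^sub>R f i (?m + j))) = (\<Sum>g<?m. (G ! g) p \<and>\<^sub>w \<beta> g p)"
    proof (rule sum.cong[OF refl])
      fix g assume "g \<in> {..<?m}"
      then have g: "L ! g = G ! g" by (simp add: L nth_append)
      have "(G ! g) p \<and>\<^sub>w \<beta> g p = (\<Sum>j<?m + (?k + ?l). k g j p *\<^sub>R ((L ! g) p \<and>\<^sub>w (L ! j) p))"
        unfolding \<beta>_def wedge_sum_right g n_def ..
      also have "\<dots> = (\<Sum>j<?m. k g j p *\<^sub>R ((L ! g) p \<and>\<^sub>w (L ! j) p)) +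
        (\<Sum>j<?k + ?l. k g (?m + j) p *\<^sub>R ((L ! g) p \<and>\<^sub>w (L ! (?m + j)) p))"
        by (rule sum_lessThan_add)
      also have "(\<Sum>j<?m. k g j p *\<^sub>R ((L ! g) p \<and>\<^sub>w (L ! j) p)) = (\<Sum>j<?m. f g j)"
        by (rule sum.cong) (auto simp: k_def f_def)
      also have "(\<Sum>j<?k + ?l. k g (?m + j) p *\<^sub>R ((L ! g) p \<and>\<^sub>w (L ! (?m + j)) p)) = (\<Sum>j<?k + ?l. 2 *\<^sub>R f g (?m + j))"
        by (rule sum.cong) (auto simp: k_def f_def)
      finally show "(\<Sum>j<?m. f g j) + (\<Sum>j<?k + ?l. 2 *\<^sub>R f g (?m + j)) = (G ! g) p \<and>\<^sub>w \<beta> g p" by (rule sym)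
    qed
    finally show ?thesis .
  qed
  have "(\<lambda>p. ext_d M \<theta> p - (wedge_comb A \<sigma> \<sigma> p + wedge_comb B \<tau> \<tau> p)) \<in> ideal2 M W (set G)"
    unfolding ideal2_def mem_Collect_eq
  proof (rule exI[of _ ?m], rule exI[of _ "\<lambda>g. G ! g"], rule exI[of _ \<beta>], intro conjI ballI)
    show "\<forall>i<?m. G ! i \<in> set G \<and> \<beta> i \<in> Omega1 M W (cotangent_space M)" using \<beta> by simp
    show "ext_d M \<theta> p - (wedge_comb A \<sigma> \<sigma> p + wedge_comb B \<tau> \<tau> p) = (\<Sum>i<?m. (G ! i) p \<and>\<^sub>w \<beta> i p)" if "p \<in> W" for p
      by (rule diff_eq_of_eq_add[OF main[OF that]])
  qed
  with sA sB show ?thesis by blast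
qed

end

text \<open>Condition (iii) is stated for sections over all of M. A local section is replaced by a
  global one that agrees with it near \<open>p\<close> and so has the same differential
  there.\<close>

lemma (in smooth_mfd) ext_d_split:
  assumes iii: "\<And>\<omega>. \<omega> \<in> Omega1 M (points M) T \<Longrightarrow>
      \<exists>\<xi>\<in>Omega2 M (points M) V. \<exists>\<zeta>\<in>Omega2 M (points M) V'. \<forall>p\<in>points M. ext_d M \<omega> p = \<xi> p + \<zeta> p"
    and T: "\<And>p. p \<in> points M \<Longrightarrow> subspace (T p)"
    and W: "openin (mtop M) W" "p \<in> W" and \<omega>: "\<omega> \<in> Omega1 M W T"
  shows "\<exists>\<xi>\<in>Lambda2 (V p). \<exists>\<zeta>\<in>Lambda2 (V' p). ext_d M \<omega> p = \<xi> + \<zeta>"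
proof (rule extend_form[OF W \<omega> T])
  fix \<omega>' W' assume \<omega>': "\<omega>' \<in> Omega1 M (points M) T" and W': "openin (mtop M) W'" "p \<in> W'" "W' \<subseteq> W"
    and eq: "\<And>q. q \<in> W' \<Longrightarrow> \<omega>' q = \<omega> q"
  have pM: "p \<in> points M" using W openin_subset by blast
  have "W' \<subseteq> points M" using W'(1) openin_subset by blast
  then have "ext_d M \<omega>' p = ext_d M \<omega> p"
    by (intro ext_d_cong[OF W'(1,2) eq Omega1_subset[OF \<omega>' openin_topspace W'(1)]])
  moreover obtain \<xi> \<zeta> where "\<xi> \<in> Omega2 M (points M) V" "\<zeta> \<in> Omega2 M (points M) V'"
    "ext_d M \<omega>' p = \<xi> p + \<zeta> p" using iii[OF \<omega>'] pM by blast
  ultimately show ?thesis using pM unfolding Omega2_def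
    by (intro bexI[of _ "\<xi> p"] bexI[of _ "\<zeta> p"]) auto
qed

theorem theorem2p9:
  fixes M :: "('m, 'e::euclidean_space) manifold"
    and Vh Vc :: "'m \<Rightarrow> ('m, 'e) covector set"
  assumes "smooth_manifold M"
    and "darboux_pair M Vh Vc"
    and "p\<^sub>0 \<in> points M"
  shows "\<exists>W \<theta> \<sigma>h \<eta>h \<sigma>c \<eta>c Eh Fh Ec Fc A B.
    openin (mtop M) W \<and> p\<^sub>0 \<in> W \<and>
    zero_adapted_coframe M Vh Vc W \<theta> \<sigma>h \<eta>h \<sigma>c \<eta>c \<and>
    smooth_coeffs M W Eh \<and> smooth_coeffs M W Fh \<and>
    smooth_coeffs M W Ec \<and> smooth_coeffs M W Fc \<and>
    smooth_coeffs M W A \<and> smooth_coeffs M W B \<and>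
    (\<forall>a<length \<sigma>h. \<forall>p\<in>W. ext_d M (\<sigma>h ! a) p = 0) \<and>
    (\<forall>a<length \<eta>h. \<forall>p\<in>W. ext_d M (\<eta>h ! a) p =
       wedge_comb (Eh a) \<eta>h \<sigma>h p + wedge_comb (Fh a) \<sigma>h \<sigma>h p) \<and>
    (\<forall>a<length \<sigma>c. \<forall>p\<in>W. ext_d M (\<sigma>c ! a) p = 0) \<and>
    (\<forall>a<length \<eta>c. \<forall>p\<in>W. ext_d M (\<eta>c ! a) p =
       wedge_comb (Ec a) \<eta>c \<sigma>c p + wedge_comb (Fc a) \<sigma>c \<sigma>c p) \<and>
    (\<forall>a<length \<theta>.
       (\<lambda>p. ext_d M (\<theta> ! a) p - (wedge_comb (A a) \<sigma>h \<sigma>h p + wedge_comb (B a) \<sigma>c \<sigma>c p))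
         \<in> ideal2 M W (set (\<theta> @ \<eta>h @ \<eta>c)))"
proof -
  interpret smooth_mfd M by standard fact
  let ?p0 = "p\<^sub>0"
  note p0 = assms(3)
  define Ih where "Ih = last_derived M Vh"
  define Ic where "Ic = last_derived M Vc"
  define T where "T p = Vh p \<inter> Vc p" for p
  define Kh where "Kh p = Ih p \<inter> Vc p" for p
  define Kc where "Kc p = Vh p \<inter> Ic p" for p
  have pfh: "\<And>k. pfaffian_system M ((derived M ^^ k) Vh)" and pfc: "\<And>k. pfaffian_system M ((derived M ^^ k) Vc)"
    and pfKh: "pfaffian_system M Kh" and pfKc: "pfaffian_system M Kc" and pfT: "pfaffian_system M T"
    and i1: "\<And>p. p \<in> points M \<Longrightarrow> {\<alpha> + \<beta> | \<alpha> \<beta>. \<alpha> \<in> Vh p \<and> \<beta> \<in> Ic p} = cotangent_space M p"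
    and i2: "\<And>p. p \<in> points M \<Longrightarrow> {\<alpha> + \<beta> | \<alpha> \<beta>. \<alpha> \<in> Vc p \<and> \<beta> \<in> Ih p} = cotangent_space M p"
    and ii: "\<And>p. p \<in> points M \<Longrightarrow> Ih p \<inter> Ic p = {0}"
    and iii: "\<And>\<omega>. \<omega> \<in> Omega1 M (points M) T \<Longrightarrow>
      \<exists>\<xi>\<in>Omega2 M (points M) Vh. \<exists>\<zeta>\<in>Omega2 M (points M) Vc. \<forall>p\<in>points M. ext_d M \<omega> p = \<xi> p + \<zeta> p"
    using assms(2) unfolding darboux_pair_def Let_def Ih_def Ic_def T_def[abs_def] Kh_def[abs_def] Kc_def[abs_def]
    by simp_all
  note Ih = last_derived_facts[OF pfh p0, folded Ih_def] and Ic = last_derived_facts[OF pfc p0, folded Ic_def]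
  have pfVh: "pfaffian_system M Vh" and pfVc: "pfaffian_system M Vc" using pfh[of 0] pfc[of 0] by simp_all
  have subT: "subspace (T p)" if "p \<in> points M" for p by (rule pfaffian_subspace[OF pfT that])
  have subVh: "subspace (Vh p)" and subVc: "subspace (Vc p)" if "p \<in> points M" for p
    using pfaffian_subspace[OF pfVh that] pfaffian_subspace[OF pfVc that] by auto
  have subIh: "subspace (Ih p)" and subIc: "subspace (Ic p)" if "p \<in> points M" for p
    using pfaffian_subspace[OF Ih(1) that] pfaffian_subspace[OF Ic(1) that] by auto
  have VhC: "Vh p \<subseteq> cotangent_space M p" if p: "p \<in> points M" for p
  proof
    fix \<alpha> assume "\<alpha> \<in> Vh p"
    moreover have "\<alpha> = \<alpha> + 0" by simp
    ultimately show "\<alpha> \<in> cotangent_space M p" using i1[OF p] subspace_0[OF subIc[OF p]] by blast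
  qed
  have VcC: "Vc p \<subseteq> cotangent_space M p" if p: "p \<in> points M" for p
  proof
    fix \<alpha> assume "\<alpha> \<in> Vc p"
    moreover have "\<alpha> = \<alpha> + 0" by simp
    ultimately show "\<alpha> \<in> cotangent_space M p" using i2[OF p] subspace_0[OF subIh[OF p]] by blast
  qed
  have KhI: "Kh p \<subseteq> Ih p" and KcI: "Kc p \<subseteq> Ic p" for p by (auto simp: Kh_def Kc_def)
  \<comment> \<open>Modular law: \<open>Ih p\<close> lies in \<open>Vh p\<close>, so the sum of
    \<open>Vc p\<close> and \<open>Ih p\<close>, intersected with \<open>Vh p\<close>, is the sum of
    \<open>T p\<close> and \<open>Ih p\<close>.\<close>
  have decomp_h: "\<exists>a\<in>T p. \<exists>b\<in>Ih p. \<alpha> = a + b" if p: "p \<in> points M" and \<alpha>: "\<alpha> \<in> Vh p" for p \<alpha>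
  proof -
    have "\<alpha> \<in> cotangent_space M p" using VhC[OF p] \<alpha> by (rule subsetD)
    then obtain c d where cd: "\<alpha> = c + d" "c \<in> Vc p" "d \<in> Ih p" using i2[OF p] by blast
    have "d \<in> Vh p" using Ih(3)[OF p] cd(3) by (rule subsetD)
    with \<alpha> have "\<alpha> - d \<in> Vh p" by (rule subspace_diff[OF subVh[OF p]])
    then have "c \<in> Vh p" by (simp add: cd(1))
    then show ?thesis using cd by (auto simp: T_def)
  qed
  have decomp_c: "\<exists>a\<in>T p. \<exists>b\<in>Ic p. \<alpha> = a + b" if p: "p \<in> points M" and \<alpha>: "\<alpha> \<in> Vc p" for p \<alpha>
  proof -
    have "\<alpha> \<in> cotangent_space M p" using VcC[OF p] \<alpha> by (rule subsetD)
    then obtain c d where cd: "\<alpha> = c + d" "c \<in> Vh p" "d \<in> Ic p" using i1[OF p] by blast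
    have "d \<in> Vc p" using Ic(3)[OF p] cd(3) by (rule subsetD)
    with \<alpha> have "\<alpha> - d \<in> Vc p" by (rule subspace_diff[OF subVc[OF p]])
    then have "c \<in> Vc p" by (simp add: cd(1))
    then show ?thesis using cd by (auto simp: T_def)
  qed
  show ?thesis
  proof (rule half_coframe[OF Ih(1,2) pfKh KhI p0])
    fix Wh \<sigma>h \<eta>h eh
    assume Wh: "openin (mtop M) Wh" "?p0 \<in> Wh" and \<sigma>h: "set \<sigma>h \<subseteq> Omega1 M Wh Ih" and \<eta>h: "set \<eta>h \<subseteq> Omega1 M Wh Kh"
      and bh: "basis_list (map (\<lambda>\<omega>. \<omega> ?p0) (\<sigma>h @ \<eta>h)) (Ih ?p0)" and b\<eta>h: "basis_list (map (\<lambda>\<omega>. \<omega> ?p0) \<eta>h) (Kh ?p0)"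
      and d\<sigma>h: "\<And>s p. s \<in> set \<sigma>h \<Longrightarrow> p \<in> Wh \<Longrightarrow> ext_d M s p = 0"
      and eh: "\<And>a b. a < length \<eta>h \<Longrightarrow> b < length \<sigma>h \<Longrightarrow> smooth_fun M Wh (eh a b)"
      and d\<eta>h: "\<And>a p. a < length \<eta>h \<Longrightarrow> p \<in> Wh \<Longrightarrow> ext_d M (\<eta>h ! a) p = (\<Sum>b<length \<sigma>h. dform M (eh a b) p \<and>\<^sub>w (\<sigma>h ! b) p)"
    show ?thesis
    proof (rule half_coframe[OF Ic(1,2) pfKc KcI p0])
      fix Wc \<sigma>c \<eta>c ec
      assume Wc: "openin (mtop M) Wc" "?p0 \<in> Wc" and \<sigma>c: "set \<sigma>c \<subseteq> Omega1 M Wc Ic" and \<eta>c: "set \<eta>c \<subseteq> Omega1 M Wc Kc"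
        and bc: "basis_list (map (\<lambda>\<omega>. \<omega> ?p0) (\<sigma>c @ \<eta>c)) (Ic ?p0)" and b\<eta>c: "basis_list (map (\<lambda>\<omega>. \<omega> ?p0) \<eta>c) (Kc ?p0)"
        and d\<sigma>c: "\<And>s p. s \<in> set \<sigma>c \<Longrightarrow> p \<in> Wc \<Longrightarrow> ext_d M s p = 0"
        and ec: "\<And>a b. a < length \<eta>c \<Longrightarrow> b < length \<sigma>c \<Longrightarrow> smooth_fun M Wc (ec a b)"
        and d\<eta>c: "\<And>a p. a < length \<eta>c \<Longrightarrow> p \<in> Wc \<Longrightarrow> ext_d M (\<eta>c ! a) p = (\<Sum>b<length \<sigma>c. dform M (ec a b) p \<and>\<^sub>w (\<sigma>c ! b) p)"
      obtain Wt \<nu> where Wt: "openin (mtop M) Wt" "?p0 \<in> Wt" and \<nu>: "local_frame M Wt \<nu> T"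
        using pfT p0 unfolding pfaffian_system_def by metis
      let ?at = "\<lambda>p. map (\<lambda>\<omega>. \<omega> p)"
      have \<nu>0: "basis_list (?at ?p0 \<nu>) (T ?p0)" using \<nu> Wt(2) by (simp add: local_frame_iff)
      \<comment> \<open>By (ii) the two frames \<eta>h and \<eta>c are jointly independent; \<theta>
        is then selected from a frame of \<open>T\<close> to complete them to a basis at the base
        point.\<close>
      have "Kh ?p0 \<inter> Kc ?p0 \<subseteq> {0}" using ii[OF p0] KhI KcI by blast
      note \<eta>0 = independent_append[OF b\<eta>h b\<eta>c this]
      obtain \<theta> where \<theta>: "set \<theta> \<subseteq> set \<nu>" "distinct ((?at ?p0 \<eta>h @ ?at ?p0 \<eta>c) @ ?at ?p0 \<theta>)"
        "independent (set ((?at ?p0 \<eta>h @ ?at ?p0 \<eta>c) @ ?at ?p0 \<theta>))"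
        "(\<lambda>\<omega>. \<omega> ?p0) ` set \<nu> \<subseteq> span (set ((?at ?p0 \<eta>h @ ?at ?p0 \<eta>c) @ ?at ?p0 \<theta>))"
        using extend_to_basis[OF \<eta>0, of \<nu> "\<lambda>\<omega>. \<omega> ?p0"] by blast
      define G where "G = \<theta> @ \<eta>h @ \<eta>c"
      have G_set: "set (?at ?p0 G) = set ((?at ?p0 \<eta>h @ ?at ?p0 \<eta>c) @ ?at ?p0 \<theta>)" by (auto simp: G_def)
      have KhT: "Kh p \<subseteq> T p" and KcT: "Kc p \<subseteq> T p" if "p \<in> points M" for p
        using Ih(3)[OF that] Ic(3)[OF that] by (auto simp: Kh_def Kc_def T_def)
      have G_in: "set (?at ?p0 G) \<subseteq> T ?p0"
      proof -
        have "set (?at ?p0 \<eta>h) \<subseteq> Kh ?p0" "set (?at ?p0 \<eta>c) \<subseteq> Kc ?p0" "set (?at ?p0 \<nu>) \<subseteq> T ?p0"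
          using b\<eta>h b\<eta>c \<nu>0 span_superset unfolding basis_list_def by blast+
        moreover have "set (?at ?p0 \<theta>) \<subseteq> set (?at ?p0 \<nu>)" using \<theta>(1) by auto
        ultimately show ?thesis unfolding G_set set_append using KhT[OF p0] KcT[OF p0] by blast
      qed
      have bG: "basis_list (?at ?p0 G) (T ?p0)"
        unfolding basis_list_def
      proof (intro conjI)
        show "distinct (?at ?p0 G)" using \<theta>(2) by (auto simp: G_def)
        show "independent (set (?at ?p0 G))" unfolding G_set by (rule \<theta>(3))
        have "T ?p0 = span (set (?at ?p0 \<nu>))" using \<nu>0 by (simp add: basis_list_def)
        also have "\<dots> \<subseteq> span (set (?at ?p0 G))"
          unfolding G_set by (rule span_minimal) (use \<theta>(4) in auto)
        finally show "span (set (?at ?p0 G)) = T ?p0" using span_minimal[OF G_in subT[OF p0]] by (rule antisym[rotated])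
      qed
      \<comment> \<open>In this order the generators of the ideal for d\<theta> form the first block
        and \<sigma>h, \<sigma>c the other two, as \<open>theta_structure\<close> expects. The order
        used in the definition of a 0-adapted coframe is restored by a permutation.\<close>
      define L where "L = G @ \<sigma>h @ \<sigma>c"
      have "basis_list (?at ?p0 L) (span (set (?at ?p0 L)))"
      proof -
        have b\<sigma>h: "basis_list (?at ?p0 \<sigma>h) (span (set (?at ?p0 \<sigma>h)))" and ih: "span (set (?at ?p0 \<sigma>h)) \<inter> Kh ?p0 \<subseteq> {0}"
        proof -
          have di: "distinct (?at ?p0 \<sigma>h @ ?at ?p0 \<eta>h)" "independent (set (?at ?p0 \<sigma>h @ ?at ?p0 \<eta>h))"
            using bh by (simp_all add: basis_list_def)
          show "basis_list (?at ?p0 \<sigma>h) (span (set (?at ?p0 \<sigma>h)))"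
            using di independent_mono[OF di(2)] by (simp add: basis_list_def)
          show "span (set (?at ?p0 \<sigma>h)) \<inter> Kh ?p0 \<subseteq> {0}"
            using independent_span_Int[OF di] b\<eta>h by (simp add: basis_list_def)
        qed
        have b\<sigma>c: "basis_list (?at ?p0 \<sigma>c) (span (set (?at ?p0 \<sigma>c)))" and ic: "span (set (?at ?p0 \<sigma>c)) \<inter> Kc ?p0 \<subseteq> {0}"
        proof -
          have di: "distinct (?at ?p0 \<sigma>c @ ?at ?p0 \<eta>c)" "independent (set (?at ?p0 \<sigma>c @ ?at ?p0 \<eta>c))"
            using bc by (simp_all add: basis_list_def)
          show "basis_list (?at ?p0 \<sigma>c) (span (set (?at ?p0 \<sigma>c)))"
            using di independent_mono[OF di(2)] by (simp add: basis_list_def)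
          show "span (set (?at ?p0 \<sigma>c)) \<inter> Kc ?p0 \<subseteq> {0}"
            using independent_span_Int[OF di] b\<eta>c by (simp add: basis_list_def)
        qed
        have \<sigma>hI: "span (set (?at ?p0 \<sigma>h)) \<subseteq> Ih ?p0"
          using bh span_mono[of "set (?at ?p0 \<sigma>h)" "set (?at ?p0 (\<sigma>h @ \<eta>h))"] by (auto simp: basis_list_def)
        have \<sigma>cI: "span (set (?at ?p0 \<sigma>c)) \<subseteq> Ic ?p0"
          using bc span_mono[of "set (?at ?p0 \<sigma>c)" "set (?at ?p0 (\<sigma>c @ \<eta>c))"] by (auto simp: basis_list_def)
        \<comment> \<open>Covectors common to \<open>T\<close> and the span of \<sigma>h lie in
          \<open>Ih\<close> and in \<open>Vc\<close>, hence in \<open>Kh\<close>, which meets that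
          span only in 0. The same reasoning with \<open>Vh\<close> and \<open>Kc\<close> adds
          \<sigma>c.\<close>
        have "T ?p0 \<inter> span (set (?at ?p0 \<sigma>h)) \<subseteq> {0}"
          using ih \<sigma>hI unfolding Kh_def T_def by blast
        note s1 = independent_append[OF bG b\<sigma>h this]
        have b1: "basis_list (?at ?p0 G @ ?at ?p0 \<sigma>h) (span (set (?at ?p0 G @ ?at ?p0 \<sigma>h)))"
          using s1 unfolding basis_list_def by blast
        have "set (?at ?p0 G @ ?at ?p0 \<sigma>h) \<subseteq> Vh ?p0"
          using G_in \<sigma>hI Ih(3)[OF p0] span_superset[of "set (?at ?p0 \<sigma>h)"] unfolding T_def set_append by blast
        then have "span (set (?at ?p0 G @ ?at ?p0 \<sigma>h)) \<subseteq> Vh ?p0" by (rule span_minimal[OF _ subVh[OF p0]])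
        then have "span (set (?at ?p0 G @ ?at ?p0 \<sigma>h)) \<inter> span (set (?at ?p0 \<sigma>c)) \<subseteq> {0}"
          using ic \<sigma>cI unfolding Kc_def by blast
        from independent_append[OF b1 b\<sigma>c this] show ?thesis by (simp add: basis_list_def L_def)
      qed
      then have indL: "distinct (?at ?p0 L)" "independent (set (?at ?p0 L))" by (auto simp: basis_list_def)
      define W0 where "W0 = Wh \<inter> Wc \<inter> Wt"
      have W0: "openin (mtop M) W0" "?p0 \<in> W0" using Wh Wc Wt by (auto simp: W0_def)
      have restr: "\<omega> \<in> Omega1 M W V" if "\<omega> \<in> Omega1 M W1 V" "openin (mtop M) W1" "openin (mtop M) W" "W \<subseteq> W1" for \<omega> W W1 V
        by (rule Omega1_subset[OF that])
      have L0: "set L \<subseteq> Omega1 M W0 (cotangent_space M)"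
      proof -
        have "\<omega> \<in> Omega1 M W0 (cotangent_space M)" if "\<omega> \<in> Omega1 M Wh V \<or> \<omega> \<in> Omega1 M Wc V \<or> \<omega> \<in> Omega1 M Wt V" for \<omega> V
          using that restr[OF Omega1_cotangent _ W0(1)] Wh(1) Wc(1) Wt(1) by (auto simp: W0_def)
        moreover have "set \<nu> \<subseteq> Omega1 M Wt T" using \<nu> by (simp add: local_frame_iff)
        ultimately show ?thesis using \<theta>(1) \<eta>h \<eta>c \<sigma>h \<sigma>c unfolding L_def G_def by (simp add: subset_iff) blast
      qed
      obtain \<kappa> where \<kappa>: "\<kappa> \<in> charts_at M ?p0" using chart_cover[OF p0] by blast
      then have k: "\<kappa> \<in> atlas M" by (auto dest: charts_atD)
      show ?thesis
      proof (rule dual_fields[OF W0 L0 \<kappa> indL])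
        fix W X
        assume W: "openin (mtop M) W" "?p0 \<in> W" "W \<subseteq> W0" "W \<subseteq> dom_of \<kappa>"
          and dual: "\<And>p a c. p \<in> W \<Longrightarrow> a < length L \<Longrightarrow> c < length L \<Longrightarrow> (L ! c) p \<kappa> (X a p) = (if a = c then 1 else 0)"
          and sX0: "\<And>W'' \<alpha> V a. a < length L \<Longrightarrow> openin (mtop M) W'' \<Longrightarrow> W'' \<subseteq> W \<Longrightarrow> \<alpha> \<in> Omega1 M W'' V \<Longrightarrow>
            smooth_fun M W'' (\<lambda>p. \<alpha> p \<kappa> (X a p))"
          and sXX0: "\<And>W'' \<alpha> V a b. a < length L \<Longrightarrow> b < length L \<Longrightarrow> openin (mtop M) W'' \<Longrightarrow> W'' \<subseteq> W \<Longrightarrow> \<alpha> \<in> Omega1 M W'' V \<Longrightarrow>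
            smooth_fun M W'' (\<lambda>p. ext_d M \<alpha> p \<kappa> (X a p) (X b p))"
        have WM: "p \<in> points M" if "p \<in> W" for p using that W(1) openin_subset by blast
        have Wsub: "W \<subseteq> Wh" "W \<subseteq> Wc" "W \<subseteq> Wt" using W(3) by (auto simp: W0_def)
        have \<sigma>hW: "set \<sigma>h \<subseteq> Omega1 M W Ih" using \<sigma>h restr[OF _ Wh(1) W(1) Wsub(1)] by blast
        have \<eta>hW: "set \<eta>h \<subseteq> Omega1 M W Kh" using \<eta>h restr[OF _ Wh(1) W(1) Wsub(1)] by blast
        have \<sigma>cW: "set \<sigma>c \<subseteq> Omega1 M W Ic" using \<sigma>c restr[OF _ Wc(1) W(1) Wsub(2)] by blast
        have \<eta>cW: "set \<eta>c \<subseteq> Omega1 M W Kc" using \<eta>c restr[OF _ Wc(1) W(1) Wsub(2)] by blast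
        have \<theta>W: "set \<theta> \<subseteq> Omega1 M W T"
          using \<theta>(1) \<nu> restr[OF _ Wt(1) W(1) Wsub(3)] unfolding local_frame_iff by blast
        have up: "set xs \<subseteq> Omega1 M W V'" if "set xs \<subseteq> Omega1 M W V" "\<And>p. p \<in> points M \<Longrightarrow> V p \<subseteq> V' p" for xs V V'
        proof
          fix \<omega> assume "\<omega> \<in> set xs"
          then have \<omega>: "\<omega> \<in> Omega1 M W V" using that(1) by (rule subsetD[rotated])
          show "\<omega> \<in> Omega1 M W V'"
          proof (rule Omega1_mono[OF \<omega>])
            fix p assume p: "p \<in> W"
            then have "\<omega> p \<in> V p" using \<omega> by (simp add: Omega1_iff)
            then show "\<omega> p \<in> V' p" by (rule subsetD[OF that(2)[OF WM[OF p]]])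
          qed
        qed
        have \<eta>hI: "set \<eta>h \<subseteq> Omega1 M W Ih" by (rule up[OF \<eta>hW KhI])
        have \<eta>cI: "set \<eta>c \<subseteq> Omega1 M W Ic" by (rule up[OF \<eta>cW KcI])
        have \<eta>hT: "set \<eta>h \<subseteq> Omega1 M W T" by (rule up[OF \<eta>hW KhT])
        have \<eta>cT: "set \<eta>c \<subseteq> Omega1 M W T" by (rule up[OF \<eta>cW KcT])
        have LW: "set L \<subseteq> Omega1 M W (cotangent_space M)"
          using L0 restr[OF _ W0(1) W(1,3)] by blast
        have Lp: "distinct (?at p L)" "independent (set (?at p L))" if p: "p \<in> W" for p
          using dual_list_independent[OF dual[OF p]] by blast+
        \<comment> \<open>A sublist of \<open>L\<close> that is a basis of its system at the base
          point remains one on \<open>W\<close>: duality keeps it independent and constant rank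
          fixes the number of its members.\<close>
        have sub: "basis_list (?at p xs) (V p)"
          if "set xs \<subseteq> Omega1 M W V" "basis_list (?at ?p0 xs) (V ?p0)" "pfaffian_system M V" "set xs \<subseteq> set L"
            "distinct (?at p xs)" "p \<in> W" for xs V p
        proof (rule basis_listI_independent[OF that(5)])
          show "independent (set (?at p xs))" using that(4) by (intro independent_mono[OF Lp(2)[OF that(6)]]) auto
          show "set (?at p xs) \<subseteq> V p" using that(1,6) by (auto simp: Omega1_iff subset_iff)
          show "has_rank (length (?at p xs)) (V p)" using pfaffian_length_rank[OF that(3) p0 that(2) WM[OF that(6)]] by simp
        qed
        have f1: "basis_list (?at p \<eta>h) (Kh p)" if "p \<in> W" for p
          by (rule sub[OF \<eta>hW b\<eta>h pfKh _ _ that]) (use Lp(1)[OF that] in \<open>auto simp: L_def G_def\<close>)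
        have f2: "basis_list (?at p \<eta>c) (Kc p)" if "p \<in> W" for p
          by (rule sub[OF \<eta>cW b\<eta>c pfKc _ _ that]) (use Lp(1)[OF that] in \<open>auto simp: L_def G_def\<close>)
        have f3: "basis_list (?at p (\<sigma>h @ \<eta>h)) (Ih p)" if "p \<in> W" for p
          by (rule sub[OF _ bh Ih(1) _ _ that]) (use \<sigma>hW \<eta>hI Lp(1)[OF that] in \<open>auto simp: L_def G_def\<close>)
        have f4: "basis_list (?at p (\<sigma>c @ \<eta>c)) (Ic p)" if "p \<in> W" for p
          by (rule sub[OF _ bc Ic(1) _ _ that]) (use \<sigma>cW \<eta>cI Lp(1)[OF that] in \<open>auto simp: L_def G_def\<close>)
        have f5: "basis_list (?at p G) (T p)" if "p \<in> W" for p
          by (rule sub[OF _ bG pfT _ _ that]) (use \<theta>W \<eta>hT \<eta>cT Lp(1)[OF that] in \<open>auto simp: L_def G_def\<close>)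
        have spanI: "T p \<subseteq> span (set (?at p L))" "Ih p \<subseteq> span (set (?at p L))" "Ic p \<subseteq> span (set (?at p L))" if p: "p \<in> W" for p
        proof -
          have "span (set (?at p xs)) \<subseteq> span (set (?at p L))" if "set xs \<subseteq> set L" for xs
            using that by (intro span_mono) auto
          from this[of G] this[of "\<sigma>h @ \<eta>h"] this[of "\<sigma>c @ \<eta>c"]
          have "span (set (?at p G)) \<subseteq> span (set (?at p L))" "span (set (?at p (\<sigma>h @ \<eta>h))) \<subseteq> span (set (?at p L))"
            "span (set (?at p (\<sigma>c @ \<eta>c))) \<subseteq> span (set (?at p L))"
            by (simp_all add: L_def G_def subset_iff)
          then show "T p \<subseteq> span (set (?at p L))" "Ih p \<subseteq> span (set (?at p L))" "Ic p \<subseteq> span (set (?at p L))"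
            using f3[OF p] f4[OF p] f5[OF p] by (simp_all add: basis_list_def)
        qed
        \<comment> \<open>By (i) the cotangent space is the sum of \<open>Vh\<close> and
          \<open>Ic\<close>, and \<open>Vh\<close> is the sum of \<open>T\<close> and
          \<open>Ih\<close>; all three parts lie in the span of \<open>L\<close>.\<close>
        have f6: "basis_list (?at p L) (cotangent_space M p)" if p: "p \<in> W" for p
          unfolding basis_list_def
        proof (intro conjI Lp[OF p] antisym)
          show "span (set (?at p L)) \<subseteq> cotangent_space M p"
            using LW p by (intro span_minimal subspace_cotangent) (auto simp: Omega1_iff subset_iff)
          show "cotangent_space M p \<subseteq> span (set (?at p L))"
          proof
            fix \<alpha> assume "\<alpha> \<in> cotangent_space M p"
            then obtain a b where ab: "\<alpha> = a + b" "a \<in> Vh p" "b \<in> Ic p" using i1[OF WM[OF p]] by blast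
            obtain c d where cd: "c \<in> T p" "d \<in> Ih p" "a = c + d" using decomp_h[OF WM[OF p] ab(2)] by blast
            have "c \<in> span (set (?at p L))" "d \<in> span (set (?at p L))" "b \<in> span (set (?at p L))"
              using spanI[OF p] cd(1,2) ab(3) by blast+
            then show "\<alpha> \<in> span (set (?at p L))" unfolding ab(1) cd(3) by (intro span_add)
          qed
        qed
        have frame: "zero_adapted_coframe M Vh Vc W \<theta> \<sigma>h \<eta>h \<sigma>c \<eta>c"
        proof -
          have "mset (?at p L) = mset (?at p (\<theta> @ \<sigma>h @ \<eta>h @ \<sigma>c @ \<eta>c))" for p by (simp add: L_def G_def)
          from basis_list_perm[OF this f6]
          have "basis_list (?at p (\<theta> @ \<sigma>h @ \<eta>h @ \<sigma>c @ \<eta>c)) (cotangent_space M p)" if "p \<in> W" for p using that by blast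
          moreover have "set (\<theta> @ \<sigma>h @ \<eta>h @ \<sigma>c @ \<eta>c) = set L" by (auto simp: L_def G_def)
          ultimately have 6: "local_frame M W (\<theta> @ \<sigma>h @ \<eta>h @ \<sigma>c @ \<eta>c) (cotangent_space M)"
            unfolding local_frame_iff using LW by blast
          have 1: "local_frame M W \<eta>h Kh" unfolding local_frame_iff using \<eta>hW f1 by blast
          have 2: "local_frame M W \<eta>c Kc" unfolding local_frame_iff using \<eta>cW f2 by blast
          have 3: "local_frame M W (\<sigma>h @ \<eta>h) Ih" unfolding local_frame_iff using \<sigma>hW \<eta>hI f3 by auto
          have 4: "local_frame M W (\<sigma>c @ \<eta>c) Ic" unfolding local_frame_iff using \<sigma>cW \<eta>cI f4 by auto
          have 5: "local_frame M W (\<theta> @ \<eta>h @ \<eta>c) T" unfolding local_frame_iff using \<theta>W \<eta>hT \<eta>cT f5 by (auto simp: G_def)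
          show ?thesis
            unfolding zero_adapted_coframe_def Let_def Ih_def[symmetric] Ic_def[symmetric]
            using 1 2 3 4 5 6 unfolding Kh_def[abs_def] Kc_def[abs_def] T_def[abs_def] by blast
        qed
        let ?t = "length \<theta>" and ?eh = "length \<eta>h" and ?ec = "length \<eta>c" and ?m = "length G"
          and ?h = "length \<sigma>h" and ?c = "length \<sigma>c"
        have m: "?m = ?t + (?eh + ?ec)" by (simp add: G_def)
        have lenL: "length L = ?m + (?h + ?c)" by (simp add: L_def)
        have nG: "L ! i = G ! i" if "i < ?m" for i using that by (simp add: L_def nth_append)
        have n\<eta>h: "L ! (?t + i) = \<eta>h ! i" if "i < ?eh" for i using that by (simp add: L_def G_def nth_append)
        have n\<eta>c: "L ! (?t + (?eh + i)) = \<eta>c ! i" if "i < ?ec" for i using that by (simp add: L_def G_def nth_append)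
        have n\<sigma>h: "L ! (?m + i) = \<sigma>h ! i" if "i < ?h" for i using that by (simp add: L_def nth_append)
        have n\<sigma>c: "L ! (?m + (?h + i)) = \<sigma>c ! i" if "i < ?c" for i using that by (simp add: L_def nth_append)
        have kill_L: "(L ! i) p \<kappa> (X j p) = 0" if "p \<in> W" "i < length L" "j < length L" "i \<noteq> j" for i j p
          using dual[OF that(1,3,2)] that(4) by simp
        have kill: "\<alpha> \<kappa> (X j p) = 0"
          if "p \<in> W" "\<alpha> \<in> span (set (?at p xs))" "j < length L" "\<And>\<omega>. \<omega> \<in> set xs \<Longrightarrow> \<exists>i<length L. i \<noteq> j \<and> \<omega> = L ! i" for xs \<alpha> j p
        proof (rule span_kill[OF that(2)])
          fix \<beta> assume "\<beta> \<in> set (?at p xs)"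
          then obtain \<omega> where "\<omega> \<in> set xs" "\<beta> = \<omega> p" by auto
          then show "\<beta> \<kappa> (X j p) = 0" using that(4) kill_L[OF that(1) _ that(3)] by metis
        qed
        have killT: "\<alpha> \<kappa> (X j p) = 0" if "p \<in> W" "\<alpha> \<in> T p" "j < length L" "j \<ge> ?m" for \<alpha> j p
        proof (rule kill[OF that(1) _ that(3)])
          show "\<alpha> \<in> span (set (?at p G))" using f5[OF that(1)] that(2) by (simp add: basis_list_def)
          fix \<omega> assume "\<omega> \<in> set G"
          then obtain i where i: "i < ?m" "\<omega> = G ! i" by (auto simp: in_set_conv_nth)
          then show "\<exists>i<length L. i \<noteq> j \<and> \<omega> = L ! i" using that(4) lenL nG[OF i(1)] by (intro exI[of _ i]) auto
        qed
        \<comment> \<open>\<open>Vh\<close> is the sum of \<open>T\<close> and \<open>Ih\<close>,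
          both spanned by members of \<open>L\<close> outside \<sigma>c, so it annihilates the
          fields dual to \<sigma>c.\<close>
        have killVh: "\<alpha> \<kappa> (X (?m + (?h + j)) p) = 0" if p: "p \<in> W" and \<alpha>: "\<alpha> \<in> Vh p" and j: "j < ?c" for p \<alpha> j
        proof -
          have jL: "?m + (?h + j) < length L" using j lenL by simp
          obtain a b where ab: "a \<in> T p" "b \<in> Ih p" "\<alpha> = a + b" using decomp_h[OF WM[OF p] \<alpha>] by blast
          have "a \<kappa> (X (?m + (?h + j)) p) = 0" by (rule killT[OF p ab(1) jL]) simp
          moreover have "b \<kappa> (X (?m + (?h + j)) p) = 0"
          proof (rule kill[OF p _ jL])
            show "b \<in> span (set (?at p (\<sigma>h @ \<eta>h)))" using f3[OF p] ab(2) by (simp add: basis_list_def)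
            fix \<omega> assume "\<omega> \<in> set (\<sigma>h @ \<eta>h)"
            then consider i where "i < ?h" "\<omega> = L ! (?m + i)" | i where "i < ?eh" "\<omega> = L ! (?t + i)"
              using n\<sigma>h n\<eta>h by (auto simp: in_set_conv_nth)
            then show "\<exists>i<length L. i \<noteq> ?m + (?h + j) \<and> \<omega> = L ! i"
            proof cases
              case (1 i) then show ?thesis using lenL by (intro exI[of _ "?m + i"]) auto
            next
              case (2 i) then show ?thesis using lenL m by (intro exI[of _ "?t + i"]) auto
            qed
          qed
          ultimately show ?thesis by (simp add: ab(3))
        qed
        have killVc: "\<alpha> \<kappa> (X (?m + j) p) = 0" if p: "p \<in> W" and \<alpha>: "\<alpha> \<in> Vc p" and j: "j < ?h" for p \<alpha> j
        proof -
          have jL: "?m + j < length L" using j lenL by simp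
          obtain a b where ab: "a \<in> T p" "b \<in> Ic p" "\<alpha> = a + b" using decomp_c[OF WM[OF p] \<alpha>] by blast
          have "a \<kappa> (X (?m + j) p) = 0" by (rule killT[OF p ab(1) jL]) simp
          moreover have "b \<kappa> (X (?m + j) p) = 0"
          proof (rule kill[OF p _ jL])
            show "b \<in> span (set (?at p (\<sigma>c @ \<eta>c)))" using f4[OF p] ab(2) by (simp add: basis_list_def)
            fix \<omega> assume "\<omega> \<in> set (\<sigma>c @ \<eta>c)"
            then consider i where "i < ?c" "\<omega> = L ! (?m + (?h + i))" | i where "i < ?ec" "\<omega> = L ! (?t + (?eh + i))"
              using n\<sigma>c n\<eta>c by (auto simp: in_set_conv_nth)
            then show "\<exists>i<length L. i \<noteq> ?m + j \<and> \<omega> = L ! i"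
            proof cases
              case (1 i) then show ?thesis using lenL j by (intro exI[of _ "?m + (?h + i)"]) auto
            next
              case (2 i) then show ?thesis using lenL m by (intro exI[of _ "?t + (?eh + i)"]) auto
            qed
          qed
          ultimately show ?thesis by (simp add: ab(3))
        qed
        have L_T: "(L ! i) p \<in> T p" if "p \<in> W" "i < ?m" for i p
        proof -
          have "G ! i \<in> Omega1 M W T" using \<theta>W \<eta>hT \<eta>cT nth_mem[OF that(2)] by (auto simp: G_def)
          then show ?thesis using nG[OF that(2)] that(1) by (simp add: Omega1_iff)
        qed
        have cot_exp: "\<alpha> = (\<Sum>i<length L. \<alpha> \<kappa> (X i p) *\<^sub>R (L ! i) p)" if p: "p \<in> W" and \<alpha>: "\<alpha> \<in> cotangent_space M p" for p \<alpha>
          by (rule basis_list_expansion[OF dual[OF p]]) (use f6[OF p] \<alpha> in \<open>simp_all add: basis_list_def\<close>)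
        \<comment> \<open>The converse of \<open>killVh\<close>: without \<sigma>c-components a
          covector is a combination of members of \<open>T\<close> and \<open>Ih\<close>.\<close>
        have in_Vh: "\<alpha> \<in> Vh p" if p: "p \<in> W" and \<alpha>: "\<alpha> \<in> cotangent_space M p"
          and z: "\<And>j. j < ?c \<Longrightarrow> \<alpha> \<kappa> (X (?m + (?h + j)) p) = 0" for p \<alpha>
        proof -
          have "(\<Sum>i<?m + (?h + ?c). \<alpha> \<kappa> (X i p) *\<^sub>R (L ! i) p) \<in> Vh p"
            unfolding sum_lessThan_add
          proof (intro subspace_add[OF subVh[OF WM[OF p]]] subspace_sum[OF subVh[OF WM[OF p]]])
            show "\<alpha> \<kappa> (X i p) *\<^sub>R (L ! i) p \<in> Vh p" if "i \<in> {..<?m}" for i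
              using L_T[OF p] that by (intro subspace_scale[OF subVh[OF WM[OF p]]]) (auto simp: T_def)
            show "\<alpha> \<kappa> (X (?m + i) p) *\<^sub>R (L ! (?m + i)) p \<in> Vh p" if "i \<in> {..<?h}" for i
            proof -
              have i: "i < ?h" using that by simp
              then have "\<sigma>h ! i \<in> Omega1 M W Ih" using \<sigma>hW by auto
              then show ?thesis using p Ih(3)[OF WM[OF p]] n\<sigma>h[OF i]
                by (intro subspace_scale[OF subVh[OF WM[OF p]]]) (auto simp: Omega1_iff)
            qed
            show "\<alpha> \<kappa> (X (?m + (?h + j)) p) *\<^sub>R (L ! (?m + (?h + j))) p \<in> Vh p" if "j \<in> {..<?c}" for j
              using z[of j] that subspace_0[OF subVh[OF WM[OF p]]] by simp
          qed
          then show ?thesis using cot_exp[OF p \<alpha>] lenL by simp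
        qed
        have in_Vc: "\<alpha> \<in> Vc p" if p: "p \<in> W" and \<alpha>: "\<alpha> \<in> cotangent_space M p"
          and z: "\<And>j. j < ?h \<Longrightarrow> \<alpha> \<kappa> (X (?m + j) p) = 0" for p \<alpha>
        proof -
          have "(\<Sum>i<?m + (?h + ?c). \<alpha> \<kappa> (X i p) *\<^sub>R (L ! i) p) \<in> Vc p"
            unfolding sum_lessThan_add
          proof (intro subspace_add[OF subVc[OF WM[OF p]]] subspace_sum[OF subVc[OF WM[OF p]]])
            show "\<alpha> \<kappa> (X i p) *\<^sub>R (L ! i) p \<in> Vc p" if "i \<in> {..<?m}" for i
              using L_T[OF p] that by (intro subspace_scale[OF subVc[OF WM[OF p]]]) (auto simp: T_def)
            show "\<alpha> \<kappa> (X (?m + (?h + i)) p) *\<^sub>R (L ! (?m + (?h + i))) p \<in> Vc p" if "i \<in> {..<?c}" for i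
            proof -
              have i: "i < ?c" using that by simp
              then have "\<sigma>c ! i \<in> Omega1 M W Ic" using \<sigma>cW by auto
              then show ?thesis using p Ic(3)[OF WM[OF p]] n\<sigma>c[OF i]
                by (intro subspace_scale[OF subVc[OF WM[OF p]]]) (auto simp: Omega1_iff)
            qed
            show "\<alpha> \<kappa> (X (?m + j) p) *\<^sub>R (L ! (?m + j)) p \<in> Vc p" if "j \<in> {..<?h}" for j
              using z[of j] that subspace_0[OF subVc[OF WM[OF p]]] by simp
          qed
          then show ?thesis using cot_exp[OF p \<alpha>] lenL by simp
        qed
        have split: "\<exists>\<xi>\<in>Lambda2 (Vh p). \<exists>\<zeta>\<in>Lambda2 (Vc p). ext_d M \<omega> p = \<xi> + \<zeta>" if "\<omega> \<in> Omega1 M W T" "p \<in> W" for \<omega> p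
          by (rule ext_d_split[OF iii subT W(1) that(2,1)])
        \<comment> \<open>Positions in \<open>L\<close> of the entries of
          \<open>\<sigma>h @ \<eta>h\<close>: \<sigma>h starts at \<open>?m\<close>, while \<eta>h
          starts at \<open>?t\<close> inside \<open>G\<close>.\<close>
        define idh where "idh a = (if a < ?h then ?m + a else ?t + (a - ?h))" for a
        define idc where "idc a = (if a < ?c then ?m + (?h + a) else ?t + (?eh + (a - ?c)))" for a
        have idh: "idh a < length L" "L ! idh a = (\<sigma>h @ \<eta>h) ! a" if "a < length (\<sigma>h @ \<eta>h)" for a
          using that n\<sigma>h n\<eta>h[of "a - ?h"] lenL m by (auto simp: idh_def nth_append)
        have idc: "idc a < length L" "L ! idc a = (\<sigma>c @ \<eta>c) ! a" if "a < length (\<sigma>c @ \<eta>c)" for a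
          using that n\<sigma>c n\<eta>c[of "a - ?c"] lenL m by (auto simp: idc_def nth_append)
        have idh_inj: "idh a = idh b \<longleftrightarrow> a = b" if "a < length (\<sigma>h @ \<eta>h)" "b < length (\<sigma>h @ \<eta>h)" for a b
          using that m by (auto simp: idh_def)
        have idc_inj: "idc a = idc b \<longleftrightarrow> a = b" if "a < length (\<sigma>c @ \<eta>c)" "b < length (\<sigma>c @ \<eta>c)" for a b
          using that m by (auto simp: idc_def)
        \<comment> \<open>The fields dual to \<sigma>c are the vectors whose annihilator is
          \<open>Vh\<close>, and the fields dual to \<sigma>h are annihilated by \<open>Vc\<close>;
          these are the two kinds of vectors that \<open>eta_structure\<close> pairs.\<close>
        have "\<exists>E F. smooth_coeffs M W E \<and> smooth_coeffs M W F \<and>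
          (\<forall>a<length \<eta>h. \<forall>p\<in>W. ext_d M (\<eta>h ! a) p = wedge_comb (E a) \<eta>h \<sigma>h p + wedge_comb (F a) \<sigma>h \<sigma>h p)"
        proof (rule eta_structure[where V=Vh and V'=Vc and e=eh and Y="\<lambda>a. X (idh a)" and Z="\<lambda>p. {X (?m + (?h + j)) p |j. j < ?c}", OF pfh W(1,4) k])
          show "s p \<in> Vh p" if "p \<in> W" "s \<in> set \<sigma>h" for p s
            using \<sigma>hW that Ih(3)[OF WM[OF that(1)]] by (auto simp: Omega1_iff subset_iff)
          show "last_derived M Vh p \<subseteq> span (set (?at p (\<sigma>h @ \<eta>h)))" if "p \<in> W" for p
            using f3[OF that] by (simp add: basis_list_def Ih_def)
          show "smooth_fun M W (eh a b)" if "a < ?eh" "b < ?h" for a b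
            by (rule smooth_fun_subset[OF eh[OF that] Wh(1) W(1) Wsub(1)])
          show "ext_d M (\<eta>h ! a) p = (\<Sum>b<?h. dform M (eh a b) p \<and>\<^sub>w (\<sigma>h ! b) p)" if "a < ?eh" "p \<in> W" for a p
            by (rule d\<eta>h[OF that(1) subsetD[OF Wsub(1) that(2)]])
          show "((\<sigma>h @ \<eta>h) ! c) p \<kappa> (X (idh a) p) = (if a = c then 1 else 0)"
            if "p \<in> W" "a < length (\<sigma>h @ \<eta>h)" "c < length (\<sigma>h @ \<eta>h)" for p a c
            using dual[OF that(1) idh(1)[OF that(2)] idh(1)[OF that(3)]] idh(2)[OF that(3)] idh_inj[OF that(2,3)] by simp
          show "smooth_fun M W (\<lambda>p. \<alpha> p \<kappa> (X (idh a) p))" if "a < length (\<sigma>h @ \<eta>h)" "\<alpha> \<in> Omega1 M W V" for \<alpha> a V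
            by (rule sX0[OF idh(1)[OF that(1)] W(1) order_refl that(2)])
          show "\<exists>\<xi>\<in>Lambda2 (Vh p). \<exists>\<zeta>\<in>Lambda2 (Vc p). ext_d M (\<eta>h ! a) p = \<xi> + \<zeta>" if "a < ?eh" "p \<in> W" for a p
            by (rule split[OF subsetD[OF \<eta>hT nth_mem[OF that(1)]] that(2)])
          show "\<alpha> \<in> Vh p" if "p \<in> W" "\<alpha> \<in> cotangent_space M p" "\<And>z. z \<in> {X (?m + (?h + j)) p |j. j < ?c} \<Longrightarrow> \<alpha> \<kappa> z = 0" for p \<alpha>
            by (rule in_Vh[OF that(1,2)]) (use that(3) in blast)
          show "\<alpha> \<kappa> z = 0" if "p \<in> W" "\<alpha> \<in> Vh p" "z \<in> {X (?m + (?h + j)) p |j. j < ?c}" for p \<alpha> z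
            using killVh[OF that(1,2)] that(3) by blast
          show "\<alpha> \<kappa> (X (idh b) p) = 0" if "p \<in> W" "\<alpha> \<in> Vc p" "b < ?h" for p \<alpha> b
            using killVc[OF that] that(3) by (simp add: idh_def)
        qed
        then obtain Eh Fh where Eh: "smooth_coeffs M W Eh" and Fh: "smooth_coeffs M W Fh"
          and deh: "\<forall>a<length \<eta>h. \<forall>p\<in>W. ext_d M (\<eta>h ! a) p = wedge_comb (Eh a) \<eta>h \<sigma>h p + wedge_comb (Fh a) \<sigma>h \<sigma>h p"
          by (elim exE conjE) (rule that)
        have "\<exists>E F. smooth_coeffs M W E \<and> smooth_coeffs M W F \<and>
          (\<forall>a<length \<eta>c. \<forall>p\<in>W. ext_d M (\<eta>c ! a) p = wedge_comb (E a) \<eta>c \<sigma>c p + wedge_comb (F a) \<sigma>c \<sigma>c p)"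
        proof (rule eta_structure[where V=Vc and V'=Vh and e=ec and Y="\<lambda>a. X (idc a)" and Z="\<lambda>p. {X (?m + j) p |j. j < ?h}", OF pfc W(1,4) k])
          show "s p \<in> Vc p" if "p \<in> W" "s \<in> set \<sigma>c" for p s
            using \<sigma>cW that Ic(3)[OF WM[OF that(1)]] by (auto simp: Omega1_iff subset_iff)
          show "last_derived M Vc p \<subseteq> span (set (?at p (\<sigma>c @ \<eta>c)))" if "p \<in> W" for p
            using f4[OF that] by (simp add: basis_list_def Ic_def)
          show "smooth_fun M W (ec a b)" if "a < ?ec" "b < ?c" for a b
            by (rule smooth_fun_subset[OF ec[OF that] Wc(1) W(1) Wsub(2)])
          show "ext_d M (\<eta>c ! a) p = (\<Sum>b<?c. dform M (ec a b) p \<and>\<^sub>w (\<sigma>c ! b) p)" if "a < ?ec" "p \<in> W" for a p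
            by (rule d\<eta>c[OF that(1) subsetD[OF Wsub(2) that(2)]])
          show "((\<sigma>c @ \<eta>c) ! c) p \<kappa> (X (idc a) p) = (if a = c then 1 else 0)"
            if "p \<in> W" "a < length (\<sigma>c @ \<eta>c)" "c < length (\<sigma>c @ \<eta>c)" for p a c
            using dual[OF that(1) idc(1)[OF that(2)] idc(1)[OF that(3)]] idc(2)[OF that(3)] idc_inj[OF that(2,3)] by simp
          show "smooth_fun M W (\<lambda>p. \<alpha> p \<kappa> (X (idc a) p))" if "a < length (\<sigma>c @ \<eta>c)" "\<alpha> \<in> Omega1 M W V" for \<alpha> a V
            by (rule sX0[OF idc(1)[OF that(1)] W(1) order_refl that(2)])
          show "\<exists>\<xi>\<in>Lambda2 (Vc p). \<exists>\<zeta>\<in>Lambda2 (Vh p). ext_d M (\<eta>c ! a) p = \<xi> + \<zeta>" if "a < ?ec" "p \<in> W" for a p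
            using split[OF subsetD[OF \<eta>cT nth_mem[OF that(1)]] that(2)] add.commute by metis
          show "\<alpha> \<in> Vc p" if "p \<in> W" "\<alpha> \<in> cotangent_space M p" "\<And>z. z \<in> {X (?m + j) p |j. j < ?h} \<Longrightarrow> \<alpha> \<kappa> z = 0" for p \<alpha>
            by (rule in_Vc[OF that(1,2)]) (use that(3) in blast)
          show "\<alpha> \<kappa> z = 0" if "p \<in> W" "\<alpha> \<in> Vc p" "z \<in> {X (?m + j) p |j. j < ?h}" for p \<alpha> z
            using killVc[OF that(1,2)] that(3) by blast
          show "\<alpha> \<kappa> (X (idc b) p) = 0" if "p \<in> W" "\<alpha> \<in> Vh p" "b < ?c" for p \<alpha> b
            using killVh[OF that] that(3) by (simp add: idc_def)
        qed
        then obtain Ec Fc where Ec: "smooth_coeffs M W Ec" and Fc: "smooth_coeffs M W Fc"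
          and dec: "\<forall>a<length \<eta>c. \<forall>p\<in>W. ext_d M (\<eta>c ! a) p = wedge_comb (Ec a) \<eta>c \<sigma>c p + wedge_comb (Fc a) \<sigma>c \<sigma>c p"
          by (elim exE conjE) (rule that)
        \<comment> \<open>Bundling both coefficient families in one predicate allows a single
          choice, of a pair, for every component of \<theta>.\<close>
        define good where "good a A B \<longleftrightarrow> (\<forall>i j. smooth_fun M W (A i j)) \<and> (\<forall>i j. smooth_fun M W (B i j)) \<and>
          (\<lambda>p. ext_d M (\<theta> ! a) p - (wedge_comb A \<sigma>h \<sigma>h p + wedge_comb B \<sigma>c \<sigma>c p)) \<in> ideal2 M W (set G)" for a A B
        have "\<exists>A B. good a A B" if a: "a < ?t" for a
          unfolding good_def
        proof (rule theta_structure[where V=Vh and V'=Vc and X=X, OF W(1) L_def LW dual])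
          have \<theta>a: "\<theta> ! a \<in> Omega1 M W T" using \<theta>W nth_mem[OF a] by (rule subsetD)
          show "cotangent_space M p \<subseteq> span (set (?at p L))" if "p \<in> W" for p
            using f6[OF that] by (simp add: basis_list_def)
          show "smooth_fun M W (\<lambda>p. ext_d M (\<theta> ! a) p \<kappa> (X i p) (X j p))" if "i < length L" "j < length L" for i j
            by (rule sXX0[OF that W(1) order_refl \<theta>a])
          show "\<exists>\<xi>\<in>Lambda2 (Vh p). \<exists>\<zeta>\<in>Lambda2 (Vc p). ext_d M (\<theta> ! a) p = \<xi> + \<zeta>" if "p \<in> W" for p
            by (rule split[OF \<theta>a that])
        qed (use VhC VcC WM killVh killVc in blast)+
        then have "\<forall>a\<in>{..<?t}. \<exists>AB. good a (fst AB) (snd AB)" by auto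
        then obtain AB where AB: "\<And>a. a < ?t \<Longrightarrow> good a (fst (AB a)) (snd (AB a))" by (metis lessThan_iff)
        \<comment> \<open>The value is 0 beyond the length of \<theta>, since
          \<open>smooth_coeffs\<close> ranges over those indices as well.\<close>
        define A where "A a i j = (if a < ?t then fst (AB a) i j else (\<lambda>p. 0))" for a i j
        define B where "B a i j = (if a < ?t then snd (AB a) i j else (\<lambda>p. 0))" for a i j
        have sA: "smooth_coeffs M W A" and sB: "smooth_coeffs M W B"
          unfolding smooth_coeffs_def A_def B_def using AB smooth_fun_const[OF W(1)] by (auto simp: good_def)
        have dt: "(\<lambda>p. ext_d M (\<theta> ! a) p - (wedge_comb (A a) \<sigma>h \<sigma>h p + wedge_comb (B a) \<sigma>c \<sigma>c p))
            \<in> ideal2 M W (set (\<theta> @ \<eta>h @ \<eta>c))" if a: "a < ?t" for a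
        proof -
          have "A a = fst (AB a)" "B a = snd (AB a)" using a by (auto simp: A_def[abs_def] B_def[abs_def] fun_eq_iff)
          then show ?thesis using AB[OF a] by (simp only: good_def G_def)
        qed
        have closed_h: "\<forall>a<length \<sigma>h. \<forall>p\<in>W. ext_d M (\<sigma>h ! a) p = 0"
          using d\<sigma>h[OF nth_mem] Wsub(1) by blast
        have closed_c: "\<forall>a<length \<sigma>c. \<forall>p\<in>W. ext_d M (\<sigma>c ! a) p = 0"
          using d\<sigma>c[OF nth_mem] Wsub(2) by blast
        show ?thesis
          by (rule exI[of _ W], rule exI[of _ \<theta>], rule exI[of _ \<sigma>h], rule exI[of _ \<eta>h], rule exI[of _ \<sigma>c],
              rule exI[of _ \<eta>c], rule exI[of _ Eh], rule exI[of _ Fh], rule exI[of _ Ec], rule exI[of _ Fc],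
              rule exI[of _ A], rule exI[of _ B])
            (intro conjI W(1,2) frame Eh Fh Ec Fc sA sB closed_h deh closed_c dec, use dt in blast)
      qed
    qed
  qed
qed

end
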